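(* Let $\Omega\subset\mathbb{R}^3$ be a smooth axisymmetric bounded domain such that $\inf_{(x,y,z)\in\Omega}\sqrt{x^2+y^2}>0$. Let $u$ be a minimizer of $E$ in $\mathcal{A}_{nc}^{axi}$, and let $v=(v_1,v_2):\Omega_0\to\mathbb{R}^2$ be such that $u(r\cos\theta,r\sin\theta,z)=v_1(r,z)e_r+v_2(r,z)e_z$. Write $\delta=\frac{v_1}{r}\det Dv$. Then, in the sense of distributions (in $\Omega_0$), $$\frac1r\partial_r\Big(r\Big[|\partial_rv|^2-|\partial_zv|^2-\frac{v_1^2}{r^2}+H'(\delta)\delta-H(\delta)\Big]\Big)+\partial_z\big(2\,\partial_rv\cdot\partial_zv\big)=\frac1r\Big[-|Dv|^2+\frac{v_1^2}{r^2}+H'(\delta)\delta-H(\delta)\Big],$$ $$\frac1r\partial_r\big(2r\,\partial_rv\cdot\partial_zv\big)+\partial_z\Big[|\partial_zv|^2-|\partial_rv|^2-\frac{v_1^2}{r^2}+H'(\delta)\delta-H(\delta)\Big]=0.$$ This is equivalent to $$\operatorname{Div}\Big(2Du^TDu+\big[H'(\det Du)\det Du-|Du|^2-H(\det Du)\big]I\Big)=0$$ in the sense of distributions (in $\Omega$).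
   Context: Axisymmetric means with respect to the $z$-axis; $e_r=\cos\theta\,e_x+\sin\theta\,e_y$. $\Omega'\subset\mathbb{R}^3$ is a smooth bounded axisymmetric domain, $g:\overline{\Omega}\to\overline{\Omega'}$ is a $C^1$ axisymmetric diffeomorphism, and $M>0$. The energy is $E(u)=\int_\Omega |Du|^2+H(\det Du)\,dx$. $H:(0,\infty)\to[0,\infty)$ is a $C^1$ convex function with $\lim_{t\to+\infty}H(t)/t=\lim_{t\to0^+}H(t)=+\infty$, and there exist $s,c_1,c_2,d_0>0$ such that $c_1t^{-s-k}\le(-1)^k\frac{d^k}{dt^k}H(t)\le c_2t^{-s-k}$ for $k=0,1$ and $0<t<d_0$, and $\tau,c_3,c_4,d_1>0$ such that $c_3t^{\tau+1}\le H'(t)\le c_4t^{\tau+1}$ for $t\ge d_1$. Let $\Omega_0=\{(r,z): r>0,\ (r,0,z)\in\Omega\}$. A map $u:\Omega\to\mathbb{R}^3$ is axisymmetric if there is $v=(v_1,v_2):\Omega_0\to\mathbb{R}^2$ with $v_1\ge0$ a.e. and $u(r\cos\theta,r\sin\theta,z)=v_1(r,z)e_r+v_2(r,z)e_z$. $Dv=\begin{pmatrix}\partial_rv_1&\partial_zv_1\\ \partial_rv_2&\partial_zv_2\end{pmatrix}$. For $u\in W^{1,2}(\Omega,\mathbb{R}^3)$ with $\det Du\in L^1(\Omega)$ and $f\in C^\infty_c(\Omega\times\mathbb{R}^3,\mathbb{R}^3)$ set $$\mathcal{E}_u(f)=\int_\Omega \langle\operatorname{cof}Du(x),D_xf(x,u(x))\rangle+\det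 Du(x)\,\operatorname{div}_yf(x,u(x))\,dx,\qquad \mathcal{E}(u)=\sup\{\mathcal{E}_u(f): \|f\|_\infty\le1\},$$ where $\langle A,B\rangle=\operatorname{tr}(A^TB)$ and $A^T\operatorname{cof}A=(\det A)I$. $\mathcal{A}$ is the set of $u\in W^{1,2}\cap L^\infty(\Omega,\mathbb{R}^3)$ with $u|_{\partial\Omega}=g|_{\partial\Omega}$, $\|u\|_\infty\le M$, $\det Du>0$ a.e. and $u$ one-to-one a.e. $\mathcal{A}_{nc}=\{u\in\mathcal{A}:\mathcal{E}(u)=0\}$ and $\mathcal{A}_{nc}^{axi}=\{u\in\mathcal{A}_{nc}:u\text{ axisymmetric}\}$. It is assumed that $0<\inf\{E(w):w\in\mathcal{A}_{nc}^{axi}\}<+\infty$. *)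

theory Defs
  imports "HOL-Analysis.Analysis"
begin

section \<open>Smooth functions, smooth domains, test functions\<close>

text \<open>Differentiability classes on an open set \<open>S\<close>.\<close>

primrec Ck_on :: "nat \<Rightarrow> 'a::euclidean_space set \<Rightarrow> ('a \<Rightarrow> 'b::real_normed_vector) \<Rightarrow> bool" where
  "Ck_on 0 S f \<longleftrightarrow> continuous_on S f"
| "Ck_on (Suc k) S f \<longleftrightarrow> (\<forall>x\<in>S. f differentiable (at x)) \<and>
     (\<forall>v. Ck_on k S (\<lambda>x. frechet_derivative f (at x) v))"

definition smooth_on :: "'a::euclidean_space set \<Rightarrow> ('a \<Rightarrow> 'b::real_normed_vector) \<Rightarrow> bool" where
  "smooth_on S f \<longleftrightarrow> (\<forall>k. Ck_on k S f)"

text \<open>\<open>C\<^sup>1\<close> up to the boundary: \<open>S\<close> is the closure of a smooth domain in what follows, so that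
  derivatives within \<open>S\<close> are unique also at boundary points.\<close>

definition C1_upto_boundary :: "'a::euclidean_space set \<Rightarrow> ('a \<Rightarrow> 'b::euclidean_space) \<Rightarrow> bool" where
  "C1_upto_boundary S f \<longleftrightarrow> (\<exists>f' :: 'a \<Rightarrow> 'a \<Rightarrow>\<^sub>L 'b.
     (\<forall>x\<in>S. (f has_derivative blinfun_apply (f' x)) (at x within S)) \<and> continuous_on S f')"

definition C1_diffeomorphism ::
  "'a::euclidean_space set \<Rightarrow> 'b::euclidean_space set \<Rightarrow> ('a \<Rightarrow> 'b) \<Rightarrow> bool" where
  "C1_diffeomorphism S T f \<longleftrightarrow> bij_betw f S T \<and>
     C1_upto_boundary S f \<and> C1_upto_boundary T (inv_into S f)"

text \<open>The boundary of a smooth domain is locally the regular level set of a smooth function,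
  with the domain on one side.\<close>

definition smooth_bounded_domain :: "'a::euclidean_space set \<Rightarrow> bool" where
  "smooth_bounded_domain \<Omega> \<longleftrightarrow> open \<Omega> \<and> connected \<Omega> \<and> \<Omega> \<noteq> {} \<and> bounded \<Omega> \<and>
     (\<forall>p\<in>frontier \<Omega>. \<exists>U (\<rho>::'a \<Rightarrow> real). open U \<and> p \<in> U \<and> smooth_on U \<rho> \<and>
        (\<forall>x\<in>U. frechet_derivative \<rho> (at x) \<noteq> (\<lambda>_. 0)) \<and>
        \<Omega> \<inter> U = {x\<in>U. \<rho> x < 0})"

text \<open>\<open>C\<^sub>c\<^sup>\<infinity>\<close> of an open set; test functions are extended by zero to the whole space.\<close>

definition test_function ::
  "'a::euclidean_space set \<Rightarrow> ('a \<Rightarrow> 'b::real_normed_vector) \<Rightarrow> bool" where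
  "test_function U \<phi> \<longleftrightarrow> smooth_on UNIV \<phi> \<and>
     (\<exists>K. compact K \<and> K \<subseteq> U \<and> (\<forall>x. x \<notin> K \<longrightarrow> \<phi> x = 0))"


section \<open>Distributions\<close>

text \<open>Distributions are represented by their action on scalar test functions.\<close>

type_synonym 'n distr = "(real^'n \<Rightarrow> real) \<Rightarrow> real"

definition locally_integrable ::
  "'a::euclidean_space set \<Rightarrow> ('a \<Rightarrow> 'b::euclidean_space) \<Rightarrow> bool" where
  "locally_integrable U f \<longleftrightarrow> (\<forall>K. compact K \<and> K \<subseteq> U \<longrightarrow> f absolutely_integrable_on K)"

definition regular_distr :: "(real^'n) set \<Rightarrow> (real^'n \<Rightarrow> real) \<Rightarrow> 'n::finite distr" where
  "regular_distr U f = (\<lambda>\<phi>. LINT x|lebesgue_on U. f x * \<phi> x)"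

definition distr_partial :: "'n \<Rightarrow> 'n distr \<Rightarrow> 'n::finite distr" where
  "distr_partial j T = (\<lambda>\<phi>. - T (\<lambda>x. frechet_derivative \<phi> (at x) (axis j 1)))"

text \<open>Product of a distribution with a function \<open>a\<close> that is smooth on the open set considered.\<close>

definition distr_mult :: "(real^'n \<Rightarrow> real) \<Rightarrow> 'n distr \<Rightarrow> 'n::finite distr" where
  "distr_mult a T = (\<lambda>\<phi>. T (\<lambda>x. a x * \<phi> x))"

definition distr_eq :: "(real^'n) set \<Rightarrow> 'n distr \<Rightarrow> 'n::finite distr \<Rightarrow> bool" where
  "distr_eq U S T \<longleftrightarrow> (\<forall>\<phi>. test_function U \<phi> \<longrightarrow> S \<phi> = T \<phi>)"


section \<open>Sobolev maps\<close>

text \<open>Gradients are Jacobian matrices: row \<open>i\<close> belongs to the component \<open>u\<^sub>i\<close>, column \<open>j\<close> to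
  \<open>\<partial>\<^sub>j\<close>.\<close>

definition is_weak_D ::
  "(real^'n) set \<Rightarrow> (real^'n \<Rightarrow> real^'m) \<Rightarrow> (real^'n \<Rightarrow> real^'n^'m) \<Rightarrow> bool" where
  "is_weak_D U u A \<longleftrightarrow> locally_integrable U u \<and> locally_integrable U A \<and>
     (\<forall>i j. distr_eq U (distr_partial j (regular_distr U (\<lambda>x. u x $ i)))
                       (regular_distr U (\<lambda>x. A x $ i $ j)))"

text \<open>A representative of the weak gradient, determined up to null sets if it exists.\<close>

definition weak_D :: "(real^'n) set \<Rightarrow> (real^'n \<Rightarrow> real^'m) \<Rightarrow> real^'n \<Rightarrow> real^'n^'m" where
  "weak_D U u = (SOME A. is_weak_D U u A)"

text \<open>The norm on matrices is the Frobenius norm.\<close>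

definition W12 :: "(real^'n) set \<Rightarrow> (real^'n \<Rightarrow> real^'m) \<Rightarrow> bool" where
  "W12 U u \<longleftrightarrow> u \<in> borel_measurable (lebesgue_on U) \<and>
     integrable (lebesgue_on U) (\<lambda>x. (norm (u x))\<^sup>2) \<and>
     (\<exists>A. is_weak_D U u A) \<and>
     integrable (lebesgue_on U) (\<lambda>x. (norm (weak_D U u x))\<^sup>2)"

text \<open>Closure of the test functions in \<open>W\<^sup>1\<^sup>,\<^sup>2\<close>.\<close>

definition W12_zero :: "(real^'n) set \<Rightarrow> (real^'n \<Rightarrow> real^'m) \<Rightarrow> bool" where
  "W12_zero U u \<longleftrightarrow> W12 U u \<and> (\<exists>\<phi>::nat \<Rightarrow> real^'n \<Rightarrow> real^'m. (\<forall>k. test_function U (\<phi> k)) \<and>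
     (\<lambda>k. \<integral>\<^sup>+x. ennreal ((norm (u x - \<phi> k x))\<^sup>2 +
        (norm (weak_D U u x - jacobian (\<phi> k) (at x)))\<^sup>2) \<partial>lebesgue_on U) \<longlonglongrightarrow> 0)"


section \<open>Axial symmetry\<close>

definition e_r :: "real \<Rightarrow> real^3" where
  "e_r \<theta> = vector [cos \<theta>, sin \<theta>, 0]"

definition e_z :: "real^3" where
  "e_z = vector [0, 0, 1]"

definition cyl :: "real \<Rightarrow> real \<Rightarrow> real \<Rightarrow> real^3" where
  "cyl r \<theta> z = vector [r * cos \<theta>, r * sin \<theta>, z]"

definition axisymmetric_set :: "(real^3) set \<Rightarrow> bool" where
  "axisymmetric_set \<Omega> \<longleftrightarrow> (\<forall>r \<theta> \<theta>' z. cyl r \<theta> z \<in> \<Omega> \<longrightarrow> cyl r \<theta>' z \<in> \<Omega>)"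

text \<open>The set \<open>\<Omega>\<^sub>0\<close>; a point \<open>p\<close> of the half-plane has the coordinates \<open>r = p $ 1\<close>, \<open>z = p $ 2\<close>.\<close>

definition meridian :: "(real^3) set \<Rightarrow> (real^2) set" where
  "meridian \<Omega> = {p. p $ 1 > 0 \<and> vector [p $ 1, 0, p $ 2] \<in> \<Omega>}"

text \<open>Sobolev maps are only defined up to null sets, so the identity
  \<open>u(r cos \<theta>, r sin \<theta>, z) = v\<^sub>1(r,z) e\<^sub>r + v\<^sub>2(r,z) e\<^sub>z\<close> is required at almost every point.\<close>

definition meridian_rep :: "(real^3) set \<Rightarrow> (real^3 \<Rightarrow> real^3) \<Rightarrow> (real^2 \<Rightarrow> real^2) \<Rightarrow> bool" where
  "meridian_rep \<Omega> u v \<longleftrightarrow> (AE x in lebesgue_on \<Omega>. \<forall>r>0. \<forall>\<theta> z. x = cyl r \<theta> z \<longrightarrow>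
     u x = v (vector [r, z]) $ 1 *\<^sub>R e_r \<theta> + v (vector [r, z]) $ 2 *\<^sub>R e_z)"

definition axisymmetric_map :: "(real^3) set \<Rightarrow> (real^3 \<Rightarrow> real^3) \<Rightarrow> bool" where
  "axisymmetric_map \<Omega> u \<longleftrightarrow> (\<exists>v. (AE p in lebesgue_on (meridian \<Omega>). v p $ 1 \<ge> 0) \<and>
     meridian_rep \<Omega> u v)"


section \<open>The energies and the admissible classes\<close>

definition energy_density_assms :: "(real \<Rightarrow> real) \<Rightarrow> bool" where
  "energy_density_assms H \<longleftrightarrow>
     (\<forall>t>0. H t \<ge> 0) \<and>
     (\<forall>t>0. H differentiable (at t)) \<and> continuous_on {0<..} (deriv H) \<and>
     convex_on {0<..} H \<and>
     filterlim (\<lambda>t. H t / t) at_top at_top \<and> filterlim H at_top (at_right 0) \<and>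
     (\<exists>s>0. \<exists>c\<^sub>1>0. \<exists>c\<^sub>2>0. \<exists>d\<^sub>0>0. \<forall>k\<in>{0, 1::nat}. \<forall>t. 0 < t \<and> t < d\<^sub>0 \<longrightarrow>
        c\<^sub>1 * t powr (- s - real k) \<le> (-1) ^ k * (deriv ^^ k) H t \<and>
        (-1) ^ k * (deriv ^^ k) H t \<le> c\<^sub>2 * t powr (- s - real k)) \<and>
     (\<exists>\<tau>>0. \<exists>c\<^sub>3>0. \<exists>c\<^sub>4>0. \<exists>d\<^sub>1>0. \<forall>t\<ge>d\<^sub>1.
        c\<^sub>3 * t powr (\<tau> + 1) \<le> deriv H t \<and> deriv H t \<le> c\<^sub>4 * t powr (\<tau> + 1))"

definition energy :: "(real \<Rightarrow> real) \<Rightarrow> (real^3) set \<Rightarrow> (real^3 \<Rightarrow> real^3) \<Rightarrow> ennreal" where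
  "energy H \<Omega> u = (\<integral>\<^sup>+x. ennreal ((norm (weak_D \<Omega> u x))\<^sup>2 + H (det (weak_D \<Omega> u x))) \<partial>lebesgue_on \<Omega>)"

text \<open>The \<open>(i,j)\<close> cofactor is the determinant after replacing row \<open>i\<close> by the \<open>j\<close>-th unit vector.\<close>

definition cof :: "real^'n^'n \<Rightarrow> real^'n^'n" where
  "cof A = (\<chi> i j. det (\<chi> k. if k = i then axis j 1 else A $ k))"

lemma transpose_mult_cof:
  fixes A :: "real^3^3"
  shows "transpose A ** cof A = det A *\<^sub>R mat 1"
  by (simp add: vec_eq_iff forall_3 matrix_matrix_mult_def transpose_def cof_def det_3 sum_3
      mat_def axis_def algebra_simps)

lemma inner_matrix_eq_trace:
  fixes A B :: "real^'n^'m"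
  shows "A \<bullet> B = trace (transpose A ** B)"
  unfolding trace_def inner_vec_def matrix_matrix_mult_def transpose_def
  by (simp add: sum.swap[where A = "UNIV :: 'm set"])

definition surface_functional ::
  "(real^3) set \<Rightarrow> (real^3 \<Rightarrow> real^3) \<Rightarrow> ((real^3) \<times> (real^3) \<Rightarrow> real^3) \<Rightarrow> real" where
  "surface_functional \<Omega> u f = (LINT x|lebesgue_on \<Omega>.
     cof (weak_D \<Omega> u x) \<bullet> jacobian (\<lambda>x'. f (x', u x)) (at x) +
     det (weak_D \<Omega> u x) * trace (jacobian (\<lambda>y. f (x, y)) (at (u x))))"

definition surface_energy :: "(real^3) set \<Rightarrow> (real^3 \<Rightarrow> real^3) \<Rightarrow> ereal" where
  "surface_energy \<Omega> u =
     (SUP f \<in> {f. test_function (\<Omega> \<times> UNIV) f \<and> (\<forall>p. norm (f p) \<le> 1)}.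
        ereal (surface_functional \<Omega> u f))"

text \<open>The boundary condition \<open>u = g\<close> on \<open>\<partial>\<Omega>\<close> is understood as \<open>u - g \<in> W\<^sub>0\<^sup>1\<^sup>,\<^sup>2\<close>.\<close>

definition admissible :: "(real^3) set \<Rightarrow> (real^3 \<Rightarrow> real^3) \<Rightarrow> real \<Rightarrow> (real^3 \<Rightarrow> real^3) set" where
  "admissible \<Omega> g M = {u. W12 \<Omega> u \<and>
     W12_zero \<Omega> (\<lambda>x. u x - g x) \<and>
     (AE x in lebesgue_on \<Omega>. norm (u x) \<le> M) \<and>
     (AE x in lebesgue_on \<Omega>. det (weak_D \<Omega> u x) > 0) \<and>
     (\<exists>N. negligible N \<and> inj_on u (\<Omega> - N))}"

text \<open>The surface energy is only defined if \<open>det Du\<close> is integrable.\<close>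

definition admissible_nc :: "(real^3) set \<Rightarrow> (real^3 \<Rightarrow> real^3) \<Rightarrow> real \<Rightarrow> (real^3 \<Rightarrow> real^3) set" where
  "admissible_nc \<Omega> g M = {u \<in> admissible \<Omega> g M.
     integrable (lebesgue_on \<Omega>) (\<lambda>x. det (weak_D \<Omega> u x)) \<and> surface_energy \<Omega> u = 0}"

definition admissible_nc_axi ::
  "(real^3) set \<Rightarrow> (real^3 \<Rightarrow> real^3) \<Rightarrow> real \<Rightarrow> (real^3 \<Rightarrow> real^3) set" where
  "admissible_nc_axi \<Omega> g M = {u \<in> admissible_nc \<Omega> g M. axisymmetric_map \<Omega> u}"


section \<open>The Euler--Lagrange equations for inner variations\<close>

text \<open>Equations in the sense of distributions presuppose that the fields involved are locally
  integrable; this is part of the two predicates below.\<close>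

definition meridian_equations :: "(real \<Rightarrow> real) \<Rightarrow> (real^2) set \<Rightarrow> (real^2 \<Rightarrow> real^2) \<Rightarrow> bool" where
  "meridian_equations H U v \<longleftrightarrow>
    (let r = (\<lambda>p::real^2. p $ 1);
         Dv = weak_D U v;
         dr_v = (\<lambda>p. column 1 (Dv p));
         dz_v = (\<lambda>p. column 2 (Dv p));
         \<delta> = (\<lambda>p. v p $ 1 / r p * det (Dv p));
         F\<^sub>r\<^sub>r = (\<lambda>p. (norm (dr_v p))\<^sup>2 - (norm (dz_v p))\<^sup>2 - (v p $ 1)\<^sup>2 / (r p)\<^sup>2
                  + deriv H (\<delta> p) * \<delta> p - H (\<delta> p));
         F\<^sub>r\<^sub>z = (\<lambda>p. 2 * (dr_v p \<bullet> dz_v p));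
         F\<^sub>z\<^sub>z = (\<lambda>p. (norm (dz_v p))\<^sup>2 - (norm (dr_v p))\<^sup>2 - (v p $ 1)\<^sup>2 / (r p)\<^sup>2
                  + deriv H (\<delta> p) * \<delta> p - H (\<delta> p));
         G = (\<lambda>p. - (norm (Dv p))\<^sup>2 + (v p $ 1)\<^sup>2 / (r p)\<^sup>2
                  + deriv H (\<delta> p) * \<delta> p - H (\<delta> p))
     in locally_integrable U F\<^sub>r\<^sub>r \<and> locally_integrable U F\<^sub>r\<^sub>z \<and>
        locally_integrable U F\<^sub>z\<^sub>z \<and> locally_integrable U G \<and>
        distr_eq U
          (\<lambda>\<phi>. distr_mult (\<lambda>p. 1 / r p) (distr_partial 1 (regular_distr U (\<lambda>p. r p * F\<^sub>r\<^sub>r p))) \<phi>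
              + distr_partial 2 (regular_distr U F\<^sub>r\<^sub>z) \<phi>)
          (regular_distr U (\<lambda>p. 1 / r p * G p)) \<and>
        distr_eq U
          (\<lambda>\<phi>. distr_mult (\<lambda>p. 1 / r p) (distr_partial 1 (regular_distr U (\<lambda>p. r p * F\<^sub>r\<^sub>z p))) \<phi>
              + distr_partial 2 (regular_distr U F\<^sub>z\<^sub>z) \<phi>)
          (\<lambda>\<phi>. 0))"

text \<open>\<open>Div T = 0\<close> in the sense of distributions, where \<open>(Div T)\<^sub>i = \<Sum>\<^sub>j \<partial>\<^sub>j T\<^sub>i\<^sub>j\<close>.\<close>

definition Div_free :: "(real^'n) set \<Rightarrow> (real^'n \<Rightarrow> real^'n^'m) \<Rightarrow> bool" where
  "Div_free U T \<longleftrightarrow> locally_integrable U T \<and>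
     (\<forall>i. distr_eq U (\<lambda>\<phi>. \<Sum>j\<in>UNIV. distr_partial j (regular_distr U (\<lambda>x. T x $ i $ j)) \<phi>) (\<lambda>\<phi>. 0))"

definition energy_momentum ::
  "(real \<Rightarrow> real) \<Rightarrow> (real^3) set \<Rightarrow> (real^3 \<Rightarrow> real^3) \<Rightarrow> real^3 \<Rightarrow> real^3^3" where
  "energy_momentum H \<Omega> u x = (let A = weak_D \<Omega> u x in
     2 *\<^sub>R (transpose A ** A) +
     (deriv H (det A) * det A - (norm A)\<^sup>2 - H (det A)) *\<^sub>R mat 1)"

end

theory Submission
  imports Defs
begin

text \<open>The domain stays away from the axis, so a test field \<open>\<phi>\<^sub>1 e\<^sub>r + \<phi>\<^sub>2 e\<^sub>z\<close> is smooth and the inner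
  variations \<open>u \<circ> (id + t X)\<close> along it remain axisymmetric, injective almost everywhere, free of
  surface energy and equal to \<open>g\<close> on the boundary. The growth conditions on \<open>H\<close> give
  \<open>\<bar>t H'(t)\<bar> \<le> C (1 + H(t))\<close>, which dominates the difference quotients of the energy after the change of
  variables \<open>id + t X\<close>; minimality therefore yields \<open>\<integral> T \<bullet> DX = 0\<close> for the energy-momentum tensor \<open>T\<close>.
  In cylindrical coordinates \<open>T = R S R\<^sup>T\<close>, where \<open>R\<close> is the rotation by \<open>\<theta>\<close> and \<open>S\<close> depends on \<open>(r, z)\<close> only and
  has the entries \<open>F\<^sub>r\<^sub>r\<close>, \<open>F\<^sub>r\<^sub>z\<close>, \<open>F\<^sub>z\<^sub>z\<close> and \<open>G\<close>. The fields \<open>(f/r) e\<^sub>r\<close> and \<open>(f/r) e\<^sub>z\<close> give the meridian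
  equations. For a field \<open>\<phi> e\<^sub>k\<close> that is not axisymmetric, apply the meridian equations in each half-plane
  \<open>\<theta> = const\<close> and integrate over \<open>\<theta>\<close>: what remains is \<open>G\<close> times the \<open>\<theta>\<close>-derivative of a periodic function.\<close>

section \<open>Smooth functions on open sets\<close>

text \<open>The function \<open>v\<close> enters only through the almost everywhere identity
  \<open>meridian_rep\<close>. Neither measurability nor weak differentiability of \<open>v\<close>
  is assumed; both are extracted from \<open>u\<close> by averaging over the angle. Moreover
  \<open>weak_D\<close> is a chosen representative, so every pointwise computation holds almost
  everywhere only and rests on the fundamental lemma. The difference quotients are formed after the
  change of variables: Du then stays at a fixed point, and the deformation only multiplies the
  argument of H by det(I + t DX). This is why a bound of H(a s) by H(a) for s in [1/2, 2] suffices.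
  Cylindrical coordinates are a diffeomorphism only off the half-plane \<theta> = \<pi>. It is a
  null set, but test functions need not vanish on it, which is where periodicity in \<theta> enters.
  Both systems of equations are derived from the vanishing of \<open>weak_form\<close>, and the
  equivalence follows because both sides hold.\<close>

lemma Ck_on_continuous_on: "Ck_on k S f \<Longrightarrow> continuous_on S f"
proof (cases k)
  case (Suc m)
  assume "Ck_on k S f"
  then have "f differentiable_on S"
    using Suc by (auto simp: differentiable_on_def intro: differentiable_at_withinI)
  then show ?thesis by (rule differentiable_imp_continuous_on)
qed simp

lemma Ck_on_subset: "Ck_on k T f \<Longrightarrow> S \<subseteq> T \<Longrightarrow> Ck_on k S f"
  by (induction k arbitrary: f) (auto intro: continuous_on_subset)

lemma Ck_on_SucD: "Ck_on (Suc k) S f \<Longrightarrow> Ck_on k S f"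
proof (induction k arbitrary: f)
  case 0
  then show ?case using Ck_on_continuous_on[OF 0] by simp
next
  case (Suc k)
  from Suc.prems have "\<forall>v. Ck_on k S (\<lambda>x. frechet_derivative f (at x) v)"
    using Suc.IH by (metis Ck_on.simps(2))
  then show ?case using Suc.prems by (auto simp only: Ck_on.simps)
qed

lemma frechet_derivative_transform:
  assumes "open S" "x \<in> S" "\<And>y. y \<in> S \<Longrightarrow> f y = g y"
  shows "frechet_derivative f (at x) = frechet_derivative g (at x)"
proof -
  have "(f has_derivative D) (at x) \<longleftrightarrow> (g has_derivative D) (at x)" for D
    using assms has_derivative_transform_within_open by metis
  then show ?thesis by (simp add: frechet_derivative_def)
qed

lemma Ck_on_cong:
  assumes "open S" "\<And>x. x \<in> S \<Longrightarrow> f x = g x" "Ck_on k S f"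
  shows "Ck_on k S g"
  using assms(2,3)
proof (induction k arbitrary: f g)
  case 0
  then show ?case using continuous_on_eq[of S f g] by simp
next
  case (Suc k)
  have eq: "\<And>x. x \<in> S \<Longrightarrow> frechet_derivative f (at x) = frechet_derivative g (at x)"
    using frechet_derivative_transform[OF assms(1)] Suc.prems(1) by blast
  have "g differentiable (at x)" if "x \<in> S" for x
  proof -
    have "f differentiable (at x)" using Suc.prems(2) that by simp
    then obtain D where "(f has_derivative D) (at x)" by (auto simp: differentiable_def)
    then have "(g has_derivative D) (at x)"
      by (rule has_derivative_transform_within_open[OF _ assms(1) that]) (rule Suc.prems(1))
    then show ?thesis by (auto simp: differentiable_def)
  qed
  moreover have "Ck_on k S (\<lambda>x. frechet_derivative g (at x) v)" for v
    by (rule Suc.IH[of "\<lambda>x. frechet_derivative f (at x) v"]) (use eq Suc.prems in auto)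
  ultimately show ?case by simp
qed

lemma Ck_on_SucI:
  assumes "open S" "\<And>x. x \<in> S \<Longrightarrow> (f has_derivative D x) (at x)"
    and "\<And>v. Ck_on k S (\<lambda>x. D x v)"
  shows "Ck_on (Suc k) S f"
proof -
  have eq: "frechet_derivative f (at x) = D x" if "x \<in> S" for x
    using assms(2)[OF that] by (metis frechet_derivative_at)
  have "Ck_on k S (\<lambda>x. frechet_derivative f (at x) v)" for v
    by (rule Ck_on_cong[OF assms(1) _ assms(3)[of v]]) (simp add: eq)
  moreover have "f differentiable (at x)" if "x \<in> S" for x
    using assms(2)[OF that] by (auto simp: differentiable_def)
  ultimately show ?thesis by simp
qed

lemma Ck_on_Suc_has_derivative:
  "Ck_on (Suc k) S f \<Longrightarrow> x \<in> S \<Longrightarrow> (f has_derivative frechet_derivative f (at x)) (at x)"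
  by (simp add: frechet_derivative_works[symmetric])

text \<open>Derivatives are taken at the point and not within \<open>S\<close>, so regularity is a
  local property. This is what glues a function on an open set to zero outside its support.\<close>

lemma Ck_on_local:
  assumes "\<And>x. x \<in> S \<Longrightarrow> \<exists>T. open T \<and> x \<in> T \<and> Ck_on k T f"
  shows "Ck_on k S f"
  using assms
proof (induction k arbitrary: f)
  case 0
  then have "continuous (at x) f" if "x \<in> S" for x
    using that by (metis Ck_on.simps(1) continuous_on_eq_continuous_at)
  then show ?case by (simp add: continuous_at_imp_continuous_on)
next
  case (Suc k)
  have "Ck_on k S (\<lambda>x. frechet_derivative f (at x) v)" for v
    by (rule Suc.IH) (use Suc.prems in fastforce)
  then show ?case using Suc.prems by fastforce
qed

lemma Ck_on_bounded_linear:
  assumes "bounded_linear L" "open S" "Ck_on k S f"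
  shows "Ck_on k S (\<lambda>x. L (f x))"
  using assms(3)
proof (induction k arbitrary: f)
  case 0
  then show ?case
    using linear_continuous_on[OF assms(1)] continuous_on_compose2[of UNIV L S f] by simp
next
  case (Suc k)
  show ?case
  proof (rule Ck_on_SucI[OF assms(2)])
    show "((\<lambda>x. L (f x)) has_derivative (\<lambda>v. L (frechet_derivative f (at x) v))) (at x)"
      if "x \<in> S" for x
      by (rule bounded_linear.has_derivative[OF assms(1) Ck_on_Suc_has_derivative[OF Suc.prems that]])
    show "Ck_on k S (\<lambda>x. L (frechet_derivative f (at x) v))" for v
      using Suc by auto
  qed
qed

lemma Ck_on_const: "Ck_on k (S::'a::euclidean_space set) (\<lambda>_. c)"
proof (induction k arbitrary: c)
  case (Suc k)
  have "frechet_derivative (\<lambda>_. c) (at x) = (\<lambda>_. 0)" for x :: 'a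
    by (metis frechet_derivative_at has_derivative_const)
  then show ?case using Suc by simp
qed simp

lemma Ck_on_linear:
  assumes "bounded_linear L" "open S" shows "Ck_on k S L"
proof (cases k)
  case 0
  then show ?thesis using linear_continuous_on[OF assms(1)] by simp
next
  case (Suc m)
  show ?thesis unfolding Suc
    by (rule Ck_on_SucI[where D = "\<lambda>_. L"])
      (use assms bounded_linear_imp_has_derivative Ck_on_const in auto)
qed

lemma Ck_on_add:
  assumes "open S" "Ck_on k S f" "Ck_on k S g"
  shows "Ck_on k S (\<lambda>x. f x + g x)"
  using assms(2,3)
proof (induction k arbitrary: f g)
  case 0
  then show ?case by (auto intro: continuous_on_add)
next
  case (Suc k)
  show ?case
    by (rule Ck_on_SucI[where D = "\<lambda>x v. frechet_derivative f (at x) v + frechet_derivative g (at x) v"])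
      (use assms Suc in \<open>auto intro!: has_derivative_add Suc.IH simp: frechet_derivative_works[symmetric]\<close>)
qed

lemma Ck_on_sum:
  assumes "open S" "\<And>i. i \<in> I \<Longrightarrow> Ck_on k S (f i)"
  shows "Ck_on k S (\<lambda>x. \<Sum>i\<in>I. f i x)"
  using assms(2)
  by (induction I rule: infinite_finite_induct) (auto intro: Ck_on_const Ck_on_add assms(1))

lemma Ck_on_bilinear:
  assumes bb: "bounded_bilinear B" and "open S" "Ck_on k S f" "Ck_on k S g"
  shows "Ck_on k S (\<lambda>x. B (f x) (g x))"
  using assms(3,4)
proof (induction k arbitrary: f g)
  case 0
  then show ?case using bounded_bilinear.continuous_on[OF bb] by simp
next
  case (Suc k)
  have f: "Ck_on k S f" and g: "Ck_on k S g" using Suc.prems Ck_on_SucD by blast+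
  show ?case
  proof (rule Ck_on_SucI[OF assms(2)])
    show "((\<lambda>x. B (f x) (g x)) has_derivative
        (\<lambda>v. B (f x) (frechet_derivative g (at x) v) + B (frechet_derivative f (at x) v) (g x))) (at x)"
      if "x \<in> S" for x
      by (rule bounded_bilinear.FDERIV[OF bb Ck_on_Suc_has_derivative[OF Suc.prems(1) that]
            Ck_on_Suc_has_derivative[OF Suc.prems(2) that]])
    show "Ck_on k S (\<lambda>x. B (f x) (frechet_derivative g (at x) v) +
        B (frechet_derivative f (at x) v) (g x))" for v
      by (rule Ck_on_add[OF assms(2)]; rule Suc.IH) (use Suc.prems f g in auto)
  qed
qed

lemma linear_euclidean_expand:
  fixes L :: "'a::euclidean_space \<Rightarrow> 'b::real_normed_vector"
  assumes "linear L"
  shows "L w = (\<Sum>b\<in>Basis. (w \<bullet> b) *\<^sub>R L b)"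
proof -
  have "L w = L (\<Sum>b\<in>Basis. (w \<bullet> b) *\<^sub>R b)" by (simp add: euclidean_representation)
  also have "\<dots> = (\<Sum>b\<in>Basis. (w \<bullet> b) *\<^sub>R L b)"
    using assms by (simp add: linear_sum linear_scale)
  finally show ?thesis .
qed

text \<open>\<open>Ck_on\<close> controls derivatives in fixed directions only, while the chain rule
  produces the derivative of \<open>f\<close> in the direction g'(x) v, which varies with x.
  Expanding this direction in the basis gives a sum of products, and the induction hypothesis
  applies to each factor.\<close>

lemma Ck_on_compose:
  fixes f :: "'b::euclidean_space \<Rightarrow> 'c::real_normed_vector" and g :: "'a::euclidean_space \<Rightarrow> 'b"
  assumes "open S" "open T" "Ck_on k S g" "g ` S \<subseteq> T" "Ck_on k T f"
  shows "Ck_on k S (\<lambda>x. f (g x))"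
  using assms(3,5)
proof (induction k arbitrary: f)
  case 0
  then show ?case using continuous_on_compose2[of T f S g] assms(4) by simp
next
  case (Suc k)
  have g: "Ck_on k S g" using Suc.prems Ck_on_SucD by blast
  have *: "((\<lambda>x. f (g x)) has_derivative
        (\<lambda>v. \<Sum>b\<in>Basis. (frechet_derivative g (at x) v \<bullet> b) *\<^sub>R frechet_derivative f (at (g x)) b)) (at x)"
      if "x \<in> S" for x
  proof -
    have df: "(f has_derivative frechet_derivative f (at (g x))) (at (g x))"
      by (rule Ck_on_Suc_has_derivative[OF Suc.prems(2)]) (use that assms(4) in auto)
    have dg: "(g has_derivative frechet_derivative g (at x)) (at x)"
      by (rule Ck_on_Suc_has_derivative[OF Suc.prems(1)]) (use that in auto)
    have "(\<lambda>v. frechet_derivative f (at (g x)) (frechet_derivative g (at x) v)) =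
        (\<lambda>v. \<Sum>b\<in>Basis. (frechet_derivative g (at x) v \<bullet> b) *\<^sub>R frechet_derivative f (at (g x)) b)"
      by (rule ext) (rule linear_euclidean_expand[OF has_derivative_linear[OF df]])
    then show ?thesis using has_derivative_compose[OF dg df] by (simp only:)
  qed
  show ?case
  proof (rule Ck_on_SucI[OF assms(1) *])
    show "Ck_on k S (\<lambda>x. \<Sum>b\<in>Basis. (frechet_derivative g (at x) v \<bullet> b) *\<^sub>R
        frechet_derivative f (at (g x)) b)" for v
    proof (intro Ck_on_sum[OF assms(1)] Ck_on_bilinear[OF bounded_bilinear_scaleR assms(1)])
      show "Ck_on k S (\<lambda>x. frechet_derivative g (at x) v \<bullet> b)" for b
        by (rule Ck_on_bounded_linear[OF bounded_linear_inner_left assms(1)]) (use Suc.prems in auto)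
      show "Ck_on k S (\<lambda>x. frechet_derivative f (at (g x)) b)" for b
        by (rule Suc.IH[OF g]) (use Suc.prems in auto)
    qed
  qed
qed

lemma Ck_on_DERIV:
  assumes "open S" "\<And>x. x \<in> S \<Longrightarrow> (f has_real_derivative f' x) (at x)" "Ck_on k S f'"
  shows "Ck_on (Suc k) S f"
proof (rule Ck_on_SucI[OF assms(1)])
  show "(f has_derivative (\<lambda>v. v * f' x)) (at x)" if "x \<in> S" for x
    using assms(2)[OF that] by (simp add: has_field_derivative_def mult.commute[of _ "f' x"])
  show "Ck_on k S (\<lambda>x. v * f' x)" for v
    by (rule Ck_on_bounded_linear[OF bounded_linear_mult_right assms(1,3)])
qed

lemma Ck_on_inverse_real: "Ck_on k (- {0::real}) inverse"
proof (induction k)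
  case (Suc k)
  have 1: "Ck_on k (- {0::real}) (\<lambda>x. inverse x * inverse x)"
    by (rule Ck_on_bilinear[OF bounded_bilinear_mult]) (use Suc in \<open>auto simp: open_Compl\<close>)
  have 2: "Ck_on k (- {0::real}) (\<lambda>x. - (inverse x * inverse x))"
    by (rule Ck_on_bounded_linear[OF bounded_linear_minus[OF bounded_linear_ident] _ 1])
      (auto simp: open_Compl)
  show ?case
    by (rule Ck_on_DERIV[OF _ _ 2]) (auto intro!: derivative_eq_intros simp: open_Compl power2_eq_square)
qed (auto intro!: continuous_intros)

lemma Ck_on_sin_cos: "Ck_on k UNIV (sin :: real \<Rightarrow> real) \<and> Ck_on k UNIV (cos :: real \<Rightarrow> real)"
proof (induction k)
  case (Suc k)
  have "Ck_on k UNIV (\<lambda>x::real. - sin x)"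
    by (rule Ck_on_bounded_linear[OF bounded_linear_minus[OF bounded_linear_ident]]) (use Suc in auto)
  then show ?case
    using Ck_on_DERIV[OF open_UNIV DERIV_sin] Ck_on_DERIV[OF open_UNIV DERIV_cos] Suc by blast
qed (auto intro!: continuous_intros)

lemma Ck_on_sqrt: "Ck_on k {0<..} sqrt"
proof (induction k)
  case (Suc k)
  have "Ck_on k {0<..} (\<lambda>x. inverse (sqrt x))"
    by (rule Ck_on_compose[OF _ _ Suc _ Ck_on_inverse_real]) (auto simp: open_Compl)
  then have "Ck_on k {0<..} (\<lambda>x. inverse (sqrt x) / 2)"
    by (rule Ck_on_bounded_linear[OF bounded_linear_divide, rotated]) auto
  then show ?case
    by (rule Ck_on_DERIV[rotated 2]) (auto intro!: derivative_eq_intros)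
qed (auto intro!: continuous_intros)

lemma smooth_onI: "(\<And>k. Ck_on k S f) \<Longrightarrow> smooth_on S f"
  by (simp add: smooth_on_def)

lemma smooth_onD: "smooth_on S f \<Longrightarrow> Ck_on k S f"
  by (simp add: smooth_on_def)

lemma smooth_on_subset: "smooth_on T f \<Longrightarrow> S \<subseteq> T \<Longrightarrow> smooth_on S f"
  by (auto simp: smooth_on_def intro: Ck_on_subset)

lemma smooth_on_cong:
  "open S \<Longrightarrow> (\<And>x. x \<in> S \<Longrightarrow> f x = g x) \<Longrightarrow> smooth_on S f \<Longrightarrow> smooth_on S g"
  unfolding smooth_on_def by (blast intro: Ck_on_cong[of S f g])

lemma smooth_on_local:
  "(\<And>x. x \<in> S \<Longrightarrow> \<exists>T. open T \<and> x \<in> T \<and> smooth_on T f) \<Longrightarrow> smooth_on S f"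
  by (intro smooth_onI Ck_on_local) (metis smooth_onD)

lemma smooth_on_Un: "open S \<Longrightarrow> open T \<Longrightarrow> smooth_on S f \<Longrightarrow> smooth_on T f \<Longrightarrow> smooth_on (S \<union> T) f"
  by (rule smooth_on_local) blast

lemma smooth_on_has_derivative:
  "smooth_on S f \<Longrightarrow> x \<in> S \<Longrightarrow> (f has_derivative frechet_derivative f (at x)) (at x)"
  using Ck_on_Suc_has_derivative[of 0 S f x] by (simp add: smooth_on_def del: Ck_on.simps)

lemma smooth_on_differentiable: "smooth_on S f \<Longrightarrow> x \<in> S \<Longrightarrow> f differentiable (at x)"
  using smooth_on_has_derivative differentiable_def by blast

lemma smooth_on_frechet_derivative:
  "smooth_on S f \<Longrightarrow> smooth_on S (\<lambda>x. frechet_derivative f (at x) v)"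
  unfolding smooth_on_def by (metis Ck_on.simps(2))

lemma smooth_on_continuous_on: "smooth_on S f \<Longrightarrow> continuous_on S f"
  using Ck_on_continuous_on by (auto simp: smooth_on_def)

lemma smooth_on_const: "smooth_on S (\<lambda>_. c)"
  by (simp add: smooth_on_def Ck_on_const)

lemma smooth_on_linear: "bounded_linear L \<Longrightarrow> open S \<Longrightarrow> smooth_on S L"
  by (simp add: smooth_on_def Ck_on_linear)

lemma smooth_on_id: "open S \<Longrightarrow> smooth_on S (\<lambda>x. x)"
  using smooth_on_linear[OF bounded_linear_ident] .

lemma smooth_on_bounded_linear:
  "bounded_linear L \<Longrightarrow> open S \<Longrightarrow> smooth_on S f \<Longrightarrow> smooth_on S (\<lambda>x. L (f x))"
  by (simp add: smooth_on_def Ck_on_bounded_linear)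

lemma smooth_on_bilinear:
  "bounded_bilinear B \<Longrightarrow> open S \<Longrightarrow> smooth_on S f \<Longrightarrow> smooth_on S g \<Longrightarrow> smooth_on S (\<lambda>x. B (f x) (g x))"
  by (simp add: smooth_on_def Ck_on_bilinear)

lemma smooth_on_compose:
  fixes f :: "'b::euclidean_space \<Rightarrow> 'c::real_normed_vector" and g :: "'a::euclidean_space \<Rightarrow> 'b"
  shows "open S \<Longrightarrow> open T \<Longrightarrow> smooth_on S g \<Longrightarrow> g ` S \<subseteq> T \<Longrightarrow> smooth_on T f \<Longrightarrow> smooth_on S (\<lambda>x. f (g x))"
  by (simp add: smooth_on_def Ck_on_compose)

lemma smooth_on_add: "open S \<Longrightarrow> smooth_on S f \<Longrightarrow> smooth_on S g \<Longrightarrow> smooth_on S (\<lambda>x. f x + g x)"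
  by (simp add: smooth_on_def Ck_on_add)

lemma smooth_on_sum:
  "open S \<Longrightarrow> (\<And>i. i \<in> I \<Longrightarrow> smooth_on S (f i)) \<Longrightarrow> smooth_on S (\<lambda>x. \<Sum>i\<in>I. f i x)"
  by (simp add: smooth_on_def Ck_on_sum)

lemma smooth_on_minus: "open S \<Longrightarrow> smooth_on S f \<Longrightarrow> smooth_on S (\<lambda>x. - f x)"
  by (rule smooth_on_bounded_linear[OF bounded_linear_minus[OF bounded_linear_ident]])

lemma smooth_on_diff: "open S \<Longrightarrow> smooth_on S f \<Longrightarrow> smooth_on S g \<Longrightarrow> smooth_on S (\<lambda>x. f x - g x)"
  using smooth_on_add[OF _ _ smooth_on_minus, of S f g] by simp

lemmas smooth_on_scaleR = smooth_on_bilinear[OF bounded_bilinear_scaleR]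
lemmas smooth_on_inner = smooth_on_bilinear[OF bounded_bilinear_inner]

lemma smooth_on_mult:
  fixes f g :: "'a::euclidean_space \<Rightarrow> real"
  shows "open S \<Longrightarrow> smooth_on S f \<Longrightarrow> smooth_on S g \<Longrightarrow> smooth_on S (\<lambda>x. f x * g x)"
  by (rule smooth_on_bilinear[OF bounded_bilinear_mult])

lemma smooth_on_power:
  fixes f :: "'a::euclidean_space \<Rightarrow> real"
  shows "open S \<Longrightarrow> smooth_on S f \<Longrightarrow> smooth_on S (\<lambda>x. f x ^ n)"
  by (induction n) (auto intro: smooth_on_const smooth_on_mult)

lemma smooth_on_prod:
  fixes f :: "'i \<Rightarrow> 'a::euclidean_space \<Rightarrow> real"
  shows "open S \<Longrightarrow> (\<And>i. i \<in> I \<Longrightarrow> smooth_on S (f i)) \<Longrightarrow> smooth_on S (\<lambda>x. \<Prod>i\<in>I. f i x)"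
  by (induction I rule: infinite_finite_induct) (auto intro: smooth_on_const smooth_on_mult)

lemma smooth_on_inverse:
  fixes f :: "'a::euclidean_space \<Rightarrow> real"
  assumes "open S" "smooth_on S f" "\<And>x. x \<in> S \<Longrightarrow> f x \<noteq> 0"
  shows "smooth_on S (\<lambda>x. inverse (f x))"
  by (rule smooth_on_compose[OF assms(1) _ assms(2), of "- {0}"])
    (use assms(3) in \<open>auto simp: open_Compl smooth_on_def Ck_on_inverse_real\<close>)

lemma smooth_on_divide:
  fixes f g :: "'a::euclidean_space \<Rightarrow> real"
  assumes "open S" "smooth_on S f" "smooth_on S g" "\<And>x. x \<in> S \<Longrightarrow> g x \<noteq> 0"
  shows "smooth_on S (\<lambda>x. f x / g x)"
  unfolding divide_inverse by (intro smooth_on_mult smooth_on_inverse assms)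

lemma smooth_on_sqrt:
  assumes "open S" "smooth_on S f" "\<And>x. x \<in> S \<Longrightarrow> f x > 0"
  shows "smooth_on S (\<lambda>x. sqrt (f x))"
  by (rule smooth_on_compose[OF assms(1) _ assms(2), of "{0<..}"])
    (use assms(3) in \<open>auto simp: smooth_on_def Ck_on_sqrt\<close>)

lemma smooth_on_sin:
  fixes f :: "'a::euclidean_space \<Rightarrow> real"
  assumes "open S" "smooth_on S f" shows "smooth_on S (\<lambda>x. sin (f x))"
  by (rule smooth_on_compose[OF assms(1) _ assms(2), of "UNIV"]) (auto simp: smooth_on_def Ck_on_sin_cos)

lemma smooth_on_cos:
  fixes f :: "'a::euclidean_space \<Rightarrow> real"
  assumes "open S" "smooth_on S f" shows "smooth_on S (\<lambda>x. cos (f x))"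
  by (rule smooth_on_compose[OF assms(1) _ assms(2), of "UNIV"]) (auto simp: smooth_on_def Ck_on_sin_cos)

lemma smooth_on_nth: "open S \<Longrightarrow> smooth_on S f \<Longrightarrow> smooth_on S (\<lambda>x. f x $ i)"
  by (rule smooth_on_bounded_linear[OF bounded_linear_vec_nth])

lemma smooth_on_vec_lambda:
  fixes f :: "'i::finite \<Rightarrow> 'a::euclidean_space \<Rightarrow> real"
  assumes "open S" "\<And>i. smooth_on S (f i)"
  shows "smooth_on S (\<lambda>x. \<chi> i. f i x)"
proof -
  have eq: "(\<chi> i. f i x) = (\<Sum>i\<in>UNIV. f i x *\<^sub>R axis i 1)" for x
    by (simp add: vec_eq_iff axis_def if_distrib cong: if_cong)
  show ?thesis unfolding eq by (intro smooth_on_sum smooth_on_scaleR smooth_on_const assms)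
qed

lemma smooth_on_cart:
  fixes f :: "'a::euclidean_space \<Rightarrow> real^'n"
  assumes "open S" "\<And>i. smooth_on S (\<lambda>x. f x $ i)"
  shows "smooth_on S f"
  using smooth_on_vec_lambda[of S "\<lambda>i x. f x $ i"] assms by simp

lemma smooth_on_Pair:
  fixes f :: "'a::euclidean_space \<Rightarrow> 'b::euclidean_space" and g :: "'a \<Rightarrow> 'c::euclidean_space"
  assumes "open S" "smooth_on S f" "smooth_on S g"
  shows "smooth_on S (\<lambda>x. (f x, g x))"
proof -
  have eq: "(f x, g x) = (f x, 0) + (0, g x)" for x by simp
  show ?thesis unfolding eq
    by (intro smooth_on_add assms smooth_on_bounded_linear[where L = "\<lambda>y. (y, 0)"]
        smooth_on_bounded_linear[where L = "\<lambda>y. (0, y)"] bounded_linear_Pair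
        bounded_linear_ident bounded_linear_zero)
qed

lemma smooth_on_det:
  fixes A :: "'a::euclidean_space \<Rightarrow> real^'n^'n"
  assumes "open S" "\<And>i j. smooth_on S (\<lambda>x. A x $ i $ j)"
  shows "smooth_on S (\<lambda>x. det (A x))"
  unfolding det_def by (intro smooth_on_sum smooth_on_mult smooth_on_const smooth_on_prod assms)

lemma jacobian_nth: "jacobian f (at x) $ i $ j = frechet_derivative f (at x) (axis j 1) $ i"
  by (simp add: jacobian_def matrix_def)

lemma smooth_on_jacobian:
  fixes f :: "real^'n \<Rightarrow> real^'m"
  assumes "open S" "smooth_on S f"
  shows "smooth_on S (\<lambda>x. jacobian f (at x) $ i $ j)"
  unfolding jacobian_nth by (intro smooth_on_nth smooth_on_frechet_derivative assms)

lemma smooth_on_has_derivative_jacobian: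
  fixes f :: "real^'n \<Rightarrow> real^'m"
  assumes "smooth_on S f" "x \<in> S"
  shows "(f has_derivative (*v) (jacobian f (at x))) (at x)"
  using jacobian_works smooth_on_differentiable[OF assms] by blast

text \<open>Bootstrap: the derivative of \<zeta> is the inverse matrix of D\<psi> at \<zeta>, and
  Cramer's rule writes it with determinants of the entries and 1/det. If \<zeta> is of class C^k,
  then so is its derivative.\<close>

lemma smooth_on_inverse_map:
  fixes \<psi> \<zeta> :: "real^'n \<Rightarrow> real^'n"
  assumes V: "open V" and U: "open U" and \<psi>: "smooth_on V \<psi>"
    and \<zeta>U: "\<zeta> ` U \<subseteq> V" and \<zeta>\<psi>: "\<And>x. x \<in> V \<Longrightarrow> \<zeta> (\<psi> x) = x" and \<psi>\<zeta>: "\<And>y. y \<in> U \<Longrightarrow> \<psi> (\<zeta> y) = y"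
    and det: "\<And>x. x \<in> V \<Longrightarrow> det (jacobian \<psi> (at x)) \<noteq> 0"
  shows "smooth_on U \<zeta>"
proof -
  define J where "J y = jacobian \<psi> (at (\<zeta> y))" for y
  define D where "D y v = (\<chi> k. det (\<chi> i j. if j = k then v $ i else J y $ i $ j) / det (J y))" for y and v :: "real^'n"
  have dJ: "det (J y) \<noteq> 0" if "y \<in> U" for y
    unfolding J_def using det \<zeta>U that by blast
  have JD: "J y *v D y v = v" if "y \<in> U" for y v
    using cramer[OF dJ[OF that], of "D y v" v] unfolding D_def by blast
  have der: "(\<zeta> has_derivative D y) (at y)" if "y \<in> U" for y
  proof (rule has_derivative_inverse_strong_x[OF V _ smooth_on_continuous_on[OF \<psi>]])
    show "\<zeta> y \<in> V" using that \<zeta>U by auto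
    then show "(\<psi> has_derivative (*v) (J y)) (at (\<zeta> y))"
      unfolding J_def by (rule smooth_on_has_derivative_jacobian[OF \<psi>])
    show "(*v) (J y) \<circ> D y = id" using JD[OF that] by (auto simp: fun_eq_iff)
  qed (use that \<zeta>\<psi> \<psi>\<zeta> in auto)
  have "Ck_on k U \<zeta>" for k
  proof (induction k)
    case 0
    have "\<zeta> differentiable_on U" using der
      by (auto simp: differentiable_on_def differentiable_def intro: has_derivative_at_withinI)
    then show ?case using differentiable_imp_continuous_on by auto
  next
    case (Suc k)
    have J: "Ck_on k U (\<lambda>y. J y $ i $ j)" for i j
      unfolding J_def
      by (rule Ck_on_compose[OF U V Suc \<zeta>U smooth_onD[OF smooth_on_jacobian[OF V \<psi>]]])
    have m: "Ck_on k U f \<Longrightarrow> Ck_on k U g \<Longrightarrow> Ck_on k U (\<lambda>y. f y * g y)" for f g :: "_ \<Rightarrow> real"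
      by (rule Ck_on_bilinear[OF bounded_bilinear_mult U])
    have p: "(\<And>i. i \<in> I \<Longrightarrow> Ck_on k U (f i)) \<Longrightarrow> Ck_on k U (\<lambda>y. \<Prod>i\<in>I. f i y)"
      for f :: "'n \<Rightarrow> _ \<Rightarrow> real" and I
      by (induction I rule: infinite_finite_induct) (auto intro: Ck_on_const m)
    have d: "Ck_on k U (\<lambda>y. det (A y))" if "\<And>i j. Ck_on k U (\<lambda>y. A y $ i $ j)"
      for A :: "_ \<Rightarrow> real^'n^'n"
      unfolding det_def by (intro Ck_on_sum m Ck_on_const p that U)
    have inv: "Ck_on k U (\<lambda>y. inverse (det (J y)))"
      by (rule Ck_on_compose[OF U _ d[OF J] _ Ck_on_inverse_real])
        (use dJ in \<open>auto simp: open_Compl\<close>)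
    have ent: "Ck_on k U (\<lambda>y. det (\<chi> i j. if j = l then v $ i else J y $ i $ j) * inverse (det (J y)))"
      for l and v :: "real^'n"
    proof (rule m[OF d inv])
      show "Ck_on k U (\<lambda>y. (\<chi> i j. if j = l then v $ i else J y $ i $ j) $ i $ j)" for i j
        by (cases "j = l") (auto intro: Ck_on_const J)
    qed
    have eq: "D y v = (\<Sum>l\<in>UNIV. (det (\<chi> i j. if j = l then v $ i else J y $ i $ j) * inverse (det (J y)))
        *\<^sub>R axis l 1)" for y v
      by (simp add: vec_eq_iff axis_def D_def divide_inverse if_distrib cong: if_cong)
    show ?case
    proof (rule Ck_on_SucI[OF U der])
      show "Ck_on k U (\<lambda>y. D y v)" for v
        unfolding eq
        by (intro Ck_on_sum U Ck_on_bilinear[OF bounded_bilinear_scaleR] ent Ck_on_const)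
    qed
  qed
  then show ?thesis by (simp add: smooth_on_def)
qed

section \<open>Integrals of functions with compact support\<close>

lemma integrable_compact_support:
  fixes f :: "'a::euclidean_space \<Rightarrow> 'b::{banach, second_countable_topology}"
  assumes "continuous_on UNIV f" "compact K" "\<And>x. x \<notin> K \<Longrightarrow> f x = 0"
  shows "integrable lborel f"
proof -
  have "integrable lborel (\<lambda>x. indicator K x *\<^sub>R f x)"
    using assms by (intro borel_integrable_compact) (auto intro: continuous_on_subset)
  moreover have "(\<lambda>x. indicator K x *\<^sub>R f x) = f"
    using assms(3) by (auto simp: fun_eq_iff indicator_def)
  ultimately show ?thesis by simp
qed

lemma bounded_compact_support:
  fixes f :: "'a::euclidean_space \<Rightarrow> 'b::real_normed_vector"
  assumes "continuous_on UNIV f" "compact K" "\<And>x. x \<notin> K \<Longrightarrow> f x = 0"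
  obtains B where "B \<ge> 0" "\<And>x. norm (f x) \<le> B"
proof -
  have "compact (f ` K)" using assms by (auto intro: compact_continuous_image continuous_on_subset)
  then obtain B where B: "\<And>x. x \<in> K \<Longrightarrow> norm (f x) \<le> B"
    using compact_imp_bounded bounded_iff by (metis imageI)
  have "norm (f x) \<le> max B 0" for x using B[of x] assms(3)[of x] by (cases "x \<in> K") auto
  then show thesis using that[of "max B 0"] by auto
qed

lemma compact_thickening:
  fixes K :: "'a::euclidean_space set"
  assumes "compact K" shows "compact (\<Union>x\<in>K. cball x e)"
proof -
  have "(\<Union>x\<in>K. cball x e) = {x + y |x y. x \<in> K \<and> y \<in> cball 0 e}" (is "?L = ?R")
  proof (intro set_eqI iffI)
    fix z assume "z \<in> ?L"
    then obtain x where "x \<in> K" "dist x z \<le> e" by auto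
    then show "z \<in> ?R" by (intro CollectI exI[of _ x] exI[of _ "z - x"]) (auto simp: dist_norm norm_minus_commute)
  next
    fix z assume "z \<in> ?R"
    then obtain x y where "z = x + y" "x \<in> K" "norm y \<le> e" by auto
    then show "z \<in> ?L" by (intro UN_I[of x]) (auto simp: dist_norm)
  qed
  then show ?thesis using compact_sums[OF assms compact_cball[of 0 e]] by (simp only:)
qed

lemma uniformly_continuous_compact_support:
  fixes f :: "'a::euclidean_space \<Rightarrow> 'b::real_normed_vector"
  assumes "continuous_on UNIV f" "compact K" "\<And>x. x \<notin> K \<Longrightarrow> f x = 0"
  shows "uniformly_continuous_on UNIV f"
  unfolding uniformly_continuous_on_def
proof (intro allI impI)
  fix e :: real assume e: "e > 0"
  \<comment> \<open>Two points at distance below 1, one of them in \<open>K\<close>, both lie in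
    this compact set; if neither lies in \<open>K\<close>, both values are zero.\<close>
  define K' where "K' = (\<Union>x\<in>K. cball x 1)"
  have "compact K'" unfolding K'_def using assms(2) by (rule compact_thickening)
  then have "uniformly_continuous_on K' f"
    using assms(1) by (auto intro: compact_uniformly_continuous continuous_on_subset)
  then obtain d where d: "d > 0" "\<And>x y. x \<in> K' \<Longrightarrow> y \<in> K' \<Longrightarrow> dist y x < d \<Longrightarrow> dist (f y) (f x) < e"
    using e unfolding uniformly_continuous_on_def by metis
  have KK: "x \<in> K'" if "y \<in> K" "dist y x < 1" for x y
    using that by (auto simp: K'_def intro!: bexI[of _ y])
  have "dist (f y) (f x) < e" if "dist y x < min d 1" for x y
  proof (cases "x \<in> K \<or> y \<in> K")
    case True
    then have "x \<in> K'" "y \<in> K'" using KK[of x y] KK[of y x] KK[of x x] KK[of y y] that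
      by (auto simp: dist_commute)
    then show ?thesis using d that by auto
  qed (use assms(3) e in auto)
  then show "\<exists>d>0. \<forall>x\<in>UNIV. \<forall>x'\<in>UNIV. dist x' x < d \<longrightarrow> dist (f x') (f x) < e"
    using d(1) by (intro exI[of _ "min d 1"]) auto
qed

lemma lborel_integral_translation:
  fixes f :: "'a::euclidean_space \<Rightarrow> real"
  assumes "f \<in> borel_measurable borel"
  shows "(LINT x|lborel. f (c + x)) = (LINT x|lborel. f x)"
proof -
  have "(LINT x|lborel. f x) = (LINT x|distr lborel borel ((+) c). f x)"
    by (simp add: lborel_distr_plus)
  also have "\<dots> = (LINT x|lborel. f (c + x))"
    using assms by (subst integral_distr) auto
  finally show ?thesis by simp
qed

lemma frechet_derivative_outside_support:
  assumes "compact K" "\<And>x. x \<notin> K \<Longrightarrow> f x = (0::'b::real_normed_vector)" "x \<notin> K"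
  shows "frechet_derivative f (at (x::'a::euclidean_space)) = (\<lambda>_. 0)"
proof -
  have "frechet_derivative f (at x) = frechet_derivative (\<lambda>_. 0) (at x)"
    by (rule frechet_derivative_transform[of "- K"])
      (use assms compact_imp_closed in \<open>auto simp: open_Compl\<close>)
  also have "\<dots> = (\<lambda>_. 0)" by (metis frechet_derivative_at has_derivative_const)
  finally show ?thesis .
qed

lemma line_has_real_derivative:
  fixes f :: "'a::euclidean_space \<Rightarrow> real"
  assumes "f differentiable (at (x + t *\<^sub>R v))"
  shows "((\<lambda>t. f (x + t *\<^sub>R v)) has_real_derivative frechet_derivative f (at (x + t *\<^sub>R v)) v) (at t)"
proof -
  have D: "(f has_derivative frechet_derivative f (at (x + t *\<^sub>R v))) (at (x + t *\<^sub>R v))"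
    using assms frechet_derivative_works by blast
  have "((\<lambda>t. x + t *\<^sub>R v) has_derivative (\<lambda>s. s *\<^sub>R v)) (at t)"
    by (auto intro!: derivative_eq_intros)
  from has_derivative_compose[OF this D]
  have "((\<lambda>t. f (x + t *\<^sub>R v)) has_derivative (\<lambda>s. s * frechet_derivative f (at (x + t *\<^sub>R v)) v)) (at t)"
    by (simp add: linear_scale[OF has_derivative_linear[OF D]])
  then show ?thesis unfolding has_field_derivative_def
    by (simp add: mult.commute[of _ "frechet_derivative f (at (x + t *\<^sub>R v)) v"])
qed

text \<open>By translation invariance every difference quotient has integral zero; dominated
  convergence carries this over to the derivative.\<close>

lemma integral_derivative_compact_support:
  fixes f :: "'a::euclidean_space \<Rightarrow> real"
  assumes f: "Ck_on 1 UNIV f" and K: "compact K" "\<And>x. x \<notin> K \<Longrightarrow> f x = 0"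
  shows "(LINT x|lborel. frechet_derivative f (at x) v) = 0"
proof -
  define D where "D x = frechet_derivative f (at x) v" for x
  have contf: "continuous_on UNIV f" using Ck_on_continuous_on[OF f] .
  have contD: "continuous_on UNIV D" using f by (auto simp: D_def)
  have D0: "D x = 0" if "x \<notin> K" for x
    unfolding D_def using frechet_derivative_outside_support[OF K that] by simp
  obtain B where B: "B \<ge> 0" "\<And>x. norm (D x) \<le> B"
    using bounded_compact_support[OF contD K(1) D0] by blast
  define q where "q n x = real (Suc n) * (f ((1 / real (Suc n)) *\<^sub>R v + x) - f x)" for n x
  have mv: "\<exists>z. 0 < z \<and> z < 1 / real (Suc n) \<and> q n x = D (x + z *\<^sub>R v)" for n x
  proof -
    have "f differentiable (at y)" for y using f by simp
    then have "\<exists>z. 0 < z \<and> z < 1 / real (Suc n) \<and>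
        f (x + (1 / real (Suc n)) *\<^sub>R v) - f (x + 0 *\<^sub>R v) = (1 / real (Suc n) - 0) * D (x + z *\<^sub>R v)"
      unfolding D_def by (intro MVT2) (auto intro!: line_has_real_derivative simp del: of_nat_Suc)
    then show ?thesis by (auto simp: q_def add.commute simp del: of_nat_Suc)
  qed
  \<comment> \<open>Contains the supports of all difference quotients: the intermediate point of the
    mean value theorem is at distance at most \<open>norm v\<close>.\<close>
  define K' where "K' = (\<Union>x\<in>K. cball x (norm v))"
  have K': "compact K'" unfolding K'_def using K(1) by (rule compact_thickening)
  have intf: "integrable lborel f" by (rule integrable_compact_support[OF contf K])
  have fb: "f \<in> borel_measurable borel" using contf by (rule borel_measurable_continuous_onI)
  have ints: "integrable lborel (\<lambda>x. f (c + x))" for c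
  proof (rule integrable_compact_support)
    show "continuous_on UNIV (\<lambda>x. f (c + x))"
      by (rule continuous_on_compose2[OF contf]) (auto intro!: continuous_intros)
    show "compact ((+) (- c) ` K)" using K(1) by (rule compact_translation)
    show "f (c + x) = 0" if "x \<notin> (+) (- c) ` K" for x
      using that K(2)[of "c + x"] by (force simp: image_iff)
  qed
  have "(\<lambda>n. LINT x|lborel. q n x) \<longlonglongrightarrow> (LINT x|lborel. D x)"
  proof (rule integral_dominated_convergence[where w = "\<lambda>x. indicator K' x *\<^sub>R B"])
    show "D \<in> borel_measurable lborel" using borel_measurable_continuous_onI[OF contD] by simp
    show "q n \<in> borel_measurable lborel" for n
    proof -
      have "continuous_on UNIV (q n)"
        unfolding q_def by (intro continuous_intros continuous_on_compose2[OF contf]) auto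
      then show ?thesis using borel_measurable_continuous_onI by simp
    qed
    show "integrable lborel (\<lambda>x. indicator K' x *\<^sub>R B)"
      by (rule borel_integrable_compact[OF K']) auto
    show "AE x in lborel. (\<lambda>n. q n x) \<longlonglongrightarrow> D x"
    proof (rule AE_I2)
      fix x
      from mv[of _ x] obtain z where z: "\<And>n. 0 < z n \<and> z n < 1 / real (Suc n) \<and> q n x = D (x + z n *\<^sub>R v)"
        by metis
      have "z \<longlonglongrightarrow> 0"
        by (rule tendsto_sandwich[OF _ _ tendsto_const LIMSEQ_inverse_real_of_nat])
          (use z in \<open>auto simp: inverse_eq_divide less_imp_le simp del: of_nat_Suc\<close>)
      then have "(\<lambda>n. x + z n *\<^sub>R v) \<longlonglongrightarrow> x + 0 *\<^sub>R v" by (intro tendsto_intros)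
      then have "(\<lambda>n. D (x + z n *\<^sub>R v)) \<longlonglongrightarrow> D x"
        using contD by (auto intro: continuous_on_tendsto_compose)
      then show "(\<lambda>n. q n x) \<longlonglongrightarrow> D x" using z by simp
    qed
    show "AE x in lborel. norm (q n x) \<le> indicator K' x *\<^sub>R B" for n
    proof (rule AE_I2)
      fix x
      obtain z where z: "0 < z" "z < 1 / real (Suc n)" "q n x = D (x + z *\<^sub>R v)" using mv by blast
      show "norm (q n x) \<le> indicator K' x *\<^sub>R B"
      proof (cases "x + z *\<^sub>R v \<in> K")
        case True
        have "1 / real (Suc n) \<le> 1" by simp
        then have "z \<le> 1" using z(2) by linarith
        then have "dist (x + z *\<^sub>R v) x \<le> norm v" using z(1) by (simp add: dist_norm mult_left_le_one_le)
        then have "x \<in> K'" using True by (auto simp: K'_def)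
        then show ?thesis using B z by simp
      qed (use z D0 B in \<open>auto simp: indicator_def\<close>)
    qed
  qed
  moreover have "(LINT x|lborel. q n x) = 0" for n
    using lborel_integral_translation[OF fb] ints intf by (simp add: q_def del: of_nat_Suc)
  ultimately have "(\<lambda>n. 0) \<longlonglongrightarrow> (LINT x|lborel. D x)" by simp
  then show ?thesis unfolding D_def using LIMSEQ_unique tendsto_const by blast
qed

lemma frechet_derivative_mult:
  fixes f g :: "'a::euclidean_space \<Rightarrow> real"
  assumes "f differentiable (at x)" "g differentiable (at x)"
  shows "frechet_derivative (\<lambda>x. f x * g x) (at x) v =
    f x * frechet_derivative g (at x) v + frechet_derivative f (at x) v * g x"
proof -
  have "((\<lambda>x. f x * g x) has_derivative (\<lambda>v. f x * frechet_derivative g (at x) v +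
      frechet_derivative f (at x) v * g x)) (at x)"
    using assms by (intro has_derivative_mult) (auto simp: frechet_derivative_works[symmetric])
  from frechet_derivative_at[OF this, symmetric] show ?thesis by simp
qed

lemma Ck_on_mult:
  fixes f g :: "'a::euclidean_space \<Rightarrow> real"
  shows "open S \<Longrightarrow> Ck_on k S f \<Longrightarrow> Ck_on k S g \<Longrightarrow> Ck_on k S (\<lambda>x. f x * g x)"
  by (rule Ck_on_bilinear[OF bounded_bilinear_mult])

lemma integration_by_parts_compact_support:
  fixes f g :: "'a::euclidean_space \<Rightarrow> real"
  assumes f: "Ck_on 1 UNIV f" and g: "Ck_on 1 UNIV g"
    and K: "compact K" "\<And>x. x \<notin> K \<Longrightarrow> g x = 0"
  shows "(LINT x|lborel. f x * frechet_derivative g (at x) v) =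
    - (LINT x|lborel. frechet_derivative f (at x) v * g x)"
proof -
  have c: "continuous_on UNIV f" "continuous_on UNIV g"
    by (rule Ck_on_continuous_on[OF f], rule Ck_on_continuous_on[OF g])
  have c': "continuous_on UNIV (\<lambda>x. frechet_derivative f (at x) v)"
    "continuous_on UNIV (\<lambda>x. frechet_derivative g (at x) v)"
    using f g by simp_all
  have "frechet_derivative g (at x) v = 0" if "x \<notin> K" for x
    using frechet_derivative_outside_support[OF K that] by simp
  then have i: "integrable lborel (\<lambda>x. f x * frechet_derivative g (at x) v)"
    by (intro integrable_compact_support[OF continuous_on_mult[OF c(1) c'(2)] K(1)]) simp
  have i': "integrable lborel (\<lambda>x. frechet_derivative f (at x) v * g x)"
    by (rule integrable_compact_support[OF continuous_on_mult[OF c'(1) c(2)] K(1)]) (simp add: K(2))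
  have "(LINT x|lborel. frechet_derivative (\<lambda>x. f x * g x) (at x) v) = 0"
    by (rule integral_derivative_compact_support[OF Ck_on_mult[OF open_UNIV f g] K(1)]) (use K in auto)
  also have "(\<lambda>x. frechet_derivative (\<lambda>x. f x * g x) (at x) v) =
      (\<lambda>x. f x * frechet_derivative g (at x) v + frechet_derivative f (at x) v * g x)"
    using f g by (intro ext frechet_derivative_mult) simp_all
  finally show ?thesis using Bochner_Integration.integral_add[OF i i'] by linarith
qed

section \<open>A flat function, bump functions and mollifiers\<close>

definition flat_exp :: "nat \<Rightarrow> real \<Rightarrow> real" where
  "flat_exp n s = (if s > 0 then inverse s ^ n * exp (- inverse s) else 0)"

text \<open>With y = 1/s, a single term of the exponential series gives y^(n+2) \<le> (n+2)! e^y.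
  The quadratic decay at 0 is what makes the difference quotient there vanish.\<close>

lemma flat_exp_le: "0 \<le> flat_exp n s" "flat_exp n s \<le> fact (n + 2) * s\<^sup>2"
proof -
  show "0 \<le> flat_exp n s" by (simp add: flat_exp_def)
  show "flat_exp n s \<le> fact (n + 2) * s\<^sup>2"
  proof (cases "s > 0")
    case True
    define y where "y = inverse s"
    have y: "y > 0" "s = inverse y" using True by (auto simp: y_def)
    have "y ^ (n + 2) /\<^sub>R fact (n + 2) = (\<Sum>k\<in>{n + 2}. y ^ k /\<^sub>R fact k)" by simp
    also have "\<dots> \<le> (\<Sum>k. y ^ k /\<^sub>R fact k)"
      by (rule sum_le_suminf[OF summable_exp_generic]) (use y in auto)
    also have "\<dots> = exp y" by (simp add: exp_def)
    finally have "y ^ (n + 2) \<le> fact (n + 2) * exp y"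
      by (simp add: divide_inverse[symmetric] mult.commute[of "inverse _"] pos_divide_le_eq mult.commute[of "exp y"]
          del: fact_Suc add_2_eq_Suc')
    then have "y ^ (n + 2) * exp (- y) \<le> fact (n + 2) * exp y * exp (- y)"
      by (rule mult_right_mono) simp
    also have "\<dots> = fact (n + 2)" by (simp add: mult.assoc exp_minus)
    finally have "y ^ (n + 2) * exp (- y) * s\<^sup>2 \<le> fact (n + 2) * s\<^sup>2"
      by (rule mult_right_mono) simp
    moreover have "y ^ (n + 2) * exp (- y) * s\<^sup>2 = flat_exp n s"
    proof -
      have "y\<^sup>2 * s\<^sup>2 = 1" using y by (simp flip: power_mult_distrib)
      then have "y ^ n * exp (- y) * (y\<^sup>2 * s\<^sup>2) = flat_exp n s"
        using True by (simp add: flat_exp_def y_def)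
      then show ?thesis by (simp only: power_add mult_ac)
    qed
    ultimately show ?thesis by simp
  qed (simp add: flat_exp_def)
qed

text \<open>The family s^(-n) e^(-1/s) is closed under differentiation up to linear combinations.
  Carrying the index n is what lets smoothness be proved by induction on the order.\<close>

lemma flat_exp_has_derivative:
  "(flat_exp n has_real_derivative flat_exp (n + 2) s - real n * flat_exp (n + 1) s) (at s)"
proof -
  consider "s > 0" | "s < 0" | "s = 0" by linarith
  then show ?thesis
  proof cases
    case 1
    have d: "(inverse has_real_derivative - (inverse s)\<^sup>2) (at s)"
      using 1 by (auto intro!: derivative_eq_intros simp: power2_eq_square)
    have "((\<lambda>s. inverse s ^ n * exp (- inverse s)) has_real_derivative
        inverse s ^ n * (exp (- inverse s) * - (- (inverse s)\<^sup>2)) +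
        (of_nat n * (- (inverse s)\<^sup>2 * inverse s ^ (n - Suc 0))) * exp (- inverse s)) (at s)"
      by (intro DERIV_mult' DERIV_power d DERIV_chain2[of exp] DERIV_exp DERIV_minus)
    moreover have "inverse s ^ n * (exp (- inverse s) * - (- (inverse s)\<^sup>2)) +
        (of_nat n * (- (inverse s)\<^sup>2 * inverse s ^ (n - Suc 0))) * exp (- inverse s) =
        flat_exp (n + 2) s - real n * flat_exp (n + 1) s"
      using 1 by (cases n) (simp_all add: flat_exp_def algebra_simps power2_eq_square)
    ultimately have "((\<lambda>s. inverse s ^ n * exp (- inverse s)) has_real_derivative
        flat_exp (n + 2) s - real n * flat_exp (n + 1) s) (at s)" by simp
    then show ?thesis
      by (rule has_field_derivative_transform_within_open[of _ _ _ "{0<..}"])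
        (use 1 in \<open>auto simp: flat_exp_def\<close>)
  next
    case 2
    have "((\<lambda>s. 0) has_real_derivative flat_exp (n + 2) s - real n * flat_exp (n + 1) s) (at s)"
      using 2 by (simp add: flat_exp_def)
    then show ?thesis
      by (rule has_field_derivative_transform_within_open[of _ _ _ "{..<0}"])
        (use 2 in \<open>auto simp: flat_exp_def\<close>)
  next
    case 3
    have "(\<lambda>h. flat_exp n h / h) \<midarrow>0\<rightarrow> 0"
    proof (rule Lim_null_comparison)
      show "\<forall>\<^sub>F h in at 0. norm (flat_exp n h / h) \<le> fact (n + 2) * \<bar>h\<bar>"
      proof (rule eventually_at_filter[THEN iffD2], intro always_eventually allI impI)
        fix h :: real assume "h \<noteq> 0"
        then show "norm (flat_exp n h / h) \<le> fact (n + 2) * \<bar>h\<bar>"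
          using flat_exp_le[of n h] by (simp add: divide_le_eq power2_eq_square abs_mult mult.assoc)
      qed
      show "((\<lambda>h. fact (n + 2) * \<bar>h\<bar>) \<longlongrightarrow> 0) (at (0::real))"
        by (auto intro!: tendsto_eq_intros)
    qed
    then show ?thesis using 3 by (simp add: has_field_derivative_iff flat_exp_def)
  qed
qed

lemma smooth_on_flat_exp: "smooth_on UNIV (flat_exp n)"
proof (rule smooth_onI)
  show "Ck_on k UNIV (flat_exp n)" for k
  proof (induction k arbitrary: n)
    case 0
    have "isCont (flat_exp n) s" for s using flat_exp_has_derivative DERIV_isCont by blast
    then show ?case by (simp add: continuous_at_imp_continuous_on)
  next
    case (Suc k)
    show ?case
    proof (rule Ck_on_DERIV[OF open_UNIV flat_exp_has_derivative])
      have "Ck_on k UNIV (\<lambda>s. flat_exp (n + 2) s + - real n * flat_exp (n + 1) s)"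
        by (intro Ck_on_add Ck_on_mult Ck_on_const Suc open_UNIV)
      then show "Ck_on k UNIV (\<lambda>s. flat_exp (n + 2) s - real n * flat_exp (n + 1) s)" by simp
    qed
  qed
qed

text \<open>A multiple of exp(-1/(e^2 - |x|^2)) inside the ball. Evenness is recorded so that y
  \<mapsto> \<eta>(x - y) is a translate of \<eta> and therefore has integral one.\<close>

lemma mollifier_exists:
  assumes "e > 0"
  obtains \<eta> :: "'a::euclidean_space \<Rightarrow> real"
  where "smooth_on UNIV \<eta>" "\<And>x. \<eta> x \<ge> 0" "\<And>x. norm x \<ge> e \<Longrightarrow> \<eta> x = 0"
    "\<And>x. \<eta> (- x) = \<eta> x" "integrable lborel \<eta>" "(LINT x|lborel. \<eta> x) = 1"
proof -
  define \<beta> :: "'a \<Rightarrow> real" where "\<beta> x = flat_exp 0 (e\<^sup>2 - x \<bullet> x)" for x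
  have sm: "smooth_on UNIV \<beta>"
    unfolding \<beta>_def
    by (rule smooth_on_compose[OF _ _ _ _ smooth_on_flat_exp])
      (auto intro!: smooth_on_diff smooth_on_inner smooth_on_const smooth_on_id)
  have nn: "\<beta> x \<ge> 0" for x by (simp add: \<beta>_def flat_exp_le)
  have z: "\<beta> x = 0" if "norm x \<ge> e" for x
  proof -
    have "e\<^sup>2 \<le> (norm x)\<^sup>2" using that assms by (intro power_mono) auto
    then show ?thesis by (simp add: \<beta>_def flat_exp_def dot_square_norm)
  qed
  have z': "\<beta> x = 0" if "x \<notin> cball 0 e" for x using z[of x] that by simp
  have c: "continuous_on UNIV \<beta>" using sm by (rule smooth_on_continuous_on)
  have int: "integrable lborel \<beta>" by (rule integrable_compact_support[OF c compact_cball z'])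
  \<comment> \<open>A vanishing integral would force \<beta> = 0 almost everywhere, although \<beta>
    is positive on a ball of positive measure.\<close>
  have "0 < (LINT x|lborel. \<beta> x)"
  proof -
    have "(LINT x|lborel. \<beta> x) \<noteq> 0"
    proof
      assume "(LINT x|lborel. \<beta> x) = 0"
      then have "AE x in lborel. \<beta> x = 0" using integral_nonneg_eq_0_iff_AE[OF int] nn by auto
      then have "AE x in lborel. x \<notin> ball (0::'a) e"
      proof (rule AE_mp, intro AE_I2 impI)
        fix x assume "\<beta> x = 0"
        then show "x \<notin> ball 0 e"
          using assms by (auto simp: \<beta>_def flat_exp_def dot_square_norm power_strict_mono split: if_splits)
      qed
      then have "emeasure lborel (ball (0::'a) e) = 0"
        by (subst (asm) AE_iff_measurable[of "ball 0 e"]) auto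
      then show False using content_ball_pos[OF assms, of "0::'a"] by (simp add: measure_def)
    qed
    moreover have "(LINT x|lborel. \<beta> x) \<ge> 0" using nn by simp
    ultimately show ?thesis by linarith
  qed
  moreover have "\<beta> (- x) = \<beta> x" for x by (simp add: \<beta>_def)
  ultimately show thesis
    using int nn z
    by (intro that[of "\<lambda>x. inverse (LINT x|lborel. \<beta> x) * \<beta> x"])
      (auto intro!: smooth_on_mult smooth_on_const sm)
qed

section \<open>Mollification and the fundamental lemma\<close>

lemma integral_cbox_compact_support:
  fixes f :: "'a::euclidean_space \<Rightarrow> real"
  assumes "continuous_on UNIV f" "K \<subseteq> cbox a b" "compact K" "\<And>x. x \<notin> K \<Longrightarrow> f x = 0"
  shows "integral (cbox a b) f = (LINT x|lborel. f x)"
proof -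
  have "(LINT x|lborel. f x) = integral UNIV f"
    using integral_lborel[OF integrable_compact_support[OF assms(1,3,4)]] by simp
  moreover have "f = (\<lambda>x. if x \<in> cbox a b then f x else 0)"
    using assms(2,4) by fastforce
  ultimately show ?thesis by (metis integral_restrict_UNIV)
qed

text \<open>All derivatives fall on \<open>h\<close>, so \<open>G\<close> need only be continuous.
  The Leibniz rule is applied on a box containing the support of \<open>G\<close>, with the
  derivative as a bounded linear function depending continuously on both variables.\<close>

lemma convolution_has_derivative:
  fixes h G :: "'a::euclidean_space \<Rightarrow> real"
  assumes h: "Ck_on 1 UNIV h" and G: "continuous_on UNIV G" "compact K" "\<And>x. x \<notin> K \<Longrightarrow> G x = 0"
  shows "((\<lambda>x. LINT y|lborel. h (x - y) * G y) has_derivative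
    (\<lambda>v. LINT y|lborel. frechet_derivative h (at (x - y)) v * G y)) (at x)"
proof -
  obtain a b where ab: "K \<subseteq> cbox a b"
    using bounded_subset_cbox_symmetric[OF compact_imp_bounded[OF G(2)]] by metis
  define D where "D = (\<lambda>x. frechet_derivative h (at x))"
  have dh: "(h has_derivative D x) (at x)" for x
    unfolding D_def using h by (simp add: frechet_derivative_works[symmetric])
  have cD: "continuous_on UNIV (\<lambda>x. D x v)" for v using h by (simp add: D_def)
  have ch: "continuous_on UNIV h" by (rule Ck_on_continuous_on[OF h])
  have lin: "bounded_linear (\<lambda>v. D (x - y) v * G y)" for x y
    using has_derivative_bounded_linear[OF dh] by (rule bounded_linear_mult_const)
  define F where "F x y = Blinfun (\<lambda>v. D (x - y) v * G y)" for x y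
  have F: "blinfun_apply (F x y) = (\<lambda>v. D (x - y) v * G y)" for x y
    unfolding F_def by (rule bounded_linear_Blinfun_apply[OF lin])
  have eq: "integral (cbox a b) (\<lambda>y. f (x - y) * G y) = (LINT y|lborel. f (x - y) * G y)"
    if "continuous_on UNIV f" for f x
    by (rule integral_cbox_compact_support[OF _ ab G(2)])
      (auto intro!: continuous_on_mult G(1) continuous_on_compose2[OF that] continuous_intros simp: G(3))
  have "((\<lambda>x. integral (cbox a b) (\<lambda>y. h (x - y) * G y)) has_derivative
      integral (cbox a b) (F x)) (at x within UNIV)"
  proof (rule leibniz_rule)
    show "((\<lambda>x. h (x - t) * G t) has_derivative blinfun_apply (F x t)) (at x within UNIV)" for x t
    proof -
      have "((\<lambda>x. x - t) has_derivative (\<lambda>v. v)) (at x)" by (auto intro!: derivative_eq_intros)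
      from has_derivative_compose[OF this dh]
      have "((\<lambda>x. h (x - t)) has_derivative D (x - t)) (at x)" .
      then show ?thesis unfolding F by (rule has_derivative_mult_left)
    qed
    show "(\<lambda>y. h (x - y) * G y) integrable_on cbox a b" for x
      by (rule integrable_continuous)
        (auto intro!: continuous_on_mult continuous_on_subset[OF G(1)] continuous_on_compose2[OF ch] continuous_intros)
    show "continuous_on (UNIV \<times> cbox a b) (\<lambda>(x, t). F x t)"
      unfolding split_beta
      by (rule continuous_on_blinfun_componentwise, unfold F)
        (auto intro!: continuous_on_mult continuous_on_compose2[OF G(1)] continuous_on_compose2[OF cD] continuous_intros)
  qed auto
  moreover have "blinfun_apply (integral (cbox a b) (F x)) v = (LINT y|lborel. D (x - y) v * G y)" for v
  proof -
    have "F x integrable_on cbox a b"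
      by (rule integrable_continuous, rule continuous_on_blinfun_componentwise, unfold F)
        (auto intro!: continuous_on_mult continuous_on_compose2[OF G(1)] continuous_on_compose2[OF cD] continuous_intros)
    then have "blinfun_apply (integral (cbox a b) (F x)) v = integral (cbox a b) (\<lambda>y. D (x - y) v * G y)"
      by (simp add: blinfun_apply_integral F)
    then show ?thesis using eq[OF cD] by simp
  qed
  then have "blinfun_apply (integral (cbox a b) (F x)) = (\<lambda>v. LINT y|lborel. D (x - y) v * G y)" ..
  ultimately show ?thesis unfolding eq[OF ch] D_def by simp
qed

lemma smooth_on_convolution:
  fixes h G :: "'a::euclidean_space \<Rightarrow> real"
  assumes h: "smooth_on UNIV h" and G: "continuous_on UNIV G" "compact K" "\<And>x. x \<notin> K \<Longrightarrow> G x = 0"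
  shows "smooth_on UNIV (\<lambda>x. LINT y|lborel. h (x - y) * G y)"
proof -
  have "Ck_on k UNIV (\<lambda>x. LINT y|lborel. h (x - y) * G y)" if "smooth_on UNIV h" for k h
    using that
  proof (induction k arbitrary: h)
    case 0
    note * = convolution_has_derivative[OF smooth_onD[OF 0] G]
    show ?case using has_derivative_continuous[OF *] by (simp add: continuous_at_imp_continuous_on)
  next
    case (Suc k)
    show ?case
      by (rule Ck_on_SucI[OF open_UNIV convolution_has_derivative[OF smooth_onD[OF Suc.prems] G]])
        (use Suc.IH[OF smooth_on_frechet_derivative[OF Suc.prems]] in auto)
  qed
  then show ?thesis using h smooth_onI by blast
qed

lemma convolution_approx:
  fixes \<eta> G :: "'a::euclidean_space \<Rightarrow> real"
  assumes \<eta>: "continuous_on UNIV \<eta>" "\<And>x. \<eta> x \<ge> 0" "\<And>x. norm x \<ge> d \<Longrightarrow> \<eta> x = 0" "\<And>x. \<eta> (- x) = \<eta> x"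
    "(LINT x|lborel. \<eta> x) = 1"
    and G: "continuous_on UNIV G" "compact K" "\<And>x. x \<notin> K \<Longrightarrow> G x = 0"
    and e: "\<And>x y. dist x y < d \<Longrightarrow> \<bar>G x - G y\<bar> \<le> e"
  shows "\<bar>(LINT y|lborel. \<eta> (x - y) * G y) - G x\<bar> \<le> e"
proof -
  have sym: "\<eta> (x - y) = \<eta> (- x + y)" for y using \<eta>(4)[of "x - y"] by simp
  have c: "continuous_on UNIV (\<lambda>y. \<eta> (x - y))"
    by (rule continuous_on_compose2[OF \<eta>(1)]) (auto intro!: continuous_intros)
  have z: "\<eta> (x - y) = 0" if "y \<notin> cball x d" for y
    using that by (intro \<eta>(3)) (simp add: dist_norm)
  have i: "integrable lborel (\<lambda>y. \<eta> (x - y))"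
    by (rule integrable_compact_support[OF c compact_cball z])
  have I1: "(LINT y|lborel. \<eta> (x - y)) = 1"
    unfolding sym using \<eta>(1,5) by (subst lborel_integral_translation) (auto intro: borel_measurable_continuous_onI)
  have i2: "integrable lborel (\<lambda>y. \<eta> (x - y) * G y)"
    by (rule integrable_compact_support[OF continuous_on_mult[OF c G(1)] G(2)]) (simp add: G(3))
  have "(LINT y|lborel. \<eta> (x - y) * G y) - G x = (LINT y|lborel. \<eta> (x - y) * G y - \<eta> (x - y) * G x)"
    using I1 i i2 by simp
  also have "\<bar>\<dots>\<bar> \<le> (LINT y|lborel. \<eta> (x - y) * e)"
  proof (rule integral_abs_bound_integral)
    show "\<bar>\<eta> (x - y) * G y - \<eta> (x - y) * G x\<bar> \<le> \<eta> (x - y) * e" for y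
    proof (cases "dist y x < d")
      case True
      have "\<bar>\<eta> (x - y) * G y - \<eta> (x - y) * G x\<bar> = \<eta> (x - y) * \<bar>G y - G x\<bar>"
        using \<eta>(2) by (simp add: abs_mult flip: right_diff_distrib)
      then show ?thesis using e[OF True] \<eta>(2) by (simp add: mult_left_mono)
    next
      case False
      then have "\<eta> (x - y) = 0" by (intro \<eta>(3)) (simp add: dist_norm norm_minus_commute)
      then show ?thesis by simp
    qed
  qed (use i i2 in auto)
  also have "\<dots> = e" using I1 i by simp
  finally show ?thesis .
qed

text \<open>One construction serves two purposes: the fundamental lemma needs uniform approximation
  of a merely continuous \<open>G\<close>, while the boundary condition also needs convergence of
  the gradients. Hence the clause for \<open>Ck_on 1\<close> is an implication inside the
  conclusion.\<close>

lemma mollification: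
  fixes G :: "'a::euclidean_space \<Rightarrow> real"
  assumes G: "continuous_on UNIV G" and K: "compact K" "\<And>x. x \<notin> K \<Longrightarrow> G x = 0" and "d > 0" "e > 0"
  shows "\<exists>\<phi>. smooth_on UNIV \<phi> \<and> (\<forall>x. x \<notin> (\<Union>y\<in>K. cball y d) \<longrightarrow> \<phi> x = 0) \<and>
    (\<forall>x. \<bar>\<phi> x - G x\<bar> \<le> e) \<and>
    (Ck_on 1 UNIV G \<longrightarrow> (\<forall>x. \<forall>b\<in>Basis.
      \<bar>frechet_derivative \<phi> (at x) b - frechet_derivative G (at x) b\<bar> \<le> e))"
proof -
  define D where "D b x = frechet_derivative G (at x) b" for b x
  have D0: "D b x = 0" if "x \<notin> K" for b x
    unfolding D_def using frechet_derivative_outside_support[OF K that] by simp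
  have mod: "\<exists>\<delta>>0. \<forall>x y. dist x y < \<delta> \<longrightarrow> \<bar>F x - F y\<bar> \<le> e"
    if F: "continuous_on UNIV F" "\<And>x. x \<notin> K \<Longrightarrow> F x = 0" for F :: "'a \<Rightarrow> real"
  proof -
    obtain \<delta> where "\<delta> > 0" "\<And>x y. dist x y < \<delta> \<Longrightarrow> dist (F x) (F y) < e"
      using uniformly_continuous_compact_support[OF F(1) K(1) F(2)] \<open>e > 0\<close>
      unfolding uniformly_continuous_on_def by (metis UNIV_I)
    then show ?thesis by (intro exI[of _ \<delta>]) (auto simp: dist_real_def less_imp_le)
  qed
  have "\<exists>\<delta>>0. Ck_on 1 UNIV G \<longrightarrow> (\<forall>x y. dist x y < \<delta> \<longrightarrow> \<bar>D b x - D b y\<bar> \<le> e)" for b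
  proof (cases "Ck_on 1 UNIV G")
    case True
    then have "continuous_on UNIV (D b)" by (simp add: D_def[abs_def])
    from mod[OF this D0] show ?thesis by auto
  qed (auto intro: exI[of _ 1])
  then obtain \<delta> where \<delta>: "\<And>b. \<delta> b > 0"
      "\<And>b x y. Ck_on 1 UNIV G \<Longrightarrow> dist x y < \<delta> b \<Longrightarrow> \<bar>D b x - D b y\<bar> \<le> e"
    by metis
  obtain \<delta>0 where \<delta>0: "\<delta>0 > 0" "\<And>x y. dist x y < \<delta>0 \<Longrightarrow> \<bar>G x - G y\<bar> \<le> e"
    using mod[OF G K(2)] by auto
  \<comment> \<open>The radius respects the permitted enlargement \<open>d\<close> of the support
    and the moduli of continuity of \<open>G\<close> and of all its partial derivatives.\<close>
  define r where "r = Min (insert d (insert \<delta>0 (\<delta> ` Basis)))"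
  have r: "r > 0" "r \<le> d" "r \<le> \<delta>0" "\<And>b. b \<in> Basis \<Longrightarrow> r \<le> \<delta> b"
    using \<delta>(1) \<delta>0(1) \<open>d > 0\<close> unfolding r_def by (auto intro!: Min_le simp del: Min_insert)
  obtain \<eta> :: "'a \<Rightarrow> real" where \<eta>: "smooth_on UNIV \<eta>" "\<And>x. \<eta> x \<ge> 0" "\<And>x. norm x \<ge> r \<Longrightarrow> \<eta> x = 0"
    "\<And>x. \<eta> (- x) = \<eta> x" "(LINT x|lborel. \<eta> x) = 1"
    using mollifier_exists[OF r(1)] by metis
  have c\<eta>: "continuous_on UNIV \<eta>" by (rule smooth_on_continuous_on[OF \<eta>(1)])
  define \<phi> where "\<phi> x = (LINT y|lborel. \<eta> (x - y) * G y)" for x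
  show ?thesis
  proof (intro exI[of _ \<phi>] conjI allI impI ballI)
    show "smooth_on UNIV \<phi>" unfolding \<phi>_def[abs_def] by (rule smooth_on_convolution[OF \<eta>(1) G K])
    show "\<phi> x = 0" if "x \<notin> (\<Union>y\<in>K. cball y d)" for x
    proof -
      have "\<eta> (x - y) * G y = 0" for y
      proof (cases "y \<in> K")
        case True
        then have "dist y x > d" using that by auto
        then have "norm (x - y) \<ge> r" using r by (simp add: dist_norm norm_minus_commute)
        then show ?thesis using \<eta>(3) by simp
      qed (use K in auto)
      then have "(\<lambda>y. \<eta> (x - y) * G y) = (\<lambda>_. 0)" by blast
      then show ?thesis by (simp only: \<phi>_def integral_zero)
    qed
    show "\<bar>\<phi> x - G x\<bar> \<le> e" for x unfolding \<phi>_def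
      by (rule convolution_approx[OF c\<eta> \<eta>(2-5) G K]) (use \<delta>0(2) r in auto)
    fix x and b :: 'a assume C1: "Ck_on 1 UNIV G" and b: "b \<in> Basis"
    have cD: "continuous_on UNIV (D b)" using C1 by (simp add: D_def[abs_def])
    have "frechet_derivative \<phi> (at x) b = (LINT y|lborel. frechet_derivative \<eta> (at (x - y)) b * G y)"
      using frechet_derivative_at[OF convolution_has_derivative[OF smooth_onD[OF \<eta>(1)] G K, of x], symmetric]
      by (simp add: \<phi>_def[abs_def])
    also have "\<dots> = - (LINT y|lborel. frechet_derivative (\<lambda>y. \<eta> (x - y)) (at y) b * G y)"
    proof -
      have "frechet_derivative (\<lambda>y. \<eta> (x - y)) (at y) b = - frechet_derivative \<eta> (at (x - y)) b" for y
      proof -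
        have d: "(\<eta> has_derivative frechet_derivative \<eta> (at (x - y))) (at (x - y))"
          by (rule smooth_on_has_derivative[OF \<eta>(1)]) simp
        have "((\<lambda>y. x - y) has_derivative (\<lambda>v. - v)) (at y)" by (auto intro!: derivative_eq_intros)
        from frechet_derivative_at[OF has_derivative_compose[OF this d], symmetric]
        show ?thesis by (simp add: linear_neg[OF has_derivative_linear[OF d]])
      qed
      then show ?thesis by simp
    qed
    \<comment> \<open>Integration by parts moves the derivative from the kernel to \<open>G\<close>,
      so the averaging estimate for \<open>G\<close> applies verbatim to its derivative.\<close>
    also have "\<dots> = (LINT y|lborel. \<eta> (x - y) * D b y)"
    proof -
      have "smooth_on UNIV (\<lambda>y. \<eta> (x - y))"
        by (rule smooth_on_compose[OF _ _ _ _ \<eta>(1)])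
          (auto intro!: smooth_on_diff smooth_on_const smooth_on_id)
      then have "Ck_on 1 UNIV (\<lambda>y. \<eta> (x - y))" by (rule smooth_onD)
      from integration_by_parts_compact_support[OF this C1 K, of b] show ?thesis by (simp add: D_def)
    qed
    finally have eq: "frechet_derivative \<phi> (at x) b = (LINT y|lborel. \<eta> (x - y) * D b y)" .
    have "\<bar>(LINT y|lborel. \<eta> (x - y) * D b y) - D b x\<bar> \<le> e"
      by (rule convolution_approx[OF c\<eta> \<eta>(2-5) cD K(1) D0]) (use \<delta>(2)[OF C1] r(4)[OF b] in auto)
    then show "\<bar>frechet_derivative \<phi> (at x) b - frechet_derivative G (at x) b\<bar> \<le> e"
      by (simp add: eq D_def)
  qed
qed

section \<open>Integrals over subsets and the fundamental lemma of the calculus of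
  variations\<close>

lemma lebesgue_on_integral:
  fixes f :: "'a::euclidean_space \<Rightarrow> 'b::euclidean_space"
  assumes "S \<in> sets lebesgue"
  shows "(LINT x|lebesgue_on S. f x) = (LINT x|lebesgue. indicator S x *\<^sub>R f x)"
    and "integrable (lebesgue_on S) f \<longleftrightarrow> integrable lebesgue (\<lambda>x. indicator S x *\<^sub>R f x)"
    and "integrable (lebesgue_on S) f \<longleftrightarrow> f absolutely_integrable_on S"
  using assms by (simp_all add: integral_restrict_space integrable_restrict_space set_integrable_def)

lemma lebesgue_on_integral_support:
  fixes f :: "'a::euclidean_space \<Rightarrow> 'b::euclidean_space"
  assumes "S \<in> sets lebesgue" "T \<in> sets lebesgue" "T \<subseteq> S" "\<And>x. x \<in> S - T \<Longrightarrow> f x = 0"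
  shows "(LINT x|lebesgue_on S. f x) = (LINT x|lebesgue_on T. f x)"
    and "integrable (lebesgue_on S) f \<longleftrightarrow> integrable (lebesgue_on T) f"
proof -
  have "(\<lambda>x. indicator S x *\<^sub>R f x) = (\<lambda>x. indicator T x *\<^sub>R f x)"
    using assms by (force simp: indicator_def fun_eq_iff)
  then show "(LINT x|lebesgue_on S. f x) = (LINT x|lebesgue_on T. f x)"
    and "integrable (lebesgue_on S) f \<longleftrightarrow> integrable (lebesgue_on T) f"
    by (simp_all only: lebesgue_on_integral[OF assms(1)] lebesgue_on_integral[OF assms(2)])
qed

lemma borel_measurable_lebesgue_continuous:
  fixes f :: "'a::euclidean_space \<Rightarrow> 'b::euclidean_space"
  shows "continuous_on UNIV f \<Longrightarrow> f \<in> borel_measurable (lebesgue_on S)"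
  by (intro measurable_restrict_space1 measurable_completion) (simp add: borel_measurable_continuous_onI)

lemma integrable_mult_bounded:
  fixes f \<phi> :: "'a \<Rightarrow> real"
  assumes "integrable M f" "\<phi> \<in> borel_measurable M" "\<And>x. \<bar>\<phi> x\<bar> \<le> B"
  shows "integrable M (\<lambda>x. f x * \<phi> x)"
proof (rule Bochner_Integration.integrable_bound)
  show "integrable M (\<lambda>x. B * f x)" using assms(1) by simp
  show "(\<lambda>x. f x * \<phi> x) \<in> borel_measurable M" using assms by (intro borel_measurable_times) auto
  have "\<bar>f x * \<phi> x\<bar> \<le> \<bar>B * f x\<bar>" for x
    using assms(3)[of x] by (simp add: abs_mult mult.commute mult_right_mono)
  then show "AE x in M. norm (f x * \<phi> x) \<le> norm (B * f x)" by simp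
qed

lemma compact_lebesgue: "compact K \<Longrightarrow> K \<in> sets lebesgue"
  using fmeasurableD lmeasurable_compact by blast

lemma open_lebesgue: "open (U :: 'a::euclidean_space set) \<Longrightarrow> U \<in> sets lebesgue"
  by simp

lemma fundamental_lemma_continuous:
  fixes f \<phi> :: "'a::euclidean_space \<Rightarrow> real"
  assumes U: "open U" and f: "locally_integrable U f"
    and test: "\<And>\<phi>. test_function U \<phi> \<Longrightarrow> (LINT x|lebesgue_on U. f x * \<phi> x) = 0"
    and \<phi>: "continuous_on UNIV \<phi>" "compact K" "K \<subseteq> U" "\<And>x. x \<notin> K \<Longrightarrow> \<phi> x = 0"
  shows "(LINT x|lebesgue_on U. f x * \<phi> x) = 0"
proof (rule ccontr)
  obtain d where d: "d > 0" "(\<Union>x\<in>K. cball x d) \<subseteq> U"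
    using compact_subset_open_imp_cball_epsilon_subset[OF \<phi>(2) U \<phi>(3)] by blast
  define L where "L = (\<Union>x\<in>K. cball x d)"
  have L: "compact L" "L \<subseteq> U" "K \<subseteq> L" using d \<phi>(2) by (auto simp: L_def compact_thickening)
  define I where "I = (LINT x|lebesgue_on L. f x * \<phi> x)"
  have red: "(LINT x|lebesgue_on U. f x * \<psi> x) = (LINT x|lebesgue_on L. f x * \<psi> x)"
    if "\<And>x. x \<notin> L \<Longrightarrow> \<psi> x = 0" for \<psi>
    by (rule lebesgue_on_integral_support) (use U L that in \<open>auto intro: compact_lebesgue\<close>)
  assume "(LINT x|lebesgue_on U. f x * \<phi> x) \<noteq> 0"
  moreover have "\<phi> x = 0" if "x \<notin> L" for x using \<phi>(4) L(3) that by blast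
  ultimately have I0: "I \<noteq> 0" using red[of \<phi>] by (simp add: I_def)
  have fL: "integrable (lebesgue_on L) f"
    using f L by (simp add: locally_integrable_def lebesgue_on_integral(3)[OF compact_lebesgue])
  define C where "C = (LINT x|lebesgue_on L. \<bar>f x\<bar>)"
  have C: "C \<ge> 0" by (simp add: C_def)
  \<comment> \<open>Chosen so that \<open>C * e\<close> stays below the absolute value of
    \<open>I\<close>; the summand 1 keeps the denominator positive when \<open>C\<close> is
    zero.\<close>
  define e where "e = \<bar>I\<bar> / (2 * (C + 1))"
  have e: "e > 0" using I0 C by (simp add: e_def)
  obtain \<psi> where \<psi>: "smooth_on UNIV \<psi>" "\<And>x. x \<notin> L \<Longrightarrow> \<psi> x = 0" "\<And>x. \<bar>\<psi> x - \<phi> x\<bar> \<le> e"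
    using mollification[OF \<phi>(1,2,4) d(1) e, folded L_def] by blast
  have "test_function U \<psi>" using \<psi> L by (auto simp: test_function_def)
  then have z: "(LINT x|lebesgue_on L. f x * \<psi> x) = 0" using test[of \<psi>] red[of \<psi>] \<psi>(2) by presburger
  have c\<psi>: "continuous_on UNIV \<psi>" by (rule smooth_on_continuous_on[OF \<psi>(1)])
  have i: "integrable (lebesgue_on L) (\<lambda>x. f x * g x)" if g: "continuous_on UNIV g" "\<And>x. x \<notin> L \<Longrightarrow> g x = 0" for g
  proof -
    obtain B where "\<And>x. norm (g x) \<le> B" using bounded_compact_support[OF g(1) L(1) g(2)] by blast
    then show ?thesis
      by (intro integrable_mult_bounded[OF fL, of _ B] borel_measurable_lebesgue_continuous g(1)) auto
  qed
  have i1: "integrable (lebesgue_on L) (\<lambda>x. f x * \<phi> x)" using \<phi> L by (intro i) auto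
  have i2: "integrable (lebesgue_on L) (\<lambda>x. f x * \<psi> x)" by (rule i[OF c\<psi> \<psi>(2)])
  have "I = (LINT x|lebesgue_on L. f x * \<phi> x - f x * \<psi> x)" using i1 i2 z by (simp add: I_def)
  also have "\<bar>\<dots>\<bar> \<le> (LINT x|lebesgue_on L. \<bar>f x\<bar> * e)"
  proof (rule integral_abs_bound_integral)
    show "\<bar>f x * \<phi> x - f x * \<psi> x\<bar> \<le> \<bar>f x\<bar> * e" for x
      using \<psi>(3)[of x] by (simp add: abs_mult abs_minus_commute mult_left_mono flip: right_diff_distrib)
  qed (use i1 i2 fL in auto)
  also have "\<dots> = C * e" by (simp add: C_def)
  also have "\<dots> < \<bar>I\<bar>"
  proof -
    have "C * \<bar>I\<bar> < \<bar>I\<bar> * (2 * (C + 1))" using I0 C by (simp add: algebra_simps add_strict_increasing2)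
    then show ?thesis using C by (simp add: e_def divide_less_eq)
  qed
  finally show False by simp
qed

text \<open>The indicator of \<open>C\<close> is the pointwise limit of continuous cut-offs that
  equal 1 on \<open>C\<close> and vanish at distance d/(n+1) or more, so all of them are supported
  in one compact subset of \<open>U\<close>.\<close>

lemma integral_compact_zero:
  fixes f :: "'a::euclidean_space \<Rightarrow> real"
  assumes U: "open U" and f: "locally_integrable U f"
    and test: "\<And>\<phi>. test_function U \<phi> \<Longrightarrow> (LINT x|lebesgue_on U. f x * \<phi> x) = 0"
    and C: "compact C" "C \<subseteq> U"
  shows "(LINT x|lebesgue_on C. f x) = 0"
proof (cases "C = {}")
  case True
  then show ?thesis by (simp add: lebesgue_on_integral)
next
  case False
  obtain d where d: "d > 0" "(\<Union>x\<in>C. cball x d) \<subseteq> U"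
    using compact_subset_open_imp_cball_epsilon_subset[OF C(1) U C(2)] by blast
  define L where "L = (\<Union>x\<in>C. cball x d)"
  have L: "compact L" "L \<subseteq> U" "C \<subseteq> L" using d C(1) by (auto simp: L_def compact_thickening)
  have Ll: "L \<in> sets lebesgue" "C \<in> sets lebesgue" using L C compact_lebesgue by auto
  define \<phi> where "\<phi> n x = max 0 (1 - (real (Suc n) / d) * infdist x C)" for n x
  have c: "continuous_on UNIV (\<phi> n)" for n
    unfolding \<phi>_def by (intro continuous_intros)
  have z: "\<phi> n x = 0" if "x \<notin> L" for n x
  proof -
    obtain y where y: "y \<in> C" "infdist x C = dist x y"
      using infdist_attains_inf[OF compact_imp_closed[OF C(1)] False] by blast
    then have "dist x y > d" using that unfolding L_def by (auto simp: dist_commute)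
    then have "1 \<le> (1 / d) * infdist x C" using y d by (simp add: field_simps)
    also have "\<dots> \<le> (real (Suc n) / d) * infdist x C"
      using d by (intro mult_right_mono divide_right_mono) (auto simp: infdist_nonneg)
    finally show ?thesis by (simp add: \<phi>_def)
  qed
  have b: "\<bar>\<phi> n x\<bar> \<le> 1" for n x using d by (auto simp: \<phi>_def infdist_nonneg)
  have fL: "integrable (lebesgue_on L) f"
    using f L by (simp add: locally_integrable_def lebesgue_on_integral(3)[OF Ll(1)])
  have "(\<lambda>n. LINT x|lebesgue_on L. f x * \<phi> n x) \<longlonglongrightarrow> (LINT x|lebesgue_on L. f x * indicator C x)"
  proof (rule integral_dominated_convergence[where w = "\<lambda>x. \<bar>f x\<bar>"])
    show "(\<lambda>x. f x * indicator C x) \<in> borel_measurable (lebesgue_on L)"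
      by (intro borel_measurable_times borel_measurable_integrable[OF fL] borel_measurable_indicator)
        (use L Ll in \<open>auto simp: sets_restrict_space_iff\<close>)
    show "(\<lambda>x. f x * \<phi> n x) \<in> borel_measurable (lebesgue_on L)" for n
      by (intro borel_measurable_times borel_measurable_integrable[OF fL] borel_measurable_lebesgue_continuous c)
    show "integrable (lebesgue_on L) (\<lambda>x. \<bar>f x\<bar>)" using fL by simp
    show "AE x in lebesgue_on L. (\<lambda>n. f x * \<phi> n x) \<longlonglongrightarrow> f x * indicator C x"
    proof (intro AE_I2 tendsto_mult tendsto_const)
      fix x
      show "(\<lambda>n. \<phi> n x) \<longlonglongrightarrow> indicator C x"
      proof (cases "x \<in> C")
        case True
        then show ?thesis by (simp add: \<phi>_def)
      next
        case nC: False
        then have pos: "infdist x C > 0"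
          using infdist_pos_not_in_closed[OF compact_imp_closed[OF C(1)] False] by simp
        obtain N where N: "real N > d / infdist x C" using reals_Archimedean2 by blast
        have "\<phi> n x = 0" if "n \<ge> N" for n
        proof -
          have "d / infdist x C < real (Suc n)" using N that by linarith
          then have "1 \<le> (real (Suc n) / d) * infdist x C" using pos d by (simp add: field_simps)
          then show ?thesis by (simp add: \<phi>_def)
        qed
        then have "\<forall>\<^sub>F n in sequentially. \<phi> n x = 0" unfolding eventually_sequentially by blast
        then show ?thesis using nC by (simp add: tendsto_eventually)
      qed
    qed
    show "AE x in lebesgue_on L. norm (f x * \<phi> n x) \<le> \<bar>f x\<bar>" for n
      using mult_left_mono[OF b, of "\<bar>f _\<bar>"] by (simp add: abs_mult)
  qed
  moreover have "(LINT x|lebesgue_on L. f x * \<phi> n x) = 0" for n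
  proof -
    have "(LINT x|lebesgue_on U. f x * \<phi> n x) = (LINT x|lebesgue_on L. f x * \<phi> n x)"
      by (rule lebesgue_on_integral_support) (use U L z Ll in auto)
    then show ?thesis using fundamental_lemma_continuous[OF U f test c L(1,2) z] by simp
  qed
  ultimately have "(LINT x|lebesgue_on L. f x * indicator C x) = 0"
    by (simp add: LIMSEQ_const_iff)
  moreover have "(LINT x|lebesgue_on L. f x * indicator C x) = (LINT x|lebesgue_on C. f x * indicator C x)"
    by (rule lebesgue_on_integral_support) (use L Ll in auto)
  moreover have "\<dots> = (LINT x|lebesgue_on C. f x)"
    by (rule Bochner_Integration.integral_cong) auto
  ultimately show ?thesis by simp
qed

text \<open>Inner regularity exhausts the positivity set, up to measure \<open>e\<close>, by a
  compact subset. There \<open>f\<close> is positive with integral zero, so the compact subset is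
  null.\<close>

lemma negligible_positive_part:
  fixes f :: "'a::euclidean_space \<Rightarrow> real"
  assumes K: "compact K" and f: "f absolutely_integrable_on K"
    and z: "\<And>C. compact C \<Longrightarrow> C \<subseteq> K \<Longrightarrow> (LINT x|lebesgue_on C. f x) = 0"
  shows "negligible {x \<in> K. f x > 0}"
proof -
  define P where "P = {x \<in> K. f x > 0}"
  have "(\<lambda>x. indicator K x *\<^sub>R f x) \<in> borel_measurable lebesgue"
    using f unfolding set_integrable_def by (rule borel_measurable_integrable)
  then have "{x \<in> space lebesgue. indicator K x *\<^sub>R f x > 0} \<in> sets lebesgue"
    by (rule borel_measurable_less[OF borel_measurable_const])
  also have "{x \<in> space lebesgue. indicator K x *\<^sub>R f x > 0} = P"
    by (auto simp: P_def indicator_def split: if_splits)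
  finally have P: "P \<in> sets lebesgue" .
  have small: "emeasure lebesgue P < ennreal e" if e: "e > 0" for e
  proof -
    obtain T where T: "closed T" "T \<subseteq> P" "P - T \<in> lmeasurable" "emeasure lebesgue (P - T) < ennreal e"
      using sets_lebesgue_inner_closed[OF P e] by blast
    have TK: "T \<subseteq> K" using T(2) by (auto simp: P_def)
    then have cT: "compact T" using K T(1) compact_Int_closed[of K T] by (simp add: inf.absorb2)
    have Tl: "T \<in> sets lebesgue" using cT by (rule compact_lebesgue)
    have "f absolutely_integrable_on T" using set_integrable_subset[OF f Tl TK] .
    then have fT: "integrable (lebesgue_on T) f" by (simp add: lebesgue_on_integral(3)[OF Tl])
    have pos: "f x > 0" if "x \<in> T" for x using that T(2) by (auto simp: P_def)
    have "AE x in lebesgue_on T. f x = 0"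
      using z[OF cT TK] integral_nonneg_eq_0_iff_AE[OF fT] pos
      by (metis (no_types, lifting) AE_I2 less_imp_le space_lebesgue_on)
    then have "AE x in lebesgue. x \<notin> T"
      using Tl by (subst (asm) AE_restrict_space_iff) (auto elim!: eventually_mono dest!: pos)
    then have "emeasure lebesgue T = 0"
      using Tl by (subst (asm) AE_iff_measurable[of T]) auto
    then have "emeasure lebesgue P \<le> emeasure lebesgue (P - T)"
      using emeasure_subadditive[of "P - T" lebesgue T] P Tl T(2) by (simp add: Un_absorb2)
    then show ?thesis using T(4) by simp
  qed
  have "emeasure lebesgue P \<le> 0"
  proof (rule ennreal_le_epsilon)
    fix e :: real assume "0 < e"
    from less_imp_le[OF small[OF this]] show "emeasure lebesgue P \<le> 0 + ennreal e" by simp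
  qed
  then show ?thesis using P by (simp add: negligible_iff_null_sets P_def[symmetric] null_sets_def)
qed

lemma fundamental_lemma:
  fixes f :: "'a::euclidean_space \<Rightarrow> real"
  assumes U: "open U" and f: "locally_integrable U f"
    and test: "\<And>\<phi>. test_function U \<phi> \<Longrightarrow> (LINT x|lebesgue_on U. f x * \<phi> x) = 0"
  shows "AE x in lebesgue_on U. f x = 0"
proof -
  obtain F :: "nat \<Rightarrow> 'a set" where F: "\<And>n. compact (F n)" "\<And>n. F n \<subseteq> U" "(\<Union>n. F n) = U"
    using open_Union_compact_subsets[OF U] by (metis (no_types, lifting))
  have "negligible {x \<in> F n. f x \<noteq> 0}" for n
  proof -
    have fi: "f absolutely_integrable_on F n" using f F by (simp add: locally_integrable_def)
    have z: "(LINT x|lebesgue_on C. f x) = 0" if "compact C" "C \<subseteq> F n" for C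
      using integral_compact_zero[OF U f test that(1)] that F by blast
    have "negligible {x \<in> F n. f x > 0}" by (rule negligible_positive_part[OF F(1) fi z])
    moreover have "negligible {x \<in> F n. - f x > 0}"
      by (rule negligible_positive_part[OF F(1)]) (use fi z in \<open>auto simp: set_integrable_def\<close>)
    ultimately have "negligible ({x \<in> F n. f x > 0} \<union> {x \<in> F n. - f x > 0})"
      by (rule negligible_Un)
    then show ?thesis by (rule negligible_subset) auto
  qed
  then have "negligible (\<Union>n. {x \<in> F n. f x \<noteq> 0})" by (auto intro!: negligible_countable_Union)
  then have "negligible {x \<in> U. f x \<noteq> 0}" by (rule negligible_subset) (use F(3) in auto)
  then have "{x \<in> U. f x \<noteq> 0} \<in> null_sets lebesgue" by (simp add: negligible_iff_null_sets)
  then show ?thesis using U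
    by (subst AE_restrict_space_iff) (auto intro: AE_I')
qed

section \<open>Test functions and uniqueness of weak gradients\<close>

lemma locally_integrable_nth:
  fixes A :: "'a::euclidean_space \<Rightarrow> real^'n"
  shows "locally_integrable U A \<Longrightarrow> locally_integrable U (\<lambda>x. A x $ i)"
  unfolding locally_integrable_def
  using absolutely_integrable_linear[OF _ bounded_linear_vec_nth[of i]] by (auto simp: o_def)

lemma locally_integrable_nth_nth:
  fixes A :: "'a::euclidean_space \<Rightarrow> real^'n^'m"
  assumes "locally_integrable U A" shows "locally_integrable U (\<lambda>x. A x $ i $ j)"
  unfolding locally_integrable_def
proof (intro allI impI)
  fix K assume "compact K \<and> K \<subseteq> U"
  then have "A absolutely_integrable_on K" using assms by (simp add: locally_integrable_def)
  from absolutely_integrable_linear[OF this bounded_linear_compose[OF bounded_linear_vec_nth[of j] bounded_linear_vec_nth[of i]]]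
  show "(\<lambda>x. A x $ i $ j) absolutely_integrable_on K" by (simp add: o_def)
qed

lemma test_function_support:
  assumes "test_function U \<phi>"
  obtains K where "compact K" "K \<subseteq> U" "\<And>x. x \<notin> K \<Longrightarrow> \<phi> x = 0"
  using assms unfolding test_function_def by blast

lemma test_function_smooth: "test_function U \<phi> \<Longrightarrow> smooth_on UNIV \<phi>"
  by (simp add: test_function_def)

lemma test_function_frechet_derivative:
  assumes "test_function U \<phi>" shows "test_function U (\<lambda>x. frechet_derivative \<phi> (at x) v)"
proof -
  obtain K where K: "compact K" "K \<subseteq> U" "\<And>x. x \<notin> K \<Longrightarrow> \<phi> x = 0" using test_function_support[OF assms] by blast
  have "frechet_derivative \<phi> (at x) v = 0" if "x \<notin> K" for x
    using frechet_derivative_outside_support[OF K(1,3) that] by simp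
  then show ?thesis
    using smooth_on_frechet_derivative[OF test_function_smooth[OF assms]] K by (auto simp: test_function_def)
qed

lemma integrable_test_function:
  fixes f \<phi> :: "'a::euclidean_space \<Rightarrow> real"
  assumes "open U" "locally_integrable U f" "test_function U \<phi>"
  shows "integrable (lebesgue_on U) (\<lambda>x. f x * \<phi> x)"
proof -
  obtain K where K: "compact K" "K \<subseteq> U" "\<And>x. x \<notin> K \<Longrightarrow> \<phi> x = 0" using test_function_support[OF assms(3)] by blast
  have c: "continuous_on UNIV \<phi>" by (rule smooth_on_continuous_on[OF test_function_smooth[OF assms(3)]])
  obtain B where B: "\<And>x. norm (\<phi> x) \<le> B" using bounded_compact_support[OF c K(1,3)] by blast
  have "integrable (lebesgue_on K) f"
    using assms(2) K by (simp add: locally_integrable_def lebesgue_on_integral(3)[OF compact_lebesgue])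
  then have "integrable (lebesgue_on K) (\<lambda>x. f x * \<phi> x)"
    by (rule integrable_mult_bounded[where B = B]) (use B borel_measurable_lebesgue_continuous[OF c] in auto)
  then show ?thesis
    by (subst lebesgue_on_integral_support(2)[of _ K]) (use assms K compact_lebesgue in auto)
qed

lemma is_weak_D_D:
  assumes "is_weak_D U u A" "test_function U \<phi>"
  shows "(LINT x|lebesgue_on U. A x $ i $ j * \<phi> x) =
    - (LINT x|lebesgue_on U. u x $ i * frechet_derivative \<phi> (at x) (axis j 1))"
  using assms by (simp add: is_weak_D_def distr_eq_def distr_partial_def regular_distr_def)

text \<open>\<open>weak_D\<close> is an arbitrary choice among the weak gradients; uniqueness up to
  null sets allows every computation to use the most convenient one.\<close>

lemma is_weak_D_unique:
  fixes A B :: "real^'n \<Rightarrow> real^'n^'m"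
  assumes U: "open U" and A: "is_weak_D U u A" and B: "is_weak_D U u B"
  shows "AE x in lebesgue_on U. A x = B x"
proof -
  have lA: "locally_integrable U (\<lambda>x. A x $ i $ j)" and lB: "locally_integrable U (\<lambda>x. B x $ i $ j)" for i j
    using A B locally_integrable_nth_nth unfolding is_weak_D_def by blast+
  have "AE x in lebesgue_on U. A x $ i $ j - B x $ i $ j = 0" for i j
  proof (rule fundamental_lemma[OF U])
    show "locally_integrable U (\<lambda>x. A x $ i $ j - B x $ i $ j)"
      using lA[of i j] lB[of i j] by (simp add: locally_integrable_def set_integral_diff)
    show "(LINT x|lebesgue_on U. (A x $ i $ j - B x $ i $ j) * \<phi> x) = 0" if "test_function U \<phi>" for \<phi>
      using is_weak_D_D[OF A that, of i j] is_weak_D_D[OF B that, of i j]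
        integrable_test_function[OF U lA that, of i j] integrable_test_function[OF U lB that, of i j]
      by (simp add: left_diff_distrib)
  qed
  then have "AE x in lebesgue_on U. \<forall>i j. A x $ i $ j - B x $ i $ j = 0"
    by (intro eventually_all_finite)
  then show ?thesis by (auto simp: vec_eq_iff elim!: eventually_mono)
qed

lemma is_weak_D_weak_D: "is_weak_D U u A \<Longrightarrow> is_weak_D U u (weak_D U u)"
  unfolding weak_D_def by (rule someI[of "is_weak_D U u"])

section \<open>Weak derivatives under diffeomorphisms\<close>

lemma AE_lebesgue_on_iff:
  assumes "S \<in> sets lebesgue"
  shows "(AE x in lebesgue_on S. P x) \<longleftrightarrow> negligible {x \<in> S. \<not> P x}"
proof -
  have "(AE x in lebesgue_on S. P x) \<longleftrightarrow> (AE x in lebesgue. x \<in> S \<longrightarrow> P x)"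
    using assms by (subst AE_restrict_space_iff) auto
  also have "\<dots> \<longleftrightarrow> negligible {x \<in> S. \<not> P x}"
    by (simp add: completion.AE_iff_null_sets negligible_iff_null_sets)
  finally show ?thesis .
qed

lemma locally_integrable_cong:
  assumes "\<And>x. x \<in> U \<Longrightarrow> f x = g x" "locally_integrable U f"
  shows "locally_integrable U g"
  unfolding locally_integrable_def
proof (intro allI impI)
  fix K assume K: "compact K \<and> K \<subseteq> U"
  have "f absolutely_integrable_on K \<longleftrightarrow> g absolutely_integrable_on K"
    by (rule set_integrable_cong) (use K assms(1) in auto)
  then show "g absolutely_integrable_on K" using assms(2) K by (simp add: locally_integrable_def)
qed

lemma locally_integrable_continuous:
  fixes f :: "'a::euclidean_space \<Rightarrow> 'b::euclidean_space"
  shows "continuous_on U f \<Longrightarrow> locally_integrable U f"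
  unfolding locally_integrable_def
proof (intro allI impI)
  fix K assume f: "continuous_on U f" and K: "compact K \<and> K \<subseteq> U"
  then have "integrable lborel (\<lambda>x. indicator K x *\<^sub>R f x)"
    by (intro borel_integrable_compact) (auto intro: continuous_on_subset)
  then show "f absolutely_integrable_on K"
    unfolding set_integrable_def by (subst integrable_completion) auto
qed

lemma locally_integrable_mult_continuous:
  fixes f g :: "'a::euclidean_space \<Rightarrow> real"
  assumes "locally_integrable U f" "continuous_on U g"
  shows "locally_integrable U (\<lambda>x. g x * f x)"
  unfolding locally_integrable_def
proof (intro allI impI)
  fix K assume K: "compact K \<and> K \<subseteq> U"
  then have c: "continuous_on K g" using assms(2) continuous_on_subset by blast
  have Kl: "K \<in> sets lebesgue" using K compact_lebesgue by blast
  obtain B where B: "\<And>x. x \<in> K \<Longrightarrow> norm (g x) \<le> B"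
    using compact_imp_bounded[OF compact_continuous_image[OF c]] K unfolding bounded_iff by (metis imageI)
  have f: "integrable (lebesgue_on K) f"
    using assms(1) K by (simp add: locally_integrable_def lebesgue_on_integral(3)[OF Kl])
  have "integrable (lebesgue_on K) (\<lambda>x. g x * f x)"
  proof (rule Bochner_Integration.integrable_bound)
    show "integrable (lebesgue_on K) (\<lambda>x. B * f x)" using f by simp
    show "(\<lambda>x. g x * f x) \<in> borel_measurable (lebesgue_on K)"
      by (intro borel_measurable_times borel_measurable_integrable[OF f]
          continuous_imp_measurable_on_sets_lebesgue[OF c Kl])
    show "AE x in lebesgue_on K. norm (g x * f x) \<le> norm (B * f x)"
    proof (rule AE_I2)
      fix x assume "x \<in> space (lebesgue_on K)"
      then have "\<bar>g x\<bar> \<le> \<bar>B\<bar>" using B[of x] by auto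
      then show "norm (g x * f x) \<le> norm (B * f x)" by (simp add: abs_mult mult_right_mono)
    qed
  qed
  then show "(\<lambda>x. g x * f x) absolutely_integrable_on K" by (simp add: lebesgue_on_integral(3)[OF Kl])
qed

lemma locally_integrable_add:
  fixes f g :: "'a::euclidean_space \<Rightarrow> 'b::euclidean_space"
  shows "locally_integrable U f \<Longrightarrow> locally_integrable U g \<Longrightarrow> locally_integrable U (\<lambda>x. f x + g x)"
  by (auto simp: locally_integrable_def)

lemma locally_integrable_diff:
  fixes f g :: "'a::euclidean_space \<Rightarrow> 'b::euclidean_space"
  shows "locally_integrable U f \<Longrightarrow> locally_integrable U g \<Longrightarrow> locally_integrable U (\<lambda>x. f x - g x)"
  by (auto simp: locally_integrable_def)

lemma locally_integrable_sum:
  fixes f :: "'i \<Rightarrow> 'a::euclidean_space \<Rightarrow> 'b::euclidean_space"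
  assumes "\<And>i. i \<in> I \<Longrightarrow> locally_integrable U (f i)"
  shows "locally_integrable U (\<lambda>x. \<Sum>i\<in>I. f i x)"
  using assms
  by (induction I rule: infinite_finite_induct)
    (auto intro: locally_integrable_add locally_integrable_continuous[OF continuous_on_const])

lemma locally_integrable_linear:
  fixes f :: "'a::euclidean_space \<Rightarrow> 'b::euclidean_space" and L :: "'b \<Rightarrow> 'c::euclidean_space"
  assumes "bounded_linear L" "locally_integrable U f"
  shows "locally_integrable U (\<lambda>x. L (f x))"
  using assms(2) absolutely_integrable_linear[OF _ assms(1)] by (auto simp: locally_integrable_def o_def)

lemma locally_integrable_cart:
  fixes f :: "'a::euclidean_space \<Rightarrow> ('b::euclidean_space)^'n"
  assumes "\<And>i. locally_integrable U (\<lambda>x. f x $ i)"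
  shows "locally_integrable U f"
proof -
  have lin: "bounded_linear (\<lambda>y::'b. axis i y :: 'b^'n)" for i
    by (rule bounded_linearI'[of _ ]) (auto simp: axis_def vec_eq_iff)
  have eq: "f = (\<lambda>x. \<Sum>i\<in>UNIV. axis i (f x $ i))"
    by (simp add: fun_eq_iff vec_eq_iff axis_def if_distrib cong: if_cong)
  show ?thesis
    by (subst eq) (intro locally_integrable_sum locally_integrable_linear[OF lin] assms)
qed

text \<open>The determinant is required to be positive, so that the change of variables carries no
  absolute value and composition preserves the sign of det Du. The inverse is an argument because
  the Piola transform is written with it.\<close>

definition smooth_diffeo :: "(real^'n) set \<Rightarrow> (real^'n) set \<Rightarrow> (real^'n \<Rightarrow> real^'n) \<Rightarrow> (real^'n \<Rightarrow> real^'n) \<Rightarrow> bool" where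
  "smooth_diffeo V U \<psi> \<zeta> \<longleftrightarrow> open V \<and> open U \<and> smooth_on V \<psi> \<and> smooth_on U \<zeta> \<and>
     \<psi> ` V \<subseteq> U \<and> \<zeta> ` U \<subseteq> V \<and> (\<forall>x\<in>V. \<zeta> (\<psi> x) = x) \<and> (\<forall>y\<in>U. \<psi> (\<zeta> y) = y) \<and>
     (\<forall>x\<in>V. det (jacobian \<psi> (at x)) > 0)"

lemma smooth_diffeoI:
  assumes "open V" "open U" "smooth_on V \<psi>" "\<psi> ` V \<subseteq> U" "\<zeta> ` U \<subseteq> V"
    "\<And>x. x \<in> V \<Longrightarrow> \<zeta> (\<psi> x) = x" "\<And>y. y \<in> U \<Longrightarrow> \<psi> (\<zeta> y) = y"
    and d: "\<And>x. x \<in> V \<Longrightarrow> det (jacobian \<psi> (at x)) > 0"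
  shows "smooth_diffeo V U \<psi> \<zeta>"
proof -
  have "smooth_on U \<zeta>"
    by (rule smooth_on_inverse_map[OF assms(1-3,5-7)]) (use d in \<open>auto simp: less_imp_neq[symmetric]\<close>)
  then show ?thesis using assms by (simp add: smooth_diffeo_def)
qed

lemma linear_cart_expand:
  fixes L :: "real^'n \<Rightarrow> 'b::real_vector"
  assumes "linear L" shows "L w = (\<Sum>k\<in>UNIV. w $ k *\<^sub>R L (axis k 1))"
proof -
  have "w = (\<Sum>k\<in>UNIV. w $ k *\<^sub>R axis k 1)"
    by (simp add: vec_eq_iff axis_def if_distrib cong: if_cong)
  then have "L w = L (\<Sum>k\<in>UNIV. w $ k *\<^sub>R axis k 1)" by simp
  also have "\<dots> = (\<Sum>k\<in>UNIV. w $ k *\<^sub>R L (axis k 1))"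
    using assms by (simp add: linear_sum linear_scale)
  finally show ?thesis .
qed

lemma frechet_derivative_compose_cart:
  fixes \<eta> :: "real^'n \<Rightarrow> real" and \<psi> :: "real^'m \<Rightarrow> real^'n"
  assumes "\<psi> differentiable (at x)" "\<eta> differentiable (at (\<psi> x))"
  shows "frechet_derivative (\<lambda>x. \<eta> (\<psi> x)) (at x) (axis j 1) =
    (\<Sum>k\<in>UNIV. jacobian \<psi> (at x) $ k $ j * frechet_derivative \<eta> (at (\<psi> x)) (axis k 1))"
proof -
  have d1: "(\<psi> has_derivative (*v) (jacobian \<psi> (at x))) (at x)" using assms(1) jacobian_works by blast
  have d2: "(\<eta> has_derivative frechet_derivative \<eta> (at (\<psi> x))) (at (\<psi> x))"
    using assms(2) frechet_derivative_works by blast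
  have "frechet_derivative (\<lambda>x. \<eta> (\<psi> x)) (at x) (axis j 1) =
      frechet_derivative \<eta> (at (\<psi> x)) (jacobian \<psi> (at x) *v axis j 1)"
    using frechet_derivative_at[OF has_derivative_compose[OF d1 d2], symmetric] by simp
  also have "\<dots> = (\<Sum>k\<in>UNIV. (jacobian \<psi> (at x) *v axis j 1) $ k *\<^sub>R frechet_derivative \<eta> (at (\<psi> x)) (axis k 1))"
    by (rule linear_cart_expand[OF has_derivative_linear[OF d2]])
  also have "\<dots> = (\<Sum>k\<in>UNIV. jacobian \<psi> (at x) $ k $ j * frechet_derivative \<eta> (at (\<psi> x)) (axis k 1))"
    by (simp add: matrix_vector_mult_basis column_def)
  finally show ?thesis .
qed

text \<open>\<open>U\<close> and the complement of \<open>K\<close> are open and cover the space,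
  and the extension is smooth on each of them.\<close>

lemma test_function_extend:
  fixes f :: "'a::euclidean_space \<Rightarrow> 'b::real_normed_vector"
  assumes U: "open U" and f: "smooth_on U f" and K: "compact K" "K \<subseteq> U" "\<And>y. y \<in> U - K \<Longrightarrow> f y = 0"
  shows "test_function U (\<lambda>y. if y \<in> U then f y else 0)"
proof -
  have o: "open (- K)" using K compact_imp_closed by (auto simp: open_Compl)
  have 1: "smooth_on U (\<lambda>y. if y \<in> U then f y else 0)"
    by (rule smooth_on_cong[OF U _ f]) simp
  have 2: "smooth_on (- K) (\<lambda>y. if y \<in> U then f y else 0)"
    by (rule smooth_on_cong[OF o _ smooth_on_const[of _ 0]]) (use K in auto)
  have "smooth_on (U \<union> - K) (\<lambda>y. if y \<in> U then f y else 0)"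
    by (rule smooth_on_Un[OF U o 1 2])
  moreover have "U \<union> - K = UNIV" using K(2) by auto
  ultimately show ?thesis using K by (auto simp: test_function_def)
qed

lemma lebesgue_on_integral_lborel:
  fixes h :: "'a::euclidean_space \<Rightarrow> real"
  assumes "U \<in> sets lebesgue" "continuous_on UNIV h" "\<And>x. x \<notin> U \<Longrightarrow> h x = 0"
  shows "(LINT x|lebesgue_on U. h x) = (LINT x|lborel. h x)"
proof -
  have "(LINT x|lebesgue_on U. h x) = (LINT x|lebesgue. indicator U x *\<^sub>R h x)"
    by (rule lebesgue_on_integral(1)[OF assms(1)])
  also have "(\<lambda>x. indicator U x *\<^sub>R h x) = h" using assms(3) by (auto simp: indicator_def fun_eq_iff)
  also have "(LINT x|lebesgue. h x) = (LINT x|lborel. h x)"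
    by (rule integral_completion) (use borel_measurable_continuous_onI[OF assms(2)] in simp)
  finally show ?thesis .
qed

lemma integration_by_parts_test_function:
  fixes f g :: "'a::euclidean_space \<Rightarrow> real"
  assumes U: "open U" and f: "Ck_on 1 UNIV f" and g: "Ck_on 1 UNIV g"
    and K: "compact K" "K \<subseteq> U" "\<And>x. x \<notin> K \<Longrightarrow> g x = 0"
  shows "(LINT x|lebesgue_on U. f x * frechet_derivative g (at x) v) =
    - (LINT x|lebesgue_on U. frechet_derivative f (at x) v * g x)"
proof -
  have c: "continuous_on UNIV f" "continuous_on UNIV g"
    by (rule Ck_on_continuous_on[OF f], rule Ck_on_continuous_on[OF g])
  have c': "continuous_on UNIV (\<lambda>x. frechet_derivative f (at x) v)"
    "continuous_on UNIV (\<lambda>x. frechet_derivative g (at x) v)"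
    using f g by simp_all
  have z: "g x = 0 \<and> frechet_derivative g (at x) v = 0" if "x \<notin> U" for x
  proof -
    have "x \<notin> K" using that K(2) by blast
    then show ?thesis using frechet_derivative_outside_support[OF K(1,3)] K(3) by simp
  qed
  have "(LINT x|lebesgue_on U. f x * frechet_derivative g (at x) v) =
      (LINT x|lborel. f x * frechet_derivative g (at x) v)"
    by (rule lebesgue_on_integral_lborel[OF open_lebesgue[OF U] continuous_on_mult[OF c(1) c'(2)]]) (simp add: z)
  moreover have "(LINT x|lebesgue_on U. frechet_derivative f (at x) v * g x) =
      (LINT x|lborel. frechet_derivative f (at x) v * g x)"
    by (rule lebesgue_on_integral_lborel[OF open_lebesgue[OF U] continuous_on_mult[OF c'(1) c(2)]]) (simp add: z)
  ultimately show ?thesis using integration_by_parts_compact_support[OF f g K(1,3)] by simp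
qed

context
  fixes V U :: "(real^'n::{finite,wellorder}) set" and \<psi> \<zeta> :: "real^'n::{finite,wellorder} \<Rightarrow> real^'n::{finite,wellorder}"
  assumes diffeo: "smooth_diffeo V U \<psi> \<zeta>"
begin

lemma diffeo_props:
  "open V" "open U" "smooth_on V \<psi>" "smooth_on U \<zeta>" "\<psi> ` V = U" "\<zeta> ` U = V"
  "x \<in> V \<Longrightarrow> \<zeta> (\<psi> x) = x" "y \<in> U \<Longrightarrow> \<psi> (\<zeta> y) = y"
  "x \<in> V \<Longrightarrow> det (jacobian \<psi> (at x)) > 0" "inj_on \<psi> V"
  "x \<in> V \<Longrightarrow> \<psi> x \<in> U" "y \<in> U \<Longrightarrow> \<zeta> y \<in> V"
proof -
  note d = diffeo[unfolded smooth_diffeo_def]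
  show "open V" "open U" "smooth_on V \<psi>" "smooth_on U \<zeta>"
    "x \<in> V \<Longrightarrow> \<zeta> (\<psi> x) = x" "y \<in> U \<Longrightarrow> \<psi> (\<zeta> y) = y"
    "x \<in> V \<Longrightarrow> det (jacobian \<psi> (at x)) > 0" "x \<in> V \<Longrightarrow> \<psi> x \<in> U" "y \<in> U \<Longrightarrow> \<zeta> y \<in> V"
    using d by auto
  show "\<psi> ` V = U" using d by (auto simp: image_iff) (metis image_subset_iff)
  show "\<zeta> ` U = V" using d by (auto simp: image_iff) (metis image_subset_iff)
  show "inj_on \<psi> V" using d by (metis inj_onI)
qed

lemma diffeo_has_derivative: "x \<in> V \<Longrightarrow> (\<psi> has_derivative (*v) (jacobian \<psi> (at x))) (at x)"
  by (rule smooth_on_has_derivative_jacobian[OF diffeo_props(3)])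

text \<open>The real-valued \<open>F\<close> is read as a map into \<open>real^1\<close>, so that
  the change of variables for vector-valued functions applies. Equivalence of integrability is part
  of the claim, because it makes the equality of the integrals unconditional.\<close>

lemma diffeo_change_of_variables_on:
  fixes F :: "real^'n::_ \<Rightarrow> real"
  assumes S: "S \<in> sets lebesgue" "S \<subseteq> V"
  shows "integrable (lebesgue_on (\<psi> ` S)) F \<longleftrightarrow>
      integrable (lebesgue_on S) (\<lambda>x. det (jacobian \<psi> (at x)) * F (\<psi> x))"
    and "(LINT y|lebesgue_on (\<psi> ` S). F y) = (LINT x|lebesgue_on S. det (jacobian \<psi> (at x)) * F (\<psi> x))"
proof -
  have der: "(\<psi> has_derivative (*v) (jacobian \<psi> (at x))) (at x within S)" if "x \<in> S" for x
    using diffeo_has_derivative[of x] that S(2) has_derivative_at_withinI by blast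
  have inj: "inj_on \<psi> S" using diffeo_props(10) S(2) inj_on_subset by blast
  have I: "\<psi> ` S \<in> sets lebesgue"
    using S der by (intro differentiable_image_in_sets_lebesgue) (auto simp: differentiable_on_def differentiable_def)
  have ax: "bounded_linear (\<lambda>y::real. axis 1 y :: real^1)"
    by (rule bounded_linearI') (auto simp: axis_def vec_eq_iff)
  have conv: "(f absolutely_integrable_on T \<longleftrightarrow> (\<lambda>x. axis 1 (f x) :: real^1) absolutely_integrable_on T) \<and>
      (f absolutely_integrable_on T \<longrightarrow> integral T (\<lambda>x. axis 1 (f x) :: real^1) = axis 1 (integral T f))"
    for f :: "real^'n::_ \<Rightarrow> real" and T
  proof (intro conjI iffI impI)
    show "(\<lambda>x. axis 1 (f x) :: real^1) absolutely_integrable_on T" if "f absolutely_integrable_on T"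
      using absolutely_integrable_linear[OF that ax] by (simp add: o_def)
    show "f absolutely_integrable_on T" if "(\<lambda>x. axis 1 (f x) :: real^1) absolutely_integrable_on T"
      using absolutely_integrable_linear[OF that bounded_linear_vec_nth[of 1]] by (simp add: o_def axis_def)
    show "integral T (\<lambda>x. axis 1 (f x) :: real^1) = axis 1 (integral T f)" if "f absolutely_integrable_on T"
      using integral_linear[OF set_lebesgue_integral_eq_integral(1)[OF that] ax] by (simp add: o_def)
  qed
  have J: "\<bar>det (jacobian \<psi> (at x))\<bar> = det (jacobian \<psi> (at x))" if "x \<in> S" for x
    using diffeo_props(9)[of x] that S(2) by (simp add: subset_iff)
  have sc: "c *\<^sub>R (axis 1 d :: real^1) = axis 1 (c * d)" for c d :: real
    by (simp add: axis_def vec_eq_iff)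
  let ?G = "\<lambda>x. det (jacobian \<psi> (at x)) * F (\<psi> x)"
  have eqG: "(\<lambda>x. \<bar>det (matrix ((*v) (jacobian \<psi> (at x))))\<bar> *\<^sub>R (axis 1 (F (\<psi> x)) :: real^1)) absolutely_integrable_on S
      \<longleftrightarrow> (\<lambda>x. axis 1 (?G x) :: real^1) absolutely_integrable_on S"
    by (rule set_integrable_cong) (auto simp: J sc)
  have eqI: "integral S (\<lambda>x. \<bar>det (matrix ((*v) (jacobian \<psi> (at x))))\<bar> *\<^sub>R (axis 1 (F (\<psi> x)) :: real^1)) =
      integral S (\<lambda>x. axis 1 (?G x))"
    by (rule Henstock_Kurzweil_Integration.integral_cong) (simp add: J sc)
  have c1: "(\<lambda>y. axis 1 (F y) :: real^1) absolutely_integrable_on \<psi> ` S \<longleftrightarrow>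
      (\<lambda>x. \<bar>det (matrix ((*v) (jacobian \<psi> (at x))))\<bar> *\<^sub>R (axis 1 (F (\<psi> x)) :: real^1)) absolutely_integrable_on S"
    by (rule absolutely_integrable_change_of_variables[OF S(1) der inj])
  have iff: "F absolutely_integrable_on \<psi> ` S \<longleftrightarrow> ?G absolutely_integrable_on S"
    using c1 eqG conv[of "\<psi> ` S" F, THEN conjunct1] conv[of S ?G, THEN conjunct1] by argo
  then show iff': "integrable (lebesgue_on (\<psi> ` S)) F \<longleftrightarrow> integrable (lebesgue_on S) ?G"
    using lebesgue_on_integral(3)[OF S(1)] lebesgue_on_integral(3)[OF I] by blast
  show "(LINT y|lebesgue_on (\<psi> ` S). F y) = (LINT x|lebesgue_on S. ?G x)"
  proof (cases "F absolutely_integrable_on \<psi> ` S")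
    case True
    have "axis 1 (integral (\<psi> ` S) F) = (axis 1 (integral S ?G) :: real^1)"
    proof -
      have disj: "(\<lambda>y. axis 1 (F y) :: real^1) absolutely_integrable_on \<psi> ` S"
        using conv[of "\<psi> ` S" F] True by blast
      have "axis 1 (integral (\<psi> ` S) F) = integral (\<psi> ` S) (\<lambda>y. axis 1 (F y) :: real^1)"
        using conv[of "\<psi> ` S" F] True by simp
      also have "\<dots> = integral S (\<lambda>x. axis 1 (?G x))"
        by (rule trans[OF integral_change_of_variables[OF S(1) der inj disjI1[OF disj]] eqI])
      also have "\<dots> = axis 1 (integral S ?G)" using conv[of S ?G] True iff by simp
      finally show ?thesis .
    qed
    then have "integral (\<psi> ` S) F = integral S ?G" by (auto simp: axis_eq_axis)
    then show ?thesis
      using True iff lebesgue_integral_eq_integral[OF _ S(1), of ?G] lebesgue_integral_eq_integral[OF _ I, of F]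
      by (simp add: lebesgue_on_integral(3)[OF S(1)] lebesgue_on_integral(3)[OF I])
  next
    case False
    then have "\<not> integrable (lebesgue_on (\<psi> ` S)) F" using lebesgue_on_integral(3)[OF I] by blast
    moreover from this have "\<not> integrable (lebesgue_on S) ?G" using iff' by blast
    \<comment> \<open>Without integrability both integrals take the default value 0.\<close>
    ultimately show ?thesis by (simp add: not_integrable_integral_eq)
  qed
qed

lemmas diffeo_change_of_variables =
  diffeo_change_of_variables_on[OF open_lebesgue[OF diffeo_props(1)] order_refl, unfolded diffeo_props(5)]

text \<open>Smooth maps between spaces of equal dimension send null sets to null sets, and the
  exceptional sets correspond under \<psi> and \<zeta>.\<close>

lemma diffeo_AE: "(AE y in lebesgue_on U. P y) \<longleftrightarrow> (AE x in lebesgue_on V. P (\<psi> x))"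
proof -
  have n: "negligible (f ` N)" if "smooth_on S f" "N \<subseteq> S" "negligible N" for f :: "real^'n::_ \<Rightarrow> real^'n::_" and N S
  proof (rule negligible_differentiable_image_negligible[OF order_refl that(3)])
    show "f differentiable_on N"
      using that smooth_on_differentiable differentiable_at_withinI by (force simp: differentiable_on_def)
  qed
  have 1: "{y \<in> U. \<not> P y} = \<psi> ` {x \<in> V. \<not> P (\<psi> x)}"
    using diffeo_props(5) by auto
  have 2: "{x \<in> V. \<not> P (\<psi> x)} = \<zeta> ` {y \<in> U. \<not> P y}"
    unfolding 1 using diffeo_props(7) by (auto simp: image_image)
  have "negligible {y \<in> U. \<not> P y} \<longleftrightarrow> negligible {x \<in> V. \<not> P (\<psi> x)}"
    using n[OF diffeo_props(3), of "{x \<in> V. \<not> P (\<psi> x)}"] n[OF diffeo_props(4), of "{y \<in> U. \<not> P y}"] 1 2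
    by fastforce
  then show ?thesis
    by (simp only: AE_lebesgue_on_iff[OF open_lebesgue[OF diffeo_props(1)]]
        AE_lebesgue_on_iff[OF open_lebesgue[OF diffeo_props(2)]])
qed

lemma smooth_on_diffeo_det: "smooth_on V (\<lambda>x. det (jacobian \<psi> (at x)))"
  by (intro smooth_on_det smooth_on_jacobian diffeo_props)

lemma locally_integrable_diffeo:
  fixes f :: "real^'n::_ \<Rightarrow> real"
  assumes "locally_integrable U f" shows "locally_integrable V (\<lambda>x. f (\<psi> x))"
proof -
  have "locally_integrable V (\<lambda>x. det (jacobian \<psi> (at x)) * f (\<psi> x))"
    unfolding locally_integrable_def
  proof (intro allI impI)
    fix K assume K: "compact K \<and> K \<subseteq> V"
    then have "compact (\<psi> ` K)" "\<psi> ` K \<subseteq> U"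
      using smooth_on_continuous_on[OF diffeo_props(3)] diffeo_props(5)
      by (auto intro: compact_continuous_image continuous_on_subset)
    then have "integrable (lebesgue_on (\<psi> ` K)) f"
      using assms by (simp add: locally_integrable_def lebesgue_on_integral(3)[OF compact_lebesgue])
    then have "integrable (lebesgue_on K) (\<lambda>x. det (jacobian \<psi> (at x)) * f (\<psi> x))"
      using diffeo_change_of_variables_on(1)[of K f] K compact_lebesgue by blast
    then show "(\<lambda>x. det (jacobian \<psi> (at x)) * f (\<psi> x)) absolutely_integrable_on K"
      using K compact_lebesgue lebesgue_on_integral(3) by blast
  qed
  \<comment> \<open>The change of variables produces the factor det D\<psi>; it is removed by its
    reciprocal, which is continuous on \<open>V\<close> and hence bounded on compact
    subsets.\<close>
  moreover have "continuous_on V (\<lambda>x. inverse (det (jacobian \<psi> (at x))))"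
    by (intro continuous_on_inverse smooth_on_continuous_on[OF smooth_on_diffeo_det])
      (use diffeo_props(9) in force)
  ultimately have "locally_integrable V (\<lambda>x. inverse (det (jacobian \<psi> (at x))) * (det (jacobian \<psi> (at x)) * f (\<psi> x)))"
    by (rule locally_integrable_mult_continuous)
  moreover have "inverse (det (jacobian \<psi> (at x))) * (det (jacobian \<psi> (at x)) * f (\<psi> x)) = f (\<psi> x)" if "x \<in> V" for x
    using diffeo_props(9)[OF that] by simp
  ultimately show ?thesis by (rule locally_integrable_cong[rotated])
qed

text \<open>The Piola transform \<open>(D\<psi> e\<^sub>j \<phi> / det D\<psi>) \<circ> \<zeta>\<close> of the field \<open>\<phi> e\<^sub>j\<close> has divergence
  \<open>(\<partial>\<^sub>j\<phi> / det D\<psi>) \<circ> \<zeta>\<close>. Testing against smooth functions avoids second derivatives of \<open>\<psi>\<close>.\<close>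

definition piola :: "(real^'n::_ \<Rightarrow> real) \<Rightarrow> 'n \<Rightarrow> 'n \<Rightarrow> real^'n::_ \<Rightarrow> real" where
  "piola \<phi> j k = (\<lambda>y. if y \<in> U then jacobian \<psi> (at (\<zeta> y)) $ k $ j * \<phi> (\<zeta> y) / det (jacobian \<psi> (at (\<zeta> y))) else 0)"

lemma compact_diffeo_image: "compact K \<Longrightarrow> K \<subseteq> V \<Longrightarrow> compact (\<psi> ` K) \<and> \<psi> ` K \<subseteq> U"
  using smooth_on_continuous_on[OF diffeo_props(3)] diffeo_props(5)
  by (auto intro: compact_continuous_image continuous_on_subset)

lemma compact_diffeo_inv_image: "compact K \<Longrightarrow> K \<subseteq> U \<Longrightarrow> compact (\<zeta> ` K) \<and> \<zeta> ` K \<subseteq> V"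
  using smooth_on_continuous_on[OF diffeo_props(4)] diffeo_props(6)
  by (auto intro: compact_continuous_image continuous_on_subset)

lemma smooth_on_compose_inv: "smooth_on V f \<Longrightarrow> smooth_on U (\<lambda>y. f (\<zeta> y))"
  by (rule smooth_on_compose[OF diffeo_props(2,1,4)]) (use diffeo_props(6) in auto)

lemma test_function_piola:
  assumes "test_function V \<phi>" shows "test_function U (piola \<phi> j k)"
proof -
  obtain K where K: "compact K" "K \<subseteq> V" "\<And>x. x \<notin> K \<Longrightarrow> \<phi> x = 0"
    using test_function_support[OF assms] by blast
  have sm: "smooth_on V \<phi>" using smooth_on_subset[OF test_function_smooth[OF assms]] by simp
  have s: "smooth_on U (\<lambda>y. jacobian \<psi> (at (\<zeta> y)) $ k $ j * \<phi> (\<zeta> y) / det (jacobian \<psi> (at (\<zeta> y))))"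
    by (intro smooth_on_divide smooth_on_mult diffeo_props(2) smooth_on_compose_inv[OF smooth_on_jacobian[OF diffeo_props(1,3)]]
        smooth_on_compose_inv[OF sm] smooth_on_compose_inv[OF smooth_on_diffeo_det])
      (use diffeo_props(9,12) in force)
  show ?thesis unfolding piola_def
  proof (rule test_function_extend[OF diffeo_props(2) s])
    show "compact (\<psi> ` K)" "\<psi> ` K \<subseteq> U" using compact_diffeo_image[OF K(1,2)] by auto
    show "jacobian \<psi> (at (\<zeta> y)) $ k $ j * \<phi> (\<zeta> y) / det (jacobian \<psi> (at (\<zeta> y))) = 0" if "y \<in> U - \<psi> ` K" for y
    proof -
      have "\<zeta> y \<notin> K" using that diffeo_props(8)[of y] by (metis DiffD1 DiffD2 imageI)
      then show ?thesis using K(3) by simp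
    qed
  qed
qed

lemma divergence_piola:
  assumes \<phi>: "test_function V \<phi>"
  shows "AE y in lebesgue_on U. (\<Sum>k\<in>UNIV. frechet_derivative (piola \<phi> j k) (at y) (axis k 1)) =
    frechet_derivative \<phi> (at (\<zeta> y)) (axis j 1) / det (jacobian \<psi> (at (\<zeta> y)))"
proof -
  define Z where "Z k = piola \<phi> j k" for k
  define d where "d y = (\<Sum>k\<in>UNIV. frechet_derivative (Z k) (at y) (axis k 1))" for y
  define D\<phi> where "D\<phi> x = frechet_derivative \<phi> (at x) (axis j 1)" for x
  define g where "g y = D\<phi> (\<zeta> y) / det (jacobian \<psi> (at (\<zeta> y)))" for y
  have Z: "test_function U (Z k)" for k unfolding Z_def by (rule test_function_piola[OF \<phi>])
  have dZ: "test_function U (\<lambda>y. frechet_derivative (Z k) (at y) v)" for k v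
    by (rule test_function_frechet_derivative[OF Z])
  have cd: "continuous_on UNIV d" unfolding d_def
    by (intro continuous_on_sum smooth_on_continuous_on test_function_smooth[OF dZ])
  have tD\<phi>: "test_function V D\<phi>" unfolding D\<phi>_def by (rule test_function_frechet_derivative[OF \<phi>])
  have sD\<phi>: "smooth_on V D\<phi>" using smooth_on_subset[OF test_function_smooth[OF tD\<phi>]] by simp
  have det0: "det (jacobian \<psi> (at (\<zeta> y))) \<noteq> 0" if "y \<in> U" for y
    using diffeo_props(9)[OF diffeo_props(12)[OF that]] by simp
  have "smooth_on U g" unfolding g_def
    by (intro smooth_on_divide diffeo_props(2) smooth_on_compose_inv[OF sD\<phi>] smooth_on_compose_inv[OF smooth_on_diffeo_det] det0)
  then have cg: "continuous_on U g" by (rule smooth_on_continuous_on)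
  have lg: "locally_integrable U g" by (rule locally_integrable_continuous[OF cg])
  have ld: "locally_integrable U d" by (rule locally_integrable_continuous) (use cd continuous_on_subset in blast)
  have "AE y in lebesgue_on U. d y - g y = 0"
  proof (rule fundamental_lemma[OF diffeo_props(2) locally_integrable_diff[OF ld lg]])
    fix \<eta> :: "real^'n::_ \<Rightarrow> real" assume \<eta>: "test_function U \<eta>"
    obtain K where K: "compact K" "K \<subseteq> U" "\<And>x. x \<notin> K \<Longrightarrow> \<eta> x = 0"
      using test_function_support[OF \<eta>] by blast
    have s\<eta>: "smooth_on UNIV \<eta>" by (rule test_function_smooth[OF \<eta>])
    \<comment> \<open>The test function pulled back to \<open>V\<close>. Its j-th derivative pairs
      the gradient of \<eta> with column j of D\<psi>, which is exactly the column carried by the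
      Piola field.\<close>
    define \<mu> where "\<mu> x = (if x \<in> V then \<eta> (\<psi> x) else 0)" for x
    have t\<mu>: "test_function V \<mu>" unfolding \<mu>_def
    proof (rule test_function_extend[OF diffeo_props(1)])
      show "smooth_on V (\<lambda>x. \<eta> (\<psi> x))"
        by (rule smooth_on_compose[OF diffeo_props(1) open_UNIV diffeo_props(3) _ s\<eta>]) simp
      show "compact (\<zeta> ` K)" "\<zeta> ` K \<subseteq> V" using compact_diffeo_inv_image[OF K(1,2)] by auto
      show "\<eta> (\<psi> x) = 0" if "x \<in> V - \<zeta> ` K" for x
        using that diffeo_props(7)[of x] K(3)[of "\<psi> x"] by (metis DiffD1 DiffD2 imageI)
    qed
    have d\<mu>: "frechet_derivative \<mu> (at x) (axis j 1) =
        (\<Sum>k\<in>UNIV. jacobian \<psi> (at x) $ k $ j * frechet_derivative \<eta> (at (\<psi> x)) (axis k 1))" if "x \<in> V" for x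
    proof -
      have "frechet_derivative \<mu> (at x) = frechet_derivative (\<lambda>x. \<eta> (\<psi> x)) (at x)"
        by (rule frechet_derivative_transform[OF diffeo_props(1) that]) (simp add: \<mu>_def)
      then show ?thesis
        using frechet_derivative_compose_cart[OF smooth_on_differentiable[OF diffeo_props(3) that]
            smooth_on_differentiable[OF s\<eta> UNIV_I]] by simp
    qed
    have d\<eta>: "test_function U (\<lambda>y. frechet_derivative \<eta> (at y) v)" for v
      by (rule test_function_frechet_derivative[OF \<eta>])
    have ints: "integrable (lebesgue_on U) (\<lambda>y. f y * \<theta> y)" if "test_function U f" "test_function U \<theta>"
      for f \<theta> :: "real^'n::_ \<Rightarrow> real"
      by (rule integrable_test_function[OF diffeo_props(2) locally_integrable_continuous that(2)])
        (use smooth_on_continuous_on[OF test_function_smooth[OF that(1)]] continuous_on_subset in blast)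
    have "(LINT y|lebesgue_on U. d y * \<eta> y) =
        (\<Sum>k\<in>UNIV. LINT y|lebesgue_on U. frechet_derivative (Z k) (at y) (axis k 1) * \<eta> y)"
      unfolding d_def sum_distrib_right by (rule Bochner_Integration.integral_sum) (rule ints[OF dZ \<eta>])
    also have "\<dots> = (\<Sum>k\<in>UNIV. - (LINT y|lebesgue_on U. Z k y * frechet_derivative \<eta> (at y) (axis k 1)))"
      using integration_by_parts_test_function[OF diffeo_props(2) smooth_onD[OF test_function_smooth[OF Z]]
          smooth_onD[OF s\<eta>] K] by simp
    also have "\<dots> = - (LINT y|lebesgue_on U. (\<Sum>k\<in>UNIV. Z k y * frechet_derivative \<eta> (at y) (axis k 1)))"
      by (subst Bochner_Integration.integral_sum) (auto intro: ints[OF Z d\<eta>] simp: sum_negf)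
    also have "(LINT y|lebesgue_on U. (\<Sum>k\<in>UNIV. Z k y * frechet_derivative \<eta> (at y) (axis k 1))) =
        (LINT x|lebesgue_on V. det (jacobian \<psi> (at x)) * (\<Sum>k\<in>UNIV. Z k (\<psi> x) * frechet_derivative \<eta> (at (\<psi> x)) (axis k 1)))"
      by (rule diffeo_change_of_variables(2))
    also have "\<dots> = (LINT x|lebesgue_on V. \<phi> x * frechet_derivative \<mu> (at x) (axis j 1))"
    proof (rule Bochner_Integration.integral_cong[OF refl])
      fix x assume "x \<in> space (lebesgue_on V)"
      then have x: "x \<in> V" by simp
      have "det (jacobian \<psi> (at x)) * Z k (\<psi> x) = jacobian \<psi> (at x) $ k $ j * \<phi> x" for k
        using diffeo_props(7,9,11)[OF x] by (simp add: Z_def piola_def)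
      then have "det (jacobian \<psi> (at x)) * (Z k (\<psi> x) * w) = \<phi> x * (jacobian \<psi> (at x) $ k $ j * w)" for k w
        by (simp only: mult.assoc[symmetric]) (simp only: mult_ac)
      then show "det (jacobian \<psi> (at x)) * (\<Sum>k\<in>UNIV. Z k (\<psi> x) * frechet_derivative \<eta> (at (\<psi> x)) (axis k 1)) =
          \<phi> x * frechet_derivative \<mu> (at x) (axis j 1)"
        unfolding d\<mu>[OF x] sum_distrib_left by (rule sum.cong[OF refl])
    qed
    also have "- \<dots> = (LINT x|lebesgue_on V. D\<phi> x * \<mu> x)"
    proof -
      obtain L where "compact L" "L \<subseteq> V" "\<And>x. x \<notin> L \<Longrightarrow> \<mu> x = 0"
        using test_function_support[OF t\<mu>] by blast
      from integration_by_parts_test_function[OF diffeo_props(1) smooth_onD[OF test_function_smooth[OF \<phi>]]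
          smooth_onD[OF test_function_smooth[OF t\<mu>]] this]
      show ?thesis by (simp add: D\<phi>_def)
    qed
    also have "\<dots> = (LINT x|lebesgue_on V. det (jacobian \<psi> (at x)) * (g (\<psi> x) * \<eta> (\<psi> x)))"
    proof (rule Bochner_Integration.integral_cong[OF refl])
      fix x assume "x \<in> space (lebesgue_on V)"
      then have x: "x \<in> V" by simp
      show "D\<phi> x * \<mu> x = det (jacobian \<psi> (at x)) * (g (\<psi> x) * \<eta> (\<psi> x))"
        using diffeo_props(7,9,11)[OF x] x by (simp add: g_def \<mu>_def)
    qed
    also have "\<dots> = (LINT y|lebesgue_on U. g y * \<eta> y)"
      by (rule diffeo_change_of_variables(2)[symmetric])
    finally show "(LINT y|lebesgue_on U. (d y - g y) * \<eta> y) = 0"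
      using integrable_test_function[OF diffeo_props(2) ld \<eta>] integrable_test_function[OF diffeo_props(2) lg \<eta>]
      by (simp add: left_diff_distrib)
  qed
  then show ?thesis unfolding d_def g_def Z_def D\<phi>_def by (auto elim!: eventually_mono)
qed

text \<open>Chain rule for weak gradients. The Piola fields are legitimate test functions for
  \<open>u\<close>; pulling back leaves (Du \<circ> \<psi>) D\<psi> on the gradient side, and
  \<open>divergence_piola\<close> turns the divergence on the other side into the j-th derivative of
  the test function.\<close>

lemma is_weak_D_diffeo:
  fixes u :: "real^'n::_ \<Rightarrow> real^'m"
  assumes u: "is_weak_D U u A"
  shows "is_weak_D V (\<lambda>x. u (\<psi> x)) (\<lambda>x. A (\<psi> x) ** jacobian \<psi> (at x))"
proof -
  have lu: "locally_integrable U (\<lambda>x. u x $ i)" for i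
    using u by (intro locally_integrable_nth) (simp add: is_weak_D_def)
  have lA: "locally_integrable U (\<lambda>x. A x $ i $ j)" for i j
    using u by (intro locally_integrable_nth_nth) (simp add: is_weak_D_def)
  have "locally_integrable V (\<lambda>x. u (\<psi> x))"
    by (rule locally_integrable_cart) (rule locally_integrable_diffeo[OF lu])
  moreover have "locally_integrable V (\<lambda>x. A (\<psi> x) ** jacobian \<psi> (at x))"
  proof (intro locally_integrable_cart)
    fix i j
    have "locally_integrable V (\<lambda>x. \<Sum>k\<in>UNIV. jacobian \<psi> (at x) $ k $ j * A (\<psi> x) $ i $ k)"
      by (intro locally_integrable_sum locally_integrable_mult_continuous locally_integrable_diffeo[OF lA]
          smooth_on_continuous_on smooth_on_jacobian diffeo_props)
    then show "locally_integrable V (\<lambda>x. (A (\<psi> x) ** jacobian \<psi> (at x)) $ i $ j)"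
      by (simp add: matrix_matrix_mult_def mult.commute)
  qed
  moreover have "- (LINT x|lebesgue_on V. u (\<psi> x) $ i * frechet_derivative \<phi> (at x) (axis j 1)) =
      (LINT x|lebesgue_on V. (A (\<psi> x) ** jacobian \<psi> (at x)) $ i $ j * \<phi> x)"
    if \<phi>: "test_function V \<phi>" for \<phi> i j
  proof -
    have det_cancel: "det (jacobian \<psi> (at x)) * (w * (c / det (jacobian \<psi> (at (\<zeta> (\<psi> x)))))) = w * c"
      "\<zeta> (\<psi> x) = x" if "x \<in> V" for x w c
      using diffeo_props(7,9)[OF that] by simp_all
    define Z where "Z k = piola \<phi> j k" for k
    have Z: "test_function U (Z k)" for k unfolding Z_def by (rule test_function_piola[OF \<phi>])
    have dZ: "test_function U (\<lambda>y. frechet_derivative (Z k) (at y) v)" for k v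
      by (rule test_function_frechet_derivative[OF Z])
    have "(LINT x|lebesgue_on V. (A (\<psi> x) ** jacobian \<psi> (at x)) $ i $ j * \<phi> x) =
        (LINT x|lebesgue_on V. det (jacobian \<psi> (at x)) * (\<Sum>k\<in>UNIV. A (\<psi> x) $ i $ k * Z k (\<psi> x)))"
    proof (rule Bochner_Integration.integral_cong[OF refl])
      fix x assume "x \<in> space (lebesgue_on V)"
      then have x: "x \<in> V" by simp
      have "det (jacobian \<psi> (at x)) * Z k (\<psi> x) = jacobian \<psi> (at x) $ k $ j * \<phi> x" for k
        using diffeo_props(7,9,11)[OF x] by (simp add: Z_def piola_def)
      then have "w * jacobian \<psi> (at x) $ k $ j * \<phi> x = det (jacobian \<psi> (at x)) * (w * Z k (\<psi> x))" for k w
        by (simp only: mult.left_commute[of _ w] mult.assoc)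
      then show "(A (\<psi> x) ** jacobian \<psi> (at x)) $ i $ j * \<phi> x =
          det (jacobian \<psi> (at x)) * (\<Sum>k\<in>UNIV. A (\<psi> x) $ i $ k * Z k (\<psi> x))"
        unfolding sum_distrib_left matrix_matrix_mult_def vec_lambda_beta sum_distrib_right
        by (rule sum.cong[OF refl])
    qed
    also have "\<dots> = (LINT y|lebesgue_on U. (\<Sum>k\<in>UNIV. A y $ i $ k * Z k y))"
      by (rule diffeo_change_of_variables(2)[symmetric])
    also have "\<dots> = (\<Sum>k\<in>UNIV. LINT y|lebesgue_on U. A y $ i $ k * Z k y)"
      by (rule Bochner_Integration.integral_sum) (rule integrable_test_function[OF diffeo_props(2) lA Z])
    also have "\<dots> = (\<Sum>k\<in>UNIV. - (LINT y|lebesgue_on U. u y $ i * frechet_derivative (Z k) (at y) (axis k 1)))"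
      using is_weak_D_D[OF u Z] by simp
    also have "\<dots> = - (LINT y|lebesgue_on U. u y $ i * (\<Sum>k\<in>UNIV. frechet_derivative (Z k) (at y) (axis k 1)))"
      unfolding sum_distrib_left
      by (subst Bochner_Integration.integral_sum)
        (auto intro: integrable_test_function[OF diffeo_props(2) lu dZ] simp: sum_negf)
    also have "(LINT y|lebesgue_on U. u y $ i * (\<Sum>k\<in>UNIV. frechet_derivative (Z k) (at y) (axis k 1))) =
        (LINT y|lebesgue_on U. u y $ i * (frechet_derivative \<phi> (at (\<zeta> y)) (axis j 1) / det (jacobian \<psi> (at (\<zeta> y)))))"
    proof (rule integral_cong_AE)
      have "integrable (lebesgue_on U) (\<lambda>y. \<Sum>k\<in>UNIV. u y $ i * frechet_derivative (Z k) (at y) (axis k 1))"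
        by (intro Bochner_Integration.integrable_sum integrable_test_function[OF diffeo_props(2) lu dZ])
      then show "(\<lambda>y. u y $ i * (\<Sum>k\<in>UNIV. frechet_derivative (Z k) (at y) (axis k 1))) \<in> borel_measurable (lebesgue_on U)"
        unfolding sum_distrib_left by (rule borel_measurable_integrable)
      have "integrable (lebesgue_on U) (\<lambda>y. u y $ i * (frechet_derivative \<phi> (at (\<zeta> y)) (axis j 1) / det (jacobian \<psi> (at (\<zeta> y)))))"
        unfolding diffeo_change_of_variables(1)
      proof (subst Bochner_Integration.integrable_cong[OF refl])
        show "integrable (lebesgue_on V) (\<lambda>x. u (\<psi> x) $ i * frechet_derivative \<phi> (at x) (axis j 1))"
          by (rule integrable_test_function[OF diffeo_props(1) locally_integrable_diffeo[OF lu]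
                test_function_frechet_derivative[OF \<phi>]])
      qed (use det_cancel in simp)
      then show "(\<lambda>y. u y $ i * (frechet_derivative \<phi> (at (\<zeta> y)) (axis j 1) / det (jacobian \<psi> (at (\<zeta> y)))))
          \<in> borel_measurable (lebesgue_on U)" by (rule borel_measurable_integrable)
      show "AE y in lebesgue_on U. u y $ i * (\<Sum>k\<in>UNIV. frechet_derivative (Z k) (at y) (axis k 1)) =
          u y $ i * (frechet_derivative \<phi> (at (\<zeta> y)) (axis j 1) / det (jacobian \<psi> (at (\<zeta> y))))"
        using divergence_piola[OF \<phi>, of j] unfolding Z_def by (auto elim!: eventually_mono)
    qed
    also have "\<dots> = (LINT x|lebesgue_on V. det (jacobian \<psi> (at x)) *
        (u (\<psi> x) $ i * (frechet_derivative \<phi> (at (\<zeta> (\<psi> x))) (axis j 1) / det (jacobian \<psi> (at (\<zeta> (\<psi> x)))))))"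
      by (rule diffeo_change_of_variables(2))
    also have "\<dots> = (LINT x|lebesgue_on V. u (\<psi> x) $ i * frechet_derivative \<phi> (at x) (axis j 1))"
      by (rule Bochner_Integration.integral_cong[OF refl]) (use det_cancel in simp)
    finally show ?thesis by simp
  qed
  ultimately show ?thesis
    by (auto simp: is_weak_D_def distr_eq_def distr_partial_def regular_distr_def)
qed

end

section \<open>Inner variations\<close>

text \<open>Local integrability speaks about compact sets only; measurability on \<open>U\<close> is
  glued from a countable compact exhaustion.\<close>

lemma locally_integrable_measurable:
  fixes f :: "'a::euclidean_space \<Rightarrow> 'b::euclidean_space"
  assumes U: "open U" and f: "locally_integrable U f"
  shows "f \<in> borel_measurable (lebesgue_on U)"
proof -
  obtain F :: "nat \<Rightarrow> 'a set" where F: "\<And>n. compact (F n)" "\<And>n. F n \<subseteq> U" "(\<Union>n. F n) = U"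
    using open_Union_compact_subsets[OF U] by (metis (no_types, lifting))
  show ?thesis
  proof (rule measurable_piecewise_restrict[of "range F"])
    show "\<Omega> \<inter> space (lebesgue_on U) \<in> sets (lebesgue_on U)" if "\<Omega> \<in> range F" for \<Omega>
    proof -
      have "\<Omega> \<in> sets lebesgue" "\<Omega> \<subseteq> U" using that F compact_lebesgue by blast+
      then show ?thesis using U by (simp add: sets_restrict_space_iff Int_absorb2)
    qed
    show "f \<in> borel_measurable (restrict_space (lebesgue_on U) \<Omega>)" if "\<Omega> \<in> range F" for \<Omega>
    proof -
      have \<Omega>: "compact \<Omega>" "\<Omega> \<subseteq> U" using that F by auto
      have "restrict_space (lebesgue_on U) \<Omega> = lebesgue_on (U \<inter> \<Omega>)"
        using U compact_lebesgue[OF \<Omega>(1)] by (intro restrict_restrict_space) auto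
      then have "restrict_space (lebesgue_on U) \<Omega> = lebesgue_on \<Omega>" using \<Omega>(2) by (simp add: Int_absorb1)
      moreover have "integrable (lebesgue_on \<Omega>) f"
        using f \<Omega> by (simp add: locally_integrable_def lebesgue_on_integral(3)[OF compact_lebesgue])
      ultimately show ?thesis by (simp add: borel_measurable_integrable)
    qed
  qed (use F in auto)
qed

lemma is_weak_D_add:
  fixes u w :: "real^'n \<Rightarrow> real^'m"
  assumes U: "open U" and u: "is_weak_D U u A" and w: "is_weak_D U w B"
  shows "is_weak_D U (\<lambda>x. u x + w x) (\<lambda>x. A x + B x)"
proof -
  have l: "locally_integrable U u" "locally_integrable U w" "locally_integrable U A" "locally_integrable U B"
    using u w by (auto simp: is_weak_D_def)
  have "- (LINT x|lebesgue_on U. (u x + w x) $ i * frechet_derivative \<phi> (at x) (axis j 1)) =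
      (LINT x|lebesgue_on U. (A x + B x) $ i $ j * \<phi> x)" if \<phi>: "test_function U \<phi>" for \<phi> i j
    using is_weak_D_D[OF u \<phi>, of i j] is_weak_D_D[OF w \<phi>, of i j]
      integrable_test_function[OF U locally_integrable_nth[OF l(1)] test_function_frechet_derivative[OF \<phi>], of i "axis j 1"]
      integrable_test_function[OF U locally_integrable_nth[OF l(2)] test_function_frechet_derivative[OF \<phi>], of i "axis j 1"]
      integrable_test_function[OF U locally_integrable_nth_nth[OF l(3)] \<phi>, of i j]
      integrable_test_function[OF U locally_integrable_nth_nth[OF l(4)] \<phi>, of i j]
    by (simp add: distrib_right)
  then show ?thesis using l
    by (auto simp: is_weak_D_def distr_eq_def distr_partial_def regular_distr_def intro: locally_integrable_add)
qed

lemma is_weak_D_cong: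
  fixes u w :: "real^'n \<Rightarrow> real^'m"
  assumes "\<And>x. x \<in> U \<Longrightarrow> u x = w x" "\<And>x. x \<in> U \<Longrightarrow> A x = B x" and u: "is_weak_D U u A"
  shows "is_weak_D U w B"
proof -
  have "locally_integrable U w" "locally_integrable U B"
    using assms locally_integrable_cong[of U u w] locally_integrable_cong[of U A B] by (auto simp: is_weak_D_def)
  moreover have "- (LINT x|lebesgue_on U. w x $ i * frechet_derivative \<phi> (at x) (axis j 1)) =
      (LINT x|lebesgue_on U. B x $ i $ j * \<phi> x)" if \<phi>: "test_function U \<phi>" for \<phi> i j
  proof -
    have "(LINT x|lebesgue_on U. w x $ i * frechet_derivative \<phi> (at x) (axis j 1)) =
        (LINT x|lebesgue_on U. u x $ i * frechet_derivative \<phi> (at x) (axis j 1))"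
      by (rule Bochner_Integration.integral_cong[OF refl]) (simp add: assms(1))
    moreover have "(LINT x|lebesgue_on U. B x $ i $ j * \<phi> x) = (LINT x|lebesgue_on U. A x $ i $ j * \<phi> x)"
      by (rule Bochner_Integration.integral_cong[OF refl]) (simp add: assms(2))
    ultimately show ?thesis using is_weak_D_D[OF u \<phi>, of i j] by simp
  qed
  ultimately show ?thesis by (simp add: is_weak_D_def distr_eq_def distr_partial_def regular_distr_def)
qed

lemma Ck_on_nth: "open S \<Longrightarrow> Ck_on k S f \<Longrightarrow> Ck_on k S (\<lambda>x. f x $ i)"
  by (rule Ck_on_bounded_linear[OF bounded_linear_vec_nth])

lemma frechet_derivative_nth:
  fixes f :: "real^'n \<Rightarrow> real^'m"
  assumes "f differentiable (at x)"
  shows "frechet_derivative (\<lambda>x. f x $ i) (at x) v = frechet_derivative f (at x) v $ i"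
proof -
  have "(f has_derivative frechet_derivative f (at x)) (at x)" using assms frechet_derivative_works by blast
  then have "((\<lambda>x. f x $ i) has_derivative (\<lambda>v. frechet_derivative f (at x) v $ i)) (at x)"
    by (rule bounded_linear.has_derivative[OF bounded_linear_vec_nth])
  from frechet_derivative_at[OF this, symmetric] show ?thesis by simp
qed

lemma is_weak_D_C1:
  fixes G :: "real^'n \<Rightarrow> real^'m"
  assumes U: "open U" and G: "Ck_on 1 UNIV G"
  shows "is_weak_D U G (\<lambda>x. jacobian G (at x))"
proof -
  have c: "continuous_on UNIV G" by (rule Ck_on_continuous_on[OF G])
  have cD: "continuous_on UNIV (\<lambda>x. frechet_derivative G (at x) v)" for v using G by simp
  have "locally_integrable U G" by (rule locally_integrable_continuous[OF continuous_on_subset[OF c subset_UNIV]])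
  moreover have "locally_integrable U (\<lambda>x. jacobian G (at x))"
    unfolding jacobian_nth
    by (intro locally_integrable_cart locally_integrable_continuous)
      (auto simp: jacobian_nth intro!: continuous_on_component continuous_on_subset[OF cD])
  moreover have "- (LINT x|lebesgue_on U. G x $ i * frechet_derivative \<phi> (at x) (axis j 1)) =
      (LINT x|lebesgue_on U. jacobian G (at x) $ i $ j * \<phi> x)" if \<phi>: "test_function U \<phi>" for \<phi> i j
  proof -
    obtain K where K: "compact K" "K \<subseteq> U" "\<And>x. x \<notin> K \<Longrightarrow> \<phi> x = 0" using test_function_support[OF \<phi>] by blast
    have d: "frechet_derivative (\<lambda>x. G x $ i) (at x) (axis j 1) = jacobian G (at x) $ i $ j" for x
      unfolding jacobian_nth by (rule frechet_derivative_nth) (use G in simp)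
    show ?thesis
      using integration_by_parts_test_function[OF U Ck_on_nth[OF open_UNIV G] smooth_onD[OF test_function_smooth[OF \<phi>]] K,
          of i "axis j 1"]
      by (simp add: d)
  qed
  ultimately show ?thesis by (simp add: is_weak_D_def distr_eq_def distr_partial_def regular_distr_def)
qed

lemma norm_matrix_mult_bound:
  obtains C where "C > 0" "\<And>(A::real^'n^'m) (B::real^'k^'n). norm (A ** B) \<le> norm A * norm B * C"
proof -
  have "bilinear (\<lambda>(A::real^'n^'m) (B::real^'k^'n). A ** B)"
    unfolding bilinear_def linear_iff
    by (auto simp: matrix_matrix_mult_def vec_eq_iff distrib_left distrib_right sum.distrib sum_distrib_left mult_ac)
  then have "bounded_bilinear (\<lambda>(A::real^'n^'m) (B::real^'k^'n). A ** B)"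
    by (simp add: bilinear_conv_bounded_bilinear)
  then show thesis using bounded_bilinear.pos_bounded that by metis
qed

lemma norm_matrix_le_sum: "norm (A::real^'n^'m) \<le> (\<Sum>i\<in>UNIV. \<Sum>j\<in>UNIV. \<bar>A $ i $ j\<bar>)"
proof -
  have "norm A \<le> (\<Sum>i\<in>UNIV. norm (A $ i))" by (simp add: norm_vec_def L2_set_le_sum)
  also have "\<dots> \<le> (\<Sum>i\<in>UNIV. \<Sum>j\<in>UNIV. \<bar>A $ i $ j\<bar>)"
    by (intro sum_mono norm_le_l1_cart)
  finally show ?thesis .
qed

text \<open>The bound 1/2 makes \<open>X\<close> a contraction, so that id + X is a bijection of the
  whole space by Banach's fixed point theorem, and it keeps id + s DX invertible for 0 \<le> s \<le>
  1.\<close>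

locale inner_variation =
  fixes \<Omega> :: "(real^'n::{finite,wellorder}) set" and X :: "real^'n::{finite,wellorder} \<Rightarrow> real^'n::{finite,wellorder}"
  assumes open_\<Omega>: "open \<Omega>" and X_test: "test_function \<Omega> X"
    and X_small: "\<And>x v. norm (jacobian X (at x) *v v) \<le> norm v / 2"
begin

definition \<psi> where "\<psi> x = x + X x"
definition \<zeta> where "\<zeta> = inv \<psi>"

lemma smooth_X: "smooth_on UNIV X" by (rule test_function_smooth[OF X_test])

lemma X_support: obtains K where "compact K" "K \<subseteq> \<Omega>" "\<And>x. x \<notin> K \<Longrightarrow> X x = 0"
  using test_function_support[OF X_test] by blast

lemma X_has_derivative: "(X has_derivative (*v) (jacobian X (at x))) (at x)"
  by (rule smooth_on_has_derivative_jacobian[OF smooth_X UNIV_I])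

lemma smooth_\<psi>: "smooth_on UNIV \<psi>"
  unfolding \<psi>_def[abs_def] by (intro smooth_on_add smooth_on_id smooth_X open_UNIV)

lemma jacobian_\<psi>: "jacobian \<psi> (at x) = mat 1 + jacobian X (at x)"
proof -
  have "(\<psi> has_derivative (\<lambda>v. v + jacobian X (at x) *v v)) (at x)"
    unfolding \<psi>_def[abs_def] by (intro has_derivative_add has_derivative_ident X_has_derivative)
  from frechet_derivative_at[OF this, symmetric] show ?thesis
    by (simp add: jacobian_def[of \<psi>] matrix_def vec_eq_iff mat_def axis_def
        matrix_vector_mult_basis[unfolded axis_def] column_def matrix_vector_mult_def if_distrib cong: if_cong)
qed

lemma X_lipschitz: "norm (X x - X y) \<le> 1 / 2 * norm (x - y)"
proof (rule differentiable_bound[OF convex_UNIV])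
  show "(X has_derivative (*v) (jacobian X (at x))) (at x within UNIV)" for x using X_has_derivative by simp
  show "onorm ((*v) (jacobian X (at x))) \<le> 1 / 2" for x
    by (rule onorm_le) (use X_small in auto)
qed auto

lemma bij_\<psi>: "bij \<psi>"
proof (rule bijI)
  show "inj \<psi>"
  proof (rule injI)
    fix x y assume "\<psi> x = \<psi> y"
    then have "x - y = X y - X x" by (simp add: \<psi>_def algebra_simps)
    then have "norm (x - y) \<le> 1 / 2 * norm (x - y)" using X_lipschitz[of y x] by (simp add: norm_minus_commute)
    then show "x = y" by simp
  qed
  show "surj \<psi>"
  proof (rule surjI)
    fix y
    have "dist (y - X x) (y - X z) \<le> 1 / 2 * dist x z" for x z
      using X_lipschitz[of z x] by (simp add: dist_norm norm_minus_commute)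
    \<comment> \<open>A preimage of \<open>y\<close> is a fixed point of the contraction x \<mapsto>
      y - X x.\<close>
    then have "\<exists>!x. y - X x = x" by (intro banach_fix_type[where c = "1 / 2"]) auto
    then obtain x where "y - X x = x" by blast
    then have "\<psi> x = y" unfolding \<psi>_def by (metis diff_add_cancel)
    then show "\<psi> (inv \<psi> y) = y" by (metis f_inv_into_f rangeI)
  qed
qed

lemma \<zeta>_\<psi>: "\<zeta> (\<psi> x) = x" and \<psi>_\<zeta>: "\<psi> (\<zeta> y) = y"
  using bij_\<psi> by (simp_all add: \<zeta>_def bij_is_inj bij_is_surj surj_f_inv_f)

text \<open>Along the segment from the identity to D\<psi> no matrix is singular, so the determinant
  keeps the sign it has at the identity.\<close>

lemma det_\<psi>: "det (jacobian \<psi> (at x)) > 0"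
proof -
  define B where "B s = mat 1 + s *\<^sub>R jacobian X (at x)" for s
  have nz: "det (B s) \<noteq> 0" if s: "0 \<le> s" "s \<le> 1" for s
  proof
    assume "det (B s) = 0"
    then obtain v where v: "v \<noteq> 0" "B s *v v = 0"
      using invertible_det_nz matrix_left_invertible_ker invertible_left_inverse by blast
    then have "v = - (s *\<^sub>R (jacobian X (at x) *v v))"
      by (simp add: B_def matrix_vector_mult_add_rdistrib scaleR_matrix_vector_assoc eq_neg_iff_add_eq_0)
    then have "norm v = s * norm (jacobian X (at x) *v v)" using s by (metis norm_minus_cancel norm_scaleR abs_of_nonneg)
    also have "\<dots> \<le> 1 * (norm v / 2)" using s X_small by (intro mult_mono) auto
    finally show False using v(1) by simp
  qed
  have c: "continuous_on {0..1} (\<lambda>s. det (B s))"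
    unfolding det_def B_def by (intro continuous_intros)
  have "det (B 1) > 0"
  proof (rule ccontr)
    assume "\<not> det (B 1) > 0"
    then have "\<exists>s. 0 \<le> s \<and> s \<le> 1 \<and> det (B s) = 0"
      by (intro IVT2'[of "\<lambda>s. det (B s)"] c) (auto simp: B_def)
    then show False using nz by blast
  qed
  then show ?thesis by (simp add: jacobian_\<psi> B_def)
qed

text \<open>Points outside the support of \<open>X\<close> are fixed. A point of the support that
  was sent out of \<Omega> would have a fixed point as its image, hence be that point by
  injectivity.\<close>

lemma \<psi>_in_iff: "\<psi> x \<in> \<Omega> \<longleftrightarrow> x \<in> \<Omega>"
proof -
  obtain K where K: "compact K" "K \<subseteq> \<Omega>" "\<And>x. x \<notin> K \<Longrightarrow> X x = 0" using X_support by blast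
  have fix_out: "\<psi> z = z" if "z \<notin> K" for z using K(3)[OF that] by (simp add: \<psi>_def)
  show ?thesis
  proof (cases "x \<in> K")
    case True
    have "\<psi> x \<in> \<Omega>"
    proof (rule ccontr)
      assume a: "\<psi> x \<notin> \<Omega>"
      then have "\<psi> (\<psi> x) = \<psi> x" using fix_out K(2) by blast
      then have "\<psi> x = x" using \<zeta>_\<psi> by metis
      then show False using a True K(2) by auto
    qed
    then show ?thesis using True K(2) by auto
  qed (simp add: fix_out)
qed

lemma diffeo_\<Omega>: "smooth_diffeo \<Omega> \<Omega> \<psi> \<zeta>"
proof (rule smooth_diffeoI[OF open_\<Omega> open_\<Omega> smooth_on_subset[OF smooth_\<psi>]])
  show "\<zeta> ` \<Omega> \<subseteq> \<Omega>" using \<psi>_in_iff \<psi>_\<zeta> by (metis image_subsetI)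
qed (auto simp: \<psi>_in_iff \<zeta>_\<psi> \<psi>_\<zeta> det_\<psi>)

lemma diffeo_UNIV: "smooth_diffeo UNIV UNIV \<psi> \<zeta>"
  by (rule smooth_diffeoI[OF open_UNIV open_UNIV smooth_\<psi>]) (auto simp: \<zeta>_\<psi> \<psi>_\<zeta> det_\<psi>)

lemma smooth_\<zeta>: "smooth_on UNIV \<zeta>"
  using diffeo_UNIV by (simp add: smooth_diffeo_def)

lemma jacobian_bounds:
  obtains c C where "c > 0" "\<And>x. det (jacobian \<psi> (at x)) \<ge> c" "C > 0" "\<And>x. norm (jacobian \<psi> (at x)) \<le> C"
proof -
  obtain K where K: "compact K" "K \<subseteq> \<Omega>" "\<And>x. x \<notin> K \<Longrightarrow> X x = 0" using X_support by blast
  have out: "jacobian \<psi> (at x) = mat 1" if "x \<notin> K" for x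
    unfolding jacobian_\<psi> using frechet_derivative_outside_support[OF K(1,3) that]
    by (simp add: jacobian_def matrix_def vec_eq_iff)
  have ce: "continuous_on UNIV (\<lambda>x. jacobian \<psi> (at x) $ i $ j)" for i j
    by (rule smooth_on_continuous_on[OF smooth_on_jacobian[OF open_UNIV smooth_\<psi>]])
  have cj: "continuous_on UNIV (\<lambda>x. jacobian \<psi> (at x))"
    by (intro continuous_on_vec_lambda[where f = "\<lambda>i x. jacobian \<psi> (at x) $ i", simplified]
        continuous_on_vec_lambda[where f = "\<lambda>j x. jacobian \<psi> (at x) $ i $ j" for i, simplified] ce)
  have cd: "continuous_on UNIV (\<lambda>x. det (jacobian \<psi> (at x)))"
    by (rule smooth_on_continuous_on[OF smooth_on_det[OF open_UNIV smooth_on_jacobian[OF open_UNIV smooth_\<psi>]]])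
  have cK: "compact ((\<lambda>x. inverse (det (jacobian \<psi> (at x)))) ` K)" "compact ((\<lambda>x. jacobian \<psi> (at x)) ` K)"
    using det_\<psi> by (auto intro!: compact_continuous_image[OF _ K(1)] continuous_on_inverse
        continuous_on_subset[OF cd] continuous_on_subset[OF cj] simp: less_imp_neq[symmetric])
  obtain B1 where B1: "\<And>x. x \<in> K \<Longrightarrow> norm (inverse (det (jacobian \<psi> (at x)))) \<le> B1"
    using compact_imp_bounded[OF cK(1)] unfolding bounded_iff by (metis imageI)
  obtain B2 where B2: "\<And>x. x \<in> K \<Longrightarrow> norm (jacobian \<psi> (at x)) \<le> B2"
    using compact_imp_bounded[OF cK(2)] unfolding bounded_iff by (metis imageI)
  \<comment> \<open>The maximum with 1 also covers the points outside \<open>K\<close>, where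
    D\<psi> is the identity.\<close>
  define c where "c = inverse (max 1 B1)"
  have c: "c > 0" by (simp add: c_def)
  have "det (jacobian \<psi> (at x)) \<ge> c" for x
  proof (cases "x \<in> K")
    case True
    then have "inverse (det (jacobian \<psi> (at x))) \<le> max 1 B1" using B1[OF True] det_\<psi>[of x] by simp
    then have "c \<le> inverse (inverse (det (jacobian \<psi> (at x))))"
      unfolding c_def using det_\<psi>[of x] by (intro le_imp_inverse_le) auto
    then show ?thesis by simp
  next
    case False
    then show ?thesis using out[OF False] by (simp add: c_def inverse_le_1_iff)
  qed
  moreover have "norm (jacobian \<psi> (at x)) \<le> max (norm (mat 1 :: real^'n::_^'n::_)) (max B2 1)" for x
    using B2[of x] out[of x] by (cases "x \<in> K") auto
  ultimately show thesis using that[OF c, of "max (norm (mat 1 :: real^'n::_^'n::_)) (max B2 1)"]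
    by (meson less_max_iff_disj zero_less_one)
qed

lemma integrable_compose:
  assumes F: "integrable (lebesgue_on \<Omega>) F"
  shows "integrable (lebesgue_on \<Omega>) (\<lambda>x. F (\<psi> x) :: real)"
proof -
  obtain c C :: real where c: "c > 0" "\<And>x. det (jacobian \<psi> (at x)) \<ge> c" using jacobian_bounds by metis
  have i: "integrable (lebesgue_on \<Omega>) (\<lambda>x. det (jacobian \<psi> (at x)) * F (\<psi> x))"
    using diffeo_change_of_variables(1)[OF diffeo_\<Omega>] F by blast
  have cd: "continuous_on UNIV (\<lambda>x. inverse (det (jacobian \<psi> (at x))))"
    using det_\<psi> by (intro continuous_on_inverse smooth_on_continuous_on[OF smooth_on_det[OF open_UNIV smooth_on_jacobian[OF open_UNIV smooth_\<psi>]]])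
      (auto simp: less_imp_neq[symmetric])
  have "integrable (lebesgue_on \<Omega>) (\<lambda>x. (det (jacobian \<psi> (at x)) * F (\<psi> x)) * inverse (det (jacobian \<psi> (at x))))"
  proof (rule integrable_mult_bounded[OF i borel_measurable_lebesgue_continuous[OF cd]])
    show "\<bar>inverse (det (jacobian \<psi> (at x)))\<bar> \<le> inverse c" for x
      using c(2)[of x] det_\<psi>[of x] c(1) by (simp add: le_imp_inverse_le)
  qed
  moreover have "(det (jacobian \<psi> (at x)) * F (\<psi> x)) * inverse (det (jacobian \<psi> (at x))) = F (\<psi> x)" for x
    using det_\<psi>[of x] by simp
  ultimately show ?thesis by simp
qed

text \<open>The constant is the reciprocal of a lower bound of det D\<psi> and does not depend on
  \<open>F\<close>. The version with values in \<open>ennreal\<close> is the one that fits the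
  convergence in \<open>W12_zero\<close>.\<close>

lemma nn_integral_compose:
  obtains C where "C > 0" "\<And>F. F \<in> borel_measurable (lebesgue_on \<Omega>) \<Longrightarrow> (\<And>x. F x \<ge> 0) \<Longrightarrow>
    (\<integral>\<^sup>+x. ennreal (F (\<psi> x)) \<partial>lebesgue_on \<Omega>) \<le> ennreal C * (\<integral>\<^sup>+x. ennreal (F x) \<partial>lebesgue_on \<Omega>)"
proof -
  obtain c C :: real where c: "c > 0" "\<And>x. det (jacobian \<psi> (at x)) \<ge> c" using jacobian_bounds by metis
  have "(\<integral>\<^sup>+x. ennreal (F (\<psi> x)) \<partial>lebesgue_on \<Omega>) \<le> ennreal (inverse c) * (\<integral>\<^sup>+x. ennreal (F x) \<partial>lebesgue_on \<Omega>)"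
    if F: "F \<in> borel_measurable (lebesgue_on \<Omega>)" "\<And>x. F x \<ge> 0" for F
  proof (cases "(\<integral>\<^sup>+x. ennreal (F x) \<partial>lebesgue_on \<Omega>) = \<infinity>")
    case True
    then show ?thesis using c(1) by (simp add: ennreal_mult_top)
  next
    case False
    then have iF: "integrable (lebesgue_on \<Omega>) F"
      using F by (intro integrableI_nonneg) (auto simp: less_top)
    have i: "integrable (lebesgue_on \<Omega>) (\<lambda>x. det (jacobian \<psi> (at x)) * F (\<psi> x))"
      using diffeo_change_of_variables(1)[OF diffeo_\<Omega>] iF by blast
    have "(LINT x|lebesgue_on \<Omega>. F (\<psi> x)) \<le> (LINT x|lebesgue_on \<Omega>. inverse c * (det (jacobian \<psi> (at x)) * F (\<psi> x)))"
    proof (rule integral_mono[OF integrable_compose[OF iF]])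
      show "F (\<psi> x) \<le> inverse c * (det (jacobian \<psi> (at x)) * F (\<psi> x))" for x
      proof -
        have "1 \<le> inverse c * det (jacobian \<psi> (at x))" using c(2)[of x] c(1) by (simp add: field_simps)
        from mult_right_mono[OF this F(2)[of "\<psi> x"]] show ?thesis by (simp add: mult.assoc)
      qed
    qed (use i in simp)
    also have "\<dots> = inverse c * (LINT x|lebesgue_on \<Omega>. F x)"
      using diffeo_change_of_variables(2)[OF diffeo_\<Omega>, of F] by simp
    finally have "(LINT x|lebesgue_on \<Omega>. F (\<psi> x)) \<le> inverse c * (LINT x|lebesgue_on \<Omega>. F x)" .
    then show ?thesis
      using nn_integral_eq_integral[OF iF] nn_integral_eq_integral[OF integrable_compose[OF iF]] F(2) c(1)
      by (simp add: ennreal_mult[symmetric] ennreal_leI)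
  qed
  then show thesis using that[of "inverse c"] c(1) by simp
qed

end

section \<open>Sobolev maps and the boundary condition under inner variations\<close>

lemma power2_norm_add_le:
  fixes a b :: "'a::real_normed_vector"
  shows "(norm (a + b))\<^sup>2 \<le> 2 * (norm a)\<^sup>2 + 2 * (norm b)\<^sup>2"
proof -
  have "(norm (a + b))\<^sup>2 \<le> (norm a + norm b)\<^sup>2"
    by (intro power_mono norm_triangle_ineq norm_ge_zero)
  also have "\<dots> \<le> 2 * (norm a)\<^sup>2 + 2 * (norm b)\<^sup>2"
    using zero_le_power2[of "norm a - norm b"] by (simp add: power2_sum power2_diff)
  finally show ?thesis .
qed

lemma square_integrable_add:
  fixes f g :: "'a::euclidean_space \<Rightarrow> 'b::euclidean_space"
  assumes "f \<in> borel_measurable M" "g \<in> borel_measurable M"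
    "integrable M (\<lambda>x. (norm (f x))\<^sup>2)" "integrable M (\<lambda>x. (norm (g x))\<^sup>2)"
  shows "integrable M (\<lambda>x. (norm (f x + g x))\<^sup>2)"
proof (rule Bochner_Integration.integrable_bound)
  show "integrable M (\<lambda>x. 2 * (norm (f x))\<^sup>2 + 2 * (norm (g x))\<^sup>2)" using assms by simp
  show "(\<lambda>x. (norm (f x + g x))\<^sup>2) \<in> borel_measurable M" using assms by measurable
  show "AE x in M. norm ((norm (f x + g x))\<^sup>2) \<le> norm (2 * (norm (f x))\<^sup>2 + 2 * (norm (g x))\<^sup>2)"
    using power2_norm_add_le[of "f _" "g _"] by simp
qed

lemma is_weak_D_AE_eq:
  "open U \<Longrightarrow> is_weak_D U u A \<Longrightarrow> AE x in lebesgue_on U. weak_D U u x = A x"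
  using is_weak_D_unique[OF _ is_weak_D_weak_D] by blast

lemma is_weak_D_measurable:
  assumes "open U" "is_weak_D U u A"
  shows "u \<in> borel_measurable (lebesgue_on U)" "A \<in> borel_measurable (lebesgue_on U)"
  using assms by (auto simp: is_weak_D_def intro: locally_integrable_measurable)

lemma W12I:
  fixes u :: "real^'n \<Rightarrow> real^'m"
  assumes U: "open U" and u: "is_weak_D U u A"
    and "integrable (lebesgue_on U) (\<lambda>x. (norm (u x))\<^sup>2)" "integrable (lebesgue_on U) (\<lambda>x. (norm (A x))\<^sup>2)"
  shows "W12 U u"
proof -
  note m = is_weak_D_measurable[OF U u] is_weak_D_measurable(2)[OF U is_weak_D_weak_D[OF u]]
  have "integrable (lebesgue_on U) (\<lambda>x. (norm (weak_D U u x))\<^sup>2)"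
  proof (subst integrable_cong_AE)
    show "AE x in lebesgue_on U. (norm (weak_D U u x))\<^sup>2 = (norm (A x))\<^sup>2"
      using is_weak_D_AE_eq[OF U u] by (rule eventually_mono) simp
  qed (use m assms(4) in measurable)
  then show ?thesis using assms(3) m(1) u by (auto simp: W12_def)
qed

lemma W12_weak_D:
  assumes "W12 U u"
  shows "is_weak_D U u (weak_D U u)" "integrable (lebesgue_on U) (\<lambda>x. (norm (u x))\<^sup>2)"
    "integrable (lebesgue_on U) (\<lambda>x. (norm (weak_D U u x))\<^sup>2)"
  using assms is_weak_D_weak_D by (auto simp: W12_def)

lemma test_function_add:
  fixes f g :: "'a::euclidean_space \<Rightarrow> 'b::real_normed_vector"
  assumes "test_function U f" "test_function U g"
  shows "test_function U (\<lambda>x. f x + g x)"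
proof -
  obtain K where K: "compact K" "K \<subseteq> U" "\<And>x. x \<notin> K \<Longrightarrow> f x = 0" using test_function_support[OF assms(1)] by blast
  obtain L where L: "compact L" "L \<subseteq> U" "\<And>x. x \<notin> L \<Longrightarrow> g x = 0" using test_function_support[OF assms(2)] by blast
  have "smooth_on UNIV (\<lambda>x. f x + g x)"
    by (rule smooth_on_add[OF open_UNIV test_function_smooth[OF assms(1)] test_function_smooth[OF assms(2)]])
  moreover have "compact (K \<union> L)" "K \<union> L \<subseteq> U" "\<forall>x. x \<notin> K \<union> L \<longrightarrow> f x + g x = 0"
    using K L by auto
  ultimately show ?thesis unfolding test_function_def by blast
qed

lemma mollification_vector:
  fixes G :: "real^'n \<Rightarrow> real^'m"
  assumes U: "open U" and G: "Ck_on 1 UNIV G" and K: "compact K" "K \<subseteq> U" "\<And>x. x \<notin> K \<Longrightarrow> G x = 0"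
    and e: "e > 0"
  shows "\<exists>\<gamma>. test_function U \<gamma> \<and> (\<forall>x. norm (\<gamma> x - G x) \<le> e \<and> norm (jacobian \<gamma> (at x) - jacobian G (at x)) \<le> e)"
proof -
  obtain d where d: "d > 0" "(\<Union>x\<in>K. cball x d) \<subseteq> U"
    using compact_subset_open_imp_cball_epsilon_subset[OF K(1) U K(2)] by blast
  define L where "L = (\<Union>x\<in>K. cball x d)"
  \<comment> \<open>An error of at most \<open>r\<close> in each entry adds up to at most
    \<open>e\<close> in the norm of the matrix.\<close>
  define r where "r = e / (real CARD('m) * real CARD('n))"
  have r: "r > 0" using e by (simp add: r_def)
  have Gi: "Ck_on 1 UNIV (\<lambda>x. G x $ i)" for i by (rule Ck_on_nth[OF open_UNIV G])
  have "\<exists>\<phi>. smooth_on UNIV \<phi> \<and> (\<forall>x. x \<notin> L \<longrightarrow> \<phi> x = 0) \<and> (\<forall>x. \<bar>\<phi> x - G x $ i\<bar> \<le> r) \<and>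
      (\<forall>x. \<forall>b\<in>Basis. \<bar>frechet_derivative \<phi> (at x) b - frechet_derivative (\<lambda>x. G x $ i) (at x) b\<bar> \<le> r)" for i
    using mollification[OF Ck_on_continuous_on[OF Gi] K(1) _ d(1) r, of i] K(3) Gi[of i] unfolding L_def by auto
  then obtain \<phi> where \<phi>: "\<And>i. smooth_on UNIV (\<phi> i)" "\<And>i x. x \<notin> L \<Longrightarrow> \<phi> i x = 0"
    "\<And>i x. \<bar>\<phi> i x - G x $ i\<bar> \<le> r"
    "\<And>i x b. b \<in> Basis \<Longrightarrow> \<bar>frechet_derivative (\<phi> i) (at x) b - frechet_derivative (\<lambda>x. G x $ i) (at x) b\<bar> \<le> r"
    by metis
  define \<gamma> :: "real^'n \<Rightarrow> real^'m" where "\<gamma> x = (\<chi> i. \<phi> i x)" for x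
  have s: "smooth_on UNIV \<gamma>" unfolding \<gamma>_def[abs_def] by (intro smooth_on_vec_lambda open_UNIV \<phi>(1))
  have z: "\<gamma> x = 0" if "x \<notin> L" for x using \<phi>(2)[OF that] by (simp add: \<gamma>_def vec_eq_iff)
  have L: "compact L" "L \<subseteq> U" using d K(1) by (auto simp: L_def compact_thickening)
  have "test_function U \<gamma>" using s z L by (auto simp: test_function_def)
  moreover have "norm (\<gamma> x - G x) \<le> e" for x
  proof -
    have "norm (\<gamma> x - G x) \<le> (\<Sum>i\<in>UNIV. \<bar>(\<gamma> x - G x) $ i\<bar>)" by (rule norm_le_l1_cart)
    also have "\<dots> \<le> (\<Sum>i\<in>(UNIV::'m set). r)" using \<phi>(3) by (intro sum_mono) (simp add: \<gamma>_def)
    also have "\<dots> = e / real CARD('n)" by (simp add: r_def)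
    also have "\<dots> \<le> e / 1"
    proof (rule divide_left_mono)
      have "1 \<le> CARD('n)" by (simp add: Suc_leI)
      then show "1 \<le> real CARD('n)" by linarith
    qed (use e in auto)
    finally show ?thesis by simp
  qed
  moreover have "norm (jacobian \<gamma> (at x) - jacobian G (at x)) \<le> e" for x
  proof -
    have "\<bar>(jacobian \<gamma> (at x) - jacobian G (at x)) $ i $ j\<bar> \<le> r" for i j
    proof -
      have "jacobian \<gamma> (at x) $ i $ j = frechet_derivative (\<lambda>x. \<gamma> x $ i) (at x) (axis j 1)"
        unfolding jacobian_nth by (rule frechet_derivative_nth[symmetric]) (rule smooth_on_differentiable[OF s UNIV_I])
      moreover have "jacobian G (at x) $ i $ j = frechet_derivative (\<lambda>x. G x $ i) (at x) (axis j 1)"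
        unfolding jacobian_nth by (rule frechet_derivative_nth[symmetric]) (use G in simp)
      moreover have "(\<lambda>x. \<gamma> x $ i) = \<phi> i" by (simp add: \<gamma>_def)
      moreover have "axis j (1::real) \<in> (Basis :: (real^'n) set)" by (simp add: axis_in_Basis_iff)
      ultimately show ?thesis using \<phi>(4)[of "axis j 1" i x] by simp
    qed
    then have "(\<Sum>i\<in>(UNIV::'m set). \<Sum>j\<in>(UNIV::'n set). \<bar>(jacobian \<gamma> (at x) - jacobian G (at x)) $ i $ j\<bar>) \<le>
        (\<Sum>i\<in>(UNIV::'m set). \<Sum>j\<in>(UNIV::'n set). r)" by (intro sum_mono)
    also have "\<dots> = e" by (simp add: r_def)
    finally show ?thesis using norm_matrix_le_sum order_trans by blast
  qed
  ultimately show ?thesis by blast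
qed

lemma jacobian_add:
  fixes f g :: "real^'n \<Rightarrow> real^'m"
  assumes "f differentiable (at x)" "g differentiable (at x)"
  shows "jacobian (\<lambda>x. f x + g x) (at x) = jacobian f (at x) + jacobian g (at x)"
proof -
  have "((\<lambda>x. f x + g x) has_derivative (\<lambda>v. frechet_derivative f (at x) v + frechet_derivative g (at x) v)) (at x)"
    using assms by (intro has_derivative_add) (simp_all add: frechet_derivative_works[symmetric])
  from frechet_derivative_at[OF this, symmetric] show ?thesis
    by (simp add: jacobian_def matrix_def vec_eq_iff)
qed

lemma jacobian_compose:
  fixes f :: "real^'n \<Rightarrow> real^'m" and h :: "real^'k \<Rightarrow> real^'n"
  assumes "h differentiable (at x)" "f differentiable (at (h x))"
  shows "jacobian (\<lambda>x. f (h x)) (at x) = jacobian f (at (h x)) ** jacobian h (at x)"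
proof -
  have d: "(h has_derivative (*v) (jacobian h (at x))) (at x)"
    "(f has_derivative (*v) (jacobian f (at (h x)))) (at (h x))"
    using assms jacobian_works by blast+
  from frechet_derivative_at[OF has_derivative_compose[OF this], symmetric]
  show ?thesis by (simp add: jacobian_def[of "\<lambda>x. f (h x)"] matrix_vector_mul_assoc)
qed

lemma finite_measure_bounded_open:
  fixes U :: "'a::euclidean_space set"
  assumes "open U" "bounded U"
  shows "emeasure (lebesgue_on U) U < \<infinity>" "finite_measure (lebesgue_on U)"
proof -
  have "U \<in> lmeasurable" using assms by (simp add: lmeasurable_open)
  then show "emeasure (lebesgue_on U) U < \<infinity>" "finite_measure (lebesgue_on U)"
    by (auto simp: emeasure_restrict_space fmeasurable_def finite_measure_lebesgue_on)
qed

lemma integrable_bounded_continuous: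
  fixes f :: "'a::euclidean_space \<Rightarrow> real"
  assumes "open U" "bounded U" "continuous_on UNIV f" "\<And>x. \<bar>f x\<bar> \<le> B"
  shows "integrable (lebesgue_on U) f"
proof -
  interpret finite_measure "lebesgue_on U" by (rule finite_measure_bounded_open[OF assms(1,2)])
  show ?thesis by (rule integrable_const_bound[of _ B]) (use assms in \<open>auto intro: borel_measurable_lebesgue_continuous\<close>)
qed

context inner_variation
begin

text \<open>Continuity does not suffice for Lebesgue measurable sets. The preimage under \<psi> is
  the image under \<zeta>, and differentiable maps send Lebesgue measurable sets to such
  sets.\<close>

lemma measurable_\<psi>: "\<psi> \<in> lebesgue_on \<Omega> \<rightarrow>\<^sub>M lebesgue_on \<Omega>"
proof (rule measurableI)
  fix A assume "A \<in> sets (lebesgue_on \<Omega>)"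
  then have A: "A \<in> sets lebesgue" "A \<subseteq> \<Omega>" using open_\<Omega> by (auto simp: sets_restrict_space_iff)
  have "\<psi> -` A \<inter> \<Omega> = \<zeta> ` A"
    using A(2) \<zeta>_\<psi> \<psi>_\<zeta> \<psi>_in_iff by (auto simp: image_iff) (metis, metis subsetD)
  moreover have "\<zeta> ` A \<in> sets lebesgue"
  proof (rule differentiable_image_in_sets_lebesgue[OF A(1) order_refl])
    show "\<zeta> differentiable_on A"
      by (auto simp: differentiable_on_def
          intro!: differentiable_at_withinI smooth_on_differentiable[OF smooth_\<zeta> UNIV_I])
  qed
  ultimately show "\<psi> -` A \<inter> space (lebesgue_on \<Omega>) \<in> sets (lebesgue_on \<Omega>)"
    using open_\<Omega> by (auto simp: sets_restrict_space_iff)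
qed (simp add: \<psi>_in_iff)

lemma is_weak_D_compose: "is_weak_D \<Omega> u A \<Longrightarrow> is_weak_D \<Omega> (\<lambda>x. u (\<psi> x)) (\<lambda>x. A (\<psi> x) ** jacobian \<psi> (at x))"
  by (rule is_weak_D_diffeo[OF diffeo_\<Omega>])

lemma norm_compose_jacobian_le:
  obtains C where "C > 0" "\<And>(A::real^'n::_^'m) x. (norm (A ** jacobian \<psi> (at x)))\<^sup>2 \<le> C * (norm A)\<^sup>2"
proof -
  obtain c C :: real where C: "C > 0" "\<And>x. norm (jacobian \<psi> (at x)) \<le> C" using jacobian_bounds by metis
  obtain D where D: "D > 0" "\<And>(A::real^'n::_^'m) (B::real^'n::_^'n::_). norm (A ** B) \<le> norm A * norm B * D"
    using norm_matrix_mult_bound by blast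
  have "(norm (A ** jacobian \<psi> (at x)))\<^sup>2 \<le> (C * D)\<^sup>2 * (norm A)\<^sup>2" for A :: "real^'n::_^'m" and x
  proof -
    have "norm (A ** jacobian \<psi> (at x)) \<le> norm A * norm (jacobian \<psi> (at x)) * D" by (rule D(2))
    also have "\<dots> \<le> norm A * C * D" using C D by (intro mult_right_mono mult_left_mono) auto
    finally have "(norm (A ** jacobian \<psi> (at x)))\<^sup>2 \<le> (norm A * C * D)\<^sup>2" by (intro power_mono) auto
    then show ?thesis by (simp add: power_mult_distrib mult_ac)
  qed
  then show thesis using that[of "(C * D)\<^sup>2"] C(1) D(1) by simp
qed

lemma square_integrable_compose:
  fixes A :: "real^'n::_ \<Rightarrow> real^'n::_^'m"
  assumes "is_weak_D \<Omega> u A" "integrable (lebesgue_on \<Omega>) (\<lambda>x. (norm (A x))\<^sup>2)"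
  shows "integrable (lebesgue_on \<Omega>) (\<lambda>x. (norm (A (\<psi> x) ** jacobian \<psi> (at x)))\<^sup>2)"
proof -
  obtain C where C: "C > 0" "\<And>(A::real^'n::_^'m) x. (norm (A ** jacobian \<psi> (at x)))\<^sup>2 \<le> C * (norm A)\<^sup>2"
    using norm_compose_jacobian_le by blast
  show ?thesis
  proof (rule Bochner_Integration.integrable_bound)
    show "integrable (lebesgue_on \<Omega>) (\<lambda>x. C * (norm (A (\<psi> x)))\<^sup>2)"
      using integrable_compose[OF assms(2)] by simp
    show "(\<lambda>x. (norm (A (\<psi> x) ** jacobian \<psi> (at x)))\<^sup>2) \<in> borel_measurable (lebesgue_on \<Omega>)"
      using is_weak_D_measurable(2)[OF open_\<Omega> is_weak_D_compose[OF assms(1)]] by measurable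
    show "AE x in lebesgue_on \<Omega>. norm ((norm (A (\<psi> x) ** jacobian \<psi> (at x)))\<^sup>2) \<le> norm (C * (norm (A (\<psi> x)))\<^sup>2)"
      using C by (intro AE_I2) (simp add: abs_mult)
  qed
qed

lemma W12_compose:
  assumes "W12 \<Omega> u" shows "W12 \<Omega> (\<lambda>x. u (\<psi> x))"
  by (rule W12I[OF open_\<Omega> is_weak_D_compose[OF W12_weak_D(1)[OF assms]]])
    (use W12_weak_D[OF assms] integrable_compose[of "\<lambda>x. (norm (u x))\<^sup>2"] square_integrable_compose in auto)

lemma test_function_compose:
  fixes \<phi> :: "real^'n::_ \<Rightarrow> 'b::real_normed_vector"
  assumes "test_function \<Omega> \<phi>" shows "test_function \<Omega> (\<lambda>x. \<phi> (\<psi> x))"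
proof -
  obtain K where K: "compact K" "K \<subseteq> \<Omega>" "\<And>x. x \<notin> K \<Longrightarrow> \<phi> x = 0" using test_function_support[OF assms] by blast
  have "smooth_on UNIV (\<lambda>x. \<phi> (\<psi> x))"
    by (rule smooth_on_compose[OF open_UNIV open_UNIV smooth_\<psi> _ test_function_smooth[OF assms]]) simp
  moreover have "compact (\<zeta> ` K)" "\<zeta> ` K \<subseteq> \<Omega>" using compact_diffeo_inv_image[OF diffeo_\<Omega> K(1,2)] by auto
  moreover have "\<phi> (\<psi> x) = 0" if "x \<notin> \<zeta> ` K" for x
  proof -
    have "\<psi> x \<notin> K" using that \<zeta>_\<psi>[of x] by (metis imageI)
    then show ?thesis by (rule K(3))
  qed
  ultimately show ?thesis unfolding test_function_def by blast
qed

text \<open>Although \<open>g\<close> is controlled on \<Omega> only, the difference vanishes off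
  the support of \<open>X\<close>, so its extension by zero is C^1 on the whole space.\<close>

lemma Ck_on_difference:
  fixes g :: "real^'n::_ \<Rightarrow> real^'m"
  assumes g: "Ck_on 1 \<Omega> g" and K: "compact K" "K \<subseteq> \<Omega>" "\<And>x. x \<notin> K \<Longrightarrow> X x = 0"
  shows "Ck_on 1 UNIV (\<lambda>x. if x \<in> \<Omega> then g (\<psi> x) - g x else 0)"
proof (rule Ck_on_local)
  fix x
  have o: "open (- K)" using K compact_imp_closed by (auto simp: open_Compl)
  have "Ck_on 1 \<Omega> (\<lambda>x. g (\<psi> x))"
    by (rule Ck_on_compose[OF open_\<Omega> open_\<Omega> smooth_onD[OF smooth_on_subset[OF smooth_\<psi> subset_UNIV]] _ g])
      (simp add: image_subset_iff \<psi>_in_iff)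
  then have "Ck_on 1 \<Omega> (\<lambda>x. g (\<psi> x) + - g x)"
    by (intro Ck_on_add open_\<Omega> Ck_on_bounded_linear[OF bounded_linear_minus[OF bounded_linear_ident]] g)
  then have 1: "Ck_on 1 \<Omega> (\<lambda>x. if x \<in> \<Omega> then g (\<psi> x) - g x else 0)"
    by (rule Ck_on_cong[OF open_\<Omega>, rotated]) simp
  have 2: "Ck_on 1 (- K) (\<lambda>x. if x \<in> \<Omega> then g (\<psi> x) - g x else 0)"
    by (rule Ck_on_cong[OF o _ Ck_on_const[of _ _ 0]]) (simp add: \<psi>_def K(3))
  show "\<exists>T. open T \<and> x \<in> T \<and> Ck_on 1 T (\<lambda>x. if x \<in> \<Omega> then g (\<psi> x) - g x else 0)"
  proof (cases "x \<in> \<Omega>")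
    case True
    then show ?thesis using 1 open_\<Omega> by blast
  next
    case False
    then have "x \<in> - K" using K(2) by blast
    then show ?thesis using 2 o by blast
  qed
qed

text \<open>Decompose u \<circ> \<psi> - g = (u - g) \<circ> \<psi> + (g \<circ> \<psi> - g). The
  first summand is approximated by the composed test functions, the second is C^1 with compact
  support in \<Omega> and is approximated together with its gradient by mollification.\<close>

lemma W12_zero_compose:
  fixes u g :: "real^'n::_ \<Rightarrow> real^'m"
  assumes u: "W12_zero \<Omega> (\<lambda>x. u x - g x)" and g: "Ck_on 1 \<Omega> g" and b: "bounded \<Omega>"
  shows "W12_zero \<Omega> (\<lambda>x. u (\<psi> x) - g x)"
proof -
  define h where "h x = u x - g x" for x
  have Wh: "W12 \<Omega> h" using u by (simp add: W12_zero_def h_def[abs_def])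
  define A where "A = weak_D \<Omega> h"
  have hA: "is_weak_D \<Omega> h A" "integrable (lebesgue_on \<Omega>) (\<lambda>x. (norm (h x))\<^sup>2)"
    "integrable (lebesgue_on \<Omega>) (\<lambda>x. (norm (A x))\<^sup>2)"
    using W12_weak_D[OF Wh] by (simp_all add: A_def)
  obtain \<phi> where \<phi>: "\<And>k. test_function \<Omega> (\<phi> k)"
    "(\<lambda>k. \<integral>\<^sup>+x. ennreal ((norm (h x - \<phi> k x))\<^sup>2 + (norm (A x - jacobian (\<phi> k) (at x)))\<^sup>2) \<partial>lebesgue_on \<Omega>) \<longlonglongrightarrow> 0"
    using u unfolding W12_zero_def h_def A_def by auto
  obtain K where K: "compact K" "K \<subseteq> \<Omega>" "\<And>x. x \<notin> K \<Longrightarrow> X x = 0" using X_support by blast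
  define G where "G x = (if x \<in> \<Omega> then g (\<psi> x) - g x else 0)" for x
  have G: "Ck_on 1 UNIV G" unfolding G_def[abs_def] by (rule Ck_on_difference[OF g K])
  have G0: "G x = 0" if "x \<notin> K" for x using K(3)[OF that] by (simp add: G_def \<psi>_def)
  have cG: "continuous_on UNIV G" by (rule Ck_on_continuous_on[OF G])
  have cJ: "continuous_on UNIV (\<lambda>x. jacobian G (at x))"
  proof -
    have "continuous_on UNIV (\<lambda>x. \<chi> i j. frechet_derivative G (at x) (axis j 1) $ i)"
      using G by (intro continuous_on_vec_lambda continuous_on_component) simp
    then show ?thesis by (simp add: jacobian_def matrix_def)
  qed
  have J0: "jacobian G (at x) = 0" if "x \<notin> K" for x
    using frechet_derivative_outside_support[OF K(1) G0 that] by (simp add: jacobian_def matrix_def vec_eq_iff)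
  define J where "J x = jacobian \<psi> (at x)" for x
  define D where "D x = A (\<psi> x) ** J x + jacobian G (at x)" for x
  have wG: "is_weak_D \<Omega> G (\<lambda>x. jacobian G (at x))" by (rule is_weak_D_C1[OF open_\<Omega> G])
  have wh: "is_weak_D \<Omega> (\<lambda>x. h (\<psi> x)) (\<lambda>x. A (\<psi> x) ** J x)"
    unfolding J_def by (rule is_weak_D_compose[OF hA(1)])
  have eq: "h (\<psi> x) + G x = u (\<psi> x) - g x" if "x \<in> \<Omega>" for x using that by (simp add: h_def G_def)
  have wD: "is_weak_D \<Omega> (\<lambda>x. u (\<psi> x) - g x) D"
    by (rule is_weak_D_cong[OF eq _ is_weak_D_add[OF open_\<Omega> wh wG]]) (simp_all add: D_def)
  obtain B1 where B1: "\<And>x. norm (G x) \<le> B1" using bounded_compact_support[OF cG K(1) G0] by blast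
  obtain B2 where B2: "\<And>x. norm (jacobian G (at x)) \<le> B2" using bounded_compact_support[OF cJ K(1) J0] by blast
  have sG: "integrable (lebesgue_on \<Omega>) (\<lambda>x. (norm (G x))\<^sup>2)"
    by (rule integrable_bounded_continuous[OF open_\<Omega> b, of _ "B1\<^sup>2"])
      (use B1 in \<open>auto intro!: continuous_intros cG power_mono\<close>)
  have sJ: "integrable (lebesgue_on \<Omega>) (\<lambda>x. (norm (jacobian G (at x)))\<^sup>2)"
    by (rule integrable_bounded_continuous[OF open_\<Omega> b, of _ "B2\<^sup>2"])
      (use B2 in \<open>auto intro!: continuous_intros cJ power_mono\<close>)
  have W: "W12 \<Omega> (\<lambda>x. u (\<psi> x) - g x)"
  proof (rule W12I[OF open_\<Omega> wD])
    have "integrable (lebesgue_on \<Omega>) (\<lambda>x. (norm (h (\<psi> x) + G x))\<^sup>2)"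
      by (rule square_integrable_add[OF is_weak_D_measurable(1)[OF open_\<Omega> wh] is_weak_D_measurable(1)[OF open_\<Omega> wG]
            integrable_compose[OF hA(2)] sG])
    then show "integrable (lebesgue_on \<Omega>) (\<lambda>x. (norm (u (\<psi> x) - g x))\<^sup>2)"
      by (subst Bochner_Integration.integrable_cong[OF refl]) (use eq in \<open>auto simp flip: eq\<close>)
    show "integrable (lebesgue_on \<Omega>) (\<lambda>x. (norm (D x))\<^sup>2)" unfolding D_def
      by (rule square_integrable_add[OF is_weak_D_measurable(2)[OF open_\<Omega> wh] is_weak_D_measurable(2)[OF open_\<Omega> wG]
            square_integrable_compose[OF hA(1,3), folded J_def] sJ])
  qed
  have "\<exists>\<gamma>. test_function \<Omega> \<gamma> \<and> (\<forall>x. norm (\<gamma> x - G x) \<le> 1 / real (Suc k) \<and>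
      norm (jacobian \<gamma> (at x) - jacobian G (at x)) \<le> 1 / real (Suc k))" for k
    by (rule mollification_vector[OF open_\<Omega> G K(1,2) G0]) auto
  then obtain \<gamma> where \<gamma>: "\<And>k. test_function \<Omega> (\<gamma> k)" "\<And>k x. norm (\<gamma> k x - G x) \<le> 1 / real (Suc k)"
    "\<And>k x. norm (jacobian (\<gamma> k) (at x) - jacobian G (at x)) \<le> 1 / real (Suc k)" by metis
  define \<Phi> where "\<Phi> k x = \<phi> k (\<psi> x) + \<gamma> k x" for k x
  have t\<Phi>: "test_function \<Omega> (\<Phi> k)" for k
    unfolding \<Phi>_def[abs_def] by (intro test_function_add test_function_compose \<phi>(1) \<gamma>(1))
  have diff: "test_function \<Omega> f \<Longrightarrow> f differentiable (at x)" for f :: "real^'n::_ \<Rightarrow> real^'m" and x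
    by (rule smooth_on_differentiable[OF test_function_smooth UNIV_I])
  have j\<Phi>: "jacobian (\<Phi> k) (at x) = jacobian (\<phi> k) (at (\<psi> x)) ** J x + jacobian (\<gamma> k) (at x)" for k x
    unfolding \<Phi>_def[abs_def] J_def
    by (simp add: jacobian_add[OF diff[OF test_function_compose[OF \<phi>(1)]] diff[OF \<gamma>(1)]]
        jacobian_compose[OF smooth_on_differentiable[OF smooth_\<psi> UNIV_I] diff[OF \<phi>(1)]])
  obtain C where C: "C > 0" "\<And>(A::real^'n::_^'m) x. (norm (A ** J x))\<^sup>2 \<le> C * (norm A)\<^sup>2"
    using norm_compose_jacobian_le unfolding J_def by blast
  define F where "F k x = (norm (h x - \<phi> k x))\<^sup>2 + (norm (A x - jacobian (\<phi> k) (at x)))\<^sup>2" for k x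
  have F0: "F k x \<ge> 0" for k x by (simp add: F_def)
  have mF: "F k \<in> borel_measurable (lebesgue_on \<Omega>)" for k
  proof -
    have s: "smooth_on UNIV (\<phi> k)" by (rule test_function_smooth[OF \<phi>(1)])
    have "\<phi> k \<in> borel_measurable (lebesgue_on \<Omega>)"
      by (rule borel_measurable_lebesgue_continuous[OF smooth_on_continuous_on[OF s]])
    moreover have "(\<lambda>x. jacobian (\<phi> k) (at x)) \<in> borel_measurable (lebesgue_on \<Omega>)"
      by (rule is_weak_D_measurable(2)[OF open_\<Omega> is_weak_D_C1[OF open_\<Omega> smooth_onD[OF s]]])
    ultimately show ?thesis
      using is_weak_D_measurable[OF open_\<Omega> hA(1)] unfolding F_def[abs_def] by measurable
  qed
  \<comment> \<open>The 2 comes from |a + b|^2 \<le> 2|a|^2 + 2|b|^2 and \<open>C\<close> from the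
    factor D\<psi> in the gradient; the maximum covers both summands of \<open>F\<close>.\<close>
  define c where "c = 2 * max 1 C"
  have c: "c \<ge> 2" "c \<ge> 2 * C" by (auto simp: c_def)
  have pt: "(norm (u (\<psi> x) - g x - \<Phi> k x))\<^sup>2 + (norm (D x - jacobian (\<Phi> k) (at x)))\<^sup>2 \<le>
      c * F k (\<psi> x) + 4 * (1 / real (Suc k))\<^sup>2" if x: "x \<in> \<Omega>" for k x
  proof -
    have "(norm (u (\<psi> x) - g x - \<Phi> k x))\<^sup>2 = (norm ((h (\<psi> x) - \<phi> k (\<psi> x)) + (G x - \<gamma> k x)))\<^sup>2"
      by (simp only: eq[OF x, symmetric]) (simp add: \<Phi>_def algebra_simps)
    also have "\<dots> \<le> 2 * (norm (h (\<psi> x) - \<phi> k (\<psi> x)))\<^sup>2 + 2 * (norm (G x - \<gamma> k x))\<^sup>2"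
      by (rule power2_norm_add_le)
    also have "\<dots> \<le> c * (norm (h (\<psi> x) - \<phi> k (\<psi> x)))\<^sup>2 + 2 * (1 / real (Suc k))\<^sup>2"
      using \<gamma>(2)[of k x] c by (intro add_mono mult_right_mono mult_left_mono power_mono) (auto simp: norm_minus_commute)
    finally have 1: "(norm (u (\<psi> x) - g x - \<Phi> k x))\<^sup>2 \<le>
        c * (norm (h (\<psi> x) - \<phi> k (\<psi> x)))\<^sup>2 + 2 * (1 / real (Suc k))\<^sup>2" .
    have dm: "(A (\<psi> x) - jacobian (\<phi> k) (at (\<psi> x))) ** J x = A (\<psi> x) ** J x - jacobian (\<phi> k) (at (\<psi> x)) ** J x"
      by (simp add: matrix_matrix_mult_def vec_eq_iff left_diff_distrib sum_subtractf)
    have "(norm (D x - jacobian (\<Phi> k) (at x)))\<^sup>2 =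
        (norm ((A (\<psi> x) - jacobian (\<phi> k) (at (\<psi> x))) ** J x + (jacobian G (at x) - jacobian (\<gamma> k) (at x))))\<^sup>2"
      by (simp add: D_def j\<Phi> dm algebra_simps)
    also have "\<dots> \<le> 2 * (norm ((A (\<psi> x) - jacobian (\<phi> k) (at (\<psi> x))) ** J x))\<^sup>2 +
        2 * (norm (jacobian G (at x) - jacobian (\<gamma> k) (at x)))\<^sup>2"
      by (rule power2_norm_add_le)
    also have "\<dots> \<le> 2 * (C * (norm (A (\<psi> x) - jacobian (\<phi> k) (at (\<psi> x))))\<^sup>2) + 2 * (1 / real (Suc k))\<^sup>2"
      using \<gamma>(3)[of k x] C(2) by (intro add_mono mult_left_mono power_mono) (auto simp: norm_minus_commute)
    also have "\<dots> \<le> c * (norm (A (\<psi> x) - jacobian (\<phi> k) (at (\<psi> x))))\<^sup>2 + 2 * (1 / real (Suc k))\<^sup>2"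
      using mult_right_mono[OF c(2), of "(norm (A (\<psi> x) - jacobian (\<phi> k) (at (\<psi> x))))\<^sup>2"] by simp
    finally show ?thesis using 1 by (simp add: F_def distrib_left)
  qed
  obtain E where E: "E > 0" "\<And>F. F \<in> borel_measurable (lebesgue_on \<Omega>) \<Longrightarrow> (\<And>x. F x \<ge> 0) \<Longrightarrow>
    (\<integral>\<^sup>+x. ennreal (F (\<psi> x)) \<partial>lebesgue_on \<Omega>) \<le> ennreal E * (\<integral>\<^sup>+x. ennreal (F x) \<partial>lebesgue_on \<Omega>)"
    using nn_integral_compose by metis
  define m where "m = emeasure (lebesgue_on \<Omega>) \<Omega>"
  have m: "m < \<infinity>" unfolding m_def by (rule finite_measure_bounded_open(1)[OF open_\<Omega> b])
  have bound: "(\<integral>\<^sup>+x. ennreal ((norm (u (\<psi> x) - g x - \<Phi> k x))\<^sup>2 +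
      (norm (weak_D \<Omega> (\<lambda>x. u (\<psi> x) - g x) x - jacobian (\<Phi> k) (at x)))\<^sup>2) \<partial>lebesgue_on \<Omega>) \<le>
      ennreal c * (ennreal E * (\<integral>\<^sup>+x. ennreal (F k x) \<partial>lebesgue_on \<Omega>)) + ennreal (4 * (1 / real (Suc k))\<^sup>2) * m" for k
  proof -
    have mc: "(\<lambda>x. F k (\<psi> x)) \<in> borel_measurable (lebesgue_on \<Omega>)"
      by (rule measurable_compose[OF measurable_\<psi> mF])
    have "(\<integral>\<^sup>+x. ennreal ((norm (u (\<psi> x) - g x - \<Phi> k x))\<^sup>2 +
        (norm (weak_D \<Omega> (\<lambda>x. u (\<psi> x) - g x) x - jacobian (\<Phi> k) (at x)))\<^sup>2) \<partial>lebesgue_on \<Omega>) \<le>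
      (\<integral>\<^sup>+x. ennreal c * ennreal (F k (\<psi> x)) + ennreal (4 * (1 / real (Suc k))\<^sup>2) \<partial>lebesgue_on \<Omega>)"
    proof (rule nn_integral_mono_AE)
      show "AE x in lebesgue_on \<Omega>. ennreal ((norm (u (\<psi> x) - g x - \<Phi> k x))\<^sup>2 +
          (norm (weak_D \<Omega> (\<lambda>x. u (\<psi> x) - g x) x - jacobian (\<Phi> k) (at x)))\<^sup>2) \<le>
          ennreal c * ennreal (F k (\<psi> x)) + ennreal (4 * (1 / real (Suc k))\<^sup>2)"
        using is_weak_D_AE_eq[OF open_\<Omega> wD] AE_space
      proof eventually_elim
        case (elim x)
        then have "x \<in> \<Omega>" by simp
        from ennreal_leI[OF pt[OF this, of k]] elim(1) c(1) F0[of k "\<psi> x"] show ?case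
          by (simp add: ennreal_plus[symmetric] ennreal_mult[symmetric] del: ennreal_plus)
      qed
    qed
    also have "\<dots> = ennreal c * (\<integral>\<^sup>+x. ennreal (F k (\<psi> x)) \<partial>lebesgue_on \<Omega>) + ennreal (4 * (1 / real (Suc k))\<^sup>2) * m"
      using mc by (subst nn_integral_add) (auto simp: nn_integral_cmult m_def)
    also have "\<dots> \<le> ennreal c * (ennreal E * (\<integral>\<^sup>+x. ennreal (F k x) \<partial>lebesgue_on \<Omega>)) + ennreal (4 * (1 / real (Suc k))\<^sup>2) * m"
      by (intro add_right_mono mult_left_mono E(2)[OF mF F0]) auto
    finally show ?thesis .
  qed
  have "(\<lambda>k. ennreal c * (ennreal E * (\<integral>\<^sup>+x. ennreal (F k x) \<partial>lebesgue_on \<Omega>)) + ennreal (4 * (1 / real (Suc k))\<^sup>2) * m)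
      \<longlonglongrightarrow> ennreal c * (ennreal E * 0) + ennreal 0 * m"
  proof (intro tendsto_add)
    show "(\<lambda>k. ennreal c * (ennreal E * (\<integral>\<^sup>+x. ennreal (F k x) \<partial>lebesgue_on \<Omega>))) \<longlonglongrightarrow> ennreal c * (ennreal E * 0)"
      by (intro ennreal_tendsto_cmult \<phi>(2)[folded F_def]) auto
    have "(\<lambda>k. 4 * (1 / real (Suc k))\<^sup>2) \<longlonglongrightarrow> 4 * 0\<^sup>2"
      using LIMSEQ_inverse_real_of_nat by (intro tendsto_intros) (simp add: inverse_eq_divide)
    then have "(\<lambda>k. ennreal (4 * (1 / real (Suc k))\<^sup>2)) \<longlonglongrightarrow> ennreal 0"
      by (intro tendsto_ennrealI) simp
    then have "(\<lambda>k. m * ennreal (4 * (1 / real (Suc k))\<^sup>2)) \<longlonglongrightarrow> m * ennreal 0"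
      by (intro ennreal_tendsto_cmult) (use m in simp)
    then show "(\<lambda>k. ennreal (4 * (1 / real (Suc k))\<^sup>2) * m) \<longlonglongrightarrow> ennreal 0 * m"
      by (simp only: mult.commute)
  qed
  then have "(\<lambda>k. ennreal c * (ennreal E * (\<integral>\<^sup>+x. ennreal (F k x) \<partial>lebesgue_on \<Omega>)) + ennreal (4 * (1 / real (Suc k))\<^sup>2) * m) \<longlonglongrightarrow> 0"
    by simp
  from tendsto_sandwich[OF _ _ tendsto_const this] have "(\<lambda>k. \<integral>\<^sup>+x. ennreal ((norm (u (\<psi> x) - g x - \<Phi> k x))\<^sup>2 +
      (norm (weak_D \<Omega> (\<lambda>x. u (\<psi> x) - g x) x - jacobian (\<Phi> k) (at x)))\<^sup>2) \<partial>lebesgue_on \<Omega>) \<longlonglongrightarrow> 0"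
    using bound by (simp add: always_eventually)
  then show ?thesis using W t\<Phi> unfolding W12_zero_def by blast
qed

end

lemma lebesgue_on_integral_cong_AE:
  fixes f g :: "'a::euclidean_space \<Rightarrow> 'b::euclidean_space"
  assumes S: "S \<in> sets lebesgue" and "AE x in lebesgue_on S. f x = g x"
  shows "(LINT x|lebesgue_on S. f x) = (LINT x|lebesgue_on S. g x)"
    and "integrable (lebesgue_on S) f \<longleftrightarrow> integrable (lebesgue_on S) g"
proof -
  have n: "negligible {x \<in> S. f x \<noteq> g x}" using assms by (simp add: AE_lebesgue_on_iff)
  have "f absolutely_integrable_on S \<longleftrightarrow> g absolutely_integrable_on S"
    by (rule absolutely_integrable_spike_eq[OF n]) auto
  then show iff: "integrable (lebesgue_on S) f \<longleftrightarrow> integrable (lebesgue_on S) g"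
    by (simp add: lebesgue_on_integral(3)[OF S])
  show "(LINT x|lebesgue_on S. f x) = (LINT x|lebesgue_on S. g x)"
  proof (cases "integrable (lebesgue_on S) f")
    case True
    have "integral S f = integral S g" by (rule integral_spike[OF n]) auto
    then show ?thesis using True iff S by (simp add: lebesgue_integral_eq_integral)
  next
    case False
    then show ?thesis using iff by (simp add: not_integrable_integral_eq)
  qed
qed

text \<open>Completed Lebesgue measure is not a product of completed measures, so the arguments with
  iterated integrals are carried out for Borel functions and transferred back almost
  everywhere.\<close>

lemma borel_representative:
  fixes f :: "'a::euclidean_space \<Rightarrow> real"
  assumes "S \<in> sets lebesgue" "f \<in> borel_measurable (lebesgue_on S)"
  obtains f' where "f' \<in> borel_measurable borel" "AE x in lborel. x \<in> S \<longrightarrow> f x = f' x"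
proof -
  have "(\<lambda>x. indicator S x *\<^sub>R f x) \<in> borel_measurable lebesgue"
    using assms by (simp add: borel_measurable_restrict_space_iff)
  then obtain f' where f': "f' \<in> borel_measurable lborel" "AE x in lborel. indicator S x *\<^sub>R f x = f' x"
    using completion_ex_borel_measurable_real by blast
  have "AE x in lborel. x \<in> S \<longrightarrow> f x = f' x" using f'(2) by (rule eventually_mono) auto
  then show thesis using that f'(1) by simp
qed

lemma AE_lebesgue_on_lborel:
  assumes "S \<in> sets lebesgue"
  shows "(AE x in lebesgue_on S. P x) \<longleftrightarrow> (AE x in lborel. x \<in> S \<longrightarrow> P x)"
  using assms by (subst AE_restrict_space_iff) (auto simp: AE_completion_iff)

section \<open>Splitting off the middle coordinate of three-space\<close>

definition join :: "(real^2) \<times> real \<Rightarrow> real^3" where "join q = vector [fst q $ 1, snd q, fst q $ 2]"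
definition merid :: "real^3 \<Rightarrow> real^2" where "merid x = vector [x $ 1, x $ 3]"

lemma join_nth [simp]: "join (p, t) $ 1 = p $ 1" "join (p, t) $ 2 = t" "join (p, t) $ 3 = p $ 2"
  by (simp_all add: join_def)

lemma merid_nth [simp]: "merid x $ 1 = x $ 1" "merid x $ 2 = x $ 3"
  by (simp_all add: merid_def)

lemma merid_join [simp]: "merid (join (p, t)) = p"
  by (simp add: vec_eq_iff forall_2)

lemma join_merid: "join (merid x, x $ 2) = x"
  by (simp add: vec_eq_iff forall_3)

lemma vec2_eq: "p = (vector [p $ 1, p $ 2] :: real^2)"
  by (simp add: vec_eq_iff forall_2)

lemma bounded_linear_merid: "bounded_linear merid"
  by (rule linear_conv_bounded_linear[THEN iffD1])
    (auto simp: linear_iff vec_eq_iff forall_2)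

lemma bounded_linear_join: "bounded_linear join"
  by (rule linear_conv_bounded_linear[THEN iffD1])
    (auto simp: linear_iff vec_eq_iff forall_3 join_def)

lemma continuous_on_join [continuous_intros]: "continuous_on S f \<Longrightarrow> continuous_on S (\<lambda>x. join (f x))"
  by (rule bounded_linear.continuous_on[OF bounded_linear_join])

lemma continuous_on_merid [continuous_intros]: "continuous_on S f \<Longrightarrow> continuous_on S (\<lambda>x. merid (f x))"
  by (rule bounded_linear.continuous_on[OF bounded_linear_merid])

lemma borel_measurable_join: "join \<in> borel_measurable borel"
  by (rule borel_measurable_continuous_onI) (intro continuous_intros)

lemma emeasure_lborel_box_cart:
  fixes l u :: "real^'n"
  assumes "\<And>i. l $ i \<le> u $ i"
  shows "emeasure lborel (box l u) = (\<Prod>i\<in>UNIV. u $ i - l $ i)"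
proof -
  have B: "(Basis :: (real^'n) set) = range (\<lambda>i. axis i 1)" by (auto simp: Basis_vec_def)
  have eq: "(\<Prod>b\<in>Basis. (u - l) \<bullet> b) = (\<Prod>i\<in>UNIV. u $ i - l $ i)"
    unfolding B by (subst prod.reindex) (auto simp: inj_on_def axis_eq_axis inner_axis)
  have "l \<bullet> b \<le> u \<bullet> b" if "b \<in> Basis" for b
    using that assms by (auto simp: B inner_axis)
  then show ?thesis by (subst emeasure_lborel_box) (simp_all only: eq)
qed

text \<open>Lebesgue measure is determined by its values on boxes, and the preimage of a box is a
  product of boxes with the same volume.\<close>

lemma distr_join: "distr lborel borel join = lborel"
proof (rule lborel_eqI[symmetric])
  fix l u :: "real^3" assume le: "\<And>b. b \<in> Basis \<Longrightarrow> l \<bullet> b \<le> u \<bullet> b"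
  have le': "l $ i \<le> u $ i" for i using le[of "axis i 1"] by (simp add: axis_in_Basis_iff inner_axis)
  have "emeasure (distr lborel borel join) (box l u) = emeasure lborel (join -` box l u)"
    using borel_measurable_join by (subst emeasure_distr) auto
  also have "join -` box l u = box (merid l) (merid u) \<times> box (l $ 2) (u $ 2)"
    by (auto simp: mem_box_cart forall_2 forall_3 join_def box_real)
  also have "emeasure lborel \<dots> = emeasure lborel (box (merid l) (merid u)) * emeasure lborel (box (l $ 2) (u $ 2))"
    unfolding lborel_prod[symmetric] by (rule lborel.emeasure_pair_measure_Times) auto
  also have "\<dots> = (\<Prod>i\<in>UNIV. merid u $ i - merid l $ i) * ennreal (u $ 2 - l $ 2)"
  proof -
    have "merid l $ i \<le> merid u $ i" for i using exhaust_2[of i] le' by auto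
    then show ?thesis using le'[of 2] by (simp only: emeasure_lborel_box_cart) (simp add: box_real)
  qed
  also have "\<dots> = ennreal ((u $ 1 - l $ 1) * (u $ 3 - l $ 3)) * ennreal (u $ 2 - l $ 2)"
    by (simp add: UNIV_2)
  also have "\<dots> = ennreal (\<Prod>i\<in>UNIV. u $ i - l $ i)"
  proof -
    have "(\<Prod>i\<in>UNIV. u $ i - l $ i) = (u $ 1 - l $ 1) * ((u $ 2 - l $ 2) * (u $ 3 - l $ 3))"
      unfolding UNIV_3 by simp
    also have "\<dots> = ((u $ 1 - l $ 1) * (u $ 3 - l $ 3)) * (u $ 2 - l $ 2)" by (simp only: mult_ac)
    finally have p: "(\<Prod>i\<in>UNIV. u $ i - l $ i) = ((u $ 1 - l $ 1) * (u $ 3 - l $ 3)) * (u $ 2 - l $ 2)" .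
    have 1: "0 \<le> (u $ 1 - l $ 1) * (u $ 3 - l $ 3)" using le' by (intro mult_nonneg_nonneg) auto
    have 2: "0 \<le> u $ 2 - l $ 2" using le'[of 2] by simp
    show ?thesis unfolding p by (rule ennreal_mult[OF 1 2, symmetric])
  qed
  also have "\<dots> = emeasure lborel (box l u)"
    by (rule emeasure_lborel_box_cart[OF le', symmetric])
  also have "\<dots> = ennreal (\<Prod>b\<in>Basis. (u - l) \<bullet> b)"
    by (rule emeasure_lborel_box) (rule le)
  finally show "emeasure (distr lborel borel join) (box l u) = (\<Prod>b\<in>Basis. (u - l) \<bullet> b)" .
qed simp

lemma integrable_join:
  fixes F :: "real^3 \<Rightarrow> real"
  assumes "F \<in> borel_measurable borel"
  shows "integrable lborel F \<longleftrightarrow> integrable (lborel \<Otimes>\<^sub>M lborel) (\<lambda>(p, t). F (join (p, t)))"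
    and "(LINT x|lborel. F x) = (LINT q|(lborel \<Otimes>\<^sub>M lborel). (case q of (p, t) \<Rightarrow> F (join (p, t))))"
proof -
  have m: "join \<in> borel_measurable lborel" using borel_measurable_join by simp
  have "integrable (distr lborel borel join) F \<longleftrightarrow> integrable lborel (\<lambda>q. F (join q))"
    by (rule integrable_distr_eq[OF m]) (use assms in simp)
  then show "integrable lborel F \<longleftrightarrow> integrable (lborel \<Otimes>\<^sub>M lborel) (\<lambda>(p, t). F (join (p, t)))"
    by (simp add: distr_join lborel_prod split_beta')
  have "(LINT x|distr lborel borel join. F x) = (LINT q|lborel. F (join q))"
    by (rule integral_distr[OF m]) (use assms in simp)
  then show "(LINT x|lborel. F x) = (LINT q|(lborel \<Otimes>\<^sub>M lborel). (case q of (p, t) \<Rightarrow> F (join (p, t))))"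
    by (simp add: distr_join lborel_prod split_beta')
qed

lemma AE_join: "(AE x in lborel. P x) \<longleftrightarrow> (AE q in lborel \<Otimes>\<^sub>M lborel. P (join q))"
proof
  have m: "join \<in> borel_measurable lborel" using borel_measurable_join by simp
  assume "AE x in lborel. P x"
  then have "AE x in distr lborel borel join. P x" by (subst distr_join)
  from AE_distrD[OF m this] show "AE q in lborel \<Otimes>\<^sub>M lborel. P (join q)" unfolding lborel_prod .
next
  define split where "split x = (merid x, x $ 2)" for x :: "real^3"
  have "continuous_on UNIV split" unfolding split_def by (intro continuous_intros)
  then have ms: "split \<in> borel_measurable borel" by (rule borel_measurable_continuous_onI)
  \<comment> \<open>The converse direction pulls back along the inverse of \<open>join\<close>,
    which preserves the measure because \<open>join\<close> does.\<close>
  have "distr lborel borel split = distr (distr lborel borel join) borel split" by (simp add: distr_join)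
  also have "\<dots> = distr lborel borel (split \<circ> join)"
    using ms borel_measurable_join by (subst distr_distr) auto
  also have "split \<circ> join = id" by (auto simp: split_def)
  also have "distr lborel borel id = (lborel :: ((real^2) \<times> real) measure)"
    by (simp add: id_def distr_id2)
  finally have d: "distr lborel borel split = lborel" .
  assume "AE q in lborel \<Otimes>\<^sub>M lborel. P (join q)"
  then have "AE q in distr lborel borel split. P (join q)" unfolding d lborel_prod .
  from AE_distrD[OF _ this] ms show "AE x in lborel. P x" by (simp add: split_def join_merid)
qed

lemma AE_merid:
  assumes "AE p in lborel. Q p" shows "AE x in lborel. Q (merid x)"
proof -
  obtain N where "{p \<in> space lborel. \<not> Q p} \<subseteq> N" "emeasure lborel N = 0" "N \<in> sets lborel"
    using AE_E[OF assms] by blast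
  then have N: "N \<in> null_sets lborel" "{p. \<not> Q p} \<subseteq> N" by (auto intro: null_setsI)
  have "emeasure (lborel \<Otimes>\<^sub>M lborel) (N \<times> (UNIV::real set)) = 0"
    using N(1) by (subst lborel.emeasure_pair_measure_Times) (auto simp: null_sets_def)
  then have "N \<times> (UNIV::real set) \<in> null_sets (lborel \<Otimes>\<^sub>M lborel)"
    using N(1) by (auto simp: null_sets_def)
  then have "AE q in lborel \<Otimes>\<^sub>M lborel. q \<notin> N \<times> (UNIV::real set)" by (rule AE_not_in)
  then have "AE q in lborel \<Otimes>\<^sub>M (lborel::real measure). Q (merid (join q))"
    by (rule eventually_mono) (use N(2) in auto)
  then show ?thesis by (subst AE_join)
qed

text \<open>The scalar form of \<open>is_weak_D\<close>, for one component and one direction: in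
  cylindrical coordinates the components of \<open>u\<close> along the moving frame are
  differentiated separately.\<close>

definition weak_partial :: "(real^'n) set \<Rightarrow> (real^'n \<Rightarrow> real) \<Rightarrow> 'n \<Rightarrow> (real^'n \<Rightarrow> real) \<Rightarrow> bool" where
  "weak_partial U f j g \<longleftrightarrow> locally_integrable U f \<and> locally_integrable U g \<and>
     (\<forall>\<phi>. test_function U \<phi> \<longrightarrow> (LINT x|lebesgue_on U. f x * frechet_derivative \<phi> (at x) (axis j 1)) =
        - (LINT x|lebesgue_on U. g x * \<phi> x))"

lemma is_weak_D_iff_weak_partial:
  fixes u :: "real^'n \<Rightarrow> real^'m"
  shows "is_weak_D U u A \<longleftrightarrow> (\<forall>i j. weak_partial U (\<lambda>x. u x $ i) j (\<lambda>x. A x $ i $ j))"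
proof
  assume *: "is_weak_D U u A"
  then have "locally_integrable U u" "locally_integrable U A" by (auto simp: is_weak_D_def)
  then show "\<forall>i j. weak_partial U (\<lambda>x. u x $ i) j (\<lambda>x. A x $ i $ j)"
    unfolding weak_partial_def
    by (intro allI conjI impI locally_integrable_nth locally_integrable_nth_nth) (simp_all add: is_weak_D_D[OF *])
next
  assume *: "\<forall>i j. weak_partial U (\<lambda>x. u x $ i) j (\<lambda>x. A x $ i $ j)"
  have "locally_integrable U u" "locally_integrable U A"
    using * by (auto intro!: locally_integrable_cart simp: weak_partial_def)
  then show "is_weak_D U u A" using *
    by (auto simp: weak_partial_def is_weak_D_def distr_eq_def distr_partial_def regular_distr_def)
qed

lemma weak_partial_unique:
  assumes U: "open U" and "weak_partial U f j g" "weak_partial U f j h"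
  shows "AE x in lebesgue_on U. g x = h x"
proof -
  have l: "locally_integrable U g" "locally_integrable U h" using assms by (auto simp: weak_partial_def)
  have "AE x in lebesgue_on U. g x - h x = 0"
  proof (rule fundamental_lemma[OF U locally_integrable_diff[OF l]])
    fix \<phi> :: "real^'a \<Rightarrow> real" assume \<phi>: "test_function U \<phi>"
    have "(LINT x|lebesgue_on U. g x * \<phi> x) = (LINT x|lebesgue_on U. h x * \<phi> x)"
      using assms(2,3) \<phi> by (auto simp: weak_partial_def)
    then show "(LINT x|lebesgue_on U. (g x - h x) * \<phi> x) = 0"
      using integrable_test_function[OF U l(1) \<phi>] integrable_test_function[OF U l(2) \<phi>]
      by (simp add: left_diff_distrib)
  qed
  then show ?thesis by (rule eventually_mono) simp
qed

lemma locally_integrable_cong_AE: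
  fixes f g :: "'a::euclidean_space \<Rightarrow> 'b::euclidean_space"
  assumes "U \<in> sets lebesgue" "AE x in lebesgue_on U. f x = g x" "locally_integrable U f"
  shows "locally_integrable U g"
  unfolding locally_integrable_def
proof (intro allI impI)
  fix K assume K: "compact K \<and> K \<subseteq> U"
  have "negligible {x \<in> U. f x \<noteq> g x}" using assms by (simp add: AE_lebesgue_on_iff)
  then have "f absolutely_integrable_on K \<longleftrightarrow> g absolutely_integrable_on K"
    by (rule absolutely_integrable_spike_eq) (use K in auto)
  then show "g absolutely_integrable_on K" using K assms(3) by (auto simp: locally_integrable_def)
qed

lemma weak_partial_cong_AE:
  assumes U: "open U" and "AE x in lebesgue_on U. f x = f' x" "AE x in lebesgue_on U. g x = g' x"
    and w: "weak_partial U f j g"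
  shows "weak_partial U f' j g'"
proof -
  note Ul = open_lebesgue[OF U]
  have "(LINT x|lebesgue_on U. f' x * \<phi> x) = (LINT x|lebesgue_on U. f x * \<phi> x)" for \<phi>
    by (rule lebesgue_on_integral_cong_AE(1)[OF Ul]) (use assms(2) in \<open>auto elim!: eventually_mono\<close>)
  moreover have "(LINT x|lebesgue_on U. g' x * \<phi> x) = (LINT x|lebesgue_on U. g x * \<phi> x)" for \<phi>
    by (rule lebesgue_on_integral_cong_AE(1)[OF Ul]) (use assms(3) in \<open>auto elim!: eventually_mono\<close>)
  ultimately show ?thesis
    using w locally_integrable_cong_AE[OF Ul assms(2)] locally_integrable_cong_AE[OF Ul assms(3)]
    by (simp add: weak_partial_def)
qed

lemma weak_partial_mult_smooth:
  assumes U: "open U" and w: "weak_partial U f j g" and m: "smooth_on U m"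
  shows "weak_partial U (\<lambda>x. m x * f x) j (\<lambda>x. m x * g x + frechet_derivative m (at x) (axis j 1) * f x)"
proof -
  have l: "locally_integrable U f" "locally_integrable U g" using w by (auto simp: weak_partial_def)
  have dm: "smooth_on U (\<lambda>x. frechet_derivative m (at x) (axis j 1))" by (rule smooth_on_frechet_derivative[OF m])
  note lm = locally_integrable_mult_continuous[OF l(1) smooth_on_continuous_on[OF m]]
    locally_integrable_mult_continuous[OF l(2) smooth_on_continuous_on[OF m]]
    locally_integrable_mult_continuous[OF l(1) smooth_on_continuous_on[OF dm]]
  have "(LINT x|lebesgue_on U. m x * f x * frechet_derivative \<phi> (at x) (axis j 1)) =
      - (LINT x|lebesgue_on U. (m x * g x + frechet_derivative m (at x) (axis j 1) * f x) * \<phi> x)"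
    if \<phi>: "test_function U \<phi>" for \<phi>
  proof -
    obtain K where K: "compact K" "K \<subseteq> U" "\<And>x. x \<notin> K \<Longrightarrow> \<phi> x = 0" using test_function_support[OF \<phi>] by blast
    \<comment> \<open>Although \<open>m\<close> is smooth on \<open>U\<close> only, its product with
      the test function extends by zero; testing with it yields the product rule.\<close>
    define \<mu> where "\<mu> x = (if x \<in> U then m x * \<phi> x else 0)" for x
    have t\<mu>: "test_function U \<mu>" unfolding \<mu>_def
      by (rule test_function_extend[OF U smooth_on_mult[OF U m smooth_on_subset[OF test_function_smooth[OF \<phi>] subset_UNIV]] K(1,2)])
        (use K in auto)
    have d\<mu>: "frechet_derivative \<mu> (at x) (axis j 1) = m x * frechet_derivative \<phi> (at x) (axis j 1) +
        frechet_derivative m (at x) (axis j 1) * \<phi> x" if "x \<in> U" for x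
    proof -
      have "frechet_derivative \<mu> (at x) = frechet_derivative (\<lambda>x. m x * \<phi> x) (at x)"
        by (rule frechet_derivative_transform[OF U that]) (simp add: \<mu>_def)
      then show ?thesis
        using frechet_derivative_mult[OF smooth_on_differentiable[OF m that]
            smooth_on_differentiable[OF test_function_smooth[OF \<phi>] UNIV_I]] by simp
    qed
    have "(LINT x|lebesgue_on U. f x * frechet_derivative \<mu> (at x) (axis j 1)) = - (LINT x|lebesgue_on U. g x * \<mu> x)"
      using w t\<mu> by (simp add: weak_partial_def)
    also have "(LINT x|lebesgue_on U. f x * frechet_derivative \<mu> (at x) (axis j 1)) =
        (LINT x|lebesgue_on U. m x * f x * frechet_derivative \<phi> (at x) (axis j 1) +
          frechet_derivative m (at x) (axis j 1) * f x * \<phi> x)"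
      by (rule Bochner_Integration.integral_cong[OF refl]) (simp add: d\<mu> algebra_simps)
    also have "\<dots> = (LINT x|lebesgue_on U. m x * f x * frechet_derivative \<phi> (at x) (axis j 1)) +
        (LINT x|lebesgue_on U. frechet_derivative m (at x) (axis j 1) * f x * \<phi> x)"
      by (rule Bochner_Integration.integral_add[OF integrable_test_function[OF U lm(1) test_function_frechet_derivative[OF \<phi>]]
            integrable_test_function[OF U lm(3) \<phi>]])
    also have "(LINT x|lebesgue_on U. g x * \<mu> x) = (LINT x|lebesgue_on U. m x * g x * \<phi> x)"
      by (rule Bochner_Integration.integral_cong[OF refl]) (simp add: \<mu>_def)
    finally show ?thesis
      using integrable_test_function[OF U lm(2) \<phi>] integrable_test_function[OF U lm(3) \<phi>]
      by (simp add: distrib_right)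
  qed
  then show ?thesis using lm by (simp add: weak_partial_def locally_integrable_add)
qed

lemma weak_partial_add:
  assumes U: "open U" and f: "weak_partial U f j g" and h: "weak_partial U h j k"
  shows "weak_partial U (\<lambda>x. f x + h x) j (\<lambda>x. g x + k x)"
proof -
  have l: "locally_integrable U f" "locally_integrable U g" "locally_integrable U h" "locally_integrable U k"
    using f h by (auto simp: weak_partial_def)
  have "(LINT x|lebesgue_on U. (f x + h x) * frechet_derivative \<phi> (at x) (axis j 1)) =
      - (LINT x|lebesgue_on U. (g x + k x) * \<phi> x)" if \<phi>: "test_function U \<phi>" for \<phi>
    using f h \<phi> integrable_test_function[OF U l(2) \<phi>] integrable_test_function[OF U l(4) \<phi>]
      integrable_test_function[OF U l(1) test_function_frechet_derivative[OF \<phi>], of "axis j 1"]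
      integrable_test_function[OF U l(3) test_function_frechet_derivative[OF \<phi>], of "axis j 1"]
    by (simp add: weak_partial_def distrib_right)
  then show ?thesis using l by (simp add: weak_partial_def locally_integrable_add)
qed

section \<open>Iterated integrals and weak derivatives on slabs\<close>

lemma lebesgue_on_integral_borel:
  fixes F :: "'a::euclidean_space \<Rightarrow> real"
  assumes "S \<in> sets borel" "F \<in> borel_measurable borel"
  shows "(LINT x|lebesgue_on S. F x) = (LINT x|lborel. indicator S x * F x)"
    and "integrable (lebesgue_on S) F \<longleftrightarrow> integrable lborel (\<lambda>x. indicator S x * F x)"
proof -
  have S: "S \<in> sets lebesgue" using assms(1) by simp
  have m: "(\<lambda>x. indicator S x * F x) \<in> borel_measurable lborel" using assms by simp
  show "(LINT x|lebesgue_on S. F x) = (LINT x|lborel. indicator S x * F x)"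
    using lebesgue_on_integral(1)[OF S, of F] integral_completion[OF m] by simp
  show "integrable (lebesgue_on S) F \<longleftrightarrow> integrable lborel (\<lambda>x. indicator S x * F x)"
    using lebesgue_on_integral(2)[OF S, of F] integrable_completion[OF m] by simp
qed

lemma integrable_compact_support_locally_integrable:
  fixes F \<Phi> :: "'a::euclidean_space \<Rightarrow> real"
  assumes F: "locally_integrable U F" "F \<in> borel_measurable borel"
    and \<Phi>: "\<Phi> \<in> borel_measurable borel" "\<And>x. \<bar>\<Phi> x\<bar> \<le> B"
    and L: "compact L" "L \<subseteq> U" "\<And>x. x \<notin> L \<Longrightarrow> \<Phi> x = 0"
  shows "integrable lborel (\<lambda>x. F x * \<Phi> x)"
    and "U \<in> sets borel \<Longrightarrow> (LINT x|lebesgue_on U. F x * \<Phi> x) = (LINT x|lborel. F x * \<Phi> x)"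
proof -
  have "integrable (lebesgue_on L) F"
    using F L by (simp add: locally_integrable_def lebesgue_on_integral(3)[OF compact_lebesgue])
  then have "integrable lborel (\<lambda>x. indicator L x * F x)"
    using lebesgue_on_integral_borel(2)[OF borel_compact[OF L(1)] F(2)] by simp
  then have "integrable lborel (\<lambda>x. (indicator L x * F x) * \<Phi> x)"
    by (rule integrable_mult_bounded[OF _ _ \<Phi>(2)]) (use \<Phi>(1) in simp)
  moreover have "(\<lambda>x. (indicator L x * F x) * \<Phi> x) = (\<lambda>x. F x * \<Phi> x)"
    using L(3) by (auto simp: indicator_def fun_eq_iff)
  ultimately show "integrable lborel (\<lambda>x. F x * \<Phi> x)" by simp
  show "(LINT x|lebesgue_on U. F x * \<Phi> x) = (LINT x|lborel. F x * \<Phi> x)" if U: "U \<in> sets borel"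
  proof -
    have "(\<lambda>x. indicator U x * (F x * \<Phi> x)) = (\<lambda>x. F x * \<Phi> x)"
      using L(2,3) by (auto simp: indicator_def fun_eq_iff)
    moreover have "(\<lambda>x. F x * \<Phi> x) \<in> borel_measurable borel" using F \<Phi> by simp
    ultimately show ?thesis using lebesgue_on_integral_borel(1)[OF U, of "\<lambda>x. F x * \<Phi> x"] by simp
  qed
qed

lemma axis_join_merid:
  "join (axis 1 1, 0) = axis 1 1" "join (axis 2 1, 0) = axis 3 1" "join (0, 1) = axis 2 1"
  "merid (axis 1 1) = axis 1 1" "merid (axis 3 1) = axis 2 1" "merid (axis 2 1) = 0"
  by (auto simp: vec_eq_iff forall_3 forall_2 axis_def)

lemma frechet_derivative_join:
  fixes \<Phi> :: "real^3 \<Rightarrow> real"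
  assumes "\<Phi> differentiable (at (join (p, t)))"
  shows "frechet_derivative (\<lambda>p. \<Phi> (join (p, t))) (at p) v = frechet_derivative \<Phi> (at (join (p, t))) (join (v, 0))"
    and "frechet_derivative (\<lambda>t. \<Phi> (join (p, t))) (at t) s = frechet_derivative \<Phi> (at (join (p, t))) (join (0, s))"
proof -
  have d: "(\<Phi> has_derivative frechet_derivative \<Phi> (at (join (p, t)))) (at (join (p, t)))"
    using assms frechet_derivative_works by blast
  have "((\<lambda>p. (p, t)) has_derivative (\<lambda>v. (v, 0))) (at p)" by (auto intro!: derivative_eq_intros)
  from bounded_linear.has_derivative[OF bounded_linear_join this]
  have "((\<lambda>p. join (p, t)) has_derivative (\<lambda>v. join (v, 0))) (at p)" .
  from frechet_derivative_at[OF has_derivative_compose[OF this d], symmetric]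
  show "frechet_derivative (\<lambda>p. \<Phi> (join (p, t))) (at p) v = frechet_derivative \<Phi> (at (join (p, t))) (join (v, 0))" by simp
  have "((\<lambda>t. (p, t)) has_derivative (\<lambda>s. (0, s))) (at t)" by (auto intro!: derivative_eq_intros)
  from bounded_linear.has_derivative[OF bounded_linear_join this]
  have "((\<lambda>t. join (p, t)) has_derivative (\<lambda>s. join (0, s))) (at t)" .
  from frechet_derivative_at[OF has_derivative_compose[OF this d], symmetric]
  show "frechet_derivative (\<lambda>t. \<Phi> (join (p, t))) (at t) s = frechet_derivative \<Phi> (at (join (p, t))) (join (0, s))" by simp
qed

lemma frechet_derivative_tensor:
  fixes \<phi> :: "real^2 \<Rightarrow> real" and \<chi>' :: "real \<Rightarrow> real"
  assumes "smooth_on UNIV \<phi>" "smooth_on UNIV \<chi>'"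
  shows "smooth_on UNIV (\<lambda>x. \<phi> (merid x) * \<chi>' (x $ 2))"
    and "v $ 2 = 0 \<Longrightarrow> frechet_derivative (\<lambda>x. \<phi> (merid x) * \<chi>' (x $ 2)) (at x) v =
      frechet_derivative \<phi> (at (merid x)) (merid v) * \<chi>' (x $ 2)"
proof -
  have sm: "smooth_on UNIV merid" by (rule smooth_on_linear[OF bounded_linear_merid open_UNIV])
  have sn: "smooth_on UNIV (\<lambda>x::real^3. x $ 2)" by (rule smooth_on_linear[OF bounded_linear_vec_nth open_UNIV])
  have s1: "smooth_on UNIV (\<lambda>x. \<phi> (merid x))"
    by (rule smooth_on_compose[OF open_UNIV open_UNIV sm _ assms(1)]) simp
  have s2: "smooth_on UNIV (\<lambda>x::real^3. \<chi>' (x $ 2))"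
    by (rule smooth_on_compose[OF open_UNIV open_UNIV sn _ assms(2)]) simp
  show "smooth_on UNIV (\<lambda>x. \<phi> (merid x) * \<chi>' (x $ 2))" by (rule smooth_on_mult[OF open_UNIV s1 s2])
  assume v: "v $ 2 = 0"
  have d1: "((\<lambda>x. \<phi> (merid x)) has_derivative (\<lambda>v. frechet_derivative \<phi> (at (merid x)) (merid v))) (at x)"
    using has_derivative_compose[OF bounded_linear_imp_has_derivative[OF bounded_linear_merid] smooth_on_has_derivative[OF assms(1) UNIV_I]] .
  have d2: "((\<lambda>x::real^3. \<chi>' (x $ 2)) has_derivative (\<lambda>v. frechet_derivative \<chi>' (at (x $ 2)) (v $ 2))) (at x)"
    using has_derivative_compose[OF bounded_linear_imp_has_derivative[OF bounded_linear_vec_nth] smooth_on_has_derivative[OF assms(2) UNIV_I]] .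
  have z: "frechet_derivative \<chi>' (at (x $ 2)) 0 = 0"
    using linear_0[OF has_derivative_linear[OF smooth_on_has_derivative[OF assms(2) UNIV_I]]] .
  show "frechet_derivative (\<lambda>x. \<phi> (merid x) * \<chi>' (x $ 2)) (at x) v =
      frechet_derivative \<phi> (at (merid x)) (merid v) * \<chi>' (x $ 2)"
    using frechet_derivative_at[OF has_derivative_mult[OF d1 d2], symmetric] v z by simp
qed

lemma borel_measurable_pair_join:
  fixes F :: "real^3 \<Rightarrow> real"
  assumes "F \<in> borel_measurable borel"
  shows "(\<lambda>(p, t). F (join (p, t))) \<in> borel_measurable (lborel \<Otimes>\<^sub>M lborel)"
proof -
  have "(\<lambda>q. F (join q)) \<in> borel_measurable borel" using measurable_compose[OF borel_measurable_join assms] .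
  then have "(\<lambda>q. F (join q)) \<in> borel_measurable (lborel \<Otimes>\<^sub>M lborel)" unfolding lborel_prod by simp
  then show ?thesis by (simp add: split_beta')
qed

text \<open>A planar set \<open>P\<close> times an interval for the middle coordinate. It is used
  with \<open>P\<close> the meridian set and the interval (-\<pi>, \<pi>) of angles.\<close>

locale slab =
  fixes P :: "(real^2) set" and a b :: real
  assumes open_P: "open P" and ab: "a < b"
begin

definition D where "D = {x. merid x \<in> P \<and> a < x $ 2 \<and> x $ 2 < b}"

lemma open_D: "open D"
proof -
  have "D = merid -` P \<inter> {x. a < x $ 2} \<inter> {x. x $ 2 < b}" by (auto simp: D_def)
  moreover have "open (merid -` P)"
    by (rule open_vimage[OF open_P]) (intro continuous_intros)
  ultimately show ?thesis
    by (simp add: open_Int open_Collect_less continuous_intros)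
qed

lemma D_box:
  assumes "compact K" "K \<subseteq> P" "compact S" "S \<subseteq> {a<..<b}"
  shows "compact (join ` (K \<times> S))" "join ` (K \<times> S) \<subseteq> D"
proof -
  show "compact (join ` (K \<times> S))"
    by (rule compact_continuous_image) (auto intro!: continuous_intros compact_Times assms)
  show "join ` (K \<times> S) \<subseteq> D" using assms by (auto simp: D_def)
qed

lemma D_projections:
  assumes "compact L" "L \<subseteq> D"
  shows "compact (merid ` L)" "merid ` L \<subseteq> P" "compact ((\<lambda>x. x $ 2) ` L)" "(\<lambda>x. x $ 2) ` L \<subseteq> {a<..<b}"
  using assms by (auto simp: D_def intro!: compact_continuous_image continuous_intros)

text \<open>A weight for averaging over the transversal coordinate: with integral one it reproduces
  every function that does not depend on this coordinate.\<close>

lemma bump: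
  obtains \<kappa> :: "real \<Rightarrow> real" and S where "smooth_on UNIV \<kappa>" "compact S" "S \<subseteq> {a<..<b}" "\<And>t. t \<notin> S \<Longrightarrow> \<kappa> t = 0"
    "integrable lborel \<kappa>" "(LINT t|lborel. \<kappa> t) = 1"
proof -
  define m where "m = (a + b) / 2"
  define e where "e = (b - a) / 4"
  have e: "e > 0" using ab by (simp add: e_def)
  obtain \<eta> :: "real \<Rightarrow> real" where \<eta>: "smooth_on UNIV \<eta>" "\<And>x. norm x \<ge> e \<Longrightarrow> \<eta> x = 0"
    "(LINT x|lborel. \<eta> x) = 1" using mollifier_exists[OF e] by metis
  define \<kappa> where "\<kappa> t = \<eta> (- m + t)" for t
  have s: "smooth_on UNIV \<kappa>" unfolding \<kappa>_def[abs_def]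
    by (rule smooth_on_compose[OF _ _ _ _ \<eta>(1)]) (auto intro!: smooth_on_add smooth_on_diff smooth_on_const smooth_on_id)
  have z: "\<kappa> t = 0" if "t \<notin> cball m e" for t
    using that unfolding \<kappa>_def by (intro \<eta>(2)) (simp add: dist_real_def)
  have "cball m e \<subseteq> {a<..<b}"
  proof
    fix t assume "t \<in> cball m e"
    then have "\<bar>m - t\<bar> \<le> e" by (simp add: dist_real_def)
    then show "t \<in> {a<..<b}" using ab unfolding m_def e_def abs_le_iff greaterThanLessThan_iff
      by (simp add: field_simps)
  qed
  moreover have "(LINT t|lborel. \<kappa> t) = 1"
    unfolding \<kappa>_def using \<eta>(3)
    by (subst lborel_integral_translation) (auto intro: borel_measurable_continuous_onI smooth_on_continuous_on[OF \<eta>(1)])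
  ultimately show thesis
    using that[OF s compact_cball _ z integrable_compact_support[OF smooth_on_continuous_on[OF s] compact_cball z]] by blast
qed

lemma LINT_D:
  fixes F \<Phi> :: "real^3 \<Rightarrow> real"
  assumes F: "locally_integrable D F" "F \<in> borel_measurable borel"
    and \<Phi>: "\<Phi> \<in> borel_measurable borel" "\<And>x. \<bar>\<Phi> x\<bar> \<le> B"
    and L: "compact L" "L \<subseteq> D" "\<And>x. x \<notin> L \<Longrightarrow> \<Phi> x = 0"
  shows "integrable (lborel \<Otimes>\<^sub>M lborel) (\<lambda>(p, t). F (join (p, t)) * \<Phi> (join (p, t)))"
    and "(LINT x|lebesgue_on D. F x * \<Phi> x) = (\<integral>p. (\<integral>t. F (join (p, t)) * \<Phi> (join (p, t)) \<partial>lborel) \<partial>lborel)"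
    and "(LINT x|lebesgue_on D. F x * \<Phi> x) = (\<integral>t. (\<integral>p. F (join (p, t)) * \<Phi> (join (p, t)) \<partial>lborel) \<partial>lborel)"
proof -
  have m: "(\<lambda>x. F x * \<Phi> x) \<in> borel_measurable borel" using F \<Phi> by simp
  show i: "integrable (lborel \<Otimes>\<^sub>M lborel) (\<lambda>(p, t). F (join (p, t)) * \<Phi> (join (p, t)))"
    using integrable_compact_support_locally_integrable(1)[OF F \<Phi> L] integrable_join(1)[OF m] by simp
  have e: "(LINT x|lebesgue_on D. F x * \<Phi> x) =
      (LINT q|(lborel \<Otimes>\<^sub>M lborel). (case q of (p, t) \<Rightarrow> F (join (p, t)) * \<Phi> (join (p, t))))"
    using integrable_compact_support_locally_integrable(2)[OF F \<Phi> L borel_open[OF open_D]] integrable_join(2)[OF m] by simp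
  show "(LINT x|lebesgue_on D. F x * \<Phi> x) = (\<integral>p. (\<integral>t. F (join (p, t)) * \<Phi> (join (p, t)) \<partial>lborel) \<partial>lborel)"
    unfolding e by (rule lborel_pair.integral_fst[OF i, symmetric])
  show "(LINT x|lebesgue_on D. F x * \<Phi> x) = (\<integral>t. (\<integral>p. F (join (p, t)) * \<Phi> (join (p, t)) \<partial>lborel) \<partial>lborel)"
    unfolding e by (rule lborel_pair.integral_snd[OF i, symmetric])
qed

lemma test_function_bounds:
  fixes \<Phi> :: "'a::euclidean_space \<Rightarrow> real"
  assumes "test_function U \<Phi>"
  obtains B L where "\<Phi> \<in> borel_measurable borel" "\<And>x. \<bar>\<Phi> x\<bar> \<le> B" "compact L" "L \<subseteq> U" "\<And>x. x \<notin> L \<Longrightarrow> \<Phi> x = 0"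
proof -
  obtain L where L: "compact L" "L \<subseteq> U" "\<And>x. x \<notin> L \<Longrightarrow> \<Phi> x = 0" using test_function_support[OF assms] by blast
  have c: "continuous_on UNIV \<Phi>" by (rule smooth_on_continuous_on[OF test_function_smooth[OF assms]])
  obtain B where "\<And>x. norm (\<Phi> x) \<le> B" using bounded_compact_support[OF c L(1,3)] by blast
  then show thesis using that L borel_measurable_continuous_onI[OF c] by auto
qed

lemma locally_integrable_average:
  fixes F :: "real^3 \<Rightarrow> real" and \<kappa> :: "real \<Rightarrow> real"
  assumes F: "locally_integrable D F" "F \<in> borel_measurable borel"
    and \<kappa>: "continuous_on UNIV \<kappa>" "compact S" "S \<subseteq> {a<..<b}" "\<And>t. t \<notin> S \<Longrightarrow> \<kappa> t = 0"
  shows "(\<lambda>p. \<integral>t. F (join (p, t)) * \<kappa> t \<partial>lborel) \<in> borel_measurable borel"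
    and "locally_integrable P (\<lambda>p. \<integral>t. F (join (p, t)) * \<kappa> t \<partial>lborel)"
proof -
  have m\<kappa>: "(\<lambda>x::real^3. \<kappa> (x $ 2)) \<in> borel_measurable borel"
    by (rule borel_measurable_continuous_onI, rule continuous_on_compose2[OF \<kappa>(1)]) (auto intro!: continuous_intros)
  have "(\<lambda>x. F x * \<kappa> (x $ 2)) \<in> borel_measurable borel" using F m\<kappa> by simp
  from borel_measurable_pair_join[OF this]
  have mm: "(\<lambda>(p, t). F (join (p, t)) * \<kappa> t) \<in> borel_measurable (lborel \<Otimes>\<^sub>M lborel)" by simp
  from lborel.borel_measurable_lebesgue_integral[OF mm]
  show mB: "(\<lambda>p. \<integral>t. F (join (p, t)) * \<kappa> t \<partial>lborel) \<in> borel_measurable borel" by simp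
  obtain M where M: "\<And>t. norm (\<kappa> t) \<le> M" using bounded_compact_support[OF \<kappa>(1,2,4)] by blast
  show "locally_integrable P (\<lambda>p. \<integral>t. F (join (p, t)) * \<kappa> t \<partial>lborel)"
    unfolding locally_integrable_def
  proof (intro allI impI)
    fix K assume K: "compact K \<and> K \<subseteq> P"
    have KB: "K \<in> sets borel" using K borel_compact by blast
    have "integrable (lborel \<Otimes>\<^sub>M lborel) (\<lambda>(p, t). F (join (p, t)) * (indicator K (merid (join (p, t))) * \<kappa> (join (p, t) $ 2)))"
    proof (rule LINT_D(1)[OF F])
      have "merid \<in> borel_measurable borel" by (rule borel_measurable_continuous_onI) (intro continuous_intros)
      then show "(\<lambda>x. indicator K (merid x) * \<kappa> (x $ 2)) \<in> borel_measurable borel"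
        using m\<kappa> KB by (intro borel_measurable_times) auto
      show "\<bar>indicator K (merid x) * \<kappa> (x $ 2)\<bar> \<le> \<bar>M\<bar>" for x
        using M[of "x $ 2"] by (auto simp: indicator_def abs_mult)
      show "compact (join ` (K \<times> S))" "join ` (K \<times> S) \<subseteq> D" using D_box K \<kappa> by auto
      show "indicator K (merid x) * \<kappa> (x $ 2) = 0" if "x \<notin> join ` (K \<times> S)" for x
      proof (rule ccontr)
        assume "indicator K (merid x) * \<kappa> (x $ 2) \<noteq> 0"
        then have "merid x \<in> K" "x $ 2 \<in> S" using \<kappa>(4)[of "x $ 2"] by (auto simp: indicator_def split: if_splits)
        then have "join (merid x, x $ 2) \<in> join ` (K \<times> S)" by blast
        then show False using that by (simp add: join_merid)
      qed
    qed
    then have "integrable (lborel \<Otimes>\<^sub>M lborel) (\<lambda>(p, t). indicator K p * (F (join (p, t)) * \<kappa> t))"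
      by (simp add: mult_ac)
    from lborel_pair.integrable_fst[OF this]
    have "integrable lborel (\<lambda>p. indicator K p * (\<integral>t. F (join (p, t)) * \<kappa> t \<partial>lborel))" by simp
    then show "(\<lambda>p. \<integral>t. F (join (p, t)) * \<kappa> t \<partial>lborel) absolutely_integrable_on K"
      using lebesgue_on_integral_borel(2)[OF KB mB] lebesgue_on_integral(3)[OF compact_lebesgue] K by blast
  qed
qed

lemma locally_integrable_lift:
  fixes B :: "real^2 \<Rightarrow> real"
  assumes B: "locally_integrable P B" "B \<in> borel_measurable borel"
  shows "locally_integrable D (\<lambda>x. B (merid x))"
  unfolding locally_integrable_def
proof (intro allI impI)
  fix L assume L: "compact L \<and> L \<subseteq> D"
  have mm: "merid \<in> borel_measurable borel" by (rule borel_measurable_continuous_onI) (intro continuous_intros)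
  have mB: "(\<lambda>x. B (merid x)) \<in> borel_measurable borel" using measurable_compose[OF mm B(2)] .
  define K where "K = merid ` L"
  define S where "S = (\<lambda>x. x $ 2) ` L"
  have KS: "compact K" "K \<subseteq> P" "compact S" using D_projections L unfolding K_def S_def by auto
  have KSB: "K \<in> sets borel" "S \<in> sets borel" using KS borel_compact by auto
  have iK: "integrable lborel (\<lambda>p. indicator K p * B p)"
    using B KS lebesgue_on_integral_borel(2)[OF KSB(1) B(2)] lebesgue_on_integral(3)[OF compact_lebesgue]
    by (auto simp: locally_integrable_def)
  have iS: "integrable lborel (\<lambda>t. indicator S t :: real)"
    by (rule integrable_real_indicator)
      (use KSB emeasure_bounded_finite[OF compact_imp_bounded[OF KS(3)]] in \<open>auto simp: less_top\<close>)
  have m2: "(\<lambda>x::real^3. indicator K (merid x) * B (merid x) * indicator S (x $ 2)) \<in> borel_measurable borel"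
  proof -
    have "(\<lambda>x::real^3. x $ 2) \<in> borel_measurable borel"
      by (rule borel_measurable_continuous_onI) (intro continuous_intros)
    then show ?thesis using mm mB KSB by (intro borel_measurable_times) auto
  qed
  have "integrable (lborel \<Otimes>\<^sub>M lborel) (\<lambda>(p, t). indicator K p * B p * indicator S t)"
  proof (rule lborel_pair.Fubini_integrable)
    show "(\<lambda>(p, t). indicator K p * B p * indicator S t) \<in> borel_measurable (lborel \<Otimes>\<^sub>M lborel)"
      using borel_measurable_pair_join[OF m2] by simp
    have "(\<integral>t. norm (case (p, t) of (p, t) \<Rightarrow> indicator K p * B p * indicator S t) \<partial>lborel) =
        \<bar>indicator K p * B p\<bar> * (LINT t|lborel. indicator S t)" for p
      by (simp add: abs_mult)
    then show "integrable lborel (\<lambda>p. \<integral>t. norm (case (p, t) of (p, t) \<Rightarrow> indicator K p * B p * indicator S t) \<partial>lborel)"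
      using iK by (simp only:) simp
    show "AE p in lborel. integrable lborel (\<lambda>t. case (p, t) of (p, t) \<Rightarrow> indicator K p * B p * indicator S t)"
      using iS by simp
  qed
  then have "integrable lborel (\<lambda>x. indicator K (merid x) * B (merid x) * indicator S (x $ 2))"
    using integrable_join(1)[OF m2] by simp
  then have "integrable lborel (\<lambda>x. (indicator K (merid x) * B (merid x) * indicator S (x $ 2)) * indicator L x)"
  proof (rule integrable_mult_bounded[where B = 1])
    have "L \<in> sets borel" using L borel_compact by blast
    then show "(indicator L :: real^3 \<Rightarrow> real) \<in> borel_measurable lborel" by simp
  qed (simp add: indicator_def)
  moreover have "(\<lambda>x. (indicator K (merid x) * B (merid x) * indicator S (x $ 2)) * indicator L x) =
      (\<lambda>x. indicator L x * B (merid x))"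
    by (auto simp: fun_eq_iff K_def S_def indicator_def)
  ultimately have "integrable lborel (\<lambda>x. indicator L x * B (merid x))" by simp
  then show "(\<lambda>x. B (merid x)) absolutely_integrable_on L"
    using lebesgue_on_integral_borel(2)[OF borel_compact mB] lebesgue_on_integral(3)[OF compact_lebesgue] L by blast
qed

lemma LINT_P:
  fixes B \<phi> :: "real^2 \<Rightarrow> real"
  assumes B: "locally_integrable P B" "B \<in> borel_measurable borel" and \<phi>: "test_function P \<phi>"
  shows "(LINT p|lebesgue_on P. B p * \<phi> p) = (LINT p|lborel. B p * \<phi> p)"
proof -
  obtain M L where "\<phi> \<in> borel_measurable borel" "\<And>x. \<bar>\<phi> x\<bar> \<le> M" "compact L" "L \<subseteq> P" "\<And>x. x \<notin> L \<Longrightarrow> \<phi> x = 0"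
    using test_function_bounds[OF \<phi>] by metis
  then show ?thesis
    by (rule integrable_compact_support_locally_integrable(2)[OF B _ _ _ _ _ borel_open[OF open_P]])
qed

text \<open>Test with the product of \<phi>(r, z) and the weight \<kappa>(t). In the directions
  other than the transversal one the derivative falls on \<phi> alone, and integrating out
  \<open>t\<close> averages \<open>C\<close> and leaves \<open>w\<close> unchanged.\<close>

lemma weak_partial_average:
  assumes w: "w \<in> borel_measurable borel" and C: "C \<in> borel_measurable borel"
    and wC: "weak_partial D (\<lambda>x. w (merid x)) i C"
    and ij: "merid (axis i 1) = axis j 1" "i \<noteq> 2"
    and \<kappa>: "smooth_on UNIV \<kappa>" "compact S" "S \<subseteq> {a<..<b}" "\<And>t. t \<notin> S \<Longrightarrow> \<kappa> t = 0"
      "integrable lborel \<kappa>" "(LINT t|lborel. \<kappa> t) = 1"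
  shows "weak_partial P w j (\<lambda>p. \<integral>t. C (join (p, t)) * \<kappa> t \<partial>lborel)"
proof -
  have lw: "locally_integrable D (\<lambda>x. w (merid x))" and lC: "locally_integrable D C"
    using wC by (auto simp: weak_partial_def)
  have mm: "merid \<in> borel_measurable borel" by (rule borel_measurable_continuous_onI) (intro continuous_intros)
  have mw: "(\<lambda>x. w (merid x)) \<in> borel_measurable borel" using measurable_compose[OF mm w] .
  note c\<kappa> = smooth_on_continuous_on[OF \<kappa>(1)]
  have lwP: "locally_integrable P w"
    using locally_integrable_average(2)[OF lw mw c\<kappa> \<kappa>(2-4)] \<kappa>(6) by simp
  define B where "B p = (\<integral>t. C (join (p, t)) * \<kappa> t \<partial>lborel)" for p
  have B1: "B \<in> borel_measurable borel"
    unfolding B_def[abs_def] by (rule locally_integrable_average(1)[OF lC C c\<kappa> \<kappa>(2-4)])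
  have B2: "locally_integrable P B"
    unfolding B_def[abs_def] by (rule locally_integrable_average(2)[OF lC C c\<kappa> \<kappa>(2-4)])
  note B = B1 B2
  have "(LINT p|lebesgue_on P. w p * frechet_derivative \<phi> (at p) (axis j 1)) = - (LINT p|lebesgue_on P. B p * \<phi> p)"
    if \<phi>: "test_function P \<phi>" for \<phi>
  proof -
    define \<Phi> where "\<Phi> x = \<phi> (merid x) * \<kappa> (x $ 2)" for x
    obtain K where K: "compact K" "K \<subseteq> P" "\<And>x. x \<notin> K \<Longrightarrow> \<phi> x = 0" using test_function_support[OF \<phi>] by blast
    have z: "\<Phi> x = 0" if "x \<notin> join ` (K \<times> S)" for x
    proof (rule ccontr)
      assume "\<Phi> x \<noteq> 0"
      then have "merid x \<in> K" "x $ 2 \<in> S" using \<kappa>(4)[of "x $ 2"] K(3)[of "merid x"] by (auto simp: \<Phi>_def)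
      then have "join (merid x, x $ 2) \<in> join ` (K \<times> S)" by blast
      then show False using that by (simp add: join_merid)
    qed
    have t\<Phi>: "test_function D \<Phi>"
      using frechet_derivative_tensor(1)[OF test_function_smooth[OF \<phi>] \<kappa>(1)] D_box[OF K(1,2) \<kappa>(2,3)] z
      unfolding test_function_def \<Phi>_def[abs_def] by blast
    have d\<Phi>: "frechet_derivative \<Phi> (at x) (axis i 1) = frechet_derivative \<phi> (at (merid x)) (axis j 1) * \<kappa> (x $ 2)" for x
      unfolding \<Phi>_def[abs_def] using ij
      by (subst frechet_derivative_tensor(2)[OF test_function_smooth[OF \<phi>] \<kappa>(1)]) (auto simp: axis_def)
    note td = test_function_frechet_derivative[OF t\<Phi>, of "axis i 1"]
    obtain M L where bd: "(\<lambda>x. frechet_derivative \<Phi> (at x) (axis i 1)) \<in> borel_measurable borel"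
      "\<And>x. \<bar>frechet_derivative \<Phi> (at x) (axis i 1)\<bar> \<le> M" "compact L" "L \<subseteq> D"
      "\<And>x. x \<notin> L \<Longrightarrow> frechet_derivative \<Phi> (at x) (axis i 1) = 0"
      using test_function_bounds[OF td] by metis
    obtain M' L' where bd': "\<Phi> \<in> borel_measurable borel" "\<And>x. \<bar>\<Phi> x\<bar> \<le> M'" "compact L'" "L' \<subseteq> D" "\<And>x. x \<notin> L' \<Longrightarrow> \<Phi> x = 0"
      using test_function_bounds[OF t\<Phi>] by metis
    have "(LINT p|lebesgue_on P. w p * frechet_derivative \<phi> (at p) (axis j 1)) =
        (LINT p|lborel. w p * frechet_derivative \<phi> (at p) (axis j 1))"
      by (rule LINT_P[OF lwP w test_function_frechet_derivative[OF \<phi>]])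
    also have "\<dots> = (\<integral>p. (\<integral>t. w (merid (join (p, t))) * frechet_derivative \<Phi> (at (join (p, t))) (axis i 1) \<partial>lborel) \<partial>lborel)"
      using \<kappa>(5,6) by (simp add: d\<Phi> mult.assoc[symmetric])
    also have "\<dots> = (LINT x|lebesgue_on D. w (merid x) * frechet_derivative \<Phi> (at x) (axis i 1))"
      by (rule LINT_D(2)[OF lw mw bd, symmetric])
    also have "\<dots> = - (LINT x|lebesgue_on D. C x * \<Phi> x)" using wC t\<Phi> by (simp add: weak_partial_def)
    also have "(LINT x|lebesgue_on D. C x * \<Phi> x) = (\<integral>p. (\<integral>t. C (join (p, t)) * \<Phi> (join (p, t)) \<partial>lborel) \<partial>lborel)"
      by (rule LINT_D(2)[OF lC C bd'])
    also have "\<dots> = (LINT p|lborel. B p * \<phi> p)"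
    proof (rule Bochner_Integration.integral_cong[OF refl])
      fix p
      have "(\<integral>t. C (join (p, t)) * \<Phi> (join (p, t)) \<partial>lborel) = (\<integral>t. (C (join (p, t)) * \<kappa> t) * \<phi> p \<partial>lborel)"
        by (simp add: \<Phi>_def mult_ac)
      then show "(\<integral>t. C (join (p, t)) * \<Phi> (join (p, t)) \<partial>lborel) = B p * \<phi> p" by (simp add: B_def)
    qed
    also have "\<dots> = (LINT p|lebesgue_on P. B p * \<phi> p)" by (rule LINT_P[OF B(2,1) \<phi>, symmetric])
    finally show ?thesis .
  qed
  then show ?thesis using lwP B(2) unfolding weak_partial_def B_def[abs_def] by blast
qed

lemma test_function_section:
  assumes "test_function D \<Phi>"
  shows "test_function P (\<lambda>p. \<Phi> (join (p, t)))"
proof -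
  obtain L where L: "compact L" "L \<subseteq> D" "\<And>x. x \<notin> L \<Longrightarrow> \<Phi> x = 0" using test_function_support[OF assms] by blast
  have sj: "smooth_on UNIV (\<lambda>p. join (p, t))"
    by (rule smooth_on_bounded_linear[OF bounded_linear_join open_UNIV])
      (intro smooth_on_Pair smooth_on_id smooth_on_const open_UNIV)
  have "smooth_on UNIV (\<lambda>p. \<Phi> (join (p, t)))"
    by (rule smooth_on_compose[OF open_UNIV open_UNIV sj _ test_function_smooth[OF assms]]) simp
  moreover have "\<Phi> (join (p, t)) = 0" if "p \<notin> merid ` L" for p
    using that L(3)[of "join (p, t)"] by (metis imageI merid_join)
  ultimately show ?thesis using D_projections[OF L(1,2)] unfolding test_function_def by blast
qed

text \<open>Each slice of a test function at fixed \<open>t\<close> is a test function on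
  \<open>P\<close>; integrating the identities of the slices over \<open>t\<close> gives the
  claim.\<close>

lemma weak_partial_lift:
  assumes w: "w \<in> borel_measurable borel" "locally_integrable D (\<lambda>x. w (merid x))" and B: "B \<in> borel_measurable borel"
    and wB: "weak_partial P w j B" and ij: "join (axis j 1, 0) = axis i 1"
  shows "weak_partial D (\<lambda>x. w (merid x)) i (\<lambda>x. B (merid x))"
proof -
  have lw: "locally_integrable P w" and lB: "locally_integrable P B" using wB by (auto simp: weak_partial_def)
  have mm: "merid \<in> borel_measurable borel" by (rule borel_measurable_continuous_onI) (intro continuous_intros)
  have mw: "(\<lambda>x. w (merid x)) \<in> borel_measurable borel" using measurable_compose[OF mm w(1)] .
  have mB: "(\<lambda>x. B (merid x)) \<in> borel_measurable borel" using measurable_compose[OF mm B] .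
  have lBD: "locally_integrable D (\<lambda>x. B (merid x))" by (rule locally_integrable_lift[OF lB B])
  have "(LINT x|lebesgue_on D. w (merid x) * frechet_derivative \<Phi> (at x) (axis i 1)) =
      - (LINT x|lebesgue_on D. B (merid x) * \<Phi> x)" if \<Phi>: "test_function D \<Phi>" for \<Phi>
  proof -
    note td = test_function_frechet_derivative[OF \<Phi>, of "axis i 1"]
    obtain M L where bd: "(\<lambda>x. frechet_derivative \<Phi> (at x) (axis i 1)) \<in> borel_measurable borel"
      "\<And>x. \<bar>frechet_derivative \<Phi> (at x) (axis i 1)\<bar> \<le> M" "compact L" "L \<subseteq> D"
      "\<And>x. x \<notin> L \<Longrightarrow> frechet_derivative \<Phi> (at x) (axis i 1) = 0"
      using test_function_bounds[OF td] by metis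
    obtain M' L' where bd': "\<Phi> \<in> borel_measurable borel" "\<And>x. \<bar>\<Phi> x\<bar> \<le> M'" "compact L'" "L' \<subseteq> D" "\<And>x. x \<notin> L' \<Longrightarrow> \<Phi> x = 0"
      using test_function_bounds[OF \<Phi>] by metis
    have d: "frechet_derivative (\<lambda>p. \<Phi> (join (p, t))) (at p) (axis j 1) = frechet_derivative \<Phi> (at (join (p, t))) (axis i 1)" for p t
      using frechet_derivative_join(1)[OF smooth_on_differentiable[OF test_function_smooth[OF \<Phi>] UNIV_I]] ij by simp
    have "(LINT x|lebesgue_on D. w (merid x) * frechet_derivative \<Phi> (at x) (axis i 1)) =
        (\<integral>t. (\<integral>p. w p * frechet_derivative (\<lambda>p. \<Phi> (join (p, t))) (at p) (axis j 1) \<partial>lborel) \<partial>lborel)"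
      using LINT_D(3)[OF w(2) mw bd] by (simp add: d)
    also have "\<dots> = (\<integral>t. - (\<integral>p. B p * \<Phi> (join (p, t)) \<partial>lborel) \<partial>lborel)"
    proof (rule Bochner_Integration.integral_cong[OF refl])
      fix t
      note ts = test_function_section[OF \<Phi>, of t]
      show "(\<integral>p. w p * frechet_derivative (\<lambda>p. \<Phi> (join (p, t))) (at p) (axis j 1) \<partial>lborel) = - (\<integral>p. B p * \<Phi> (join (p, t)) \<partial>lborel)"
      proof -
        have "(LINT p|lebesgue_on P. w p * frechet_derivative (\<lambda>p. \<Phi> (join (p, t))) (at p) (axis j 1)) =
            - (LINT p|lebesgue_on P. B p * \<Phi> (join (p, t)))"
          using wB ts unfolding weak_partial_def by blast
        then show ?thesis
          by (simp only: LINT_P[OF lw w(1) test_function_frechet_derivative[OF ts]] LINT_P[OF lB B ts])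
      qed
    qed
    also have "\<dots> = - (LINT x|lebesgue_on D. B (merid x) * \<Phi> x)"
      using LINT_D(3)[OF lBD mB bd'] by simp
    finally show ?thesis .
  qed
  then show ?thesis using w(2) lBD unfolding weak_partial_def by blast
qed

text \<open>For every \<open>p\<close> the transversal derivative of a test function integrates to
  zero along the line over \<open>p\<close>.\<close>

lemma weak_partial_transversal:
  assumes w: "w \<in> borel_measurable borel" "locally_integrable D (\<lambda>x. w (merid x))"
  shows "weak_partial D (\<lambda>x. w (merid x)) 2 (\<lambda>x. 0)"
proof -
  have mm: "merid \<in> borel_measurable borel" by (rule borel_measurable_continuous_onI) (intro continuous_intros)
  have mw: "(\<lambda>x. w (merid x)) \<in> borel_measurable borel" using measurable_compose[OF mm w(1)] .
  have "(LINT x|lebesgue_on D. w (merid x) * frechet_derivative \<Phi> (at x) (axis 2 1)) = 0" if \<Phi>: "test_function D \<Phi>" for \<Phi>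
  proof -
    note td = test_function_frechet_derivative[OF \<Phi>, of "axis 2 1"]
    obtain M L where bd: "(\<lambda>x. frechet_derivative \<Phi> (at x) (axis 2 1)) \<in> borel_measurable borel"
      "\<And>x. \<bar>frechet_derivative \<Phi> (at x) (axis 2 1)\<bar> \<le> M" "compact L" "L \<subseteq> D"
      "\<And>x. x \<notin> L \<Longrightarrow> frechet_derivative \<Phi> (at x) (axis 2 1) = 0"
      using test_function_bounds[OF td] by metis
    obtain L' where L': "compact L'" "L' \<subseteq> D" "\<And>x. x \<notin> L' \<Longrightarrow> \<Phi> x = 0" using test_function_support[OF \<Phi>] by blast
    have "(\<integral>t. frechet_derivative \<Phi> (at (join (p, t))) (axis 2 1) \<partial>lborel) = 0" for p
    proof -
      have "(\<integral>t. frechet_derivative (\<lambda>t. \<Phi> (join (p, t))) (at t) 1 \<partial>lborel) = 0"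
      proof (rule integral_derivative_compact_support)
        have sj: "smooth_on UNIV (\<lambda>t. join (p, t))"
          by (rule smooth_on_bounded_linear[OF bounded_linear_join open_UNIV])
            (intro smooth_on_Pair smooth_on_id smooth_on_const open_UNIV)
        have "smooth_on UNIV (\<lambda>t. \<Phi> (join (p, t)))"
          by (rule smooth_on_compose[OF open_UNIV open_UNIV sj _ test_function_smooth[OF \<Phi>]]) simp
        then show "Ck_on 1 UNIV (\<lambda>t. \<Phi> (join (p, t)))" by (rule smooth_onD)
        show "compact ((\<lambda>x. x $ 2) ` L')" by (rule D_projections[OF L'(1,2)])
        show "\<Phi> (join (p, t)) = 0" if "t \<notin> (\<lambda>x. x $ 2) ` L'" for t
        proof (rule L'(3), rule notI)
          assume "join (p, t) \<in> L'"
          then have "join (p, t) $ 2 \<in> (\<lambda>x. x $ 2) ` L'" by blast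
          then show False using that by simp
        qed
      qed
      then show ?thesis
        using frechet_derivative_join(2)[OF smooth_on_differentiable[OF test_function_smooth[OF \<Phi>] UNIV_I]]
        by (simp add: axis_join_merid)
    qed
    then show ?thesis using LINT_D(2)[OF w(2) mw bd] by simp
  qed
  then show ?thesis using w(2) unfolding weak_partial_def
    by (auto intro: locally_integrable_continuous[OF continuous_on_const])
qed

text \<open>Nothing is known about \<open>w\<close> itself. By Fubini the measurable
  \<open>W\<close> agrees on almost every line with the constant \<open>w p\<close>, so the mean of
  \<open>W\<close> over the line is a Borel version of \<open>w\<close>.\<close>

lemma AE_lborel_const:
  fixes w :: "real^2 \<Rightarrow> real"
  assumes W: "W \<in> borel_measurable borel" and eq: "AE x in lborel. x \<in> D \<longrightarrow> w (merid x) = W x"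
  obtains w' where "w' \<in> borel_measurable borel" "AE p in lborel. p \<in> P \<longrightarrow> w p = w' p"
proof -
  define w' where "w' p = (\<integral>t. W (join (p, t)) * indicator {a<..<b} t \<partial>lborel) / (b - a)" for p
  have i2: "(\<lambda>x::real^3. indicator {a<..<b} (x $ 2) :: real) \<in> borel_measurable borel"
  proof -
    have "(\<lambda>x::real^3. x $ 2) \<in> borel_measurable borel"
      by (rule borel_measurable_continuous_onI) (intro continuous_intros)
    then show ?thesis by measurable
  qed
  have "(\<lambda>x. W x * indicator {a<..<b} (x $ 2)) \<in> borel_measurable borel" using W i2 by (rule borel_measurable_times)
  from borel_measurable_pair_join[OF this]
  have "(\<lambda>(p, t). W (join (p, t)) * indicator {a<..<b} t) \<in> borel_measurable (lborel \<Otimes>\<^sub>M lborel)" by simp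
  from lborel.borel_measurable_lebesgue_integral[OF this]
  have m: "w' \<in> borel_measurable borel" unfolding w'_def[abs_def] by simp
  have "AE q in lborel \<Otimes>\<^sub>M lborel. join q \<in> D \<longrightarrow> w (merid (join q)) = W (join q)"
    using eq unfolding AE_join .
  from lborel_pair.AE_pair[OF this]
  have "AE p in lborel. AE t in lborel. join (p, t) \<in> D \<longrightarrow> w p = W (join (p, t))" by simp
  then have "AE p in lborel. p \<in> P \<longrightarrow> w p = w' p"
  proof (rule eventually_mono, intro impI)
    fix p assume ae: "AE t in lborel. join (p, t) \<in> D \<longrightarrow> w p = W (join (p, t))" and p: "p \<in> P"
    have mW: "(\<lambda>t. W (join (p, t)) * indicator {a<..<b} t) \<in> borel_measurable lborel"
    proof -
      have "(\<lambda>t. join (p, t)) \<in> borel_measurable borel"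
        by (rule borel_measurable_continuous_onI) (intro continuous_intros)
      from measurable_compose[OF this W] show ?thesis by simp
    qed
    have "(\<integral>t. W (join (p, t)) * indicator {a<..<b} t \<partial>lborel) = (\<integral>t. w p * indicator {a<..<b} t \<partial>lborel)"
    proof (rule integral_cong_AE[OF mW])
      show "AE t in lborel. W (join (p, t)) * indicator {a<..<b} t = w p * indicator {a<..<b} t"
        using ae by (rule eventually_mono) (use p in \<open>auto simp: D_def indicator_def\<close>)
    qed simp
    also have "\<dots> = w p * (b - a)" using ab by simp
    finally show "w p = w' p" using ab by (simp add: w'_def)
  qed
  then show thesis using that[OF m] by blast
qed

lemma AE_P_iff: "(AE p in lebesgue_on P. Q p) \<longleftrightarrow> (AE p in lborel. p \<in> P \<longrightarrow> Q p)"
  by (rule AE_lebesgue_on_lborel[OF open_lebesgue[OF open_P]])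

lemma AE_D_iff: "(AE x in lebesgue_on D. Q x) \<longleftrightarrow> (AE x in lborel. x \<in> D \<longrightarrow> Q x)"
  by (rule AE_lebesgue_on_lborel[OF open_lebesgue[OF open_D]])

lemma AE_lift: "AE p in lborel. p \<in> P \<longrightarrow> Q p \<Longrightarrow> AE x in lborel. x \<in> D \<longrightarrow> Q (merid x)"
  by (drule AE_merid, rule eventually_mono) (auto simp: D_def)

text \<open>The derivative in the half-plane is found by averaging over the transversal coordinate.\<close>

proposition weak_partial_slab:
  fixes w :: "real^2 \<Rightarrow> real"
  assumes wC: "\<And>j. weak_partial D (\<lambda>x. w (merid x)) j (C j)"
  obtains B1 B2 where "weak_partial P w 1 B1" "weak_partial P w 2 B2"
    "AE x in lebesgue_on D. C 1 x = B1 (merid x)" "AE x in lebesgue_on D. C 2 x = 0"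
    "AE x in lebesgue_on D. C 3 x = B2 (merid x)"
    "B1 \<in> borel_measurable borel" "B2 \<in> borel_measurable borel"
proof -
  note Dl = open_lebesgue[OF open_D]
  have lw: "locally_integrable D (\<lambda>x. w (merid x))" using wC by (simp add: weak_partial_def)
  obtain W where W: "W \<in> borel_measurable borel" "AE x in lborel. x \<in> D \<longrightarrow> w (merid x) = W x"
    using borel_representative[OF Dl locally_integrable_measurable[OF open_D lw]] by blast
  obtain w' where w': "w' \<in> borel_measurable borel" "AE p in lborel. p \<in> P \<longrightarrow> w p = w' p"
    using AE_lborel_const[OF W] by blast
  have ww: "AE x in lebesgue_on D. w (merid x) = w' (merid x)"
    unfolding AE_D_iff by (rule AE_lift[OF w'(2)])
  have wP: "AE p in lebesgue_on P. w' p = w p" unfolding AE_P_iff using w'(2) by (rule eventually_mono) auto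
  have "\<exists>C'. C' \<in> borel_measurable borel \<and> (AE x in lebesgue_on D. C j x = C' x)" for j
  proof -
    have "locally_integrable D (C j)" using wC by (simp add: weak_partial_def)
    from borel_representative[OF Dl locally_integrable_measurable[OF open_D this]]
    show ?thesis unfolding AE_D_iff by metis
  qed
  then obtain C' where C': "\<And>j. C' j \<in> borel_measurable borel" "\<And>j. AE x in lebesgue_on D. C j x = C' j x" by metis
  have wC': "weak_partial D (\<lambda>x. w' (merid x)) j (C' j)" for j
    by (rule weak_partial_cong_AE[OF open_D ww C'(2) wC])
  have lw': "locally_integrable D (\<lambda>x. w' (merid x))" using wC' by (simp add: weak_partial_def)
  obtain \<kappa> :: "real \<Rightarrow> real" and S where \<kappa>: "smooth_on UNIV \<kappa>" "compact S" "S \<subseteq> {a<..<b}" "\<And>t. t \<notin> S \<Longrightarrow> \<kappa> t = 0"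
    "integrable lborel \<kappa>" "(LINT t|lborel. \<kappa> t) = 1" using bump by blast
  define B where "B i p = (\<integral>t. C' i (join (p, t)) * \<kappa> t \<partial>lborel)" for i p
  have B1: "weak_partial P w' 1 (B 1)" unfolding B_def
    by (rule weak_partial_average[OF w'(1) C'(1) wC' _ _ \<kappa>]) (simp_all add: axis_join_merid)
  have B2: "weak_partial P w' 2 (B 3)" unfolding B_def
    by (rule weak_partial_average[OF w'(1) C'(1) wC' _ _ \<kappa>]) (simp_all add: axis_join_merid)
  have mB: "B i \<in> borel_measurable borel" for i
  proof -
    have lC: "locally_integrable D (C' i)" using wC' by (simp add: weak_partial_def)
    show ?thesis unfolding B_def[abs_def]
      by (rule locally_integrable_average(1)[OF lC C'(1) smooth_on_continuous_on[OF \<kappa>(1)] \<kappa>(2-4)])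
  qed
  have l1: "weak_partial D (\<lambda>x. w' (merid x)) 1 (\<lambda>x. B 1 (merid x))"
    by (rule weak_partial_lift[OF w'(1) lw' mB B1]) (rule axis_join_merid)
  have l3: "weak_partial D (\<lambda>x. w' (merid x)) 3 (\<lambda>x. B 3 (merid x))"
    by (rule weak_partial_lift[OF w'(1) lw' mB B2]) (rule axis_join_merid)
  have l2: "weak_partial D (\<lambda>x. w' (merid x)) 2 (\<lambda>x. 0)" by (rule weak_partial_transversal[OF w'(1) lw'])
  \<comment> \<open>The lifted averages and the given derivatives are weak derivatives of the same
    function, hence equal almost everywhere; in particular the given ones do not depend on the
    transversal coordinate.\<close>
  have u: "AE x in lebesgue_on D. C j x = g x" if "weak_partial D (\<lambda>x. w' (merid x)) j g" for j g
    using C'(2)[of j] weak_partial_unique[OF open_D wC' that] by eventually_elim simp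
  show thesis
    by (rule that[OF weak_partial_cong_AE[OF open_P wP _ B1] weak_partial_cong_AE[OF open_P wP _ B2]
          u[OF l1] u[OF l2] u[OF l3] mB mB]) simp_all
qed

end

section \<open>Cylindrical coordinates\<close>

definition rot :: "real \<Rightarrow> real^3^3" where
  "rot t = vector [vector [cos t, - sin t, 0], vector [sin t, cos t, 0], vector [0, 0, 1]]"

text \<open>The scale factors of cylindrical coordinates: the Jacobian of \<open>polar\<close> is
  \<open>rot\<close> times this matrix.\<close>

definition diag3 :: "real \<Rightarrow> real^3^3" where
  "diag3 r = vector [vector [1, 0, 0], vector [0, r, 0], vector [0, 0, 1]]"

text \<open>The gradient of an axisymmetric map in the frame \<open>(e\<^sub>r, e\<^sub>\<theta>, e\<^sub>z)\<close>, where \<open>B = Dv\<close> and \<open>s = v\<^sub>1/r\<close>.\<close>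

definition frame :: "real^2^2 \<Rightarrow> real \<Rightarrow> real^3^3" where
  "frame B s = vector [vector [B $ 1 $ 1, 0, B $ 1 $ 2], vector [0, s, 0], vector [B $ 2 $ 1, 0, B $ 2 $ 2]]"

definition polar :: "real^3 \<Rightarrow> real^3" where "polar y = cyl (y $ 1) (y $ 2) (y $ 3)"

text \<open>The angle is the principal argument, with values in (-\<pi>, \<pi>]; its jump lies on
  the half-plane where the second coordinate is 0 and the first is not positive.\<close>

definition unpolar :: "real^3 \<Rightarrow> real^3" where
  "unpolar x = vector [sqrt ((x $ 1)\<^sup>2 + (x $ 2)\<^sup>2), Arg (Complex (x $ 1) (x $ 2)), x $ 3]"

lemma polar_nth [simp]: "polar y $ 1 = y $ 1 * cos (y $ 2)" "polar y $ 2 = y $ 1 * sin (y $ 2)" "polar y $ 3 = y $ 3"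
  by (simp_all add: polar_def cyl_def)

lemma rot_orthogonal: "rot t ** transpose (rot t) = mat 1" "transpose (rot t) ** rot t = mat 1"
  by (simp_all add: vec_eq_iff forall_3 matrix_matrix_mult_def transpose_def rot_def sum_3 mat_def
      power2_eq_square[symmetric] algebra_simps)

lemma det_rot: "det (rot t) = 1"
  by (simp add: det_3 rot_def power2_eq_square[symmetric])

lemma unpolar_polar:
  assumes "y $ 1 > 0" "- pi < y $ 2" "y $ 2 < pi"
  shows "unpolar (polar y) = y"
proof -
  have "(y $ 1 * cos (y $ 2))\<^sup>2 + (y $ 1 * sin (y $ 2))\<^sup>2 = (y $ 1)\<^sup>2 * ((cos (y $ 2))\<^sup>2 + (sin (y $ 2))\<^sup>2)"
    by (simp only: power_mult_distrib distrib_left)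
  then have 1: "sqrt ((y $ 1 * cos (y $ 2))\<^sup>2 + (y $ 1 * sin (y $ 2))\<^sup>2) = y $ 1" using assms(1) by simp
  have "of_real (y $ 1) * exp (\<i> * of_real (y $ 2)) = Complex (y $ 1 * cos (y $ 2)) (y $ 1 * sin (y $ 2))"
    by (simp add: complex_eq_iff Re_exp Im_exp)
  then have 2: "Arg (Complex (y $ 1 * cos (y $ 2)) (y $ 1 * sin (y $ 2))) = y $ 2"
    by (rule Arg_unique) (use assms in auto)
  show ?thesis using 1 2 by (simp add: vec_eq_iff forall_3 unpolar_def)
qed

lemma polar_unpolar: "polar (unpolar x) = x"
proof -
  define z where "z = Complex (x $ 1) (x $ 2)"
  have c: "cmod z = sqrt ((x $ 1)\<^sup>2 + (x $ 2)\<^sup>2)" by (simp add: z_def cmod_def)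
  have "cmod z * cos (Arg z) = Re z \<and> cmod z * sin (Arg z) = Im z"
  proof (cases "z = 0")
    case False
    have "z = of_real (cmod z) * exp (\<i> * of_real (Arg z))" using Arg_eq[OF False] by simp
    then have "Re z = Re (of_real (cmod z) * exp (\<i> * of_real (Arg z)))" "Im z = Im (of_real (cmod z) * exp (\<i> * of_real (Arg z)))"
      by simp_all
    then show ?thesis by (simp add: Re_exp Im_exp)
  qed simp
  then show ?thesis
    by (simp add: vec_eq_iff forall_3 unpolar_def c[symmetric] z_def[symmetric]) (simp add: z_def)
qed

lemma has_derivative_nth [derivative_intros]:
  "(f has_derivative f') F \<Longrightarrow> ((\<lambda>y. f y $ i) has_derivative (\<lambda>v. f' v $ i)) F"
  by (rule bounded_linear.has_derivative[OF bounded_linear_vec_nth])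

lemma smooth_on_polar: "smooth_on UNIV polar"
proof (rule smooth_on_cart[OF open_UNIV])
  fix i :: 3
  have n: "smooth_on UNIV (\<lambda>y::real^3. y $ k)" for k
    by (rule smooth_on_linear[OF bounded_linear_vec_nth open_UNIV])
  consider "i = 1" | "i = 2" | "i = 3" using exhaust_3 by blast
  then show "smooth_on UNIV (\<lambda>y. polar y $ i)"
    by cases (simp_all add: n smooth_on_mult smooth_on_cos smooth_on_sin)
qed

lemma jacobian_polar: "jacobian polar (at y) = rot (y $ 2) ** diag3 (y $ 1)"
proof -
  have d: "polar differentiable (at y)" by (rule smooth_on_differentiable[OF smooth_on_polar UNIV_I])
  have j: "jacobian polar (at y) $ i $ k = D (axis k 1)" if "((\<lambda>y. polar y $ i) has_derivative D) (at y)" for i k D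
    using frechet_derivative_nth[OF d, of i "axis k 1"] frechet_derivative_at[OF that] by (simp add: jacobian_nth)
  have 1: "((\<lambda>y. polar y $ 1) has_derivative (\<lambda>v. y $ 1 * (- sin (y $ 2) * v $ 2) + v $ 1 * cos (y $ 2))) (at y)"
    by (auto intro!: derivative_eq_intros simp: fun_eq_iff)
  have 2: "((\<lambda>y. polar y $ 2) has_derivative (\<lambda>v. y $ 1 * (cos (y $ 2) * v $ 2) + v $ 1 * sin (y $ 2))) (at y)"
    by (auto intro!: derivative_eq_intros simp: fun_eq_iff)
  have 3: "((\<lambda>y. polar y $ 3) has_derivative (\<lambda>v. v $ 3)) (at y)"
    by (auto intro!: derivative_eq_intros)
  show ?thesis
    by (simp add: vec_eq_iff forall_3 j[OF 1] j[OF 2] j[OF 3] matrix_matrix_mult_def sum_3 rot_def diag3_def axis_def)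
qed

lemma det_jacobian_polar: "det (jacobian polar (at y)) = y $ 1"
  by (simp add: jacobian_polar det_mul det_rot) (simp add: det_3 diag3_def)

text \<open>\<open>off_axis\<close> keeps the distance from the axis positive throughout \<Omega>,
  so that this distance and e_r are smooth there.\<close>

locale meridional =
  fixes \<Omega> :: "(real^3) set"
  assumes open_\<Omega>: "open \<Omega>" and axi_\<Omega>: "axisymmetric_set \<Omega>"
    and off_axis: "\<And>x. x \<in> \<Omega> \<Longrightarrow> (x $ 1)\<^sup>2 + (x $ 2)\<^sup>2 > 0"
begin

abbreviation "P \<equiv> meridian \<Omega>"

lemma cyl_in_iff: "cyl r t z \<in> \<Omega> \<longleftrightarrow> cyl r t' z \<in> \<Omega>"
  using axi_\<Omega> by (auto simp: axisymmetric_set_def)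

lemma meridian_iff: "p \<in> P \<longleftrightarrow> p $ 1 > 0 \<and> cyl (p $ 1) t (p $ 2) \<in> \<Omega>"
  using cyl_in_iff[of "p $ 1" 0 "p $ 2" t] by (simp add: meridian_def cyl_def)

lemma open_meridian: "open P"
proof -
  have "P = {p. 0 < p $ 1} \<inter> (\<lambda>p. join (p, 0)) -` \<Omega>"
    by (auto simp: meridian_def join_def)
  moreover have "open ((\<lambda>p. join (p, 0)) -` \<Omega>)"
    by (rule open_vimage[OF open_\<Omega>]) (intro continuous_intros)
  ultimately show ?thesis by (simp add: open_Int open_Collect_less continuous_intros)
qed

sublocale slab P "- pi" pi
  by unfold_locales (use open_meridian in auto)

text \<open>The domain slit along the half-plane on which the angle jumps; it is the diffeomorphic
  image of \<open>D\<close> under \<open>polar\<close>.\<close>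

definition \<Omega>s where "\<Omega>s = \<Omega> - {x. x $ 2 = 0 \<and> x $ 1 \<le> 0}"

lemma D_iff: "y \<in> D \<longleftrightarrow> y $ 1 > 0 \<and> polar y \<in> \<Omega> \<and> - pi < y $ 2 \<and> y $ 2 < pi"
  unfolding D_def polar_def using meridian_iff[of "merid y" "y $ 2"] by auto

lemma open_\<Omega>s: "open \<Omega>s"
proof -
  have "closed {x::real^3. x $ 2 = 0 \<and> x $ 1 \<le> 0}"
    by (intro closed_Collect_conj closed_Collect_eq closed_Collect_le continuous_intros)
  then show ?thesis unfolding \<Omega>s_def by (intro open_Diff open_\<Omega>)
qed

lemma polar_diffeo: "smooth_diffeo D \<Omega>s polar unpolar"
proof (rule smooth_diffeoI[OF open_D open_\<Omega>s smooth_on_subset[OF smooth_on_polar subset_UNIV]])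
  show "polar ` D \<subseteq> \<Omega>s"
  proof (rule image_subsetI)
    fix y assume y: "y \<in> D"
    have "\<not> (y $ 1 * sin (y $ 2) = 0 \<and> y $ 1 * cos (y $ 2) \<le> 0)"
    proof
      assume a: "y $ 1 * sin (y $ 2) = 0 \<and> y $ 1 * cos (y $ 2) \<le> 0"
      then have s: "sin (y $ 2) = 0" and c: "cos (y $ 2) \<le> 0"
        using y by (auto simp: D_iff mult_le_0_iff)
      have "y $ 2 = 0"
      proof (rule ccontr)
        assume "y $ 2 \<noteq> 0"
        then consider "0 < y $ 2" "y $ 2 < pi" | "0 < - y $ 2" "- y $ 2 < pi" using y by (auto simp: D_iff) linarith
        then show False using s sin_gt_zero[of "y $ 2"] sin_gt_zero[of "- y $ 2"] by cases auto
      qed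
      then show False using c by simp
    qed
    then show "polar y \<in> \<Omega>s" using y by (simp add: \<Omega>s_def D_iff)
  qed
  show "unpolar ` \<Omega>s \<subseteq> D"
  proof (rule image_subsetI)
    fix x assume x: "x \<in> \<Omega>s"
    then have "x \<in> \<Omega>" by (simp add: \<Omega>s_def)
    have r: "unpolar x $ 1 > 0" using off_axis[OF \<open>x \<in> \<Omega>\<close>] by (simp add: unpolar_def)
    have "Arg (Complex (x $ 1) (x $ 2)) \<noteq> pi" using x by (auto simp: \<Omega>s_def Arg_eq_pi)
    then have "- pi < unpolar x $ 2" "unpolar x $ 2 < pi"
      using mpi_less_Arg Arg_le_pi by (auto simp: unpolar_def order.not_eq_order_implies_strict)
    then show "unpolar x \<in> D" using r \<open>x \<in> \<Omega>\<close> by (simp add: D_iff polar_unpolar)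
  qed
qed (auto simp: D_iff unpolar_polar polar_unpolar det_jacobian_polar)

lemma negligible_slit: "negligible (\<Omega> - \<Omega>s)"
proof -
  have "negligible {x::real^3. x $ 2 = 0}"
    using negligible_hyperplane[of "axis 2 (1::real) :: real^3" 0] by (simp add: inner_axis' axis_eq_0_iff)
  then show ?thesis by (rule negligible_subset) (auto simp: \<Omega>s_def)
qed

lemma AE_polar: "(AE x in lebesgue_on \<Omega>. Q x) \<longleftrightarrow> (AE y in lebesgue_on D. Q (polar y))"
proof -
  have "negligible {x \<in> \<Omega>. \<not> Q x} \<longleftrightarrow> negligible {x \<in> \<Omega>s. \<not> Q x}"
  proof
    assume "negligible {x \<in> \<Omega>. \<not> Q x}"
    then show "negligible {x \<in> \<Omega>s. \<not> Q x}" by (rule negligible_subset) (auto simp: \<Omega>s_def)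
  next
    assume "negligible {x \<in> \<Omega>s. \<not> Q x}"
    then have "negligible ({x \<in> \<Omega>s. \<not> Q x} \<union> (\<Omega> - \<Omega>s))" using negligible_slit by (rule negligible_Un)
    then show "negligible {x \<in> \<Omega>. \<not> Q x}" by (rule negligible_subset) auto
  qed
  then have "(AE x in lebesgue_on \<Omega>. Q x) \<longleftrightarrow> (AE x in lebesgue_on \<Omega>s. Q x)"
    by (simp only: AE_lebesgue_on_iff[OF open_lebesgue[OF open_\<Omega>]] AE_lebesgue_on_iff[OF open_lebesgue[OF open_\<Omega>s]])
  then show ?thesis using diffeo_AE[OF polar_diffeo] by blast
qed

text \<open>The weight is the Jacobian determinant r of \<open>polar\<close>. The integrand is set
  to zero on the slit, which is a null set, so that the diffeomorphism onto the slit domain can be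
  used.\<close>

lemma LINT_polar:
  fixes F :: "real^3 \<Rightarrow> real"
  shows "(LINT x|lebesgue_on \<Omega>. F x) = (LINT y|lebesgue_on D. y $ 1 * F (polar y))"
    and "integrable (lebesgue_on \<Omega>) F \<longleftrightarrow> integrable (lebesgue_on D) (\<lambda>y. y $ 1 * F (polar y))"
proof -
  define F' where "F' x = (if x \<in> \<Omega>s then F x else 0)" for x
  have ae: "AE x in lebesgue_on \<Omega>. F x = F' x"
    using negligible_slit by (subst AE_lebesgue_on_iff[OF open_lebesgue[OF open_\<Omega>]])
      (auto simp: F'_def elim!: negligible_subset)
  have "(LINT x|lebesgue_on \<Omega>. F x) = (LINT x|lebesgue_on \<Omega>. F' x)"
    by (rule lebesgue_on_integral_cong_AE(1)[OF open_lebesgue[OF open_\<Omega>] ae])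
  also have "\<dots> = (LINT x|lebesgue_on \<Omega>s. F' x)"
    by (rule lebesgue_on_integral_support(1)) (auto simp: F'_def \<Omega>s_def open_\<Omega> open_\<Omega>s[unfolded \<Omega>s_def])
  also have "\<dots> = (LINT y|lebesgue_on D. det (jacobian polar (at y)) * F' (polar y))"
    by (rule diffeo_change_of_variables(2)[OF polar_diffeo])
  also have "\<dots> = (LINT y|lebesgue_on D. y $ 1 * F (polar y))"
    by (rule Bochner_Integration.integral_cong[OF refl])
      (use diffeo_props(11)[OF polar_diffeo] in \<open>auto simp: det_jacobian_polar F'_def\<close>)
  finally show "(LINT x|lebesgue_on \<Omega>. F x) = (LINT y|lebesgue_on D. y $ 1 * F (polar y))" .
  have "integrable (lebesgue_on \<Omega>) F \<longleftrightarrow> integrable (lebesgue_on \<Omega>) F'"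
    by (rule lebesgue_on_integral_cong_AE(2)[OF open_lebesgue[OF open_\<Omega>] ae])
  also have "\<dots> \<longleftrightarrow> integrable (lebesgue_on \<Omega>s) F'"
    by (rule lebesgue_on_integral_support(2)) (auto simp: F'_def \<Omega>s_def open_\<Omega> open_\<Omega>s[unfolded \<Omega>s_def])
  also have "\<dots> \<longleftrightarrow> integrable (lebesgue_on D) (\<lambda>y. det (jacobian polar (at y)) * F' (polar y))"
    by (rule diffeo_change_of_variables(1)[OF polar_diffeo])
  also have "\<dots> \<longleftrightarrow> integrable (lebesgue_on D) (\<lambda>y. y $ 1 * F (polar y))"
    by (rule Bochner_Integration.integrable_cong[OF refl])
      (use diffeo_props(11)[OF polar_diffeo] in \<open>auto simp: det_jacobian_polar F'_def\<close>)
  finally show "integrable (lebesgue_on \<Omega>) F \<longleftrightarrow> integrable (lebesgue_on D) (\<lambda>y. y $ 1 * F (polar y))" .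
qed

lemma is_weak_D_subset:
  fixes u :: "real^3 \<Rightarrow> real^3"
  assumes "is_weak_D \<Omega> u A" shows "is_weak_D \<Omega>s u A"
proof -
  have s: "\<Omega>s \<subseteq> \<Omega>" by (auto simp: \<Omega>s_def)
  have l: "locally_integrable \<Omega>s u" "locally_integrable \<Omega>s A"
    using assms s by (auto simp: is_weak_D_def locally_integrable_def)
  have red: "(LINT x|lebesgue_on \<Omega>s. F x) = (LINT x|lebesgue_on \<Omega>. F x)" if "\<And>x. x \<notin> \<Omega>s \<Longrightarrow> F x = 0" for F :: "real^3 \<Rightarrow> real"
    by (rule lebesgue_on_integral_support(1)[symmetric]) (use open_\<Omega> open_\<Omega>s s that in auto)
  have "- (LINT x|lebesgue_on \<Omega>s. u x $ i * frechet_derivative \<phi> (at x) (axis j 1)) = (LINT x|lebesgue_on \<Omega>s. A x $ i $ j * \<phi> x)"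
    if \<phi>: "test_function \<Omega>s \<phi>" for \<phi> i j
  proof -
    have t: "test_function \<Omega> \<phi>" using \<phi> s unfolding test_function_def by blast
    have z: "\<phi> x = 0" "frechet_derivative \<phi> (at x) v = 0" if "x \<notin> \<Omega>s" for x v
    proof -
      have "\<exists>K. compact K \<and> K \<subseteq> \<Omega>s \<and> (\<forall>x. x \<notin> K \<longrightarrow> \<psi> x = 0)" if "test_function \<Omega>s \<psi>" for \<psi> :: "real^3 \<Rightarrow> real"
        using that by (simp add: test_function_def)
      then show "\<phi> x = 0" "frechet_derivative \<phi> (at x) v = 0"
        using \<phi> test_function_frechet_derivative[OF \<phi>, of v] that by blast+
    qed
    show ?thesis using is_weak_D_D[OF assms t, of i j] by (simp add: red z)
  qed
  then show ?thesis using l by (simp add: is_weak_D_def distr_eq_def distr_partial_def regular_distr_def)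
qed

text \<open>Weak differentiability of \<open>v\<close> is a conclusion here. Combining the Cartesian
  components of u \<circ> polar with cos and sin gives the components along e_r, e_\<theta> and e_z,
  which are \<open>v $ 1\<close>, zero and \<open>v $ 2\<close>; all of them inherit weak
  derivatives from \<open>u\<close>, and \<open>weak_partial_slab\<close> brings these down to the
  half-plane.\<close>

lemma axisymmetric_structure:
  fixes u :: "real^3 \<Rightarrow> real^3" and v :: "real^2 \<Rightarrow> real^2"
  assumes uA: "is_weak_D \<Omega> u A" and rep: "meridian_rep \<Omega> u v"
  obtains B where "is_weak_D P v B" "B \<in> borel_measurable borel"
    "AE y in lebesgue_on D. A (polar y) = rot (y $ 2) ** frame (B (merid y)) (v (merid y) $ 1 / y $ 1) ** transpose (rot (y $ 2))"
proof -
  define U where "U y = u (polar y)" for y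
  define E where "E y = A (polar y) ** jacobian polar (at y)" for y
  have wU: "is_weak_D D U E" unfolding U_def[abs_def] E_def[abs_def]
    by (rule is_weak_D_diffeo[OF polar_diffeo is_weak_D_subset[OF uA]])
  then have wp: "weak_partial D (\<lambda>y. U y $ i) j (\<lambda>y. E y $ i $ j)" for i j
    by (simp add: is_weak_D_iff_weak_partial)
  have Uv: "AE y in lebesgue_on D. U y = v (merid y) $ 1 *\<^sub>R e_r (y $ 2) + v (merid y) $ 2 *\<^sub>R e_z"
  proof -
    have "AE y in lebesgue_on D. \<forall>r>0. \<forall>\<theta> z. polar y = cyl r \<theta> z \<longrightarrow>
        u (polar y) = v (vector [r, z]) $ 1 *\<^sub>R e_r \<theta> + v (vector [r, z]) $ 2 *\<^sub>R e_z"
      using rep unfolding meridian_rep_def AE_polar .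
    then show ?thesis using AE_space
    proof eventually_elim
      case (elim y)
      then have "y $ 1 > 0" by (simp add: D_iff)
      then show ?case using elim(1) by (simp add: U_def polar_def merid_def)
    qed
  qed
  have n2: "smooth_on D (\<lambda>y::real^3. y $ 2)" by (rule smooth_on_linear[OF bounded_linear_vec_nth open_D])
  have sc: "smooth_on D (\<lambda>y. cos (y $ 2))" "smooth_on D (\<lambda>y. sin (y $ 2))" "smooth_on D (\<lambda>y. - sin (y $ 2))"
    by (intro smooth_on_cos smooth_on_sin smooth_on_minus n2 open_D)+
  have dc: "frechet_derivative (\<lambda>y::real^3. cos (y $ 2)) (at y) (axis j 1) = (if j = 2 then - sin (y $ 2) else 0)"
    "frechet_derivative (\<lambda>y::real^3. sin (y $ 2)) (at y) (axis j 1) = (if j = 2 then cos (y $ 2) else 0)"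
    "frechet_derivative (\<lambda>y::real^3. - sin (y $ 2)) (at y) (axis j 1) = (if j = 2 then - cos (y $ 2) else 0)" for y j
  proof -
    have 1: "((\<lambda>y::real^3. cos (y $ 2)) has_derivative (\<lambda>v. - sin (y $ 2) * v $ 2)) (at y)"
      and 2: "((\<lambda>y::real^3. sin (y $ 2)) has_derivative (\<lambda>v. cos (y $ 2) * v $ 2)) (at y)"
      and 3: "((\<lambda>y::real^3. - sin (y $ 2)) has_derivative (\<lambda>v. - (cos (y $ 2) * v $ 2))) (at y)"
      by (auto intro!: derivative_eq_intros)
    show "frechet_derivative (\<lambda>y::real^3. cos (y $ 2)) (at y) (axis j 1) = (if j = 2 then - sin (y $ 2) else 0)"
      "frechet_derivative (\<lambda>y::real^3. sin (y $ 2)) (at y) (axis j 1) = (if j = 2 then cos (y $ 2) else 0)"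
      "frechet_derivative (\<lambda>y::real^3. - sin (y $ 2)) (at y) (axis j 1) = (if j = 2 then - cos (y $ 2) else 0)"
      by (auto simp: frechet_derivative_at[OF 1, symmetric] frechet_derivative_at[OF 2, symmetric]
          frechet_derivative_at[OF 3, symmetric] axis_def)
  qed
  \<comment> \<open>\<open>C1\<close> and \<open>C2\<close> are the first two rows of
    \<open>transpose R ** E\<close> plus what the product rule adds in direction \<theta>. In
    \<open>C1\<close> this addition is the vanishing angular component, in \<open>C2\<close> it is
    minus the radial component.\<close>
  define C1 where "C1 j y = (cos (y $ 2) * E y $ 1 $ j + (if j = 2 then - sin (y $ 2) else 0) * U y $ 1) +
    (sin (y $ 2) * E y $ 2 $ j + (if j = 2 then cos (y $ 2) else 0) * U y $ 2)" for j y
  define C2 where "C2 j y = (- sin (y $ 2) * E y $ 1 $ j + (if j = 2 then - cos (y $ 2) else 0) * U y $ 1) +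
    (cos (y $ 2) * E y $ 2 $ j + (if j = 2 then - sin (y $ 2) else 0) * U y $ 2)" for j y
  have p1: "weak_partial D (\<lambda>y. cos (y $ 2) * U y $ 1 + sin (y $ 2) * U y $ 2) j (C1 j)" for j
    using weak_partial_add[OF open_D weak_partial_mult_smooth[OF open_D wp sc(1), of 1 j]
        weak_partial_mult_smooth[OF open_D wp sc(2), of 2 j]]
    unfolding dc C1_def[abs_def] .
  have p2: "weak_partial D (\<lambda>y. - sin (y $ 2) * U y $ 1 + cos (y $ 2) * U y $ 2) j (C2 j)" for j
    using weak_partial_add[OF open_D weak_partial_mult_smooth[OF open_D wp sc(3), of 1 j]
        weak_partial_mult_smooth[OF open_D wp sc(1), of 2 j]]
    unfolding dc C2_def[abs_def] .
  have cs: "cos t * (a * cos t) + sin t * (a * sin t) = a" for a t :: real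
  proof -
    have "cos t * (a * cos t) + sin t * (a * sin t) = a * ((cos t)\<^sup>2 + (sin t)\<^sup>2)"
      by (simp only: power2_eq_square distrib_left mult_ac)
    then show ?thesis by simp
  qed
  have q1: "weak_partial D (\<lambda>y. v (merid y) $ 1) j (C1 j)" for j
  proof (rule weak_partial_cong_AE[OF open_D _ _ p1])
    show "AE y in lebesgue_on D. cos (y $ 2) * U y $ 1 + sin (y $ 2) * U y $ 2 = v (merid y) $ 1"
      using Uv by (rule eventually_mono) (simp add: e_r_def e_z_def cs)
  qed simp
  \<comment> \<open>The component along e_\<theta> vanishes, so \<open>C2\<close> vanishes; this
    determines the second row, and its middle entry is \<open>v $ 1\<close>.\<close>
  have q2: "weak_partial D (\<lambda>y. 0) j (C2 j)" for j
  proof (rule weak_partial_cong_AE[OF open_D _ _ p2])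
    show "AE y in lebesgue_on D. - sin (y $ 2) * U y $ 1 + cos (y $ 2) * U y $ 2 = 0"
      using Uv by (rule eventually_mono) (simp add: e_r_def e_z_def)
  qed simp
  have q3: "weak_partial D (\<lambda>y. v (merid y) $ 2) j (\<lambda>y. E y $ 3 $ j)" for j
  proof (rule weak_partial_cong_AE[OF open_D _ _ wp])
    show "AE y in lebesgue_on D. U y $ 3 = v (merid y) $ 2"
      using Uv by (rule eventually_mono) (simp add: e_r_def e_z_def)
  qed simp
  have zero: "weak_partial D (\<lambda>y. 0) j (\<lambda>y. 0)" for j
    by (simp add: weak_partial_def locally_integrable_continuous[OF continuous_on_const])
  have C20: "AE y in lebesgue_on D. C2 j y = 0" for j by (rule weak_partial_unique[OF open_D q2 zero])
  obtain B11 B12 where B1: "weak_partial P (\<lambda>p. v p $ 1) 1 B11" "weak_partial P (\<lambda>p. v p $ 1) 2 B12"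
    "AE x in lebesgue_on D. C1 1 x = B11 (merid x)" "AE x in lebesgue_on D. C1 2 x = 0"
    "AE x in lebesgue_on D. C1 3 x = B12 (merid x)" "B11 \<in> borel_measurable borel" "B12 \<in> borel_measurable borel"
    using weak_partial_slab[OF q1] by blast
  obtain B21 B22 where B2: "weak_partial P (\<lambda>p. v p $ 2) 1 B21" "weak_partial P (\<lambda>p. v p $ 2) 2 B22"
    "AE x in lebesgue_on D. E x $ 3 $ 1 = B21 (merid x)" "AE x in lebesgue_on D. E x $ 3 $ 2 = 0"
    "AE x in lebesgue_on D. E x $ 3 $ 3 = B22 (merid x)" "B21 \<in> borel_measurable borel" "B22 \<in> borel_measurable borel"
    using weak_partial_slab[OF q3] by blast
  define B :: "real^2 \<Rightarrow> real^2^2" where "B p = vector [vector [B11 p, B12 p], vector [B21 p, B22 p]]" for p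
  have "is_weak_D P v B"
    unfolding is_weak_D_iff_weak_partial using B1 B2 by (simp add: forall_2 B_def)
  moreover have "B \<in> borel_measurable borel"
  proof -
    have "B = (\<lambda>p. B11 p *\<^sub>R vector [vector [1, 0], vector [0, 0]] + B12 p *\<^sub>R vector [vector [0, 1], vector [0, 0]] +
        (B21 p *\<^sub>R vector [vector [0, 0], vector [1, 0]] + B22 p *\<^sub>R vector [vector [0, 0], vector [0, 1]]))"
      by (simp add: fun_eq_iff vec_eq_iff forall_2 B_def)
    moreover have "\<dots> \<in> borel_measurable borel"
      using B1 B2 by (intro borel_measurable_add borel_measurable_scaleR) auto
    ultimately show ?thesis by simp
  qed
  moreover have "AE y in lebesgue_on D. A (polar y) = rot (y $ 2) ** frame (B (merid y)) (v (merid y) $ 1 / y $ 1) ** transpose (rot (y $ 2))"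
    using B1(3-5) B2(3-5) C20[of 1] C20[of 2] C20[of 3] Uv AE_space
  proof eventually_elim
    case (elim y)
    have r: "y $ 1 > 0" using elim by (simp add: D_iff)
    define R where "R = rot (y $ 2)"
    define N where "N = frame (B (merid y)) (v (merid y) $ 1)"
    have "transpose R ** E y = N"
      using elim(1-10) cs[of "y $ 2" "v (merid y) $ 1"]
      by (simp add: vec_eq_iff forall_3 matrix_matrix_mult_def sum_3 transpose_def R_def rot_def N_def frame_def B_def
          C1_def C2_def e_r_def e_z_def algebra_simps)
    then have "R ** (transpose R ** E y) = R ** N" by simp
    then have EN: "E y = R ** N" by (simp add: matrix_mul_assoc R_def rot_orthogonal)
    have di: "diag3 (y $ 1) ** diag3 (1 / y $ 1) = mat 1"
      using r by (simp add: vec_eq_iff forall_3 matrix_matrix_mult_def sum_3 diag3_def mat_def)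
    have Nd: "N ** diag3 (1 / y $ 1) = frame (B (merid y)) (v (merid y) $ 1 / y $ 1)"
      by (simp add: vec_eq_iff forall_3 matrix_matrix_mult_def sum_3 diag3_def N_def frame_def)
    \<comment> \<open>Since \<open>E\<close> is A times the Jacobian of \<open>polar\<close>,
      multiplication by the inverse of that Jacobian recovers A; the scaling by 1/r turns the middle
      entry into \<open>v $ 1 / r\<close>.\<close>
    have "A (polar y) = A (polar y) ** (R ** (diag3 (y $ 1) ** diag3 (1 / y $ 1)) ** transpose R)"
      by (simp add: di R_def rot_orthogonal)
    also have "\<dots> = E y ** diag3 (1 / y $ 1) ** transpose R"
      by (simp add: E_def jacobian_polar R_def matrix_mul_assoc)
    also have "\<dots> = R ** (N ** diag3 (1 / y $ 1)) ** transpose R" by (simp add: EN matrix_mul_assoc)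
    finally show ?case unfolding Nd R_def .
  qed
  ultimately show thesis by (rule that)
qed

end

section \<open>Growth of the energy density\<close>

lemma energy_density_growth:
  assumes H: "energy_density_assms H"
  obtains C where "C > 0" "\<And>t. t > 0 \<Longrightarrow> \<bar>t * deriv H t\<bar> \<le> C * (1 + H t)"
proof -
  have pos: "H t \<ge> 0" if "t > 0" for t using H that by (simp add: energy_density_assms_def)
  have der: "(H has_real_derivative deriv H t) (at t)" if "t > 0" for t
    using H that by (simp add: energy_density_assms_def DERIV_deriv_iff_real_differentiable)
  have cont: "continuous_on {0<..} (deriv H)" using H by (simp add: energy_density_assms_def)
  obtain s c1 c2 d0 where 1: "s > 0" "c1 > 0" "c2 > 0" "d0 > 0"
    "\<forall>k\<in>{0, 1::nat}. \<forall>t. 0 < t \<and> t < d0 \<longrightarrow>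
        c1 * t powr (- s - real k) \<le> (-1) ^ k * (deriv ^^ k) H t \<and>
        (-1) ^ k * (deriv ^^ k) H t \<le> c2 * t powr (- s - real k)"
    using H[unfolded energy_density_assms_def, THEN conjunct2, THEN conjunct2, THEN conjunct2, THEN conjunct2,
        THEN conjunct2, THEN conjunct2, THEN conjunct1]
    by (elim exE conjE) (rule that; assumption)
  obtain \<tau> c3 c4 d1 where 2: "\<tau> > 0" "c3 > 0" "c4 > 0" "d1 > 0"
    "\<forall>t\<ge>d1. c3 * t powr (\<tau> + 1) \<le> deriv H t \<and> deriv H t \<le> c4 * t powr (\<tau> + 1)"
    using H[unfolded energy_density_assms_def, THEN conjunct2, THEN conjunct2, THEN conjunct2, THEN conjunct2,
        THEN conjunct2, THEN conjunct2, THEN conjunct2]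
    by (elim exE conjE) (rule that; assumption)
  \<comment> \<open>Near 0 both H(t) and t H'(t) are comparable to t^(-s), so their quotient is
    bounded by the quotient of the constants.\<close>
  have near: "\<bar>t * deriv H t\<bar> \<le> c2 / c1 * H t" if t: "0 < t" "t < d0" for t
  proof -
    have a: "c1 * t powr (- s) \<le> H t" using 1(5)[rule_format, of 0 t] t by simp
    have b: "c1 * t powr (- s - 1) \<le> - deriv H t" "- deriv H t \<le> c2 * t powr (- s - 1)"
      using 1(5)[rule_format, of 1 t] t by simp_all
    have "0 \<le> c1 * t powr (- s - 1)" using 1 by simp
    then have "\<bar>t * deriv H t\<bar> = t * (- deriv H t)" using b(1) t by (simp add: abs_mult)
    also have "\<dots> \<le> t * (c2 * t powr (- s - 1))" using b(2) t by (intro mult_left_mono) auto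
    also have "\<dots> = c2 * t powr (- s)" using t by (simp add: powr_diff)
    also have "\<dots> = c2 / c1 * (c1 * t powr (- s))" using 1 by simp
    also have "\<dots> \<le> c2 / c1 * H t" using 1 a by (intro mult_left_mono) auto
    finally show ?thesis .
  qed
  \<comment> \<open>Only H' is bounded from both sides at infinity. The mean value theorem on
    [t/2, t] turns its lower bound into one for H of order t^(\<tau>+2), and the threshold
    \<open>2 * d1\<close> keeps t/2 in the admissible range.\<close>
  have far: "\<bar>t * deriv H t\<bar> \<le> c4 * 2 powr (\<tau> + 2) / c3 * H t" if t: "t \<ge> 2 * d1" for t
  proof -
    have t0: "t > 0" "t / 2 \<ge> d1" "t / 2 < t" using t 2(4) by auto
    have "\<exists>z. t / 2 < z \<and> z < t \<and> H t - H (t / 2) = (t - t / 2) * deriv H z"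
      by (rule MVT2) (use t0 der in auto)
    then obtain z where z: "t / 2 < z" "z < t" "H t - H (t / 2) = (t / 2) * deriv H z" by auto
    have "c3 * (t / 2) powr (\<tau> + 1) \<le> c3 * z powr (\<tau> + 1)"
      using 2 z t0 by (intro mult_left_mono powr_mono2) auto
    also have "\<dots> \<le> deriv H z" using 2(5) z t0 by auto
    finally have "(t / 2) * (c3 * (t / 2) powr (\<tau> + 1)) \<le> (t / 2) * deriv H z"
      using t0 by (intro mult_left_mono) auto
    also have "\<dots> \<le> H t" using z(3) pos[of "t / 2"] t0 by simp
    finally have "c3 * ((t / 2) * (t / 2) powr (\<tau> + 1)) \<le> H t" by (simp only: mult.left_commute)
    moreover have "(t / 2) * (t / 2) powr (\<tau> + 1) = (t / 2) powr (\<tau> + 2)"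
      using t0 powr_add[of "t / 2" 1 "\<tau> + 1"] by (simp add: add.commute)
    moreover have "(t / 2) powr (\<tau> + 2) = t powr (\<tau> + 2) / 2 powr (\<tau> + 2)"
      using t0 by (simp add: powr_divide)
    ultimately have low: "c3 * (t powr (\<tau> + 2) / 2 powr (\<tau> + 2)) \<le> H t" by (simp only:)
    have d: "0 \<le> deriv H t" "deriv H t \<le> c4 * t powr (\<tau> + 1)"
    proof -
      have "0 \<le> c3 * t powr (\<tau> + 1)" using 2 by simp
      also have "\<dots> \<le> deriv H t" using 2(5) t0 by auto
      finally show "0 \<le> deriv H t" .
      show "deriv H t \<le> c4 * t powr (\<tau> + 1)" using 2(5) t0 by auto
    qed
    have "\<bar>t * deriv H t\<bar> = t * deriv H t" using d t0 by simp
    also have "\<dots> \<le> t * (c4 * t powr (\<tau> + 1))" using d t0 by (intro mult_left_mono) auto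
    also have "\<dots> = c4 * t powr (\<tau> + 2)" using t0 powr_add[of t 1 "\<tau> + 1"] by (simp add: add.commute)
    also have "\<dots> = c4 * 2 powr (\<tau> + 2) / c3 * (c3 * (t powr (\<tau> + 2) / 2 powr (\<tau> + 2)))" using 2 by simp
    also have "\<dots> \<le> c4 * 2 powr (\<tau> + 2) / c3 * H t" using 2 low by (intro mult_left_mono) auto
    finally show ?thesis .
  qed
  \<comment> \<open>In the middle range compactness gives a bound; the lower end d0/2 makes this
    range overlap with the one near 0.\<close>
  have "continuous_on {d0 / 2..2 * d1} (\<lambda>t. t * deriv H t)"
    by (intro continuous_intros continuous_on_subset[OF cont]) (use 1 in auto)
  then have "compact ((\<lambda>t. t * deriv H t) ` {d0 / 2..2 * d1})" by (rule compact_continuous_image) auto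
  then obtain M where M: "\<And>t. t \<in> {d0 / 2..2 * d1} \<Longrightarrow> \<bar>t * deriv H t\<bar> \<le> M"
    using compact_imp_bounded bounded_iff by (metis (no_types, lifting) imageI real_norm_def)
  define C where "C = \<bar>M\<bar> + c2 / c1 + c4 * 2 powr (\<tau> + 2) / c3"
  have C: "C > 0" "c2 / c1 \<le> C" "c4 * 2 powr (\<tau> + 2) / c3 \<le> C" "M \<le> C"
  proof -
    have "c2 / c1 > 0" "c4 * 2 powr (\<tau> + 2) / c3 > 0" using 1 2 by simp_all
    then show "C > 0" "c2 / c1 \<le> C" "c4 * 2 powr (\<tau> + 2) / c3 \<le> C" "M \<le> C"
      unfolding C_def by linarith+
  qed
  have "\<bar>t * deriv H t\<bar> \<le> C * (1 + H t)" if t: "t > 0" for t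
  proof -
    have le: "\<bar>t * deriv H t\<bar> \<le> C * (1 + H t)" if "\<bar>t * deriv H t\<bar> \<le> k * H t" "k \<le> C" for k
    proof -
      have "k * H t \<le> C * H t" using that pos[OF t] by (intro mult_right_mono) auto
      also have "\<dots> \<le> C * (1 + H t)" using C by (simp add: distrib_left)
      finally show ?thesis using that by linarith
    qed
    consider "t < d0" | "t \<ge> 2 * d1" | "t \<in> {d0 / 2..2 * d1}" using 1(4) t by fastforce
    then show ?thesis
    proof cases
      case 1 then show ?thesis using near[OF t] le C by blast
    next
      case 2 then show ?thesis using far le C by blast
    next
      case 3
      have "0 \<le> C * H t" using C pos[OF t] by simp
      then have "M \<le> C * (1 + H t)" using C unfolding distrib_left by linarith
      then show ?thesis using M[OF 3] by linarith
    qed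
  qed
  then show thesis using that C(1) by blast
qed

text \<open>A Gronwall estimate: the growth bound says that ln(1 + H(a s)) has slope at most 2C in s
  for s \<ge> 1/2, and the distance from s to 1 is at most 1.\<close>

lemma energy_density_doubling:
  assumes H: "energy_density_assms H" and C: "C > 0" "\<And>t. t > 0 \<Longrightarrow> \<bar>t * deriv H t\<bar> \<le> C * (1 + H t)"
    and a: "a > 0" and s: "1 / 2 \<le> s" "s \<le> 2"
  shows "1 + H (a * s) \<le> exp (2 * C) * (1 + H a)"
proof -
  have pos: "H t \<ge> 0" if "t > 0" for t using H that by (simp add: energy_density_assms_def)
  have der: "(H has_real_derivative deriv H t) (at t)" if "t > 0" for t
    using H that by (simp add: energy_density_assms_def DERIV_deriv_iff_real_differentiable)
  define L where "L s = ln (1 + H (a * s))" for s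
  have dL: "(L has_real_derivative (a * deriv H (a * s)) / (1 + H (a * s))) (at s)" if "s > 0" for s
  proof -
    have "((\<lambda>s. H (a * s)) has_real_derivative deriv H (a * s) * a) (at s)"
      by (rule DERIV_chain2[OF der]) (use a that in \<open>auto intro!: derivative_eq_intros\<close>)
    then show ?thesis unfolding L_def[abs_def]
      using pos[of "a * s"] a that by (auto intro!: derivative_eq_intros simp: divide_inverse mult_ac)
  qed
  have b: "\<bar>(a * deriv H (a * s)) / (1 + H (a * s))\<bar> \<le> 2 * C" if "s \<ge> 1 / 2" for s
  proof -
    have p: "a * s > 0" "s > 0" using a that by auto
    have h: "1 + H (a * s) > 0" using pos[OF p(1)] by simp
    have "s * \<bar>a * deriv H (a * s)\<bar> \<le> C * (1 + H (a * s))"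
      using C(2)[OF p(1)] p a by (simp add: abs_mult mult_ac)
    moreover have "1 / 2 * \<bar>a * deriv H (a * s)\<bar> \<le> s * \<bar>a * deriv H (a * s)\<bar>"
      using that by (intro mult_right_mono) auto
    ultimately have "\<bar>a * deriv H (a * s)\<bar> \<le> 2 * C * (1 + H (a * s))" by linarith
    then show ?thesis using h by (simp add: pos_divide_le_eq)
  qed
  have "L s - L 1 \<le> 2 * C"
  proof (cases s "1::real" rule: linorder_cases)
    case less
    then obtain z where z: "s < z" "z < 1" "L 1 - L s = (1 - s) * ((a * deriv H (a * z)) / (1 + H (a * z)))"
      using MVT2[OF less, of L "\<lambda>s. (a * deriv H (a * s)) / (1 + H (a * s))"] dL s by auto
    have "\<bar>L 1 - L s\<bar> \<le> 1 * (2 * C)" unfolding z(3) abs_mult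
      using b[of z] z s by (intro mult_mono) auto
    then show ?thesis by linarith
  next
    case greater
    then obtain z where z: "1 < z" "z < s" "L s - L 1 = (s - 1) * ((a * deriv H (a * z)) / (1 + H (a * z)))"
      using MVT2[OF greater, of L "\<lambda>s. (a * deriv H (a * s)) / (1 + H (a * s))"] dL by auto
    have "\<bar>L s - L 1\<bar> \<le> 1 * (2 * C)" unfolding z(3) abs_mult
      using b[of z] z s by (intro mult_mono) auto
    then show ?thesis by linarith
  qed (use C in simp)
  then have "exp (L s) \<le> exp (2 * C + L 1)" by simp
  then show ?thesis
    using pos[of "a * s"] pos[OF a] a s by (simp add: L_def exp_add)
qed

text \<open>The increment \<open>t n * \<mu> n\<close> may vanish, so one cannot divide by it.
  Caratheodory's form of the derivative avoids the division.\<close>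

lemma DERIV_sequentially:
  fixes q :: "real \<Rightarrow> real"
  assumes q: "(q has_real_derivative l) (at 1)" and \<mu>: "\<mu> \<longlonglongrightarrow> m" and t: "t \<longlonglongrightarrow> 0" "\<And>n. t n \<noteq> 0"
  shows "(\<lambda>n. (q (1 + t n * \<mu> n) - q 1) / t n) \<longlonglongrightarrow> l * m"
proof -
  obtain h where h: "\<And>z. q z - q 1 = h z * (z - 1)" "isCont h 1" "h 1 = l"
    using q unfolding CARAT_DERIV by blast
  have "(\<lambda>n. 1 + t n * \<mu> n) \<longlonglongrightarrow> 1 + 0 * m" by (intro tendsto_intros t \<mu>)
  then have "(\<lambda>n. h (1 + t n * \<mu> n)) \<longlonglongrightarrow> l"
    using isCont_tendsto_compose[OF h(2)] h(3) by simp
  from tendsto_mult[OF this \<mu>] show ?thesis by (simp add: h(1) t(2))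
qed

section \<open>The energy density along a deformation\<close>

text \<open>The sum of the principal 2x2 minors, that is the quadratic coefficient in the expansion
  of det(I + tY).\<close>

definition minors :: "real^3^3 \<Rightarrow> real" where
  "minors Y = Y$1$1 * Y$2$2 - Y$1$2 * Y$2$1 + (Y$1$1 * Y$3$3 - Y$1$3 * Y$3$1) + (Y$2$2 * Y$3$3 - Y$2$3 * Y$3$2)"

lemma det_identity_plus:
  "det (mat 1 + t *\<^sub>R (Y::real^3^3)) = 1 + t * (trace Y + t * minors Y + t\<^sup>2 * det Y)"
  by (simp add: det_3 trace_def sum_3 minors_def mat_def power2_eq_square algebra_simps)

lemma entry_le_norm: "\<bar>(Y::real^'n^'m) $ i $ j\<bar> \<le> norm Y"
  using component_le_norm_cart[of "Y $ i" j] Finite_Cartesian_Product.norm_nth_le[of Y i] by linarith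

text \<open>The coefficients count products of entries: three entries in the trace, six products of
  two in \<open>minors\<close>, six products of three in the determinant.\<close>

lemma det_expansion_bound:
  assumes "norm (Y::real^3^3) \<le> K" "0 \<le> t" "t \<le> 1"
  shows "\<bar>trace Y + t * minors Y + t\<^sup>2 * det Y\<bar> \<le> 3 * K + 6 * K\<^sup>2 + 6 * K ^ 3"
proof -
  have e: "\<bar>Y $ i $ j\<bar> \<le> K" for i j using entry_le_norm[of Y i j] assms(1) by linarith
  have K: "K \<ge> 0" using e[of 1 1] by linarith
  have p2: "\<bar>Y $ i $ j * Y $ k $ l\<bar> \<le> K\<^sup>2" for i j k l
    unfolding abs_mult power2_eq_square by (intro mult_mono e K abs_ge_zero)
  have p3: "\<bar>Y $ i $ j * Y $ k $ l * Y $ m $ n\<bar> \<le> K ^ 3" for i j k l m n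
  proof -
    have "\<bar>Y $ i $ j * Y $ k $ l * Y $ m $ n\<bar> \<le> K\<^sup>2 * K"
      unfolding abs_mult[of "Y $ i $ j * Y $ k $ l"] by (intro mult_mono p2 e) auto
    then show ?thesis by (simp add: power3_eq_cube power2_eq_square)
  qed
  have "\<bar>trace Y\<bar> \<le> 3 * K"
    using e[of 1 1] e[of 2 2] e[of 3 3] by (simp add: trace_def sum_3)
  moreover have m: "\<bar>minors Y\<bar> \<le> 6 * K\<^sup>2"
    using p2[of 1 1 2 2] p2[of 1 2 2 1] p2[of 1 1 3 3] p2[of 1 3 3 1] p2[of 2 2 3 3] p2[of 2 3 3 2]
    unfolding minors_def by linarith
  moreover have d: "\<bar>det Y\<bar> \<le> 6 * K ^ 3"
    using p3[of 1 1 2 2 3 3] p3[of 1 2 2 3 3 1] p3[of 1 3 2 1 3 2] p3[of 1 1 2 3 3 2] p3[of 1 2 2 1 3 3] p3[of 1 3 2 2 3 1]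
    unfolding det_3 by linarith
  moreover have "\<bar>t * minors Y\<bar> \<le> 1 * (6 * K\<^sup>2)"
    unfolding abs_mult using assms m by (intro mult_mono) auto
  moreover have "\<bar>t\<^sup>2 * det Y\<bar> \<le> 1 * (6 * K ^ 3)"
    unfolding abs_mult using assms d by (intro mult_mono) (auto simp: power_le_one)
  ultimately show ?thesis by linarith
qed

text \<open>The energy density of u \<circ> \<psi> written in the variable y = \<psi>(x) and divided
  by the Jacobian determinant: \<open>A\<close> stands for Du(y) and \<open>F\<close> for D\<psi> at
  the preimage of y.\<close>

definition deformed_density :: "(real \<Rightarrow> real) \<Rightarrow> real^3^3 \<Rightarrow> real^3^3 \<Rightarrow> real" where
  "deformed_density H A F = ((norm (A ** F))\<^sup>2 + H (det A * det F)) / det F"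

lemma norm_mult_identity_plus:
  fixes A Y :: "real^3^3"
  shows "(norm (A ** (mat 1 + t *\<^sub>R Y)))\<^sup>2 = (norm A)\<^sup>2 + t * (2 * (A \<bullet> (A ** Y)) + t * (norm (A ** Y))\<^sup>2)"
proof -
  have "A ** (mat 1 + t *\<^sub>R Y) = A + t *\<^sub>R (A ** Y)"
    by (simp add: vec_eq_iff forall_3 matrix_matrix_mult_def sum_3 mat_def algebra_simps)
  then show ?thesis
    unfolding power2_norm_eq_inner
    by (simp add: inner_add_left inner_add_right inner_commute algebra_simps power2_eq_square)
qed

text \<open>The constants do not depend on \<open>A\<close>: up to the factor t the change is
  controlled by the undeformed density itself. This provides the integrable majorant of the
  difference quotients.\<close>

lemma deformed_density_bound:
  assumes H: "energy_density_assms H" and K: "K > 0"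
  obtains t0 E where "t0 > 0" "t0 \<le> 1" "E > 0"
    "\<And>A Y t. \<lbrakk>0 < t; t \<le> t0; norm Y \<le> K; det A > 0\<rbrakk> \<Longrightarrow> det (mat 1 + t *\<^sub>R Y) > 0 \<and>
      \<bar>deformed_density H A (mat 1 + t *\<^sub>R Y) - ((norm A)\<^sup>2 + H (det A))\<bar> \<le> t * (E * (1 + (norm A)\<^sup>2 + H (det A)))"
proof -
  obtain C where C: "C > 0" "\<And>t. t > 0 \<Longrightarrow> \<bar>t * deriv H t\<bar> \<le> C * (1 + H t)"
    using energy_density_growth[OF H] by blast
  have pos: "H t \<ge> 0" if "t > 0" for t using H that by (simp add: energy_density_assms_def)
  have der: "(H has_real_derivative deriv H t) (at t)" if "t > 0" for t
    using H that by (simp add: energy_density_assms_def DERIV_deriv_iff_real_differentiable)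
  obtain N where N: "N > 0" "\<And>(A::real^3^3) (B::real^3^3). norm (A ** B) \<le> norm A * norm B * N"
    using norm_matrix_mult_bound by blast
  define D where "D = 3 * K + 6 * K\<^sup>2 + 6 * K ^ 3"
  have D: "D > 0"
  proof -
    have "K\<^sup>2 > 0" "K ^ 3 > 0" using K by simp_all
    then show ?thesis using K unfolding D_def by linarith
  qed
  \<comment> \<open>Keeps |t \<mu>| at most 1/2, so det(I + tY) stays in the interval [1/2, 2] where
    the doubling estimate is available.\<close>
  define t0 where "t0 = min 1 (1 / (2 * D))"
  have t0: "t0 > 0" "t0 \<le> 1" "t0 * D \<le> 1 / 2" using D by (auto simp: t0_def min_def field_simps)
  define Q where "Q = 4 * (C + 1) * exp (2 * C)"
  have Q: "Q > 0" using C by (simp add: Q_def)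
  define N2 where "N2 = 2 * (2 * (K * N) + (K * N)\<^sup>2)"
  have N2: "N2 \<ge> 0" using K N by (simp add: N2_def)
  define E where "E = N2 + 2 * D + Q * D"
  have "E > 0"
  proof -
    have "Q * D > 0" using D Q by simp
    then show ?thesis using N2 D unfolding E_def by linarith
  qed
  moreover have "det (mat 1 + t *\<^sub>R Y) > 0 \<and>
      \<bar>deformed_density H A (mat 1 + t *\<^sub>R Y) - ((norm A)\<^sup>2 + H (det A))\<bar> \<le> t * (E * (1 + (norm A)\<^sup>2 + H (det A)))"
    if t: "0 < t" "t \<le> t0" and Y: "norm Y \<le> K" and A: "det A > 0" for A Y :: "real^3^3" and t
  proof -
    define F where "F = mat 1 + t *\<^sub>R Y"
    define \<mu> where "\<mu> = trace Y + t * minors Y + t\<^sup>2 * det Y"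
    define lam where "lam = det F"
    have \<mu>: "\<bar>\<mu>\<bar> \<le> D" unfolding \<mu>_def D_def using Y t t0 by (intro det_expansion_bound) auto
    have l: "lam = 1 + t * \<mu>" unfolding lam_def F_def \<mu>_def by (rule det_identity_plus)
    have tm: "\<bar>t * \<mu>\<bar> \<le> t * D" using \<mu> t by (simp add: abs_mult mult_left_mono)
    have "t * D \<le> t0 * D" using t D by (intro mult_right_mono) auto
    then have l2: "1 / 2 \<le> lam" "lam \<le> 2" using tm t0(3) unfolding l by linarith+
    define a where "a = det A"
    have a: "a > 0" using A by (simp add: a_def)
    \<comment> \<open>The H-part of the density as a function of s = det F alone; the mean value
      theorem between 1 and det F reduces its change to a bound of the derivative.\<close>
    define q where "q s = H (a * s) / s" for s
    have dq: "(q has_real_derivative (a * s * deriv H (a * s) - H (a * s)) / s\<^sup>2) (at s)" if "s > 0" for s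
    proof -
      have "((\<lambda>s. H (a * s)) has_real_derivative deriv H (a * s) * a) (at s)"
        by (rule DERIV_chain2[OF der]) (use a that in \<open>auto intro!: derivative_eq_intros\<close>)
      then show ?thesis unfolding q_def[abs_def]
        using that by (auto intro!: derivative_eq_intros simp: power2_eq_square mult_ac)
    qed
    have bq: "\<bar>(a * s * deriv H (a * s) - H (a * s)) / s\<^sup>2\<bar> \<le> Q * (1 + H a)" if s: "1 / 2 \<le> s" "s \<le> 2" for s
    proof -
      have p: "a * s > 0" using a s by simp
      have "\<bar>a * s * deriv H (a * s) - H (a * s)\<bar> \<le> C * (1 + H (a * s)) + (1 + H (a * s))"
        using C(2)[OF p] pos[OF p] by linarith
      also have "\<dots> = (C + 1) * (1 + H (a * s))" by (simp add: distrib_right)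
      also have "\<dots> \<le> (C + 1) * (exp (2 * C) * (1 + H a))"
        using energy_density_doubling[OF H C a s] C by (intro mult_left_mono) auto
      finally have 1: "\<bar>a * s * deriv H (a * s) - H (a * s)\<bar> \<le> (C + 1) * (exp (2 * C) * (1 + H a))" .
      have "(1 / 2)\<^sup>2 \<le> s\<^sup>2" using s by (intro power_mono) auto
      then have "1 / s\<^sup>2 \<le> 4" using s by (simp add: field_simps power2_eq_square)
      then have "\<bar>a * s * deriv H (a * s) - H (a * s)\<bar> * (1 / s\<^sup>2) \<le> (C + 1) * (exp (2 * C) * (1 + H a)) * 4"
        using 1 C pos[OF a] by (intro mult_mono) auto
      moreover have "(C + 1) * (exp (2 * C) * (1 + H a)) * 4 = Q * (1 + H a)"
        by (simp only: Q_def mult_ac)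
      ultimately have "\<bar>a * s * deriv H (a * s) - H (a * s)\<bar> * (1 / s\<^sup>2) \<le> Q * (1 + H a)" by (simp only:)
      moreover have "\<bar>z / s\<^sup>2\<bar> = \<bar>z\<bar> * (1 / s\<^sup>2)" for z by (simp add: abs_divide)
      ultimately show ?thesis by (simp only:)
    qed
    have q1: "\<bar>q lam - q 1\<bar> \<le> \<bar>lam - 1\<bar> * (Q * (1 + H a))"
    proof (cases lam "1::real" rule: linorder_cases)
      case less
      then obtain z where z: "lam < z" "z < 1" "q 1 - q lam = (1 - lam) * ((a * z * deriv H (a * z) - H (a * z)) / z\<^sup>2)"
        using MVT2[OF less, of q "\<lambda>s. (a * s * deriv H (a * s) - H (a * s)) / s\<^sup>2"] dq l2 by auto
      have "\<bar>q 1 - q lam\<bar> = \<bar>lam - 1\<bar> * \<bar>(a * z * deriv H (a * z) - H (a * z)) / z\<^sup>2\<bar>"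
        unfolding z(3) abs_mult by (simp add: abs_minus_commute)
      also have "\<dots> \<le> \<bar>lam - 1\<bar> * (Q * (1 + H a))" using bq[of z] z l2 by (intro mult_left_mono) auto
      finally show ?thesis by (simp add: abs_minus_commute)
    next
      case greater
      then obtain z where z: "1 < z" "z < lam" "q lam - q 1 = (lam - 1) * ((a * z * deriv H (a * z) - H (a * z)) / z\<^sup>2)"
        using MVT2[OF greater, of q "\<lambda>s. (a * s * deriv H (a * s) - H (a * s)) / s\<^sup>2"] dq by auto
      show ?thesis unfolding z(3) abs_mult using bq[of z] z l2 by (intro mult_left_mono) auto
    qed simp
    define x where "x = (norm A)\<^sup>2"
    have x: "x \<ge> 0" by (simp add: x_def)
    define \<nu> where "\<nu> = 2 * (A \<bullet> (A ** Y)) + t * (norm (A ** Y))\<^sup>2"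
    have NF: "(norm (A ** F))\<^sup>2 = x + t * \<nu>"
      unfolding F_def x_def \<nu>_def by (rule norm_mult_identity_plus)
    have AY: "norm (A ** Y) \<le> norm A * (K * N)"
    proof -
      have "norm (A ** Y) \<le> norm A * norm Y * N" by (rule N(2))
      also have "\<dots> \<le> norm A * K * N" using Y N by (intro mult_right_mono mult_left_mono) auto
      finally show ?thesis by (simp add: mult.assoc)
    qed
    have \<nu>: "2 * \<bar>\<nu>\<bar> \<le> N2 * x"
    proof -
      have "\<bar>A \<bullet> (A ** Y)\<bar> \<le> norm A * norm (A ** Y)" by (rule Cauchy_Schwarz_ineq2)
      also have "\<dots> \<le> norm A * (norm A * (K * N))" using AY by (intro mult_left_mono) auto
      finally have 1: "\<bar>A \<bullet> (A ** Y)\<bar> \<le> (K * N) * x" by (simp add: x_def power2_eq_square mult_ac)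
      have "(norm (A ** Y))\<^sup>2 \<le> (norm A * (K * N))\<^sup>2" using AY by (intro power_mono) auto
      then have "(norm (A ** Y))\<^sup>2 \<le> (K * N)\<^sup>2 * x" by (simp add: x_def power_mult_distrib mult_ac)
      moreover have "t * (norm (A ** Y))\<^sup>2 \<le> 1 * (norm (A ** Y))\<^sup>2" using t t0 by (intro mult_right_mono) auto
      ultimately have 2: "\<bar>t * (norm (A ** Y))\<^sup>2\<bar> \<le> (K * N)\<^sup>2 * x" using t by simp
      have "\<bar>\<nu>\<bar> \<le> 2 * ((K * N) * x) + (K * N)\<^sup>2 * x" using 1 2 unfolding \<nu>_def by linarith
      then show ?thesis by (simp add: N2_def algebra_simps)
    qed
    have inv: "\<bar>1 / lam - 1\<bar> \<le> 2 * (t * D)" "0 < 1 / lam" "1 / lam \<le> 2"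
    proof -
      have "1 / lam - 1 = - (t * \<mu>) / lam" using l2 by (simp add: l field_simps)
      then have "\<bar>1 / lam - 1\<bar> = \<bar>t * \<mu>\<bar> * (1 / lam)" using l2 by (simp add: abs_divide)
      also have "\<dots> \<le> (t * D) * 2" using tm l2 t D by (intro mult_mono) (auto simp: field_simps)
      finally show "\<bar>1 / lam - 1\<bar> \<le> 2 * (t * D)" by simp
      show "0 < 1 / lam" "1 / lam \<le> 2" using l2 by (auto simp: field_simps)
    qed
    \<comment> \<open>The three terms are the change of |AF|^2, the effect of the factor 1/det F on
      |A|^2, and the change of H(a s)/s.\<close>
    have eq: "deformed_density H A F - (x + H a) = t * \<nu> * (1 / lam) + x * (1 / lam - 1) + (q lam - q 1)"
      unfolding deformed_density_def NF lam_def[symmetric] a_def[symmetric] q_def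
      by (simp add: add_divide_distrib algebra_simps)
    have b1: "\<bar>t * \<nu> * (1 / lam)\<bar> \<le> t * (N2 * x)"
    proof -
      have "\<bar>t * \<nu> * (1 / lam)\<bar> = t * (\<bar>\<nu>\<bar> * (1 / lam))" using t inv by (simp add: abs_mult)
      also have "\<dots> \<le> t * (\<bar>\<nu>\<bar> * 2)" using t inv by (intro mult_left_mono) auto
      also have "\<dots> \<le> t * (N2 * x)" using t \<nu> by (intro mult_left_mono) auto
      finally show ?thesis .
    qed
    have b2: "\<bar>x * (1 / lam - 1)\<bar> \<le> t * (2 * D * x)"
    proof -
      have "x * \<bar>1 / lam - 1\<bar> \<le> x * (2 * (t * D))" using inv(1) x by (rule mult_left_mono)
      then show ?thesis using x by (simp add: abs_mult mult_ac)
    qed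
    have b3: "\<bar>q lam - q 1\<bar> \<le> t * (Q * D * (1 + H a))"
    proof -
      have "\<bar>lam - 1\<bar> * (Q * (1 + H a)) \<le> (t * D) * (Q * (1 + H a))"
        using tm Q pos[OF a] by (intro mult_right_mono) (auto simp: l)
      then show ?thesis using q1 by (simp add: mult_ac)
    qed
    have "\<bar>deformed_density H A F - (x + H a)\<bar> \<le> t * (N2 * x) + t * (2 * D * x) + t * (Q * D * (1 + H a))"
      unfolding eq using b1 b2 b3 by linarith
    also have "\<dots> = t * (N2 * x + 2 * D * x + Q * D * (1 + H a))" by (simp add: distrib_left)
    also have "\<dots> \<le> t * (E * (1 + x + H a))"
    proof (rule mult_left_mono)
      have "N2 * x \<le> N2 * (1 + x + H a)" "2 * D * x \<le> 2 * D * (1 + x + H a)" "Q * D * (1 + H a) \<le> Q * D * (1 + x + H a)"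
        using N2 D Q x pos[OF a] by (auto intro!: mult_left_mono)
      then show "N2 * x + 2 * D * x + Q * D * (1 + H a) \<le> E * (1 + x + H a)"
        unfolding E_def distrib_right by linarith
    qed (use t in simp)
    finally show ?thesis using l2 unfolding F_def[symmetric] lam_def x_def a_def by simp
  qed
  ultimately show thesis using that[OF t0(1,2)] by blast
qed

text \<open>The energy-momentum tensor as a function of the gradient. It represents the derivative
  at t = 0 of \<open>deformed_density\<close> along I + tY.\<close>

definition stress :: "(real \<Rightarrow> real) \<Rightarrow> real^3^3 \<Rightarrow> real^3^3" where
  "stress H A = 2 *\<^sub>R (transpose A ** A) + (deriv H (det A) * det A - (norm A)\<^sup>2 - H (det A)) *\<^sub>R mat 1"

lemma stress_inner:
  "stress H A \<bullet> Y = 2 * (A \<bullet> (A ** Y)) + (deriv H (det A) * det A - (norm A)\<^sup>2 - H (det A)) * trace Y"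
proof -
  have "(transpose A ** A) \<bullet> Y = A \<bullet> (A ** Y)"
    by (simp add: inner_matrix_eq_trace matrix_transpose_mul matrix_mul_assoc)
  moreover have "(mat 1 :: real^3^3) \<bullet> Y = trace Y"
    by (simp add: inner_matrix_eq_trace)
  ultimately show ?thesis by (simp add: stress_def inner_add_left)
qed

text \<open>The direction varies with n, because in \<open>first_variation\<close> the gradient of
  the field is evaluated at preimages that only converge to the given point.\<close>

lemma deformed_density_limit:
  assumes H: "energy_density_assms H" and A: "det A > 0"
    and Y: "Y \<longlonglongrightarrow> Z" and t: "t \<longlonglongrightarrow> 0" "\<And>n. t n > 0"
  shows "(\<lambda>n. (deformed_density H A (mat 1 + t n *\<^sub>R Y n) - ((norm A)\<^sup>2 + H (det A))) / t n) \<longlonglongrightarrow> stress H A \<bullet> Z"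
proof -
  have der: "(H has_real_derivative deriv H t) (at t)" if "t > 0" for t
    using H that by (simp add: energy_density_assms_def DERIV_deriv_iff_real_differentiable)
  have tn: "t n \<noteq> 0" for n using t(2)[of n] by simp
  define a where "a = det A"
  define x where "x = (norm A)\<^sup>2"
  define \<mu> where "\<mu> n = trace (Y n) + t n * minors (Y n) + (t n)\<^sup>2 * det (Y n)" for n
  define \<nu> where "\<nu> n = 2 * (A \<bullet> (A ** Y n)) + t n * (norm (A ** Y n))\<^sup>2" for n
  have Yij: "(\<lambda>n. Y n $ i $ j) \<longlonglongrightarrow> Z $ i $ j" for i j by (intro tendsto_vec_nth Y)
  have \<mu>: "\<mu> \<longlonglongrightarrow> trace Z"
  proof -
    have "(\<lambda>n. trace (Y n)) \<longlonglongrightarrow> trace Z"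
      unfolding trace_def sum_3 by (intro tendsto_add Yij)
    moreover have "(\<lambda>n. minors (Y n)) \<longlonglongrightarrow> minors Z"
      unfolding minors_def by (intro tendsto_add tendsto_diff tendsto_mult Yij)
    moreover have "(\<lambda>n. det (Y n)) \<longlonglongrightarrow> det Z"
      unfolding det_3 by (intro tendsto_add tendsto_diff tendsto_mult Yij)
    ultimately have "\<mu> \<longlonglongrightarrow> trace Z + 0 * minors Z + 0\<^sup>2 * det Z"
      unfolding \<mu>_def[abs_def] by (intro tendsto_add tendsto_mult tendsto_power t(1))
    then show ?thesis by simp
  qed
  have \<nu>: "\<nu> \<longlonglongrightarrow> 2 * (A \<bullet> (A ** Z))"
  proof -
    have AY: "(\<lambda>n. A ** Y n) \<longlonglongrightarrow> A ** Z"
    proof (intro vec_tendstoI)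
      show "(\<lambda>n. (A ** Y n) $ i $ j) \<longlonglongrightarrow> (A ** Z) $ i $ j" for i j
        unfolding matrix_matrix_mult_def vec_lambda_beta by (intro tendsto_sum tendsto_mult tendsto_const Yij)
    qed
    have "\<nu> \<longlonglongrightarrow> 2 * (A \<bullet> (A ** Z)) + 0 * (norm (A ** Z))\<^sup>2"
      unfolding \<nu>_def[abs_def]
      by (intro tendsto_add tendsto_mult tendsto_const tendsto_inner tendsto_power tendsto_norm AY t(1))
    then show ?thesis by simp
  qed
  \<comment> \<open>Its derivative at 1, namely H'(a) a - |A|^2 - H(a), is the scalar part of the
    stress; the remaining part comes from the change of |AF|^2.\<close>
  define q where "q s = (x + H (a * s)) / s" for s
  have dq: "(q has_real_derivative a * deriv H a - x - H a) (at 1)"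
  proof -
    have "((\<lambda>s. H (a * s)) has_real_derivative deriv H (a * 1) * a) (at 1)"
      by (rule DERIV_chain2[OF der]) (use A in \<open>auto intro!: derivative_eq_intros simp: a_def\<close>)
    then show ?thesis unfolding q_def[abs_def]
      by (auto intro!: derivative_eq_intros simp: algebra_simps)
  qed
  have alg: "((y + \<tau> * c + h) / d - k) / \<tau> = c / d + ((y + h) / d - k) / \<tau>" if "\<tau> \<noteq> 0" for y \<tau> c h d k :: real
  proof -
    have "(y + \<tau> * c + h) / d = \<tau> * (c / d) + (y + h) / d" by (simp add: add_divide_distrib)
    then have "((y + \<tau> * c + h) / d - k) / \<tau> = (\<tau> * (c / d) + ((y + h) / d - k)) / \<tau>" by simp
    also have "\<dots> = c / d + ((y + h) / d - k) / \<tau>" unfolding add_divide_distrib using that by simp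
    finally show ?thesis .
  qed
  have q1: "q 1 = x + H a" by (simp add: q_def)
  have eq: "(deformed_density H A (mat 1 + t n *\<^sub>R Y n) - (x + H a)) / t n =
      \<nu> n / (1 + t n * \<mu> n) + (q (1 + t n * \<mu> n) - q 1) / t n" for n
    unfolding deformed_density_def norm_mult_identity_plus det_identity_plus \<mu>_def[symmetric] \<nu>_def[symmetric] a_def[symmetric]
      x_def[symmetric] q1 unfolding q_def by (rule alg[OF tn])
  have "(\<lambda>n. 1 + t n * \<mu> n) \<longlonglongrightarrow> 1 + 0 * trace Z" by (intro tendsto_intros t \<mu>)
  then have "(\<lambda>n. \<nu> n / (1 + t n * \<mu> n)) \<longlonglongrightarrow> 2 * (A \<bullet> (A ** Z)) / 1" by (intro tendsto_divide \<nu>) auto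
  from tendsto_add[OF this DERIV_sequentially[OF dq \<mu> t(1) tn]]
  show ?thesis unfolding stress_inner eq[unfolded a_def x_def] by (simp add: a_def x_def mult.commute)
qed

section \<open>First variation of the energy\<close>

lemma bounded_jacobian_test_function:
  fixes X :: "real^'n \<Rightarrow> real^'m"
  assumes "test_function U X"
  obtains K where "K > 0" "\<And>x. norm (jacobian X (at x)) \<le> K" "continuous_on UNIV (\<lambda>x. jacobian X (at x))"
proof -
  obtain L where L: "compact L" "L \<subseteq> U" "\<And>x. x \<notin> L \<Longrightarrow> X x = 0" using test_function_support[OF assms] by blast
  have c: "continuous_on UNIV (\<lambda>x. jacobian X (at x))"
  proof -
    have "continuous_on UNIV (\<lambda>x. \<chi> i j. frechet_derivative X (at x) (axis j 1) $ i)"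
      by (intro continuous_on_vec_lambda continuous_on_component smooth_on_continuous_on
          smooth_on_frechet_derivative test_function_smooth[OF assms])
    then show ?thesis by (simp add: jacobian_def matrix_def)
  qed
  have z: "jacobian X (at x) = 0" if "x \<notin> L" for x
    using frechet_derivative_outside_support[OF L(1,3) that] by (simp add: jacobian_def matrix_def vec_eq_iff)
  obtain B where B: "B \<ge> 0" "\<And>x. norm (jacobian X (at x)) \<le> B" using bounded_compact_support[OF c L(1) z] by blast
  have "norm (jacobian X (at x)) \<le> B + 1" for x using B(2)[of x] by linarith
  then show thesis using that[of "B + 1"] B(1) c by auto
qed

lemma jacobian_scaleR:
  fixes X :: "real^'n \<Rightarrow> real^'m"
  assumes "X differentiable (at x)"
  shows "jacobian (\<lambda>x. t *\<^sub>R X x) (at x) = t *\<^sub>R jacobian X (at x)"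
proof -
  have "((\<lambda>x. t *\<^sub>R X x) has_derivative (\<lambda>v. t *\<^sub>R frechet_derivative X (at x) v)) (at x)"
    using assms by (intro has_derivative_scaleR_right) (simp add: frechet_derivative_works[symmetric])
  from frechet_derivative_at[OF this, symmetric] show ?thesis
    by (simp add: jacobian_def matrix_def vec_eq_iff)
qed

lemma norm_matrix_squared: "(norm (A::real^3^3))\<^sup>2 = (\<Sum>i\<in>UNIV. \<Sum>j\<in>UNIV. (A $ i $ j)\<^sup>2)"
  unfolding power2_norm_eq_inner inner_vec_def by (simp add: power2_eq_square)

lemma borel_measurable_lebesgue_on_AE:
  fixes f g :: "'a::euclidean_space \<Rightarrow> real"
  assumes S: "S \<in> sets lebesgue" and f: "f \<in> borel_measurable (lebesgue_on S)" and ae: "AE x in lebesgue_on S. f x = g x"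
  shows "g \<in> borel_measurable (lebesgue_on S)"
proof -
  have "(\<lambda>x. indicator S x *\<^sub>R f x) \<in> borel_measurable lebesgue"
    using f S by (simp add: borel_measurable_restrict_space_iff)
  moreover have "AE x in lebesgue. indicator S x *\<^sub>R f x = indicator S x *\<^sub>R g x"
    using ae S by (subst (asm) AE_restrict_space_iff) (auto elim!: eventually_mono simp: indicator_def)
  ultimately have "(\<lambda>x. indicator S x *\<^sub>R g x) \<in> borel_measurable lebesgue"
    by (rule borel_measurable_AE)
  then show ?thesis using S by (simp add: borel_measurable_restrict_space_iff)
qed

text \<open>Only t > 0 is used, so minimality gives an inequality; equality comes later from the
  opposite field. In the deformed variable the energy of u \<circ> \<psi> has the integrand
  \<open>g n\<close>, which is compared with \<open>f\<close> at the same point.\<close>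

lemma first_variation:
  fixes u X :: "real^3 \<Rightarrow> real^3"
  assumes \<Omega>: "open \<Omega>" "bounded \<Omega>" and H: "energy_density_assms H" and u: "is_weak_D \<Omega> u A"
    and f0: "integrable (lebesgue_on \<Omega>) (\<lambda>x. (norm (A x))\<^sup>2 + H (det (A x)))"
    and det_pos: "AE x in lebesgue_on \<Omega>. det (A x) > 0"
    and X: "test_function \<Omega> X" and \<epsilon>: "\<epsilon> > 0"
    and iv: "\<And>t. 0 < t \<Longrightarrow> t \<le> \<epsilon> \<Longrightarrow> inner_variation \<Omega> (\<lambda>x. t *\<^sub>R X x)"
    and min: "\<And>t. 0 < t \<Longrightarrow> t \<le> \<epsilon> \<Longrightarrow> energy H \<Omega> u \<le> energy H \<Omega> (\<lambda>x. u (x + t *\<^sub>R X x))"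
  shows "integrable (lebesgue_on \<Omega>) (\<lambda>x. stress H (A x) \<bullet> jacobian X (at x))"
    and "0 \<le> (LINT x|lebesgue_on \<Omega>. stress H (A x) \<bullet> jacobian X (at x))"
proof -
  note \<Omega>l = open_lebesgue[OF \<Omega>(1)]
  have pos: "H t \<ge> 0" if "t > 0" for t using H that by (simp add: energy_density_assms_def)
  obtain K where K: "K > 0" "\<And>x. norm (jacobian X (at x)) \<le> K" "continuous_on UNIV (\<lambda>x. jacobian X (at x))"
    using bounded_jacobian_test_function[OF X] by blast
  obtain t0 E where t0: "t0 > 0" "t0 \<le> 1" "E > 0"
    "\<And>A Y t. \<lbrakk>0 < t; t \<le> t0; norm Y \<le> K; det A > 0\<rbrakk> \<Longrightarrow> det (mat 1 + t *\<^sub>R Y) > 0 \<and>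
      \<bar>deformed_density H A (mat 1 + t *\<^sub>R Y) - ((norm A)\<^sup>2 + H (det A))\<bar> \<le> t * (E * (1 + (norm A)\<^sup>2 + H (det A)))"
    using deformed_density_bound[OF H K(1)] by blast
  define r where "r = min \<epsilon> t0"
  have r: "r > 0" "r \<le> \<epsilon>" "r \<le> t0" using \<epsilon> t0(1) by (auto simp: r_def)
  define t where "t n = r / real (Suc n)" for n
  have t: "0 < t n" "t n \<le> \<epsilon>" "t n \<le> t0" for n
  proof -
    have "t n \<le> r / 1" unfolding t_def using r by (intro divide_left_mono) auto
    then show "0 < t n" "t n \<le> \<epsilon>" "t n \<le> t0" using r by (auto simp: t_def)
  qed
  have tlim: "t \<longlonglongrightarrow> 0"
  proof -
    have "(\<lambda>n. r * inverse (real (Suc n))) \<longlonglongrightarrow> r * 0" by (intro tendsto_intros LIMSEQ_inverse_real_of_nat)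
    then show ?thesis by (simp add: t_def[abs_def] divide_inverse)
  qed
  have ivn: "inner_variation \<Omega> (\<lambda>x. t n *\<^sub>R X x)" for n by (rule iv[OF t(1,2)])
  define \<psi> where "\<psi> n x = x + t n *\<^sub>R X x" for n x
  define \<zeta> where "\<zeta> n = inv (\<psi> n)" for n
  have \<psi>_eq: "inner_variation.\<psi> (\<lambda>x. t n *\<^sub>R X x) = \<psi> n" for n
    by (simp add: inner_variation.\<psi>_def[OF ivn] \<psi>_def fun_eq_iff)
  have \<zeta>_eq: "inner_variation.\<zeta> (\<lambda>x. t n *\<^sub>R X x) = \<zeta> n" for n
    by (simp add: inner_variation.\<zeta>_def[OF ivn] \<zeta>_def \<psi>_eq)
  note diffeo = inner_variation.diffeo_\<Omega>[OF ivn, unfolded \<psi>_eq \<zeta>_eq]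
  note \<zeta>\<psi> = inner_variation.\<zeta>_\<psi>[OF ivn, unfolded \<psi>_eq \<zeta>_eq]
  note \<psi>\<zeta> = inner_variation.\<psi>_\<zeta>[OF ivn, unfolded \<psi>_eq \<zeta>_eq]
  have dX: "X differentiable (at x)" for x by (rule smooth_on_differentiable[OF test_function_smooth[OF X] UNIV_I])
  have J: "jacobian (\<psi> n) (at x) = mat 1 + t n *\<^sub>R jacobian X (at x)" for n x
    using inner_variation.jacobian_\<psi>[OF ivn, of n x] by (simp add: \<psi>_eq jacobian_scaleR[OF dX])
  \<comment> \<open>The gradient of the field sits at the preimage, since all integrals are written
    in the deformed variable.\<close>
  define Y where "Y n y = jacobian X (at (\<zeta> n y))" for n y
  define F where "F n y = mat 1 + t n *\<^sub>R Y n y" for n y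
  have FJ: "F n (\<psi> n x) = jacobian (\<psi> n) (at x)" for n x by (simp add: F_def Y_def \<zeta>\<psi> J)
  define f where "f x = (norm (A x))\<^sup>2 + H (det (A x))" for x
  define g where "g n y = deformed_density H (A y) (F n y)" for n y
  have f: "integrable (lebesgue_on \<Omega>) f" using f0 by (simp add: f_def[abs_def])
  have bnd: "AE y in lebesgue_on \<Omega>. \<bar>g n y - f y\<bar> \<le> t n * (E * (1 + f y))" for n
    using det_pos
  proof eventually_elim
    case (elim y)
    then show ?case using t0(4)[OF t(1,3) K(2) elim, of n "\<zeta> n y"] by (simp add: g_def f_def F_def Y_def add.assoc)
  qed
  have cY: "continuous_on UNIV (Y n)" for n
    unfolding Y_def
    by (rule continuous_on_compose2[OF K(3)])
      (use smooth_on_continuous_on[OF inner_variation.smooth_\<zeta>[OF ivn, unfolded \<zeta>_eq]] in auto)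
  have mg: "g n \<in> borel_measurable (lebesgue_on \<Omega>)" for n
  proof -
    \<comment> \<open>\<open>H\<close> is continuous on the positive half-line only and arbitrary
      elsewhere; this Borel version agrees with it along det(A) det(F), which is positive almost
      everywhere.\<close>
    define Hp where "Hp s = (if s \<in> {0<..} then H s else 0)" for s
    have "H differentiable (at s)" if "s > 0" for s using H that by (simp add: energy_density_assms_def)
    then have "H differentiable_on {0<..}"
      unfolding differentiable_on_def by (metis differentiable_at_withinI greaterThan_iff)
    then have "continuous_on {0<..} H" by (rule differentiable_imp_continuous_on)
    then have Hp: "Hp \<in> borel_measurable borel"
      unfolding Hp_def[abs_def] by (intro borel_measurable_continuous_on_if) auto
    have mA: "(\<lambda>y. A y $ i $ j) \<in> borel_measurable (lebesgue_on \<Omega>)" for i j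
      using u by (intro locally_integrable_measurable[OF \<Omega>(1)] locally_integrable_nth_nth) (simp add: is_weak_D_def)
    have mF: "(\<lambda>y. F n y $ i $ j) \<in> borel_measurable (lebesgue_on \<Omega>)" for i j
      by (rule borel_measurable_lebesgue_continuous) (auto simp: F_def intro!: continuous_intros cY)
    have mdA: "(\<lambda>y. det (A y)) \<in> borel_measurable (lebesgue_on \<Omega>)"
      unfolding det_3 by (intro borel_measurable_add borel_measurable_diff borel_measurable_times mA)
    have mdF: "(\<lambda>y. det (F n y)) \<in> borel_measurable (lebesgue_on \<Omega>)"
      unfolding det_3 by (intro borel_measurable_add borel_measurable_diff borel_measurable_times mF)
    have mN: "(\<lambda>y. (norm (A y ** F n y))\<^sup>2) \<in> borel_measurable (lebesgue_on \<Omega>)"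
      unfolding norm_matrix_squared matrix_matrix_mult_def vec_lambda_beta
      by (intro borel_measurable_sum borel_measurable_power borel_measurable_times mA mF)
    have m: "(\<lambda>y. ((norm (A y ** F n y))\<^sup>2 + Hp (det (A y) * det (F n y))) / det (F n y)) \<in> borel_measurable (lebesgue_on \<Omega>)"
      by (intro borel_measurable_divide borel_measurable_add mN mdF measurable_compose[OF _ Hp] borel_measurable_times mdA)
    have "AE y in lebesgue_on \<Omega>. ((norm (A y ** F n y))\<^sup>2 + Hp (det (A y) * det (F n y))) / det (F n y) = g n y"
      using det_pos
    proof eventually_elim
      case (elim y)
      have "det (F n y) > 0" using t0(4)[OF t(1,3) K(2) elim, of n "\<zeta> n y"] by (simp add: F_def Y_def)
      then show ?case using elim by (simp add: g_def deformed_density_def Hp_def)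
    qed
    then show ?thesis by (rule borel_measurable_lebesgue_on_AE[OF \<Omega>l m])
  qed
  have i1: "integrable (lebesgue_on \<Omega>) (\<lambda>x. 1 + f x)"
    using f integrable_bounded_continuous[OF \<Omega> continuous_on_const[of UNIV 1], of 1] by simp
  have ig: "integrable (lebesgue_on \<Omega>) (\<lambda>y. g n y - f y)" for n
  proof (rule Bochner_Integration.integrable_bound)
    show "integrable (lebesgue_on \<Omega>) (\<lambda>y. t n * (E * (1 + f y)))" using i1 by simp
    show "(\<lambda>y. g n y - f y) \<in> borel_measurable (lebesgue_on \<Omega>)" using mg f by simp
    show "AE y in lebesgue_on \<Omega>. norm (g n y - f y) \<le> norm (t n * (E * (1 + f y)))"
      using bnd[of n] by (rule eventually_mono) simp
  qed
  have ig': "integrable (lebesgue_on \<Omega>) (g n)" for n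
    using Bochner_Integration.integrable_add[OF ig f, of n] by simp
  have gpos: "AE y in lebesgue_on \<Omega>. 0 \<le> g n y" for n
    using det_pos
  proof eventually_elim
    case (elim y)
    have "det (F n y) > 0" using t0(4)[OF t(1,3) K(2) elim, of n "\<zeta> n y"] by (simp add: F_def Y_def)
    then show ?case using elim pos[of "det (A y) * det (F n y)"] by (simp add: g_def deformed_density_def)
  qed
  have le: "(LINT x|lebesgue_on \<Omega>. f x) \<le> (LINT x|lebesgue_on \<Omega>. g n x)" for n
  proof -
    have "energy H \<Omega> u = (\<integral>\<^sup>+x. ennreal (f x) \<partial>lebesgue_on \<Omega>)"
      unfolding energy_def
      by (rule nn_integral_cong_AE) (use is_weak_D_AE_eq[OF \<Omega>(1) u] in \<open>auto simp: f_def elim!: eventually_mono\<close>)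
    also have "\<dots> = ennreal (LINT x|lebesgue_on \<Omega>. f x)"
      by (rule nn_integral_eq_integral[OF f]) (use det_pos in \<open>auto simp: f_def pos elim!: eventually_mono\<close>)
    finally have eu: "energy H \<Omega> u = ennreal (LINT x|lebesgue_on \<Omega>. f x)" .
    have wu: "is_weak_D \<Omega> (\<lambda>x. u (\<psi> n x)) (\<lambda>x. A (\<psi> n x) ** jacobian (\<psi> n) (at x))"
      by (rule is_weak_D_diffeo[OF diffeo u])
    have dJ: "det (jacobian (\<psi> n) (at x)) > 0" for x
      using inner_variation.det_\<psi>[OF ivn, of n x] by (simp add: \<psi>_eq)
    have "energy H \<Omega> (\<lambda>x. u (\<psi> n x)) = (\<integral>\<^sup>+x. ennreal (det (jacobian (\<psi> n) (at x)) * g n (\<psi> n x)) \<partial>lebesgue_on \<Omega>)"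
      unfolding energy_def
    proof (rule nn_integral_cong_AE)
      show "AE x in lebesgue_on \<Omega>. ennreal ((norm (weak_D \<Omega> (\<lambda>x. u (\<psi> n x)) x))\<^sup>2 + H (det (weak_D \<Omega> (\<lambda>x. u (\<psi> n x)) x))) =
          ennreal (det (jacobian (\<psi> n) (at x)) * g n (\<psi> n x))"
        using is_weak_D_AE_eq[OF \<Omega>(1) wu]
      proof eventually_elim
        case (elim x)
        then show ?case using dJ[of x] by (simp add: g_def deformed_density_def FJ det_mul)
      qed
    qed
    also have "\<dots> = ennreal (LINT x|lebesgue_on \<Omega>. det (jacobian (\<psi> n) (at x)) * g n (\<psi> n x))"
    proof (rule nn_integral_eq_integral)
      show "integrable (lebesgue_on \<Omega>) (\<lambda>x. det (jacobian (\<psi> n) (at x)) * g n (\<psi> n x))"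
        by (rule iffD1[OF diffeo_change_of_variables(1)[OF diffeo] ig'])
      have "AE x in lebesgue_on \<Omega>. 0 \<le> g n (\<psi> n x)" by (rule iffD1[OF diffeo_AE[OF diffeo] gpos])
      then show "AE x in lebesgue_on \<Omega>. 0 \<le> det (jacobian (\<psi> n) (at x)) * g n (\<psi> n x)"
        by (rule eventually_mono) (use dJ in \<open>auto simp: less_imp_le\<close>)
    qed
    also have "\<dots> = ennreal (LINT x|lebesgue_on \<Omega>. g n x)"
      using diffeo_change_of_variables(2)[OF diffeo, of "g n"] by simp
    finally have ew: "energy H \<Omega> (\<lambda>x. u (\<psi> n x)) = ennreal (LINT x|lebesgue_on \<Omega>. g n x)" .
    \<comment> \<open>\<open>ennreal\<close> maps negative numbers to 0, so the comparison of
      energies passes to the real integrals only because this one is nonnegative.\<close>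
    have "0 \<le> (LINT x|lebesgue_on \<Omega>. g n x)" using gpos by (rule integral_nonneg_AE)
    moreover have "ennreal (LINT x|lebesgue_on \<Omega>. f x) \<le> ennreal (LINT x|lebesgue_on \<Omega>. g n x)"
      using min[OF t(1,2), of n] unfolding eu ew[symmetric] \<psi>_def .
    ultimately show ?thesis by simp
  qed
  \<comment> \<open>The preimages of x differ from x by at most t times the supremum of the field,
    so the directions \<open>Y n x\<close> converge to DX(x).\<close>
  have lim: "AE x in lebesgue_on \<Omega>. (\<lambda>n. (g n x - f x) / t n) \<longlonglongrightarrow> stress H (A x) \<bullet> jacobian X (at x)"
    using det_pos
  proof eventually_elim
    case (elim x)
    obtain L where L: "compact L" "L \<subseteq> \<Omega>" "\<And>x. x \<notin> L \<Longrightarrow> X x = 0" using test_function_support[OF X] by blast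
    obtain B where B: "\<And>x. norm (X x) \<le> B"
      using bounded_compact_support[OF smooth_on_continuous_on[OF test_function_smooth[OF X]] L(1,3)] by blast
    have le: "norm (\<zeta> n x - x) \<le> t n * B" for n
    proof -
      have "x - \<zeta> n x = t n *\<^sub>R X (\<zeta> n x)" using \<psi>\<zeta>[of n x] by (simp add: \<psi>_def algebra_simps)
      then have "norm (\<zeta> n x - x) = t n * norm (X (\<zeta> n x))" using t(1)[of n] by (simp add: norm_minus_commute)
      then show ?thesis using B[of "\<zeta> n x"] t(1)[of n] by (simp add: mult_left_mono)
    qed
    have "(\<lambda>n. t n * B) \<longlonglongrightarrow> 0" by (rule tendsto_mult_left_zero[OF tlim])
    then have "(\<lambda>n. \<zeta> n x - x) \<longlonglongrightarrow> 0" by (rule Lim_null_comparison[OF always_eventually[OF allI[OF le]]])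
    then have "(\<lambda>n. \<zeta> n x) \<longlonglongrightarrow> x" by (rule LIM_zero_cancel)
    then have "(\<lambda>n. Y n x) \<longlonglongrightarrow> jacobian X (at x)"
      unfolding Y_def by (rule continuous_on_tendsto_compose[OF K(3)]) simp_all
    from deformed_density_limit[OF H elim this tlim t(1)] show ?case by (simp add: g_def f_def F_def)
  qed
  have dom: "AE x in lebesgue_on \<Omega>. norm ((g n x - f x) / t n) \<le> E * (1 + f x)" for n
    using bnd[of n]
  proof eventually_elim
    case (elim x)
    then show ?case using t(1)[of n] by (simp add: abs_divide pos_divide_le_eq mult.commute)
  qed
  have iw: "integrable (lebesgue_on \<Omega>) (\<lambda>x. E * (1 + f x))" using i1 by simp
  have ms: "(\<lambda>x. (g n x - f x) / t n) \<in> borel_measurable (lebesgue_on \<Omega>)" for n using mg f by simp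
  have mlim: "(\<lambda>x. stress H (A x) \<bullet> jacobian X (at x)) \<in> borel_measurable (lebesgue_on \<Omega>)"
    by (rule borel_measurable_lebesgue_on_AE[OF \<Omega>l borel_measurable_lim_metric[OF ms]])
      (use lim in \<open>auto elim!: eventually_mono intro: limI\<close>)
  show "integrable (lebesgue_on \<Omega>) (\<lambda>x. stress H (A x) \<bullet> jacobian X (at x))"
    by (rule integrable_dominated_convergence[OF mlim ms iw lim dom])
  have conv: "(\<lambda>n. LINT x|lebesgue_on \<Omega>. (g n x - f x) / t n) \<longlonglongrightarrow> (LINT x|lebesgue_on \<Omega>. stress H (A x) \<bullet> jacobian X (at x))"
    by (rule integral_dominated_convergence[OF mlim ms iw lim dom])
  have "0 \<le> (LINT x|lebesgue_on \<Omega>. (g n x - f x) / t n)" for n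
    using le[of n] t(1)[of n] ig'[of n] f by simp
  with conv show "0 \<le> (LINT x|lebesgue_on \<Omega>. stress H (A x) \<bullet> jacobian X (at x))"
    by (intro LIMSEQ_le_const) auto
qed

section \<open>Cofactors and the surface energy under inner variations\<close>

lemma cof_mult: "cof (A ** B) = cof A ** cof (B :: real^3^3)"
  by (simp add: vec_eq_iff forall_3 matrix_matrix_mult_def cof_def det_3 sum_3 axis_def algebra_simps)

lemma mult_transpose_cof: "B ** transpose (cof B) = det B *\<^sub>R (mat 1 :: real^3^3)"
  by (simp add: vec_eq_iff forall_3 matrix_matrix_mult_def transpose_def cof_def det_3 sum_3
      mat_def axis_def algebra_simps)

lemma inner_matrix_mult:
  fixes X Y Z :: "real^3^3"
  shows "(X ** Y) \<bullet> Z = X \<bullet> (Z ** transpose Y)"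
  by (simp add: inner_vec_def matrix_matrix_mult_def transpose_def sum_3 algebra_simps)

text \<open>The matrix identity behind the change of variables in the surface functional: its
  cofactor term transforms like a density.\<close>

lemma cof_inner_mult:
  fixes A B Q :: "real^3^3"
  shows "cof (A ** B) \<bullet> (Q ** B) = det B * (cof A \<bullet> Q)"
proof -
  have "cof (A ** B) \<bullet> (Q ** B) = cof A \<bullet> (Q ** (B ** transpose (cof B)))"
    by (simp add: cof_mult inner_matrix_mult matrix_mul_assoc)
  also have "Q ** (B ** transpose (cof B)) = det B *\<^sub>R Q"
    by (simp add: mult_transpose_cof) (simp add: vec_eq_iff forall_3 matrix_matrix_mult_def sum_3 mat_def)
  finally show ?thesis by simp
qed

locale inner_variation3 = inner_variation \<Omega> X for \<Omega> :: "(real^3) set" and X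
begin

text \<open>With the field pulled back in its first variable by \<zeta>, both terms of the integrand
  for u \<circ> \<psi> at x equal det D\<psi>(x) times the corresponding terms for \<open>u\<close>
  at \<psi>(x).\<close>

lemma surface_functional_compose:
  assumes u: "is_weak_D \<Omega> u A" and f: "smooth_on UNIV f"
  shows "surface_functional \<Omega> (\<lambda>x. u (\<psi> x)) f = surface_functional \<Omega> u (\<lambda>(y, z). f (\<zeta> y, z))"
proof -
  note \<Omega>l = open_lebesgue[OF open_\<Omega>]
  define W where "W = weak_D \<Omega> u"
  have W: "is_weak_D \<Omega> u W" unfolding W_def by (rule is_weak_D_weak_D[OF u])
  define G where "G y = cof (W y) \<bullet> jacobian (\<lambda>y'. f (\<zeta> y', u y)) (at y) +
    det (W y) * trace (jacobian (\<lambda>z. f (\<zeta> y, z)) (at (u y)))" for y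
  have "surface_functional \<Omega> (\<lambda>x. u (\<psi> x)) f = (LINT x|lebesgue_on \<Omega>. det (jacobian \<psi> (at x)) * G (\<psi> x))"
    unfolding surface_functional_def
  proof (rule lebesgue_on_integral_cong_AE(1)[OF \<Omega>l])
    show "AE x in lebesgue_on \<Omega>. cof (weak_D \<Omega> (\<lambda>x. u (\<psi> x)) x) \<bullet> jacobian (\<lambda>x'. f (x', u (\<psi> x))) (at x) +
        det (weak_D \<Omega> (\<lambda>x. u (\<psi> x)) x) * trace (jacobian (\<lambda>y. f (x, y)) (at (u (\<psi> x)))) =
        det (jacobian \<psi> (at x)) * G (\<psi> x)"
      using is_weak_D_AE_eq[OF open_\<Omega> is_weak_D_compose[OF W]]
    proof eventually_elim
      case (elim x)
      define J where "J = jacobian \<psi> (at x)"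
      define Q where "Q = jacobian (\<lambda>y'. f (\<zeta> y', u (\<psi> x))) (at (\<psi> x))"
      have sf: "smooth_on UNIV (\<lambda>y'. f (\<zeta> y', u (\<psi> x)))"
        by (rule smooth_on_compose[OF open_UNIV open_UNIV smooth_on_Pair[OF open_UNIV smooth_\<zeta> smooth_on_const] _ f]) simp
      have "jacobian (\<lambda>x'. f (\<zeta> (\<psi> x'), u (\<psi> x))) (at x) = Q ** J"
        unfolding Q_def J_def
        by (rule jacobian_compose[of \<psi> x "\<lambda>y'. f (\<zeta> y', u (\<psi> x))"])
          (use smooth_on_differentiable[OF smooth_\<psi> UNIV_I] smooth_on_differentiable[OF sf UNIV_I] in auto)
      then have j: "jacobian (\<lambda>x'. f (x', u (\<psi> x))) (at x) = Q ** J" by (simp add: \<zeta>_\<psi>)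
      show ?case
        unfolding elim j J_def[symmetric] cof_inner_mult G_def \<zeta>_\<psi> Q_def[symmetric] det_mul
        by (simp add: distrib_left)
    qed
  qed
  also have "\<dots> = (LINT y|lebesgue_on \<Omega>. G y)"
    by (rule diffeo_change_of_variables(2)[OF diffeo_\<Omega>, symmetric])
  finally show ?thesis by (simp add: surface_functional_def G_def W_def)
qed

lemma test_function_pull:
  fixes f :: "(real^3) \<times> (real^3) \<Rightarrow> real^3"
  assumes "test_function (\<Omega> \<times> UNIV) f"
  shows "test_function (\<Omega> \<times> UNIV) (\<lambda>(y, z). f (\<zeta> y, z))"
proof -
  obtain K where K: "compact K" "K \<subseteq> \<Omega> \<times> UNIV" "\<And>p. p \<notin> K \<Longrightarrow> f p = 0" using test_function_support[OF assms] by blast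
  have bl: "bounded_linear (fst :: (real^3) \<times> (real^3) \<Rightarrow> _)" "bounded_linear (snd :: (real^3) \<times> (real^3) \<Rightarrow> _)"
    by (rule bounded_linear_fst, rule bounded_linear_snd)
  have s1: "smooth_on UNIV (\<lambda>p::(real^3) \<times> (real^3). \<zeta> (fst p))"
    by (rule smooth_on_compose[OF open_UNIV open_UNIV smooth_on_linear[OF bl(1) open_UNIV] _ smooth_\<zeta>]) simp
  have s2: "smooth_on UNIV (\<lambda>p::(real^3) \<times> (real^3). (\<zeta> (fst p), snd p))"
    by (rule smooth_on_Pair[OF open_UNIV s1 smooth_on_linear[OF bl(2) open_UNIV]])
  have "smooth_on UNIV (\<lambda>p. f (\<zeta> (fst p), snd p))"
    by (rule smooth_on_compose[OF open_UNIV open_UNIV s2 _ test_function_smooth[OF assms]]) simp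
  then have sm: "smooth_on UNIV (\<lambda>(y, z). f (\<zeta> y, z))" by (simp add: case_prod_unfold)
  define L where "L = (\<lambda>p. (\<psi> (fst p), snd p)) ` K"
  have c\<psi>: "continuous_on UNIV \<psi>" by (rule smooth_on_continuous_on[OF smooth_\<psi>])
  have "compact L" unfolding L_def
    by (rule compact_continuous_image[OF _ K(1)])
      (intro continuous_on_Pair continuous_on_compose2[OF c\<psi>] continuous_intros, simp)
  moreover have "L \<subseteq> \<Omega> \<times> UNIV" using K(2) by (auto simp: L_def \<psi>_in_iff)
  moreover have "f (\<zeta> (fst p), snd p) = 0" if "p \<notin> L" for p
  proof (rule K(3), rule notI)
    assume "(\<zeta> (fst p), snd p) \<in> K"
    then have "(\<psi> (fst (\<zeta> (fst p), snd p)), snd (\<zeta> (fst p), snd p)) \<in> L" unfolding L_def by (rule imageI)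
    then show False using that by (simp add: \<psi>_\<zeta>)
  qed
  ultimately show ?thesis using sm unfolding test_function_def case_prod_unfold by blast
qed

lemma admissible_nc_compose:
  assumes u: "u \<in> admissible_nc \<Omega> g M" and g: "Ck_on 1 \<Omega> g" and b: "bounded \<Omega>"
  shows "(\<lambda>x. u (\<psi> x)) \<in> admissible_nc \<Omega> g M"
proof -
  note \<Omega>l = open_lebesgue[OF open_\<Omega>]
  have a: "W12 \<Omega> u" "W12_zero \<Omega> (\<lambda>x. u x - g x)" "AE x in lebesgue_on \<Omega>. norm (u x) \<le> M"
    "AE x in lebesgue_on \<Omega>. det (weak_D \<Omega> u x) > 0" "\<exists>N. negligible N \<and> inj_on u (\<Omega> - N)"
    "integrable (lebesgue_on \<Omega>) (\<lambda>x. det (weak_D \<Omega> u x))" "surface_energy \<Omega> u = 0"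
    using u by (auto simp: admissible_nc_def admissible_def)
  define A where "A = weak_D \<Omega> u"
  have uA: "is_weak_D \<Omega> u A" unfolding A_def by (rule W12_weak_D(1)[OF a(1)])
  have wD: "AE x in lebesgue_on \<Omega>. weak_D \<Omega> (\<lambda>x. u (\<psi> x)) x = A (\<psi> x) ** jacobian \<psi> (at x)"
    by (rule is_weak_D_AE_eq[OF open_\<Omega> is_weak_D_compose[OF uA]])
  have 3: "AE x in lebesgue_on \<Omega>. norm (u (\<psi> x)) \<le> M" by (rule iffD1[OF diffeo_AE[OF diffeo_\<Omega>] a(3)])
  have "AE x in lebesgue_on \<Omega>. det (A (\<psi> x)) > 0" unfolding A_def by (rule iffD1[OF diffeo_AE[OF diffeo_\<Omega>] a(4)])
  then have 4: "AE x in lebesgue_on \<Omega>. det (weak_D \<Omega> (\<lambda>x. u (\<psi> x)) x) > 0"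
    using wD by eventually_elim (simp add: det_mul det_\<psi>)
  have 5: "\<exists>N. negligible N \<and> inj_on (\<lambda>x. u (\<psi> x)) (\<Omega> - N)"
  proof -
    obtain N where N: "negligible N" "inj_on u (\<Omega> - N)" using a(5) by blast
    \<comment> \<open>Differentiable maps send null sets to null sets; off this set \<psi> takes
      values in \<Omega> outside \<open>N\<close>, where \<open>u\<close> is injective.\<close>
    have "negligible (\<zeta> ` N)"
    proof (rule negligible_differentiable_image_negligible[OF order_refl N(1)])
      show "\<zeta> differentiable_on N"
        unfolding differentiable_on_def
        by (auto intro!: differentiable_at_withinI smooth_on_differentiable[OF smooth_\<zeta> UNIV_I])
    qed
    moreover have "inj_on (\<lambda>x. u (\<psi> x)) (\<Omega> - \<zeta> ` N)"
    proof (rule inj_onI)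
      fix x y assume x: "x \<in> \<Omega> - \<zeta> ` N" and y: "y \<in> \<Omega> - \<zeta> ` N" and e: "u (\<psi> x) = u (\<psi> y)"
      have "\<psi> x \<notin> N" "\<psi> y \<notin> N" using x y \<zeta>_\<psi> by (metis DiffD2 imageI)+
      then have "\<psi> x = \<psi> y" using N(2) x y e by (auto simp: inj_on_def \<psi>_in_iff)
      then show "x = y" using \<zeta>_\<psi> by metis
    qed
    ultimately show ?thesis by blast
  qed
  have i: "integrable (lebesgue_on \<Omega>) (\<lambda>x. det (jacobian \<psi> (at x)) * det (A (\<psi> x)))"
    unfolding A_def by (rule iffD1[OF diffeo_change_of_variables(1)[OF diffeo_\<Omega>] a(6)])
  have ae: "AE x in lebesgue_on \<Omega>. det (jacobian \<psi> (at x)) * det (A (\<psi> x)) = det (weak_D \<Omega> (\<lambda>x. u (\<psi> x)) x)"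
    using wD by eventually_elim (simp add: det_mul)
  have 6: "integrable (lebesgue_on \<Omega>) (\<lambda>x. det (weak_D \<Omega> (\<lambda>x. u (\<psi> x)) x))"
    by (rule iffD1[OF lebesgue_on_integral_cong_AE(2)[OF \<Omega>l ae] i])
  \<comment> \<open>Pulling back sends each competing field to a competing field for
    \<open>u\<close>, with the same bound, so the supremum does not exceed that of \<open>u\<close>;
    the zero field bounds it from below.\<close>
  have 7: "surface_energy \<Omega> (\<lambda>x. u (\<psi> x)) = 0"
  proof (rule antisym)
    show "surface_energy \<Omega> (\<lambda>x. u (\<psi> x)) \<le> 0"
      unfolding surface_energy_def
    proof (rule SUP_least)
      fix f :: "(real^3) \<times> (real^3) \<Rightarrow> real^3"
      assume f: "f \<in> {f. test_function (\<Omega> \<times> UNIV) f \<and> (\<forall>p. norm (f p) \<le> 1)}"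
      define f' where "f' = (\<lambda>(y, z). f (\<zeta> y, z))"
      have f': "f' \<in> {f. test_function (\<Omega> \<times> UNIV) f \<and> (\<forall>p. norm (f p) \<le> 1)}"
        using f test_function_pull[of f] by (auto simp: f'_def case_prod_unfold)
      have "surface_functional \<Omega> (\<lambda>x. u (\<psi> x)) f = surface_functional \<Omega> u f'"
        unfolding f'_def by (rule surface_functional_compose[OF uA]) (use f in \<open>auto intro: test_function_smooth\<close>)
      then have "ereal (surface_functional \<Omega> (\<lambda>x. u (\<psi> x)) f) \<le> surface_energy \<Omega> u"
        unfolding surface_energy_def using SUP_upper[OF f', of "\<lambda>f. ereal (surface_functional \<Omega> u f)"] by simp
      then show "ereal (surface_functional \<Omega> (\<lambda>x. u (\<psi> x)) f) \<le> 0" by (simp add: a(7))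
    qed
    have jz: "jacobian (\<lambda>x::real^3. 0::real^3) (at x) = 0" for x
      by (simp add: vec_eq_iff jacobian_nth fun_cong[OF frechet_derivative_at[OF has_derivative_const], symmetric])
    have "surface_functional \<Omega> (\<lambda>x. u (\<psi> x)) (\<lambda>p. 0) = 0"
      by (simp add: surface_functional_def jz trace_def)
    moreover have "(\<lambda>p. 0) \<in> {f :: (real^3) \<times> (real^3) \<Rightarrow> real^3. test_function (\<Omega> \<times> UNIV) f \<and> (\<forall>p. norm (f p) \<le> 1)}"
      unfolding test_function_def by (auto simp: smooth_on_const intro!: exI[of _ "{}"])
    ultimately show "0 \<le> surface_energy \<Omega> (\<lambda>x. u (\<psi> x))"
      unfolding surface_energy_def
      using SUP_upper[of "\<lambda>p. 0" "{f. test_function (\<Omega> \<times> UNIV) f \<and> (\<forall>p. norm (f p) \<le> 1)}"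
          "\<lambda>f. ereal (surface_functional \<Omega> (\<lambda>x. u (\<psi> x)) f)"] by (simp add: zero_ereal_def)
  qed
  show ?thesis
    using W12_compose[OF a(1)] W12_zero_compose[OF a(2) g b] 3 4 5 6 7
    by (simp add: admissible_nc_def admissible_def)
qed

end

section \<open>Integrability of the stress and its entries in the cylindrical frame\<close>

lemma borel_measurable_det_compose:
  fixes A :: "real^3 \<Rightarrow> real^3^3" and h :: "real \<Rightarrow> real"
  assumes \<Omega>: "open \<Omega>" and u: "is_weak_D \<Omega> u A" and pos: "AE x in lebesgue_on \<Omega>. det (A x) > 0"
    and h: "continuous_on {0<..} h"
  shows "(\<lambda>x. h (det (A x))) \<in> borel_measurable (lebesgue_on \<Omega>)"
proof -
  define h' where "h' s = (if s \<in> {0<..} then h s else 0)" for s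
  have h': "h' \<in> borel_measurable borel"
    unfolding h'_def[abs_def] using h by (intro borel_measurable_continuous_on_if) auto
  have mA: "(\<lambda>y. A y $ i $ j) \<in> borel_measurable (lebesgue_on \<Omega>)" for i j
    using u by (intro locally_integrable_measurable[OF \<Omega>] locally_integrable_nth_nth) (simp add: is_weak_D_def)
  have md: "(\<lambda>y. det (A y)) \<in> borel_measurable (lebesgue_on \<Omega>)"
    unfolding det_3 by (intro borel_measurable_add borel_measurable_diff borel_measurable_times mA)
  have "AE x in lebesgue_on \<Omega>. h' (det (A x)) = h (det (A x))"
    using pos by (rule eventually_mono) (simp add: h'_def)
  then show ?thesis by (rule borel_measurable_lebesgue_on_AE[OF open_lebesgue[OF \<Omega>] measurable_compose[OF md h']])
qed

lemma energy_density_continuous: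
  assumes "energy_density_assms H"
  shows "continuous_on {0<..} H" "continuous_on {0<..} (deriv H)" "\<And>t. t > 0 \<Longrightarrow> H t \<ge> 0"
proof -
  have "H differentiable (at s)" if "s > 0" for s using assms that by (simp add: energy_density_assms_def)
  then have "H differentiable_on {0<..}"
    unfolding differentiable_on_def by (metis differentiable_at_withinI greaterThan_iff)
  then show "continuous_on {0<..} H" by (rule differentiable_imp_continuous_on)
qed (use assms in \<open>auto simp: energy_density_assms_def\<close>)

lemma energy_density_integrable:
  fixes A :: "real^3 \<Rightarrow> real^3^3"
  assumes \<Omega>: "open \<Omega>" and H: "energy_density_assms H" and u: "is_weak_D \<Omega> u A"
    and pos: "AE x in lebesgue_on \<Omega>. det (A x) > 0" and fin: "energy H \<Omega> u < \<infinity>"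
  shows "integrable (lebesgue_on \<Omega>) (\<lambda>x. (norm (A x))\<^sup>2 + H (det (A x)))"
proof (rule integrableI_bounded)
  have mA: "(\<lambda>y. A y $ i $ j) \<in> borel_measurable (lebesgue_on \<Omega>)" for i j
    using u by (intro locally_integrable_measurable[OF \<Omega>] locally_integrable_nth_nth) (simp add: is_weak_D_def)
  have "(\<lambda>x. (norm (A x))\<^sup>2) \<in> borel_measurable (lebesgue_on \<Omega>)"
    unfolding norm_matrix_squared by (intro borel_measurable_sum borel_measurable_power mA)
  then show "(\<lambda>x. (norm (A x))\<^sup>2 + H (det (A x))) \<in> borel_measurable (lebesgue_on \<Omega>)"
    by (rule borel_measurable_add) (rule borel_measurable_det_compose[OF \<Omega> u pos energy_density_continuous(1)[OF H]])
  have "(\<integral>\<^sup>+x. ennreal (norm ((norm (A x))\<^sup>2 + H (det (A x)))) \<partial>lebesgue_on \<Omega>) = energy H \<Omega> u"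
    unfolding energy_def
  proof (rule nn_integral_cong_AE)
    show "AE x in lebesgue_on \<Omega>. ennreal (norm ((norm (A x))\<^sup>2 + H (det (A x)))) =
        ennreal ((norm (weak_D \<Omega> u x))\<^sup>2 + H (det (weak_D \<Omega> u x)))"
      using pos is_weak_D_AE_eq[OF \<Omega> u]
    proof eventually_elim
      case (elim x)
      then show ?case using energy_density_continuous(3)[OF H] by simp
    qed
  qed
  then show "(\<integral>\<^sup>+x. ennreal (norm ((norm (A x))\<^sup>2 + H (det (A x)))) \<partial>lebesgue_on \<Omega>) < \<infinity>" using fin by simp
qed

lemma stress_integrable:
  fixes A :: "real^3 \<Rightarrow> real^3^3"
  assumes \<Omega>: "open \<Omega>" "bounded \<Omega>" and H: "energy_density_assms H" and u: "is_weak_D \<Omega> u A"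
    and pos: "AE x in lebesgue_on \<Omega>. det (A x) > 0"
    and f: "integrable (lebesgue_on \<Omega>) (\<lambda>x. (norm (A x))\<^sup>2 + H (det (A x)))"
  shows "integrable (lebesgue_on \<Omega>) (\<lambda>x. stress H (A x) $ i $ j)"
proof -
  obtain C where C: "C > 0" "\<And>t. t > 0 \<Longrightarrow> \<bar>t * deriv H t\<bar> \<le> C * (1 + H t)"
    using energy_density_growth[OF H] by blast
  note Hc = energy_density_continuous[OF H]
  have mA: "(\<lambda>y. A y $ i $ j) \<in> borel_measurable (lebesgue_on \<Omega>)" for i j
    using u by (intro locally_integrable_measurable[OF \<Omega>(1)] locally_integrable_nth_nth) (simp add: is_weak_D_def)
  have m1: "(\<lambda>x. deriv H (det (A x)) * det (A x) - H (det (A x))) \<in> borel_measurable (lebesgue_on \<Omega>)"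
    by (rule borel_measurable_det_compose[OF \<Omega>(1) u pos]) (intro continuous_intros Hc)
  have m2: "(\<lambda>x. (norm (A x))\<^sup>2) \<in> borel_measurable (lebesgue_on \<Omega>)"
    unfolding norm_matrix_squared by (intro borel_measurable_sum borel_measurable_power mA)
  have "(\<lambda>x. 2 * (\<Sum>k\<in>UNIV. A x $ k $ i * A x $ k $ j) +
      (deriv H (det (A x)) * det (A x) - H (det (A x)) - (norm (A x))\<^sup>2) * (if i = j then 1 else 0)) \<in> borel_measurable (lebesgue_on \<Omega>)"
    by (intro borel_measurable_add borel_measurable_times borel_measurable_const borel_measurable_sum mA borel_measurable_diff m1 m2)
  moreover have "stress H (A x) $ i $ j = 2 * (\<Sum>k\<in>UNIV. A x $ k $ i * A x $ k $ j) +
      (deriv H (det (A x)) * det (A x) - H (det (A x)) - (norm (A x))\<^sup>2) * (if i = j then 1 else 0)" for x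
    by (simp add: stress_def matrix_matrix_mult_def transpose_def mat_def)
  ultimately have m: "(\<lambda>x. stress H (A x) $ i $ j) \<in> borel_measurable (lebesgue_on \<Omega>)" by simp
  \<comment> \<open>An entry of the Gram matrix is at most three times |A|^2; doubled, and with the
    |A|^2 of the scalar part, this gives 7. The constant \<open>C\<close> is that of the growth
    bound for det A H'(det A).\<close>
  have b: "AE x in lebesgue_on \<Omega>. norm (stress H (A x) $ i $ j) \<le> norm ((7 + C) * (1 + ((norm (A x))\<^sup>2 + H (det (A x)))))"
    using pos
  proof eventually_elim
    case (elim x)
    define a where "a = (norm (A x))\<^sup>2"
    have lin: "\<bar>\<sigma>\<bar> \<le> 7 * a + h + e"
      if "\<bar>S\<bar> \<le> 3 * a" "\<bar>d\<bar> \<le> e" "0 \<le> a" "0 \<le> h" "\<sigma> = 2 * S + (d - h - a) * (if b then 1 else 0)"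
      for \<sigma> S d h e :: real and b
    proof (cases b)
      case True
      then have "\<sigma> = 2 * S + (d - h - a)" using that by simp
      then show ?thesis using that by linarith
    next
      case False
      then have "\<sigma> = 2 * S" using that by simp
      then show ?thesis using that by linarith
    qed
    have a: "\<bar>A x $ k $ i * A x $ k $ j\<bar> \<le> a" for k
      unfolding a_def abs_mult power2_eq_square by (intro mult_mono entry_le_norm) auto
    have "\<bar>\<Sum>k\<in>UNIV. A x $ k $ i * A x $ k $ j\<bar> \<le> 3 * a"
      using a[of 1] a[of 2] a[of 3] by (simp add: sum_3)
    moreover have "\<bar>deriv H (det (A x)) * det (A x)\<bar> \<le> C * (1 + H (det (A x)))"
      using C(2)[OF elim] by (simp add: mult.commute)
    moreover have "a \<ge> 0" by (simp add: a_def)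
    moreover have "H (det (A x)) \<ge> 0" by (rule Hc(3)[OF elim])
    moreover have "stress H (A x) $ i $ j = 2 * (\<Sum>k\<in>UNIV. A x $ k $ i * A x $ k $ j) +
      (deriv H (det (A x)) * det (A x) - H (det (A x)) - a) * (if i = j then 1 else 0)"
      by (simp add: stress_def matrix_matrix_mult_def transpose_def mat_def a_def)
    ultimately have "\<bar>stress H (A x) $ i $ j\<bar> \<le> 7 * a + H (det (A x)) + C * (1 + H (det (A x)))"
      by (rule lin)
    also have "\<dots> \<le> (7 + C) * (1 + (a + H (det (A x))))"
      using C(1) Hc(3)[OF elim] by (simp add: a_def algebra_simps)
    also have "\<dots> \<le> norm ((7 + C) * (1 + (a + H (det (A x)))))" by simp
    finally show ?case unfolding a_def real_norm_def .
  qed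
  have "integrable (lebesgue_on \<Omega>) (\<lambda>x. (7 + C) * (1 + ((norm (A x))\<^sup>2 + H (det (A x)))))"
    using f integrable_bounded_continuous[OF \<Omega> continuous_on_const[of UNIV 1], of 1] by simp
  then show ?thesis by (rule Bochner_Integration.integrable_bound[OF _ m b])
qed

lemma inner_matrix_conj:
  fixes R X Y :: "real^3^3"
  assumes "transpose R ** R = mat 1"
  shows "(R ** X ** transpose R) \<bullet> (R ** Y ** transpose R) = X \<bullet> Y"
proof -
  have "(R ** X ** transpose R) \<bullet> (R ** Y ** transpose R) = (R ** X) \<bullet> (R ** Y ** (transpose R ** R))"
    by (simp add: inner_matrix_mult matrix_mul_assoc)
  also have "\<dots> = trace (transpose X ** (transpose R ** (R ** Y)))"
    by (simp only: assms matrix_mul_rid inner_matrix_eq_trace matrix_transpose_mul matrix_mul_assoc[symmetric])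
  also have "transpose R ** (R ** Y) = Y" by (simp only: assms matrix_mul_assoc matrix_mul_lid)
  also have "trace (transpose X ** Y) = X \<bullet> Y" by (simp only: inner_matrix_eq_trace)
  finally show ?thesis .
qed

text \<open>Isotropy: the determinant and the norm are invariant under conjugation by a rotation,
  and the Gram matrix is conjugated along.\<close>

lemma stress_conj:
  fixes R M :: "real^3^3"
  assumes R: "transpose R ** R = mat 1" "R ** transpose R = mat 1" "det R = 1"
  shows "stress H (R ** M ** transpose R) = R ** stress H M ** transpose R"
proof -
  have 1: "transpose (R ** M ** transpose R) ** (R ** M ** transpose R) = R ** (transpose M ** M) ** transpose R"
  proof -
    have "transpose (R ** M ** transpose R) ** (R ** M ** transpose R) =
        R ** transpose M ** (transpose R ** R) ** M ** transpose R"
      by (simp only: matrix_transpose_mul transpose_transpose matrix_mul_assoc)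
    also have "\<dots> = R ** (transpose M ** M) ** transpose R"
      by (simp only: R matrix_mul_rid matrix_mul_lid) (simp only: matrix_mul_assoc)
    finally show ?thesis .
  qed
  have 2: "det (R ** M ** transpose R) = det M" by (simp add: det_mul R)
  have 3: "(norm (R ** M ** transpose R))\<^sup>2 = (norm M)\<^sup>2"
    by (simp add: power2_norm_eq_inner inner_matrix_conj[OF R(1)])
  have "R ** (2 *\<^sub>R N + c *\<^sub>R mat 1) ** transpose R = 2 *\<^sub>R (R ** N ** transpose R) + c *\<^sub>R (R ** transpose R)" for N c
  proof -
    have "(Y + Z) ** transpose R = Y ** transpose R + Z ** transpose R" for Y Z :: "real^3^3"
      by (simp add: vec_eq_iff matrix_matrix_mult_def sum.distrib distrib_right)
    moreover have "(k *\<^sub>R Y) ** Z = k *\<^sub>R (Y ** Z)" "Y ** (k *\<^sub>R Z) = k *\<^sub>R (Y ** Z)" for k and Y Z :: "real^3^3"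
      by (simp_all add: vec_eq_iff matrix_matrix_mult_def sum_distrib_left mult_ac)
    ultimately show ?thesis by (simp add: matrix_add_ldistrib)
  qed
  then show ?thesis by (simp add: stress_def 1 2 3 R)
qed

text \<open>The four entries are the fields \<open>F\<^sub>r\<^sub>r\<close>,
  \<open>F\<^sub>r\<^sub>z\<close>, \<open>F\<^sub>z\<^sub>z\<close> and \<open>G\<close> of the
  meridian equations, with s = v1/r. The last clause holds because the stress is symmetric and does
  not couple e_\<theta> with e_r or e_z.\<close>

lemma stress_frame:
  fixes B :: "real^2^2" and s :: real and H :: "real \<Rightarrow> real"
  defines "K \<equiv> deriv H (s * det B) * (s * det B) - H (s * det B)"
  shows "stress H (frame B s) $ 1 $ 1 = (norm (column 1 B))\<^sup>2 - (norm (column 2 B))\<^sup>2 - s\<^sup>2 + K"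
    and "stress H (frame B s) $ 1 $ 3 = 2 * (column 1 B \<bullet> column 2 B)"
    and "stress H (frame B s) $ 3 $ 3 = (norm (column 2 B))\<^sup>2 - (norm (column 1 B))\<^sup>2 - s\<^sup>2 + K"
    and "stress H (frame B s) $ 2 $ 2 = - (norm B)\<^sup>2 + s\<^sup>2 + K"
    and "stress H (frame B s) \<bullet> S = stress H (frame B s) $ 1 $ 1 * S $ 1 $ 1 +
      stress H (frame B s) $ 1 $ 3 * (S $ 1 $ 3 + S $ 3 $ 1) + stress H (frame B s) $ 3 $ 3 * S $ 3 $ 3 +
      stress H (frame B s) $ 2 $ 2 * S $ 2 $ 2"
proof -
  have d: "det (frame B s) = s * det B" by (simp add: det_3 det_2 frame_def algebra_simps)
  have n2: "(norm (w :: real^2))\<^sup>2 = (w $ 1)\<^sup>2 + (w $ 2)\<^sup>2" for w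
    unfolding power2_norm_eq_inner inner_vec_def by (simp add: sum_2 power2_eq_square)
  have nB: "(norm B)\<^sup>2 = (B $ 1 $ 1)\<^sup>2 + (B $ 1 $ 2)\<^sup>2 + ((B $ 2 $ 1)\<^sup>2 + (B $ 2 $ 2)\<^sup>2)"
    unfolding power2_norm_eq_inner inner_vec_def by (simp add: sum_2 power2_eq_square)
  have nf: "(norm (frame B s))\<^sup>2 = (norm B)\<^sup>2 + s\<^sup>2"
    unfolding nB norm_matrix_squared by (simp add: sum_3 frame_def)
  define c where "c = deriv H (det (frame B s)) * det (frame B s) - (norm (frame B s))\<^sup>2 - H (det (frame B s))"
  have c: "c = K - (norm B)\<^sup>2 - s\<^sup>2" by (simp add: c_def d nf K_def)
  have st: "stress H (frame B s) $ i $ j = 2 * (\<Sum>k\<in>UNIV. frame B s $ k $ i * frame B s $ k $ j) + (if i = j then c else 0)" for i j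
    by (simp add: stress_def c_def matrix_matrix_mult_def transpose_def mat_def)
  show "stress H (frame B s) $ 1 $ 1 = (norm (column 1 B))\<^sup>2 - (norm (column 2 B))\<^sup>2 - s\<^sup>2 + K"
    "stress H (frame B s) $ 1 $ 3 = 2 * (column 1 B \<bullet> column 2 B)"
    "stress H (frame B s) $ 3 $ 3 = (norm (column 2 B))\<^sup>2 - (norm (column 1 B))\<^sup>2 - s\<^sup>2 + K"
    "stress H (frame B s) $ 2 $ 2 = - (norm B)\<^sup>2 + s\<^sup>2 + K"
    unfolding st c n2 nB
    by (simp_all add: sum_3 sum_2 frame_def column_def inner_vec_def power2_eq_square algebra_simps)
  have z: "stress H (frame B s) $ 1 $ 2 = 0" "stress H (frame B s) $ 2 $ 1 = 0"
    "stress H (frame B s) $ 2 $ 3 = 0" "stress H (frame B s) $ 3 $ 2 = 0"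
    "stress H (frame B s) $ 3 $ 1 = stress H (frame B s) $ 1 $ 3"
    unfolding st by (simp_all add: sum_3 frame_def)
  show "stress H (frame B s) \<bullet> S = stress H (frame B s) $ 1 $ 1 * S $ 1 $ 1 +
      stress H (frame B s) $ 1 $ 3 * (S $ 1 $ 3 + S $ 3 $ 1) + stress H (frame B s) $ 3 $ 3 * S $ 3 $ 3 +
      stress H (frame B s) $ 2 $ 2 * S $ 2 $ 2"
    by (simp add: inner_vec_def sum_3 z distrib_left)
qed

section \<open>Descent to the half-plane, and iterated integrals without compact support in the
  angle\<close>

context slab
begin

text \<open>The average over the transversal coordinate with a weight of integral one gives back the
  function; the passage to a Borel version is needed because the average is an iterated
  integral.\<close>

lemma locally_integrable_descend:
  fixes f :: "real^2 \<Rightarrow> real"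
  assumes f: "locally_integrable D (\<lambda>y. f (merid y))"
  shows "locally_integrable P f"
proof -
  obtain W where W: "W \<in> borel_measurable borel" "AE x in lborel. x \<in> D \<longrightarrow> f (merid x) = W x"
    using borel_representative[OF open_lebesgue[OF open_D] locally_integrable_measurable[OF open_D f]] by blast
  obtain w where w: "w \<in> borel_measurable borel" "AE p in lborel. p \<in> P \<longrightarrow> f p = w p"
    using AE_lborel_const[OF W] by blast
  have mm: "merid \<in> borel_measurable borel" by (rule borel_measurable_continuous_onI) (intro continuous_intros)
  have mw: "(\<lambda>x. w (merid x)) \<in> borel_measurable borel" using measurable_compose[OF mm w(1)] .
  have "AE y in lebesgue_on D. f (merid y) = w (merid y)"
    unfolding AE_D_iff using AE_lift[OF w(2)] .
  then have lw: "locally_integrable D (\<lambda>x. w (merid x))"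
    by (rule locally_integrable_cong_AE[OF open_lebesgue[OF open_D] _ f])
  have "\<exists>(\<kappa> :: real \<Rightarrow> real) S. smooth_on UNIV \<kappa> \<and> compact S \<and> S \<subseteq> {a<..<b} \<and> (\<forall>t. t \<notin> S \<longrightarrow> \<kappa> t = 0) \<and> (LINT t|lborel. \<kappa> t) = 1"
    by (rule bump) blast
  then obtain \<kappa> :: "real \<Rightarrow> real" and S where \<kappa>: "smooth_on UNIV \<kappa>" "compact S" "S \<subseteq> {a<..<b}" "\<And>t. t \<notin> S \<Longrightarrow> \<kappa> t = 0"
    "(LINT t|lborel. \<kappa> t) = 1"
    by blast
  have "locally_integrable P (\<lambda>p. \<integral>t. w (merid (join (p, t))) * \<kappa> t \<partial>lborel)"
    by (rule locally_integrable_average(2)[OF lw mw smooth_on_continuous_on[OF \<kappa>(1)] \<kappa>(2-4)])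
  then have lP: "locally_integrable P w" by (simp add: \<kappa>(5))
  have "AE p in lebesgue_on P. w p = f p"
    unfolding AE_P_iff using w(2) by (rule eventually_mono) simp
  then show ?thesis using lP by (rule locally_integrable_cong_AE[OF open_lebesgue[OF open_P]])
qed

text \<open>In contrast to \<open>LINT_D\<close> the factor \<Phi> has compact support in the planar
  variable only and need not vanish at the ends of the interval. This is the situation for functions
  of the angle, and the indicator of the interval replaces the missing support.\<close>

lemma LINT_product:
  fixes f :: "real^2 \<Rightarrow> real" and \<Phi> :: "real^3 \<Rightarrow> real"
  assumes f: "locally_integrable P f" and c\<Phi>: "continuous_on UNIV \<Phi>"
    and K': "compact K" "K \<subseteq> P" "\<forall>x. merid x \<notin> K \<longrightarrow> \<Phi> x = 0"
  shows "integrable (lebesgue_on D) (\<lambda>y. f (merid y) * \<Phi> y)"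
    and "(LINT y|lebesgue_on D. f (merid y) * \<Phi> y) =
      (LINT p|lebesgue_on P. f p * (\<integral>t. indicator {a<..<b} t * \<Phi> (join (p, t)) \<partial>lborel))"
    and "(LINT y|lebesgue_on D. f (merid y) * \<Phi> y) =
      (\<integral>t. indicator {a<..<b} t * (LINT p|lebesgue_on P. f p * \<Phi> (join (p, t))) \<partial>lborel)"
    and "integrable lborel (\<lambda>t. indicator {a<..<b} t * (LINT p|lebesgue_on P. f p * \<Phi> (join (p, t))))"
proof -
  have K: "compact K" "K \<subseteq> P" "\<And>x. merid x \<notin> K \<Longrightarrow> \<Phi> x = 0" using K' by auto
  have \<Phi>: "\<Phi> \<in> borel_measurable borel" by (rule borel_measurable_continuous_onI[OF c\<Phi>])
  have "compact (\<Phi> ` join ` (K \<times> {a..b}))"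
    by (intro compact_continuous_image compact_Times K(1) compact_Icc linear_continuous_on bounded_linear_join
        continuous_on_subset[OF c\<Phi>]) auto
  then have "bounded (\<Phi> ` join ` (K \<times> {a..b}))" by (rule compact_imp_bounded)
  then obtain M where M0: "\<forall>x\<in>\<Phi> ` join ` (K \<times> {a..b}). norm x \<le> M" unfolding bounded_iff by blast
  have M: "\<bar>\<Phi> (join (p, t))\<bar> \<le> \<bar>M\<bar>" if "a < t" "t < b" for p t
  proof (cases "p \<in> K")
    case True
    then have "(p, t) \<in> K \<times> {a..b}" using that by auto
    then have "\<Phi> (join (p, t)) \<in> \<Phi> ` join ` (K \<times> {a..b})" by (intro imageI)
    then have "norm (\<Phi> (join (p, t))) \<le> M" using M0 by blast
    then show ?thesis by simp
  next
    case False
    then show ?thesis using K(3)[of "join (p, t)"] by simp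
  qed
  note Pl = open_lebesgue[OF open_P] and Dl = open_lebesgue[OF open_D]
  obtain w where w: "w \<in> borel_measurable borel" "AE p in lborel. p \<in> P \<longrightarrow> f p = w p"
    using borel_representative[OF Pl locally_integrable_measurable[OF open_P f]] by blast
  have aeP: "AE p in lebesgue_on P. f p = w p" unfolding AE_P_iff by (rule w(2))
  have lw: "locally_integrable P w" by (rule locally_integrable_cong_AE[OF Pl aeP f])
  have mm: "merid \<in> borel_measurable borel" by (rule borel_measurable_continuous_onI) (intro continuous_intros)
  have m2: "(\<lambda>x::real^3. x $ 2) \<in> borel_measurable borel" by (rule borel_measurable_continuous_onI) (intro continuous_intros)
  have mI: "(\<lambda>x::real^3. indicator {a<..<b} (x $ 2) :: real) \<in> borel_measurable borel" using m2 by measurable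
  define \<Phi>' where "\<Phi>' x = indicator {a<..<b} (x $ 2) * \<Phi> x" for x
  have m\<Phi>': "\<Phi>' \<in> borel_measurable borel" unfolding \<Phi>'_def[abs_def] by (intro borel_measurable_times mI \<Phi>)
  have Kb: "K \<in> sets borel" using K(1) by (simp add: compact_imp_closed)
  \<comment> \<open>Cut off outside \<open>K\<close> the function is integrable over the whole
    plane; the product with \<Phi> is unchanged, since \<Phi> vanishes there.\<close>
  define w' where "w' p = w p * indicator K p" for p
  have mw': "w' \<in> borel_measurable borel" unfolding w'_def[abs_def] using w(1) Kb by measurable
  have iw': "integrable lborel w'" unfolding w'_def[abs_def]
    by (rule integrable_compact_support_locally_integrable(1)[OF lw w(1) _ _ K(1,2), where B = 1])
      (use Kb in \<open>auto simp: indicator_def\<close>)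
  have wK: "w p * \<Phi> x = w' p * \<Phi> x" if "merid x = p" for p x
    using K(3)[of x] that by (cases "p \<in> K") (auto simp: w'_def)
  define F where "F x = w' (merid x) * \<Phi>' x" for x
  have mF: "F \<in> borel_measurable borel"
    unfolding F_def[abs_def] by (intro borel_measurable_times measurable_compose[OF mm mw'] m\<Phi>')
  have i: "integrable (lborel \<Otimes>\<^sub>M lborel) (\<lambda>(p, t). F (join (p, t)))"
  proof (rule Bochner_Integration.integrable_bound)
    show "integrable (lborel \<Otimes>\<^sub>M lborel) (\<lambda>(p, t). w' p * (M * indicator {a<..<b} t))"
    proof (rule lborel_pair.Fubini_integrable)
      show "(\<lambda>(p, t). w' p * (M * indicator {a<..<b} t)) \<in> borel_measurable (lborel \<Otimes>\<^sub>M (lborel :: real measure))"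
        using mw' by measurable
      have "(\<integral>t. norm (case (p, t) of (p, t) \<Rightarrow> w' p * (M * indicator {a<..<b} t)) \<partial>lborel) = \<bar>w' p\<bar> * (\<bar>M\<bar> * (b - a))" for p
        using ab by (simp add: abs_mult)
      then show "integrable lborel (\<lambda>p. \<integral>t. norm (case (p, t) of (p, t) \<Rightarrow> w' p * (M * indicator {a<..<b} t)) \<partial>lborel)"
        using iw' by simp
      have "integrable lborel (indicator {a<..<b} :: real \<Rightarrow> real)"
        by (rule integrable_real_indicator) (use ab in auto)
      then show "AE p in lborel. integrable lborel (\<lambda>t. case (p, t) of (p, t) \<Rightarrow> w' p * (M * indicator {a<..<b} t))"
        by simp
    qed
    show "(\<lambda>(p, t). F (join (p, t))) \<in> borel_measurable (lborel \<Otimes>\<^sub>M lborel)" by (rule borel_measurable_pair_join[OF mF])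
    have "\<bar>F (join (p, t))\<bar> \<le> \<bar>w' p * (M * indicator {a<..<b} t)\<bar>" for p t
    proof -
      have "\<bar>w' p\<bar> * \<bar>\<Phi> (join (p, t))\<bar> \<le> \<bar>w' p\<bar> * \<bar>M\<bar>" if "a < t" "t < b"
        using M[OF that] by (rule mult_left_mono) simp
      then show ?thesis by (simp add: F_def \<Phi>'_def abs_mult indicator_def)
    qed
    then show "AE q in lborel \<Otimes>\<^sub>M lborel. norm (case q of (p, t) \<Rightarrow> F (join (p, t))) \<le>
        norm (case q of (p, t) \<Rightarrow> w' p * (M * indicator {a<..<b} t))" by auto
  qed
  have iF: "integrable lborel F" using i integrable_join(1)[OF mF] by blast
  have aeD: "AE y in lebesgue_on D. f (merid y) * \<Phi> y = w (merid y) * \<Phi> y"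
    unfolding AE_D_iff using AE_lift[OF w(2)] by (rule eventually_mono) simp
  have mG: "(\<lambda>y. w (merid y) * \<Phi> y) \<in> borel_measurable borel"
    by (intro borel_measurable_times measurable_compose[OF mm w(1)] \<Phi>)
  have eqF: "(\<lambda>y. indicator D y * (w (merid y) * \<Phi> y)) = F"
  proof
    fix y
    have "y \<in> D" if "merid y \<in> K" "y $ 2 \<in> {a<..<b}" using that K(2) by (auto simp: D_def)
    then show "indicator D y * (w (merid y) * \<Phi> y) = F y"
      using K(3)[of y] by (auto simp: F_def \<Phi>'_def w'_def indicator_def D_def)
  qed
  show "integrable (lebesgue_on D) (\<lambda>y. f (merid y) * \<Phi> y)"
    using lebesgue_on_integral_cong_AE(2)[OF Dl aeD] lebesgue_on_integral_borel(2)[OF borel_open[OF open_D] mG] iF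
    unfolding eqF by blast
  have "(LINT y|lebesgue_on D. f (merid y) * \<Phi> y) = (LINT y|lborel. F y)"
    using lebesgue_on_integral_cong_AE(1)[OF Dl aeD] lebesgue_on_integral_borel(1)[OF borel_open[OF open_D] mG]
    unfolding eqF by simp
  then have e: "(LINT y|lebesgue_on D. f (merid y) * \<Phi> y) =
      (LINT q|(lborel \<Otimes>\<^sub>M lborel). (case q of (p, t) \<Rightarrow> F (join (p, t))))" using integrable_join(2)[OF mF] by simp
  have onP: "(LINT p|lebesgue_on P. f p * h p) = (LINT p|lborel. w' p * h p)"
    if h: "h \<in> borel_measurable borel" "\<And>p. p \<notin> K \<Longrightarrow> h p = 0" for h
  proof -
    have "AE p in lebesgue_on P. f p * h p = w p * h p" using aeP by (rule eventually_mono) simp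
    then have "(LINT p|lebesgue_on P. f p * h p) = (LINT p|lebesgue_on P. w p * h p)"
      by (rule lebesgue_on_integral_cong_AE(1)[OF Pl])
    also have "\<dots> = (LINT p|lborel. indicator P p * (w p * h p))"
      by (rule lebesgue_on_integral_borel(1)[OF borel_open[OF open_P] borel_measurable_times[OF w(1) h(1)]])
    also have "(\<lambda>p. indicator P p * (w p * h p)) = (\<lambda>p. w' p * h p)"
      using h(2) K(2) by (fastforce simp: w'_def indicator_def)
    finally show ?thesis .
  qed
  have F': "F (join (p, t)) = w' p * (indicator {a<..<b} t * \<Phi> (join (p, t)))" for p t
    by (simp add: F_def \<Phi>'_def)
  have F'': "F (join (p, t)) = indicator {a<..<b} t * (w' p * \<Phi> (join (p, t)))" for p t
    by (simp add: F')
  have \<Phi>K: "\<Phi> (join (p, t)) = 0" if "p \<notin> K" for p t using K(3)[of "join (p, t)"] that by simp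
  show "(LINT y|lebesgue_on D. f (merid y) * \<Phi> y) =
      (LINT p|lebesgue_on P. f p * (\<integral>t. indicator {a<..<b} t * \<Phi> (join (p, t)) \<partial>lborel))"
  proof -
    define h where "h p = (\<integral>t. indicator {a<..<b} t * \<Phi> (join (p, t)) \<partial>lborel)" for p
    have "(\<lambda>(p, t). indicator {a<..<b} t * \<Phi> (join (p, t))) \<in> borel_measurable (lborel \<Otimes>\<^sub>M lborel)"
      using borel_measurable_pair_join[OF m\<Phi>'] by (simp add: \<Phi>'_def)
    from lborel.borel_measurable_lebesgue_integral[OF this]
    have mh: "h \<in> borel_measurable borel" by (simp add: h_def[abs_def])
    have hK: "h p = 0" if "p \<notin> K" for p by (simp add: h_def \<Phi>K[OF that])
    have "(LINT y|lebesgue_on D. f (merid y) * \<Phi> y) = (\<integral>p. (\<integral>t. F (join (p, t)) \<partial>lborel) \<partial>lborel)"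
      unfolding e by (rule lborel_pair.integral_fst[OF i, symmetric])
    also have "\<dots> = (LINT p|lborel. w' p * h p)" unfolding F' h_def by simp
    also have "\<dots> = (LINT p|lebesgue_on P. f p * h p)" by (rule onP[OF mh hK, symmetric])
    finally show ?thesis unfolding h_def .
  qed
  have mj: "(\<lambda>p. \<Phi> (join (p, t))) \<in> borel_measurable borel" for t
  proof -
    have "(\<lambda>p. join (p, t)) \<in> borel_measurable borel" by (rule borel_measurable_continuous_onI) (intro continuous_intros)
    from measurable_compose[OF this \<Phi>] show ?thesis .
  qed
  show "(LINT y|lebesgue_on D. f (merid y) * \<Phi> y) =
      (\<integral>t. indicator {a<..<b} t * (LINT p|lebesgue_on P. f p * \<Phi> (join (p, t))) \<partial>lborel)"
  proof -
    have "(LINT y|lebesgue_on D. f (merid y) * \<Phi> y) = (\<integral>t. (\<integral>p. F (join (p, t)) \<partial>lborel) \<partial>lborel)"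
      unfolding e by (rule lborel_pair.integral_snd[OF i, symmetric])
    also have "\<dots> = (\<integral>t. indicator {a<..<b} t * (\<integral>p. w' p * \<Phi> (join (p, t)) \<partial>lborel) \<partial>lborel)"
      unfolding F'' by (simp only: integral_mult_right_zero)
    finally show ?thesis by (simp add: onP[OF mj \<Phi>K])
  qed
  show "integrable lborel (\<lambda>t. indicator {a<..<b} t * (LINT p|lebesgue_on P. f p * \<Phi> (join (p, t))))"
  proof -
    have "integrable lborel (\<lambda>t. (\<integral>p. F (join (p, t)) \<partial>lborel))" by (rule lborel_pair.integrable_snd[OF i])
    then show ?thesis
      unfolding F'' by (simp add: onP[OF mj \<Phi>K])
  qed
qed

end

section \<open>Axisymmetric variations\<close>

lemma norm_matrix_vector_le: "norm ((A::real^3^3) *v w) \<le> 3 * norm A * norm w"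
proof -
  have "\<bar>(A *v w) $ i\<bar> \<le> norm A * norm w" for i
  proof -
    have "\<bar>(A *v w) $ i\<bar> \<le> norm (A $ i) * norm w"
      unfolding matrix_vector_mul_component by (rule Cauchy_Schwarz_ineq2)
    also have "\<dots> \<le> norm A * norm w" by (intro mult_right_mono Finite_Cartesian_Product.norm_nth_le) auto
    finally show ?thesis .
  qed
  then have "(\<Sum>i\<in>UNIV. \<bar>(A *v w) $ i\<bar>) \<le> (\<Sum>i\<in>(UNIV::3 set). norm A * norm w)" by (intro sum_mono)
  then show ?thesis using norm_le_l1_cart[of "A *v w"] by simp
qed

lemma test_function_scaleR:
  assumes "test_function U \<phi>" shows "test_function U (\<lambda>x. (t::real) *\<^sub>R \<phi> x)"
proof -
  obtain K where K: "compact K" "K \<subseteq> U" "\<forall>x. x \<notin> K \<longrightarrow> \<phi> x = 0" using test_function_support[OF assms] by blast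
  have "smooth_on UNIV (\<lambda>x. t *\<^sub>R \<phi> x)"
    by (rule smooth_on_bounded_linear[OF bounded_linear_scaleR_right open_UNIV test_function_smooth[OF assms]])
  moreover have "\<forall>x. x \<notin> K \<longrightarrow> t *\<^sub>R \<phi> x = 0" using K(3) by simp
  ultimately show ?thesis using K(1,2) unfolding test_function_def by blast
qed

lemma inner_variation_small:
  fixes X :: "real^3 \<Rightarrow> real^3"
  assumes \<Omega>: "open \<Omega>" and X: "test_function \<Omega> X"
  obtains \<epsilon> where "\<epsilon> > 0" "\<And>t. 0 < t \<Longrightarrow> t \<le> \<epsilon> \<Longrightarrow> inner_variation \<Omega> (\<lambda>x. t *\<^sub>R X x)"
proof -
  obtain K where K: "K > 0" "\<And>x. norm (jacobian X (at x)) \<le> K"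
    using bounded_jacobian_test_function[OF X] by blast
  \<comment> \<open>The 6 is the factor 3 of \<open>norm_matrix_vector_le\<close> times the 2 of the
    required contraction constant 1/2.\<close>
  have "inner_variation \<Omega> (\<lambda>x. t *\<^sub>R X x)" if t: "0 < t" "t \<le> 1 / (6 * K)" for t
  proof
    show "open \<Omega>" by (rule \<Omega>)
    show "test_function \<Omega> (\<lambda>x. t *\<^sub>R X x)" by (rule test_function_scaleR[OF X])
    show "norm (jacobian (\<lambda>x. t *\<^sub>R X x) (at x) *v w) \<le> norm w / 2" for x w
    proof -
      have "norm (jacobian (\<lambda>x. t *\<^sub>R X x) (at x)) = t * norm (jacobian X (at x))"
        using t by (simp add: jacobian_scaleR[OF smooth_on_differentiable[OF test_function_smooth[OF X] UNIV_I]])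
      also have "\<dots> \<le> 1 / (6 * K) * K" using t K(1) by (intro mult_mono K(2)) auto
      finally have "norm (jacobian (\<lambda>x. t *\<^sub>R X x) (at x)) \<le> 1 / 6" using K(1) by simp
      then have "3 * norm (jacobian (\<lambda>x. t *\<^sub>R X x) (at x)) * norm w \<le> 1 / 2 * norm w"
        by (intro mult_right_mono) auto
      then show ?thesis using norm_matrix_vector_le[of "jacobian (\<lambda>x. t *\<^sub>R X x) (at x)" w] by linarith
    qed
  qed
  then show thesis using that[of "1 / (6 * K)"] K(1) by simp
qed

text \<open>The meridian coordinates (r, z) of a Cartesian point.\<close>

definition cm :: "real^3 \<Rightarrow> real^2" where "cm x = merid (unpolar x)"

text \<open>The field \<phi>1 e_r + \<phi>2 e_z in Cartesian form, with e_r = (x/r, y/r, 0). On the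
  axis the quotients are 0 by the convention for division by zero.\<close>

definition axial :: "(real^2 \<Rightarrow> real^2) \<Rightarrow> real^3 \<Rightarrow> real^3" where
  "axial \<phi> x = vector [\<phi> (cm x) $ 1 * x $ 1 / cm x $ 1, \<phi> (cm x) $ 1 * x $ 2 / cm x $ 1, \<phi> (cm x) $ 2]"

lemma cm_nth: "cm x $ 1 = sqrt ((x $ 1)\<^sup>2 + (x $ 2)\<^sup>2)" "cm x $ 2 = x $ 3"
  by (simp_all add: cm_def unpolar_def)

lemma cm_polar:
  assumes "y $ 1 > 0" shows "cm (polar y) = merid y"
proof -
  have "(y $ 1 * cos (y $ 2))\<^sup>2 + (y $ 1 * sin (y $ 2))\<^sup>2 = (y $ 1)\<^sup>2 * ((cos (y $ 2))\<^sup>2 + (sin (y $ 2))\<^sup>2)"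
    by (simp only: power_mult_distrib distrib_left)
  then show ?thesis using assms by (simp add: vec_eq_iff forall_2 cm_nth)
qed

lemma axial_polar:
  assumes "y $ 1 > 0"
  shows "axial \<phi> (polar y) = \<phi> (merid y) $ 1 *\<^sub>R e_r (y $ 2) + \<phi> (merid y) $ 2 *\<^sub>R e_z"
  using assms by (simp add: vec_eq_iff forall_3 axial_def cm_polar e_r_def e_z_def)

lemma axial_scaleR: "axial (\<lambda>p. t *\<^sub>R \<phi> p) x = t *\<^sub>R axial \<phi> x"
  by (simp add: vec_eq_iff forall_3 axial_def)

text \<open>The deformation preserves the angle and moves points within their half-plane; this is
  why it respects axial symmetry.\<close>

lemma polar_add_axial:
  assumes "y $ 1 > 0"
  shows "polar y + axial \<phi> (polar y) = cyl (y $ 1 + \<phi> (merid y) $ 1) (y $ 2) (y $ 3 + \<phi> (merid y) $ 2)"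
  by (simp add: axial_polar[OF assms] vec_eq_iff forall_3 e_r_def e_z_def cyl_def algebra_simps)

context meridional
begin

lemma cm_in_iff: "cm x \<in> P \<longleftrightarrow> x \<in> \<Omega>"
proof -
  have "cyl (cm x $ 1) (unpolar x $ 2) (cm x $ 2) = polar (unpolar x)" by (simp add: polar_def cm_def)
  then have "cm x \<in> P \<longleftrightarrow> cm x $ 1 > 0 \<and> x \<in> \<Omega>"
    using meridian_iff[of "cm x" "unpolar x $ 2"] by (simp add: polar_unpolar)
  moreover have "x \<in> \<Omega> \<Longrightarrow> cm x $ 1 > 0" using off_axis[of x] by (simp add: cm_nth)
  ultimately show ?thesis by blast
qed

lemma test_function_axial:
  assumes \<phi>: "test_function P \<phi>" shows "test_function \<Omega> (axial \<phi>)"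
proof -
  obtain K where K: "compact K" "K \<subseteq> P" "\<And>p. p \<notin> K \<Longrightarrow> \<phi> p = 0" using test_function_support[OF \<phi>] by blast
  have n: "smooth_on \<Omega> (\<lambda>x::real^3. x $ i)" for i by (rule smooth_on_linear[OF bounded_linear_vec_nth open_\<Omega>])
  have c1: "smooth_on \<Omega> (\<lambda>x. cm x $ 1)"
    unfolding cm_nth by (intro smooth_on_sqrt smooth_on_add smooth_on_power n open_\<Omega> off_axis)
  have cm: "smooth_on \<Omega> cm"
  proof (rule smooth_on_cart[OF open_\<Omega>])
    fix i :: 2
    have c2: "smooth_on \<Omega> (\<lambda>x. cm x $ 2)" unfolding cm_nth by (rule n)
    consider "i = 1" | "i = 2" using exhaust_2 by blast
    then show "smooth_on \<Omega> (\<lambda>x. cm x $ i)" by cases (simp_all only: c1 c2)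
  qed
  have \<phi>c: "smooth_on \<Omega> (\<lambda>x. \<phi> (cm x) $ i)" for i
    by (intro smooth_on_nth open_\<Omega> smooth_on_compose[OF open_\<Omega> open_UNIV cm _ test_function_smooth[OF \<phi>]]) simp
  have nz: "cm x $ 1 \<noteq> 0" if "x \<in> \<Omega>" for x
  proof -
    have "cm x $ 1 > 0" unfolding cm_nth by (rule real_sqrt_gt_zero[OF off_axis[OF that]])
    then show ?thesis by simp
  qed
  have "smooth_on \<Omega> (\<lambda>x. axial \<phi> x $ i)" for i
  proof -
    consider "i = 1" | "i = 2" | "i = 3" using exhaust_3 by blast
    then show ?thesis
      by cases (simp_all add: axial_def \<phi>c smooth_on_divide[OF open_\<Omega> smooth_on_mult[OF open_\<Omega> \<phi>c n] c1 nz])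
  qed
  then have sm: "smooth_on \<Omega> (axial \<phi>)" by (rule smooth_on_cart[OF open_\<Omega>])
  \<comment> \<open>\<open>K\<close> rotated about the axis. The closed interval of angles makes it
    compact and contains every value of the principal argument.\<close>
  define L where "L = polar ` join ` (K \<times> {- pi..pi})"
  have L: "compact L" unfolding L_def
    by (intro compact_continuous_image compact_Times K(1) compact_Icc linear_continuous_on bounded_linear_join
        continuous_on_subset[OF smooth_on_continuous_on[OF smooth_on_polar]]) auto
  have "cyl (p $ 1) t (p $ 2) \<in> \<Omega>" if "p \<in> K" for p t using meridian_iff[of p t] K(2) that by blast
  then have L\<Omega>: "L \<subseteq> \<Omega>" unfolding L_def by (auto simp: polar_def)
  have z: "\<phi> (cm x) = 0" if "x \<notin> L" for x
  proof (rule K(3), rule notI)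
    assume a: "cm x \<in> K"
    have "join (cm x, unpolar x $ 2) = unpolar x" unfolding cm_def by (rule join_merid)
    moreover have "unpolar x $ 2 \<in> {- pi..pi}"
      using mpi_less_Arg[of "Complex (x $ 1) (x $ 2)"] Arg_le_pi[of "Complex (x $ 1) (x $ 2)"] by (simp add: unpolar_def)
    ultimately have "unpolar x \<in> join ` (K \<times> {- pi..pi})" using a by (metis SigmaI imageI)
    then have "polar (unpolar x) \<in> L" unfolding L_def by (rule imageI)
    then show False using that by (simp add: polar_unpolar)
  qed
  have z': "axial \<phi> x = 0" if "x \<notin> L" for x using z[OF that] by (simp add: axial_def vec_eq_iff forall_3)
  have "test_function \<Omega> (\<lambda>x. if x \<in> \<Omega> then axial \<phi> x else 0)"
    by (rule test_function_extend[OF open_\<Omega> sm L L\<Omega>]) (use z' in auto)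
  moreover have "(\<lambda>x. if x \<in> \<Omega> then axial \<phi> x else 0) = axial \<phi>"
    using z' L\<Omega> by (auto simp: fun_eq_iff)
  ultimately show ?thesis by simp
qed

text \<open>As for axisymmetric maps, the field is differentiated in cylindrical coordinates, where
  its components along the frame are functions of (r, z), and the Jacobian of \<open>polar\<close>
  is divided out.\<close>

lemma jacobian_axial:
  assumes \<phi>: "test_function P \<phi>" and y: "y $ 1 > 0"
  shows "jacobian (axial \<phi>) (at (polar y)) =
    rot (y $ 2) ** frame (jacobian \<phi> (at (merid y))) (\<phi> (merid y) $ 1 / y $ 1) ** transpose (rot (y $ 2))"
proof -
  define R where "R = rot (y $ 2)"
  define J where "J = jacobian \<phi> (at (merid y))"
  define N where "N = frame J (\<phi> (merid y) $ 1)"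
  have op: "open {y::real^3. y $ 1 > 0}" by (intro open_Collect_less continuous_intros)
  have d\<phi>: "((\<lambda>y. \<phi> (merid y)) has_derivative (\<lambda>w. J *v merid w)) (at y)"
    unfolding J_def
    by (rule has_derivative_compose[OF bounded_linear_imp_has_derivative[OF bounded_linear_merid]])
      (rule smooth_on_has_derivative_jacobian[OF test_function_smooth[OF \<phi>] UNIV_I])
  have dp: "polar differentiable (at y)" by (rule smooth_on_differentiable[OF smooth_on_polar UNIV_I])
  have da: "axial \<phi> differentiable (at (polar y))"
    by (rule smooth_on_differentiable[OF test_function_smooth[OF test_function_axial[OF \<phi>]] UNIV_I])
  have dd: "(\<lambda>y. axial \<phi> (polar y)) differentiable (at y)"
    using differentiable_chain_at[OF dp da] by (simp add: o_def)
  have j: "jacobian (\<lambda>y. axial \<phi> (polar y)) (at y) $ i $ k = E (axis k 1)"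
    if E: "((\<lambda>y. h y) has_derivative E) (at y)" and h: "\<And>y. y $ 1 > 0 \<Longrightarrow> h y = axial \<phi> (polar y) $ i" for i k E h
  proof -
    have "((\<lambda>y. axial \<phi> (polar y) $ i) has_derivative E) (at y)"
      by (rule has_derivative_transform_within_open[OF E op]) (use y h in auto)
    from frechet_derivative_at[OF this] show ?thesis
      using frechet_derivative_nth[OF dd, of i "axis k 1"] by (simp add: jacobian_nth)
  qed
  have 1: "((\<lambda>y. \<phi> (merid y) $ 1 * cos (y $ 2)) has_derivative
      (\<lambda>w. \<phi> (merid y) $ 1 * (- sin (y $ 2) * w $ 2) + (J *v merid w) $ 1 * cos (y $ 2))) (at y)"
    by (auto intro!: derivative_eq_intros d\<phi> simp: fun_eq_iff)
  have 2: "((\<lambda>y. \<phi> (merid y) $ 1 * sin (y $ 2)) has_derivative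
      (\<lambda>w. \<phi> (merid y) $ 1 * (cos (y $ 2) * w $ 2) + (J *v merid w) $ 1 * sin (y $ 2))) (at y)"
    by (auto intro!: derivative_eq_intros d\<phi> simp: fun_eq_iff)
  have 3: "((\<lambda>y. \<phi> (merid y) $ 2) has_derivative (\<lambda>w. (J *v merid w) $ 2)) (at y)"
    by (auto intro!: derivative_eq_intros d\<phi>)
  have c: "\<phi> (merid y) $ 1 * cos (y $ 2) = axial \<phi> (polar y) $ 1" "\<phi> (merid y) $ 1 * sin (y $ 2) = axial \<phi> (polar y) $ 2"
    "\<phi> (merid y) $ 2 = axial \<phi> (polar y) $ 3" if "y $ 1 > 0" for y
    by (simp_all add: axial_polar[OF that] e_r_def e_z_def)
  have "jacobian (\<lambda>y. axial \<phi> (polar y)) (at y) = R ** N"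
    by (simp add: vec_eq_iff forall_3 j[OF 1 c(1)] j[OF 2 c(2)] j[OF 3 c(3)] R_def rot_def N_def frame_def
        matrix_matrix_mult_def matrix_vector_mult_def sum_3 sum_2 axis_def)
  moreover have "jacobian (\<lambda>y. axial \<phi> (polar y)) (at y) = jacobian (axial \<phi>) (at (polar y)) ** jacobian polar (at y)"
    by (rule jacobian_compose[OF dp da])
  ultimately have e: "jacobian (axial \<phi>) (at (polar y)) ** (R ** diag3 (y $ 1)) = R ** N"
    by (simp only: jacobian_polar R_def)
  have di: "diag3 (y $ 1) ** diag3 (1 / y $ 1) = mat 1"
    using y by (simp add: vec_eq_iff forall_3 matrix_matrix_mult_def sum_3 diag3_def mat_def)
  have Nd: "N ** diag3 (1 / y $ 1) = frame J (\<phi> (merid y) $ 1 / y $ 1)"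
    by (simp add: vec_eq_iff forall_3 matrix_matrix_mult_def sum_3 diag3_def N_def frame_def)
  have "jacobian (axial \<phi>) (at (polar y)) =
      jacobian (axial \<phi>) (at (polar y)) ** (R ** (diag3 (y $ 1) ** diag3 (1 / y $ 1)) ** transpose R)"
    by (simp add: di R_def rot_orthogonal)
  also have "\<dots> = jacobian (axial \<phi>) (at (polar y)) ** (R ** diag3 (y $ 1)) ** diag3 (1 / y $ 1) ** transpose R"
    by (simp only: matrix_mul_assoc)
  also have "\<dots> = R ** (N ** diag3 (1 / y $ 1)) ** transpose R" unfolding e by (simp only: matrix_mul_assoc)
  finally show ?thesis unfolding Nd R_def J_def .
qed

lemma axisymmetric_compose:
  assumes iv: "inner_variation \<Omega> (axial \<phi>)" and \<phi>: "test_function P \<phi>" and u: "axisymmetric_map \<Omega> u"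
  shows "axisymmetric_map \<Omega> (\<lambda>x. u (x + axial \<phi> x))"
proof -
  obtain v where v: "AE p in lebesgue_on P. v p $ 1 \<ge> 0" "meridian_rep \<Omega> u v"
    using u by (auto simp: axisymmetric_map_def)
  define \<psi> where "\<psi> x = x + axial \<phi> x" for x
  have \<psi>_eq: "inner_variation.\<psi> (axial \<phi>) = \<psi>" by (simp add: inner_variation.\<psi>_def[OF iv] \<psi>_def fun_eq_iff)
  note diffeo = inner_variation.diffeo_\<Omega>[OF iv, unfolded \<psi>_eq]
  \<comment> \<open>Comparison with the axis point \<open>b\<close> at the same height, where the
    field vanishes: the Lipschitz constant 1/2 bounds the radial displacement by r/2, so the
    deformed radius stays positive.\<close>
  have pos: "r + \<phi> p $ 1 > 0" if p: "p \<in> P" "r = p $ 1" for p r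
  proof -
    define a where "a = polar (join (p, 0))"
    define b where "b = (vector [0, 0, p $ 2] :: real^3)"
    have r: "p $ 1 > 0" using p(1) meridian_iff by blast
    have bo: "axial \<phi> b = 0"
    proof -
      have "cm b $ 1 = 0" by (simp add: cm_nth b_def)
      then have "cm b \<notin> P" using meridian_iff by (metis less_irrefl)
      then have "\<phi> (cm b) = 0" using test_function_support[OF \<phi>] by (metis subsetD)
      then show ?thesis by (simp add: axial_def vec_eq_iff forall_3)
    qed
    have "axial \<phi> a = \<phi> p $ 1 *\<^sub>R e_r 0 + \<phi> p $ 2 *\<^sub>R e_z"
      using axial_polar[of "join (p, 0)" \<phi>] r by (simp add: a_def)
    then have "\<phi> p $ 1 = (axial \<phi> a - axial \<phi> b) $ 1" by (simp add: bo e_r_def e_z_def)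
    then have "\<bar>\<phi> p $ 1\<bar> \<le> norm (axial \<phi> a - axial \<phi> b)" using component_le_norm_cart by metis
    also have "\<dots> \<le> 1 / 2 * norm (a - b)" by (rule inner_variation.X_lipschitz[OF iv])
    also have "a - b = p $ 1 *\<^sub>R axis 1 1"
      by (simp add: vec_eq_iff forall_3 a_def b_def axis_def)
    also have "norm (p $ 1 *\<^sub>R (axis 1 1 :: real^3)) = p $ 1" using r by simp
    finally show ?thesis using p(2) r by linarith
  qed
  define m where "m p = (vector [p $ 1 + \<phi> p $ 1, p $ 2 + \<phi> p $ 2] :: real^2)" for p
  \<comment> \<open>Truncation makes the sign condition immediate. It does not affect the
    representation, because \<open>v\<close> has a nonnegative first component at the deformed point
    of almost every x.\<close>
  define w where "w p = (vector [max 0 (v (m p) $ 1), v (m p) $ 2] :: real^2)" for p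
  have m_cm: "cm (\<psi> (polar y)) = m (merid y)" if y: "y $ 1 > 0" "merid y \<in> P" for y
  proof -
    have e: "\<psi> (polar y) = polar (vector [y $ 1 + \<phi> (merid y) $ 1, y $ 2, y $ 3 + \<phi> (merid y) $ 2])"
      unfolding \<psi>_def polar_add_axial[OF y(1)] by (simp add: polar_def)
    show ?thesis unfolding e using pos[OF y(2), of "y $ 1"]
      by (subst cm_polar) (simp_all add: vec_eq_iff forall_2 m_def)
  qed
  have vpos: "AE x in lebesgue_on \<Omega>. v (cm x) $ 1 \<ge> 0"
  proof -
    have "AE y in lebesgue_on D. v (merid y) $ 1 \<ge> 0"
      unfolding AE_D_iff using v(1) unfolding AE_P_iff by (rule AE_lift)
    then have "AE y in lebesgue_on D. v (cm (polar y)) $ 1 \<ge> 0" using AE_space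
    proof eventually_elim
      case (elim y)
      then show ?case using cm_polar[of y] by (simp add: D_iff)
    qed
    then show ?thesis unfolding AE_polar .
  qed
  have "AE x in lebesgue_on \<Omega>. v (cm (\<psi> x)) $ 1 \<ge> 0"
    by (rule iffD1[OF diffeo_AE[OF diffeo] vpos])
  moreover have "AE x in lebesgue_on \<Omega>. \<forall>r>0. \<forall>\<theta> z. \<psi> x = cyl r \<theta> z \<longrightarrow>
     u (\<psi> x) = v (vector [r, z]) $ 1 *\<^sub>R e_r \<theta> + v (vector [r, z]) $ 2 *\<^sub>R e_z"
    by (rule iffD1[OF diffeo_AE[OF diffeo] v(2)[unfolded meridian_rep_def]])
  ultimately have "AE x in lebesgue_on \<Omega>. \<forall>r>0. \<forall>\<theta> z. x = cyl r \<theta> z \<longrightarrow>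
     u (\<psi> x) = w (vector [r, z]) $ 1 *\<^sub>R e_r \<theta> + w (vector [r, z]) $ 2 *\<^sub>R e_z"
    using AE_space
  proof eventually_elim
    case (elim x)
    show ?case
    proof (intro allI impI)
      fix r \<theta> z assume r: "0 < r" and x: "x = cyl r \<theta> z"
      define y where "y = (vector [r, \<theta>, z] :: real^3)"
      have y: "y $ 1 > 0" "x = polar y" using r x by (simp_all add: y_def polar_def)
      have my: "merid y = vector [r, z]" by (simp add: merid_def y_def)
      have P: "merid y \<in> P" using cm_in_iff[of x] cm_polar[OF y(1)] elim(3) y(2) by simp
      have "\<psi> x = cyl (m (merid y) $ 1) \<theta> (m (merid y) $ 2)"
        unfolding \<psi>_def y(2) polar_add_axial[OF y(1)] by (simp add: m_def y_def)
      moreover have "m (merid y) $ 1 > 0" using pos[OF P, of r] by (simp add: m_def my)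
      ultimately have "u (\<psi> x) = v (vector [m (merid y) $ 1, m (merid y) $ 2]) $ 1 *\<^sub>R e_r \<theta> +
          v (vector [m (merid y) $ 1, m (merid y) $ 2]) $ 2 *\<^sub>R e_z" using elim(2) by blast
      then have "u (\<psi> x) = v (m (merid y)) $ 1 *\<^sub>R e_r \<theta> + v (m (merid y)) $ 2 *\<^sub>R e_z"
        by (simp only: vec2_eq[symmetric])
      moreover have "v (m (merid y)) $ 1 \<ge> 0" using elim(1) m_cm[OF y(1) P] y(2) by simp
      ultimately show "u (\<psi> x) = w (vector [r, z]) $ 1 *\<^sub>R e_r \<theta> + w (vector [r, z]) $ 2 *\<^sub>R e_z"
        by (simp add: w_def my[symmetric])
    qed
  qed
  then have "meridian_rep \<Omega> (\<lambda>x. u (\<psi> x)) w" unfolding meridian_rep_def .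
  moreover have "AE p in lebesgue_on P. w p $ 1 \<ge> 0" by (simp add: w_def)
  ultimately show ?thesis unfolding axisymmetric_map_def \<psi>_def by blast
qed

end

section \<open>The weak equations in cylindrical coordinates\<close>

lemma test_function_mult_smooth:
  fixes \<phi> m :: "'a::euclidean_space \<Rightarrow> real"
  assumes "test_function U \<phi>" "smooth_on UNIV m"
  shows "test_function U (\<lambda>x. m x * \<phi> x)"
proof -
  obtain K where K: "compact K" "K \<subseteq> U" "\<And>x. x \<notin> K \<Longrightarrow> \<phi> x = 0" using test_function_support[OF assms(1)] by blast
  have "smooth_on UNIV (\<lambda>x. m x * \<phi> x)"
    by (rule smooth_on_mult[OF open_UNIV assms(2) test_function_smooth[OF assms(1)]])
  moreover have "\<forall>x. x \<notin> K \<longrightarrow> m x * \<phi> x = 0" using K(3) by simp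
  ultimately show ?thesis using K(1,2) unfolding test_function_def by blast
qed

lemma continuous_on_rot: "continuous_on UNIV (\<lambda>y::real^3. rot (y $ 2) $ k $ i)"
  using exhaust_3[of k] exhaust_3[of i] by (elim disjE; simp add: rot_def; intro continuous_intros)

lemma integral_add4:
  fixes f1 f2 f3 f4 :: "'a \<Rightarrow> real"
  assumes "integrable M f1" "integrable M f2" "integrable M f3" "integrable M f4"
  shows "integrable M (\<lambda>x. f1 x + f2 x + f3 x + f4 x)"
    and "(LINT x|M. f1 x + f2 x + f3 x + f4 x) = (LINT x|M. f1 x) + (LINT x|M. f2 x) + (LINT x|M. f3 x) + (LINT x|M. f4 x)"
  using assms by simp_all

abbreviation partial :: "'n \<Rightarrow> (real^'n \<Rightarrow> real) \<Rightarrow> real^'n \<Rightarrow> real" where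
  "partial j h x \<equiv> frechet_derivative h (at x) (axis j 1)"

text \<open>The weak form, tested with \<open>h\<^sub>1 e\<^sub>r + h\<^sub>2 e\<^sub>z\<close>, of the two meridian equations for a stress with
  matrix \<open>S\<close> in the frame \<open>(e\<^sub>r, e\<^sub>\<theta>, e\<^sub>z)\<close>.\<close>

definition weak_form :: "(real^2) set \<Rightarrow> (real^2 \<Rightarrow> real^3^3) \<Rightarrow> (real^2 \<Rightarrow> real) \<Rightarrow> (real^2 \<Rightarrow> real) \<Rightarrow> real" where
  "weak_form U S h\<^sub>1 h\<^sub>2 =
     (LINT p|lebesgue_on U. S p $ 1 $ 1 * (p $ 1 * partial 1 h\<^sub>1 p)) +
     (LINT p|lebesgue_on U. S p $ 1 $ 3 * (p $ 1 * (partial 2 h\<^sub>1 p + partial 1 h\<^sub>2 p))) +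
     (LINT p|lebesgue_on U. S p $ 3 $ 3 * (p $ 1 * partial 2 h\<^sub>2 p)) +
     (LINT p|lebesgue_on U. S p $ 2 $ 2 * h\<^sub>1 p)"

text \<open>The passage between the two systems uses only that T is the rotated S, that it is
  locally integrable, and the shape expressed by \<open>S_inner\<close>: symmetry and no coupling of
  e_\<theta> with e_r or e_z.\<close>

locale meridional_stress = meridional +
  fixes T :: "real^3 \<Rightarrow> real^3^3" and S :: "real^2 \<Rightarrow> real^3^3"
  assumes T: "\<And>i j. locally_integrable \<Omega> (\<lambda>x. T x $ i $ j)"
    and TS: "AE y in lebesgue_on D. T (polar y) = rot (y $ 2) ** S (merid y) ** transpose (rot (y $ 2))"
    and S_inner: "\<And>p Q. S p \<bullet> Q = S p $ 1 $ 1 * Q $ 1 $ 1 + S p $ 1 $ 3 * (Q $ 1 $ 3 + Q $ 3 $ 1) +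
      S p $ 3 $ 3 * Q $ 3 $ 3 + S p $ 2 $ 2 * Q $ 2 $ 2"
begin

text \<open>Inverting the rotation writes the entries of S as combinations of entries of T with
  bounded continuous coefficients; local integrability then descends to the half-plane.\<close>

lemma S_integrable: "locally_integrable P (\<lambda>p. S p $ i $ j)"
proof (rule locally_integrable_descend)
  have "locally_integrable \<Omega>s (\<lambda>x. T x $ k $ l)" for k l
    using T[of k l] by (auto simp: locally_integrable_def \<Omega>s_def)
  then have l: "locally_integrable D (\<lambda>y. T (polar y) $ k $ l)" for k l
    by (rule locally_integrable_diffeo[OF polar_diffeo])
  have "locally_integrable D (\<lambda>y. \<Sum>k\<in>UNIV. \<Sum>l\<in>UNIV. rot (y $ 2) $ k $ i * (rot (y $ 2) $ l $ j * T (polar y) $ k $ l))"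
    by (intro locally_integrable_sum locally_integrable_mult_continuous l continuous_on_subset[OF continuous_on_rot]) auto
  moreover have "AE y in lebesgue_on D.
      (\<Sum>k\<in>UNIV. \<Sum>l\<in>UNIV. rot (y $ 2) $ k $ i * (rot (y $ 2) $ l $ j * T (polar y) $ k $ l)) = S (merid y) $ i $ j"
    using TS
  proof eventually_elim
    case (elim y)
    define R where "R = rot (y $ 2)"
    have "transpose R ** T (polar y) ** R = transpose R ** (R ** S (merid y) ** transpose R) ** R"
      by (simp only: elim R_def)
    also have "\<dots> = (transpose R ** R) ** S (merid y) ** (transpose R ** R)" by (simp only: matrix_mul_assoc)
    also have "\<dots> = S (merid y)" by (simp only: R_def rot_orthogonal matrix_mul_lid matrix_mul_rid)
    finally have "S (merid y) $ i $ j = (transpose R ** T (polar y) ** R) $ i $ j" by simp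
    also have "\<dots> = (\<Sum>k\<in>UNIV. \<Sum>l\<in>UNIV. R $ k $ i * (R $ l $ j * T (polar y) $ k $ l))"
      by (simp add: matrix_matrix_mult_def transpose_def sum_3 algebra_simps)
    finally show ?case unfolding R_def by simp
  qed
  ultimately show "locally_integrable D (\<lambda>y. S (merid y) $ i $ j)"
    by (rule locally_integrable_cong_AE[OF open_lebesgue[OF open_D], rotated])
qed

lemma LINT_lift_test:
  assumes f: "locally_integrable P f" and h: "test_function P h"
  shows "integrable (lebesgue_on D) (\<lambda>y. f (merid y) * h (merid y))"
    and "(LINT y|lebesgue_on D. f (merid y) * h (merid y)) = 2 * pi * (LINT p|lebesgue_on P. f p * h p)"
proof -
  obtain K where K: "compact K" "K \<subseteq> P" "\<And>p. p \<notin> K \<Longrightarrow> h p = 0" using test_function_support[OF h] by blast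
  have c: "continuous_on UNIV (\<lambda>y. h (merid y))"
    by (rule continuous_on_compose2[OF smooth_on_continuous_on[OF test_function_smooth[OF h]]]) (auto intro: continuous_intros)
  have z: "\<forall>y. merid y \<notin> K \<longrightarrow> h (merid y) = 0" using K(3) by blast
  note L = LINT_product[OF f c K(1,2) z]
  show "integrable (lebesgue_on D) (\<lambda>y. f (merid y) * h (merid y))" by (rule L(1))
  have e: "f p * (\<integral>t. indicator {- pi<..<pi} t * h p \<partial>lborel) = 2 * pi * (f p * h p)" for p by simp
  have "(LINT y|lebesgue_on D. f (merid y) * h (merid y)) = (LINT p|lebesgue_on P. 2 * pi * (f p * h p))"
    unfolding L(2) merid_join e ..
  then show "(LINT y|lebesgue_on D. f (merid y) * h (merid y)) = 2 * pi * (LINT p|lebesgue_on P. f p * h p)"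
    by simp
qed

text \<open>The volume element r dr d\<theta> dz puts the factor r on the derivative terms and
  cancels the 1/r of the angular entry \<open>h\<^sub>1 / r\<close> of the gradient. The integral
  over \<theta> gives 2\<pi>.\<close>

lemma LINT_axial:
  assumes h: "test_function P h\<^sub>1" "test_function P h\<^sub>2"
  defines "\<phi> \<equiv> \<lambda>p. (vector [h\<^sub>1 p, h\<^sub>2 p] :: real^2)"
  shows "test_function P \<phi>"
    and "(LINT x|lebesgue_on \<Omega>. T x \<bullet> jacobian (axial \<phi>) (at x)) = 2 * pi * weak_form P S h\<^sub>1 h\<^sub>2"
proof -
  have \<phi>n: "(\<lambda>p. \<phi> p $ 1) = h\<^sub>1" "(\<lambda>p. \<phi> p $ 2) = h\<^sub>2" by (simp_all add: \<phi>_def)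
  show \<phi>: "test_function P \<phi>"
  proof -
    obtain K where K: "compact K" "K \<subseteq> P" "\<And>p. p \<notin> K \<Longrightarrow> h\<^sub>1 p = 0" using test_function_support[OF h(1)] by blast
    obtain L where L: "compact L" "L \<subseteq> P" "\<And>p. p \<notin> L \<Longrightarrow> h\<^sub>2 p = 0" using test_function_support[OF h(2)] by blast
    have "smooth_on UNIV \<phi>"
    proof (rule smooth_on_cart[OF open_UNIV])
      fix i :: 2
      consider "i = 1" | "i = 2" using exhaust_2 by blast
      then show "smooth_on UNIV (\<lambda>p. \<phi> p $ i)" by cases (simp_all add: \<phi>n test_function_smooth[OF h(1)] test_function_smooth[OF h(2)])
    qed
    moreover have "\<forall>p. p \<notin> K \<union> L \<longrightarrow> \<phi> p = 0" using K(3) L(3) by (simp add: \<phi>_def vec_eq_iff forall_2)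
    moreover have "compact (K \<union> L)" "K \<union> L \<subseteq> P" using K L by auto
    ultimately show ?thesis unfolding test_function_def by blast
  qed
  have \<phi>1: "\<phi> p $ 1 = h\<^sub>1 p" for p by (simp add: \<phi>_def)
  have d\<phi>: "\<phi> differentiable (at p)" for p by (rule smooth_on_differentiable[OF test_function_smooth[OF \<phi>] UNIV_I])
  have J: "jacobian \<phi> (at p) $ 1 $ j = partial j h\<^sub>1 p" "jacobian \<phi> (at p) $ 2 $ j = partial j h\<^sub>2 p" for p j
    using frechet_derivative_nth[OF d\<phi>[of p], of 1 "axis j 1"] frechet_derivative_nth[OF d\<phi>[of p], of 2 "axis j 1"]
    unfolding \<phi>n by (simp_all add: jacobian_nth)
  have sn: "smooth_on UNIV (\<lambda>p::real^2. p $ 1)" by (rule smooth_on_linear[OF bounded_linear_vec_nth open_UNIV])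
  have t1: "test_function P (\<lambda>p. p $ 1 * partial 1 h\<^sub>1 p)"
    and t2: "test_function P (\<lambda>p. p $ 1 * (partial 2 h\<^sub>1 p + partial 1 h\<^sub>2 p))"
    and t3: "test_function P (\<lambda>p. p $ 1 * partial 2 h\<^sub>2 p)"
    by (intro test_function_mult_smooth[OF _ sn] test_function_add test_function_frechet_derivative h)+
  note L = LINT_lift_test[OF S_integrable t1, of 1 1] LINT_lift_test[OF S_integrable t2, of 1 3]
    LINT_lift_test[OF S_integrable t3, of 3 3] LINT_lift_test[OF S_integrable h(1), of 2 2]
  have "(LINT x|lebesgue_on \<Omega>. T x \<bullet> jacobian (axial \<phi>) (at x)) =
      (LINT y|lebesgue_on D. y $ 1 * (T (polar y) \<bullet> jacobian (axial \<phi>) (at (polar y))))"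
    by (rule LINT_polar(1))
  also have "\<dots> = (LINT y|lebesgue_on D. S (merid y) $ 1 $ 1 * (merid y $ 1 * partial 1 h\<^sub>1 (merid y)) +
      S (merid y) $ 1 $ 3 * (merid y $ 1 * (partial 2 h\<^sub>1 (merid y) + partial 1 h\<^sub>2 (merid y))) +
      S (merid y) $ 3 $ 3 * (merid y $ 1 * partial 2 h\<^sub>2 (merid y)) + S (merid y) $ 2 $ 2 * h\<^sub>1 (merid y))"
  proof (rule lebesgue_on_integral_cong_AE(1)[OF open_lebesgue[OF open_D]])
    show "AE y in lebesgue_on D. y $ 1 * (T (polar y) \<bullet> jacobian (axial \<phi>) (at (polar y))) =
      S (merid y) $ 1 $ 1 * (merid y $ 1 * partial 1 h\<^sub>1 (merid y)) +
      S (merid y) $ 1 $ 3 * (merid y $ 1 * (partial 2 h\<^sub>1 (merid y) + partial 1 h\<^sub>2 (merid y))) +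
      S (merid y) $ 3 $ 3 * (merid y $ 1 * partial 2 h\<^sub>2 (merid y)) + S (merid y) $ 2 $ 2 * h\<^sub>1 (merid y)"
      using TS AE_space
    proof eventually_elim
      case (elim y)
      then have y: "y $ 1 > 0" by (simp add: D_iff)
      have "T (polar y) \<bullet> jacobian (axial \<phi>) (at (polar y)) = S (merid y) \<bullet> frame (jacobian \<phi> (at (merid y))) (\<phi> (merid y) $ 1 / y $ 1)"
        unfolding elim(1) jacobian_axial[OF \<phi> y] by (rule inner_matrix_conj[OF rot_orthogonal(2)])
      also have "\<dots> = S (merid y) $ 1 $ 1 * partial 1 h\<^sub>1 (merid y) +
          S (merid y) $ 1 $ 3 * (partial 2 h\<^sub>1 (merid y) + partial 1 h\<^sub>2 (merid y)) +
          S (merid y) $ 3 $ 3 * partial 2 h\<^sub>2 (merid y) + S (merid y) $ 2 $ 2 * (h\<^sub>1 (merid y) / y $ 1)"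
        by (subst S_inner) (simp add: frame_def J \<phi>1)
      finally have e: "T (polar y) \<bullet> jacobian (axial \<phi>) (at (polar y)) = S (merid y) $ 1 $ 1 * partial 1 h\<^sub>1 (merid y) +
          S (merid y) $ 1 $ 3 * (partial 2 h\<^sub>1 (merid y) + partial 1 h\<^sub>2 (merid y)) +
          S (merid y) $ 3 $ 3 * partial 2 h\<^sub>2 (merid y) + S (merid y) $ 2 $ 2 * (h\<^sub>1 (merid y) / y $ 1)" .
      have dv: "y $ 1 * (S (merid y) $ 2 $ 2 * (h\<^sub>1 (merid y) / y $ 1)) = S (merid y) $ 2 $ 2 * h\<^sub>1 (merid y)" using y by simp
      show ?case unfolding e distrib_left[of "y $ 1"] dv by (simp add: algebra_simps)
    qed
  qed
  also have "\<dots> = 2 * pi * weak_form P S h\<^sub>1 h\<^sub>2"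
    unfolding weak_form_def integral_add4(2)[OF L(1,3,5,7)] L(2,4,6,8) by (simp only: distrib_left)
  finally show "(LINT x|lebesgue_on \<Omega>. T x \<bullet> jacobian (axial \<phi>) (at x)) = 2 * pi * weak_form P S h\<^sub>1 h\<^sub>2" .
qed

lemma Div_free_T:
  assumes weak: "\<And>h\<^sub>1 h\<^sub>2. test_function P h\<^sub>1 \<Longrightarrow> test_function P h\<^sub>2 \<Longrightarrow> weak_form P S h\<^sub>1 h\<^sub>2 = 0"
  shows "Div_free \<Omega> T"
proof -
  have main: "(LINT x|lebesgue_on \<Omega>. (\<Sum>j\<in>UNIV. T x $ k $ j * partial j \<phi> x)) = 0" if \<phi>: "test_function \<Omega> \<phi>" for \<phi> k
  proof -
    obtain K0 where K0: "compact K0" "K0 \<subseteq> \<Omega>" "\<And>x. x \<notin> K0 \<Longrightarrow> \<phi> x = 0" using test_function_support[OF \<phi>] by blast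
    \<comment> \<open>The test function in cylindrical coordinates, set to zero where r is not
      positive. It is smooth on the whole space because its support stays over the compact set
      \<open>K\<close>, where r is positive.\<close>
    define \<Phi> where "\<Phi> y = (if y $ 1 > 0 then \<phi> (polar y) else 0)" for y
    define K where "K = cm ` K0"
    have ccm: "continuous_on UNIV cm"
    proof -
      have e: "cm = (\<lambda>x. sqrt ((x $ 1)\<^sup>2 + (x $ 2)\<^sup>2) *\<^sub>R axis 1 1 + x $ 3 *\<^sub>R axis 2 1)"
        by (simp add: fun_eq_iff vec_eq_iff forall_2 cm_nth axis_def)
      show ?thesis unfolding e by (intro continuous_intros)
    qed
    have K: "compact K" "K \<subseteq> P"
      unfolding K_def using K0 cm_in_iff by (auto intro: compact_continuous_image continuous_on_subset[OF ccm])
    have zero: "\<Phi> y = 0" if "merid y \<notin> K" for y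
    proof (cases "y $ 1 > 0 \<and> polar y \<in> K0")
      case True
      then have "cm (polar y) \<in> K" unfolding K_def by blast
      then show ?thesis using that True cm_polar by simp
    next
      case False
      then show ?thesis using K0(3) by (auto simp: \<Phi>_def)
    qed
    have o1: "open {y::real^3. y $ 1 > 0}" by (intro open_Collect_less continuous_intros)
    define V where "V = {y::real^3. merid y \<notin> K}"
    have oV: "open V"
    proof -
      have "V = merid -` (- K)" by (auto simp: V_def)
      then show ?thesis using K(1) open_vimage[of "- K" merid] by (simp add: compact_imp_closed open_Compl continuous_on_merid continuous_on_id)
    qed
    have sp: "smooth_on UNIV (\<lambda>y. \<phi> (polar y))"
      by (rule smooth_on_compose[OF open_UNIV open_UNIV smooth_on_polar _ test_function_smooth[OF \<phi>]]) simp
    have s1: "smooth_on {y. y $ 1 > 0} \<Phi>"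
      by (rule smooth_on_cong[OF o1 _ smooth_on_subset[OF sp subset_UNIV]]) (simp add: \<Phi>_def)
    have s2: "smooth_on V \<Phi>"
      by (rule smooth_on_cong[OF oV _ smooth_on_const[of V 0]]) (simp add: V_def zero)
    have "{y. y $ 1 > 0} \<union> V = UNIV"
    proof -
      have "y $ 1 > 0" if "merid y \<in> K" for y using that K(2) meridian_iff[of "merid y"] by auto
      then show ?thesis by (auto simp: V_def)
    qed
    then have s\<Phi>: "smooth_on UNIV \<Phi>" using smooth_on_Un[OF o1 oV s1 s2] by simp
    have d\<Phi>: "\<Phi> differentiable (at y)" for y by (rule smooth_on_differentiable[OF s\<Phi> UNIV_I])
    have c\<Phi>: "continuous_on UNIV \<Phi>" by (rule smooth_on_continuous_on[OF s\<Phi>])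
    have cd: "continuous_on UNIV (\<lambda>y. partial j \<Phi> y)" for j
      by (rule smooth_on_continuous_on[OF smooth_on_frechet_derivative[OF s\<Phi>]])
    have zd: "partial j \<Phi> y = 0" if "merid y \<notin> K" for j y
    proof -
      have "frechet_derivative \<Phi> (at y) = frechet_derivative (\<lambda>_. 0) (at y)"
        by (rule frechet_derivative_transform[OF oV]) (use that zero in \<open>auto simp: V_def\<close>)
      then show ?thesis by (simp add: frechet_derivative_const)
    qed
    define R where "R t i = rot t $ k $ i" for t i
    have cR: "continuous_on UNIV (\<lambda>y::real^3. R (y $ 2) i)" for i unfolding R_def by (rule continuous_on_rot)
    \<comment> \<open>The first four are the factors in \<open>weak_form\<close> for the test pair
      \<open>R t 1 * \<Phi>\<close> and \<open>R t 3 * \<Phi>\<close>. The angular contribution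
      \<open>R t 2 * partial 2 \<Phi>\<close> equals \<Psi>4 + \<Psi>5, and \<Psi>5 is the
      derivative of \<open>R t 2 * \<Phi>\<close> in t, because \<open>R t 2\<close> has the
      derivative \<open>- R t 1\<close>.\<close>
    define \<Psi>1 where "\<Psi>1 y = R (y $ 2) 1 * (y $ 1 * partial 1 \<Phi> y)" for y
    define \<Psi>2 where "\<Psi>2 y = y $ 1 * (R (y $ 2) 1 * partial 3 \<Phi> y + R (y $ 2) 3 * partial 1 \<Phi> y)" for y
    define \<Psi>3 where "\<Psi>3 y = R (y $ 2) 3 * (y $ 1 * partial 3 \<Phi> y)" for y
    define \<Psi>4 where "\<Psi>4 y = R (y $ 2) 1 * \<Phi> y" for y
    define \<Psi>5 where "\<Psi>5 y = R (y $ 2) 2 * partial 2 \<Phi> y - R (y $ 2) 1 * \<Phi> y" for y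
    have c: "continuous_on UNIV \<Psi>1" "continuous_on UNIV \<Psi>2" "continuous_on UNIV \<Psi>3" "continuous_on UNIV \<Psi>4" "continuous_on UNIV \<Psi>5"
      unfolding \<Psi>1_def[abs_def] \<Psi>2_def[abs_def] \<Psi>3_def[abs_def] \<Psi>4_def[abs_def] \<Psi>5_def[abs_def]
      by (intro continuous_intros cR c\<Phi> cd)+
    have z: "\<forall>y. merid y \<notin> K \<longrightarrow> \<Psi>1 y = 0" "\<forall>y. merid y \<notin> K \<longrightarrow> \<Psi>2 y = 0"
      "\<forall>y. merid y \<notin> K \<longrightarrow> \<Psi>3 y = 0" "\<forall>y. merid y \<notin> K \<longrightarrow> \<Psi>4 y = 0"
      "\<forall>y. merid y \<notin> K \<longrightarrow> \<Psi>5 y = 0"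
      using zd zero by (simp_all add: \<Psi>1_def \<Psi>2_def \<Psi>3_def \<Psi>4_def \<Psi>5_def)
    note L1 = LINT_product[OF S_integrable c(1) K z(1), of 1 1] and L2 = LINT_product[OF S_integrable c(2) K z(2), of 1 3]
      and L3 = LINT_product[OF S_integrable c(3) K z(3), of 3 3] and L4 = LINT_product[OF S_integrable c(4) K z(4), of 2 2]
      and L5 = LINT_product[OF S_integrable c(5) K z(5), of 2 2]
    have sj: "smooth_on UNIV (\<lambda>p. join (p, t))" for t
      by (rule smooth_on_bounded_linear[OF bounded_linear_join open_UNIV])
        (intro smooth_on_Pair smooth_on_id smooth_on_const open_UNIV)
    have th: "test_function P (\<lambda>p. c * \<Phi> (join (p, t)))" for c t
    proof -
      have "smooth_on UNIV (\<lambda>p. c * \<Phi> (join (p, t)))"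
        by (rule smooth_on_mult[OF open_UNIV smooth_on_const smooth_on_compose[OF open_UNIV open_UNIV sj _ s\<Phi>]]) simp
      moreover have "\<forall>p. p \<notin> K \<longrightarrow> c * \<Phi> (join (p, t)) = 0" using zero by simp
      ultimately show ?thesis using K unfolding test_function_def by blast
    qed
    have dh: "partial 1 (\<lambda>p. c * \<Phi> (join (p, t))) p = c * partial 1 \<Phi> (join (p, t))"
      "partial 2 (\<lambda>p. c * \<Phi> (join (p, t))) p = c * partial 3 \<Phi> (join (p, t))" for c t p
    proof -
      have dj: "(\<lambda>p. \<Phi> (join (p, t))) differentiable (at p)"
        by (rule smooth_on_differentiable[OF smooth_on_compose[OF open_UNIV open_UNIV sj _ s\<Phi>] UNIV_I]) simp
      have "((\<lambda>p. c * \<Phi> (join (p, t))) has_derivative (\<lambda>w. c * frechet_derivative (\<lambda>p. \<Phi> (join (p, t))) (at p) w)) (at p)"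
        using dj by (intro has_derivative_mult_right) (simp add: frechet_derivative_works[symmetric])
      from frechet_derivative_at[OF this, symmetric]
      show "partial 1 (\<lambda>p. c * \<Phi> (join (p, t))) p = c * partial 1 \<Phi> (join (p, t))"
        "partial 2 (\<lambda>p. c * \<Phi> (join (p, t))) p = c * partial 3 \<Phi> (join (p, t))"
        by (simp_all add: frechet_derivative_join(1)[OF d\<Phi>] axis_join_merid)
    qed
    \<comment> \<open>The weak equations in the half-plane of angle t, tested with the components of
      \<phi> e_k along e_r and e_z.\<close>
    have slice: "(LINT p|lebesgue_on P. S p $ 1 $ 1 * \<Psi>1 (join (p, t))) + (LINT p|lebesgue_on P. S p $ 1 $ 3 * \<Psi>2 (join (p, t))) +
        (LINT p|lebesgue_on P. S p $ 3 $ 3 * \<Psi>3 (join (p, t))) + (LINT p|lebesgue_on P. S p $ 2 $ 2 * \<Psi>4 (join (p, t))) = 0" for t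
      using weak[OF th[of "R t 1" t] th[of "R t 3" t]]
      unfolding weak_form_def dh by (simp add: \<Psi>1_def \<Psi>2_def \<Psi>3_def \<Psi>4_def mult.left_commute)
    have I14: "(LINT y|lebesgue_on D. S (merid y) $ 1 $ 1 * \<Psi>1 y) + (LINT y|lebesgue_on D. S (merid y) $ 1 $ 3 * \<Psi>2 y) +
        (LINT y|lebesgue_on D. S (merid y) $ 3 $ 3 * \<Psi>3 y) + (LINT y|lebesgue_on D. S (merid y) $ 2 $ 2 * \<Psi>4 y) = 0"
    proof -
      have "indicator {- pi<..<pi} t * (LINT p|lebesgue_on P. S p $ 1 $ 1 * \<Psi>1 (join (p, t))) +
          indicator {- pi<..<pi} t * (LINT p|lebesgue_on P. S p $ 1 $ 3 * \<Psi>2 (join (p, t))) +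
          indicator {- pi<..<pi} t * (LINT p|lebesgue_on P. S p $ 3 $ 3 * \<Psi>3 (join (p, t))) +
          indicator {- pi<..<pi} t * (LINT p|lebesgue_on P. S p $ 2 $ 2 * \<Psi>4 (join (p, t))) = 0" for t
        unfolding distrib_left[symmetric] slice by simp
      then show ?thesis
        unfolding L1(3) L2(3) L3(3) L4(3) integral_add4(2)[OF L1(4) L2(4) L3(4) L4(4), symmetric] by simp
    qed
    have per: "(\<integral>t. indicator {- pi<..<pi} t * \<Psi>5 (join (p, t)) \<partial>lborel) = 0" for p
    proof -
      have dR: "((\<lambda>t. R t 2) has_real_derivative - R t 1) (at t)" for t
        using exhaust_3[of k] by (auto simp: R_def rot_def intro!: derivative_eq_intros)
      have dq: "((\<lambda>t. \<Phi> (join (p, t))) has_real_derivative partial 2 \<Phi> (join (p, t))) (at t)" for t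
      proof -
        have bl: "bounded_linear (\<lambda>s::real. join (0, s))"
          by (rule bounded_linear_compose[OF bounded_linear_join bounded_linear_Pair[OF bounded_linear_zero bounded_linear_ident]])
        have "((\<lambda>t. join (p, 0) + join (0, t)) has_derivative (\<lambda>s. 0 + join (0, s))) (at t)"
          by (rule has_derivative_add[OF has_derivative_const bounded_linear_imp_has_derivative[OF bl]])
        moreover have "(\<lambda>t. join (p, 0) + join (0, t)) = (\<lambda>t. join (p, t))" "(\<lambda>s. 0 + join (0, s)) = (\<lambda>s. join (0, s))"
          by (simp_all add: fun_eq_iff vec_eq_iff forall_3)
        ultimately have j1: "((\<lambda>t. join (p, t)) has_derivative (\<lambda>s. join (0, s))) (at t)" by simp
        have "((\<lambda>t. \<Phi> (join (p, t))) has_derivative (\<lambda>s. frechet_derivative \<Phi> (at (join (p, t))) (join (0, s)))) (at t)"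
          by (rule has_derivative_compose[OF j1]) (use d\<Phi> in \<open>simp add: frechet_derivative_works[symmetric]\<close>)
        moreover have "frechet_derivative \<Phi> (at (join (p, t))) (join (0, s)) = partial 2 \<Phi> (join (p, t)) * s" for s
        proof -
          have "join (0, s) = s *\<^sub>R axis 2 1" by (simp add: vec_eq_iff forall_3 axis_def)
          then show ?thesis
            using linear_scale[OF linear_frechet_derivative[OF d\<Phi>], of "join (p, t)" s "axis 2 1"] by simp
        qed
        ultimately show ?thesis by (simp add: has_field_derivative_def)
      qed
      have der: "((\<lambda>t. R t 2 * \<Phi> (join (p, t))) has_real_derivative \<Psi>5 (join (p, t))) (at t)" for t
        using DERIV_mult[OF dR dq, of t] by (simp add: \<Psi>5_def algebra_simps)
      have cj: "isCont (\<lambda>t. \<Psi>5 (join (p, t))) t" for t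
      proof -
        have "continuous_on UNIV (\<lambda>t. \<Psi>5 (join (p, t)))"
          by (rule continuous_on_compose2[OF c(5)]) (auto intro!: continuous_intros)
        then show ?thesis by (simp add: continuous_on_eq_continuous_at)
      qed
      \<comment> \<open>Both ends of the interval describe the same point of the half-plane at the
        slit, so no boundary term survives although \<phi> need not vanish there.\<close>
      have pp: "\<Phi> (join (p, pi)) = \<Phi> (join (p, - pi))" "R pi 2 = R (- pi) 2"
        by (simp_all add: \<Phi>_def polar_def cyl_def R_def rot_def)
      have "(\<integral>t. \<Psi>5 (join (p, t)) * indicator {- pi..pi} t \<partial>lborel) = R pi 2 * \<Phi> (join (p, pi)) - R (- pi) 2 * \<Phi> (join (p, - pi))"
        by (rule integral_FTC_Icc_real) (use der cj in auto)
      also have "\<dots> = 0" by (simp add: pp)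
      finally have z: "(\<integral>t. \<Psi>5 (join (p, t)) * indicator {- pi..pi} t \<partial>lborel) = 0" .
      have mj: "(\<lambda>t. \<Psi>5 (join (p, t))) \<in> borel_measurable borel"
        using cj by (intro borel_measurable_continuous_onI) (simp add: continuous_at_imp_continuous_on)
      have "(\<integral>t. indicator {- pi<..<pi} t * \<Psi>5 (join (p, t)) \<partial>lborel) = (\<integral>t. \<Psi>5 (join (p, t)) * indicator {- pi..pi} t \<partial>lborel)"
      proof (rule integral_cong_AE)
        show "(\<lambda>t. indicator {- pi<..<pi} t * \<Psi>5 (join (p, t))) \<in> borel_measurable lborel" using mj by simp
        show "(\<lambda>t. \<Psi>5 (join (p, t)) * indicator {- pi..pi} t) \<in> borel_measurable lborel" using mj by simp
        show "AE t in lborel. indicator {- pi<..<pi} t * \<Psi>5 (join (p, t)) = \<Psi>5 (join (p, t)) * indicator {- pi..pi} t"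
          using AE_lborel_singleton[of pi] AE_lborel_singleton[of "- pi"]
          by eventually_elim (auto simp: indicator_def)
      qed
      then show ?thesis using z by simp
    qed
    have I5: "(LINT y|lebesgue_on D. S (merid y) $ 2 $ 2 * \<Psi>5 y) = 0" unfolding L5(2) per by simp
    have "(LINT x|lebesgue_on \<Omega>. (\<Sum>j\<in>UNIV. T x $ k $ j * partial j \<phi> x)) =
        (LINT y|lebesgue_on D. y $ 1 * (\<Sum>j\<in>UNIV. T (polar y) $ k $ j * partial j \<phi> (polar y)))"
      by (rule LINT_polar(1))
    also have "\<dots> = (LINT y|lebesgue_on D. S (merid y) $ 1 $ 1 * \<Psi>1 y + S (merid y) $ 1 $ 3 * \<Psi>2 y +
        S (merid y) $ 3 $ 3 * \<Psi>3 y + S (merid y) $ 2 $ 2 * \<Psi>4 y + S (merid y) $ 2 $ 2 * \<Psi>5 y)"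
    proof (rule lebesgue_on_integral_cong_AE(1)[OF open_lebesgue[OF open_D]])
      show "AE y in lebesgue_on D. y $ 1 * (\<Sum>j\<in>UNIV. T (polar y) $ k $ j * partial j \<phi> (polar y)) =
          S (merid y) $ 1 $ 1 * \<Psi>1 y + S (merid y) $ 1 $ 3 * \<Psi>2 y +
          S (merid y) $ 3 $ 3 * \<Psi>3 y + S (merid y) $ 2 $ 2 * \<Psi>4 y + S (merid y) $ 2 $ 2 * \<Psi>5 y"
        using TS AE_space
      proof eventually_elim
        case (elim y)
        then have y: "y $ 1 > 0" by (simp add: D_iff)
        define w where "w j = partial j \<phi> (polar y)" for j
        have pj: "partial j \<Phi> y = (\<Sum>l\<in>UNIV. jacobian polar (at y) $ l $ j * w l)" for j
        proof -
          have "frechet_derivative \<Phi> (at y) = frechet_derivative (\<lambda>y. \<phi> (polar y)) (at y)"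
            by (rule frechet_derivative_transform[OF o1]) (use y in \<open>auto simp: \<Phi>_def\<close>)
          then show ?thesis unfolding w_def
            using frechet_derivative_compose_cart[OF smooth_on_differentiable[OF smooth_on_polar UNIV_I]
                smooth_on_differentiable[OF test_function_smooth[OF \<phi>] UNIV_I], of y j] by simp
        qed
        have p: "partial 1 \<Phi> y = cos (y $ 2) * w 1 + sin (y $ 2) * w 2"
          "partial 2 \<Phi> y = y $ 1 * (cos (y $ 2) * w 2 - sin (y $ 2) * w 1)" "partial 3 \<Phi> y = w 3"
          unfolding pj by (simp_all add: jacobian_polar sum_3 matrix_matrix_mult_def rot_def diag3_def algebra_simps)
        define r where "r = rot (y $ 2)"
        \<comment> \<open>The gradient of the field \<phi> e_k: only row k is nonzero. It turns row
          k of the divergence into an inner product of matrices, which is invariant under rotation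
          of both factors.\<close>
        define Q where "Q = ((\<chi> i j. if i = k then w j else 0) :: real^3^3)"
        have TQ: "(\<Sum>j\<in>UNIV. T (polar y) $ k $ j * w j) = T (polar y) \<bullet> Q"
          using exhaust_3[of k] by (auto simp: inner_vec_def Q_def sum_3)
        have Q': "Q = r ** (transpose r ** Q ** r) ** transpose r"
        proof -
          have "r ** (transpose r ** Q ** r) ** transpose r = (r ** transpose r) ** Q ** (r ** transpose r)"
            by (simp only: matrix_mul_assoc)
          then show ?thesis by (simp only: r_def rot_orthogonal matrix_mul_lid matrix_mul_rid)
        qed
        have "T (polar y) \<bullet> Q = S (merid y) \<bullet> (transpose r ** Q ** r)"
          unfolding elim(1) r_def[symmetric] by (subst Q') (rule inner_matrix_conj[OF rot_orthogonal(2)[of "y $ 2", folded r_def]])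
        also have "\<dots> = S (merid y) $ 1 $ 1 * (R (y $ 2) 1 * partial 1 \<Phi> y) +
            S (merid y) $ 1 $ 3 * (R (y $ 2) 1 * partial 3 \<Phi> y + R (y $ 2) 3 * partial 1 \<Phi> y) +
            S (merid y) $ 3 $ 3 * (R (y $ 2) 3 * partial 3 \<Phi> y) +
            S (merid y) $ 2 $ 2 * (R (y $ 2) 2 * (cos (y $ 2) * w 2 - sin (y $ 2) * w 1))"
        proof -
          have q: "(transpose r ** Q ** r) $ i $ j = R (y $ 2) i * (w 1 * r $ 1 $ j + w 2 * r $ 2 $ j + w 3 * r $ 3 $ j)" for i j
            using exhaust_3[of k]
            by (auto simp: matrix_matrix_mult_def transpose_def sum_3 Q_def R_def r_def[symmetric] algebra_simps)
          show ?thesis by (subst S_inner) (unfold q p, simp add: r_def rot_def algebra_simps)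
        qed
        finally have e: "(\<Sum>j\<in>UNIV. T (polar y) $ k $ j * partial j \<phi> (polar y)) = S (merid y) $ 1 $ 1 * (R (y $ 2) 1 * partial 1 \<Phi> y) +
            S (merid y) $ 1 $ 3 * (R (y $ 2) 1 * partial 3 \<Phi> y + R (y $ 2) 3 * partial 1 \<Phi> y) +
            S (merid y) $ 3 $ 3 * (R (y $ 2) 3 * partial 3 \<Phi> y) +
            S (merid y) $ 2 $ 2 * (R (y $ 2) 2 * (cos (y $ 2) * w 2 - sin (y $ 2) * w 1))"
          using TQ by (simp only: w_def)
        show ?case unfolding e \<Psi>1_def \<Psi>2_def \<Psi>3_def \<Psi>4_def \<Psi>5_def p(2) by (simp add: algebra_simps)
      qed
    qed
    also have "\<dots> = 0"
      unfolding Bochner_Integration.integral_add[OF integral_add4(1)[OF L1(1) L2(1) L3(1) L4(1)] L5(1)]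
        integral_add4(2)[OF L1(1) L2(1) L3(1) L4(1)] I14 I5 by simp
    finally show ?thesis .
  qed
  have int: "integrable (lebesgue_on \<Omega>) (\<lambda>x. T x $ k $ j * partial j \<phi> x)" if "test_function \<Omega> \<phi>" for k j \<phi>
    by (rule integrable_test_function[OF open_\<Omega> T test_function_frechet_derivative[OF that]])
  have "(\<Sum>j\<in>UNIV. - (LINT x|lebesgue_on \<Omega>. T x $ k $ j * partial j \<phi> x)) = 0" if \<phi>: "test_function \<Omega> \<phi>" for k \<phi>
  proof -
    have "(LINT x|lebesgue_on \<Omega>. (\<Sum>j\<in>UNIV. T x $ k $ j * partial j \<phi> x)) =
        (\<Sum>j\<in>UNIV. LINT x|lebesgue_on \<Omega>. T x $ k $ j * partial j \<phi> x)"
      by (rule Bochner_Integration.integral_sum) (rule int[OF \<phi>])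
    then show ?thesis unfolding main[OF \<phi>] sum_negf by simp
  qed
  moreover have "locally_integrable \<Omega> T" by (intro locally_integrable_cart T)
  ultimately show ?thesis
    unfolding Div_free_def distr_eq_def distr_partial_def regular_distr_def by blast
qed

end

section \<open>Stationarity of the minimizer and the two systems of equations\<close>

lemma Ck_on_C1_upto_boundary:
  assumes \<Omega>: "open \<Omega>" and g: "C1_upto_boundary (closure \<Omega>) g"
  shows "Ck_on 1 \<Omega> g"
proof -
  obtain g' where g': "\<forall>x\<in>closure \<Omega>. (g has_derivative blinfun_apply (g' x)) (at x within closure \<Omega>)"
    "continuous_on (closure \<Omega>) g'" using g unfolding C1_upto_boundary_def by blast
  have "Ck_on (Suc 0) \<Omega> g"
  proof (rule Ck_on_SucI[OF \<Omega>])
    show "(g has_derivative blinfun_apply (g' x)) (at x)" if x: "x \<in> \<Omega>" for x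
    proof -
      have "x \<in> closure \<Omega>" using x closure_subset by blast
      then have "(g has_derivative blinfun_apply (g' x)) (at x within \<Omega>)"
        by (rule has_derivative_subset[OF g'(1)[rule_format] closure_subset])
      then show ?thesis by (simp only: at_within_open[OF x \<Omega>])
    qed
    show "Ck_on 0 \<Omega> (\<lambda>x. blinfun_apply (g' x) w)" for w
      unfolding Ck_on.simps
      by (intro continuous_intros continuous_on_subset[OF g'(2) closure_subset])
  qed
  then show ?thesis by simp
qed

context meridional
begin

lemma minimizer_stationary:
  assumes b: "bounded \<Omega>" and H: "energy_density_assms H" and g: "Ck_on 1 \<Omega> g"
    and u: "u \<in> admissible_nc_axi \<Omega> g M"
    and min: "\<forall>w\<in>admissible_nc_axi \<Omega> g M. energy H \<Omega> u \<le> energy H \<Omega> w"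
    and f: "integrable (lebesgue_on \<Omega>) (\<lambda>x. (norm (weak_D \<Omega> u x))\<^sup>2 + H (det (weak_D \<Omega> u x)))"
    and \<phi>: "test_function P \<phi>"
  shows "(LINT x|lebesgue_on \<Omega>. stress H (weak_D \<Omega> u x) \<bullet> jacobian (axial \<phi>) (at x)) = 0"
proof -
  have nc: "u \<in> admissible_nc \<Omega> g M" and axi: "axisymmetric_map \<Omega> u" using u by (auto simp: admissible_nc_axi_def)
  have W: "W12 \<Omega> u" and pos: "AE x in lebesgue_on \<Omega>. det (weak_D \<Omega> u x) > 0"
    using nc by (auto simp: admissible_nc_def admissible_def)
  note wD = W12_weak_D(1)[OF W]
  have le: "0 \<le> (LINT x|lebesgue_on \<Omega>. stress H (weak_D \<Omega> u x) \<bullet> jacobian (axial \<eta>) (at x))"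
    if \<eta>: "test_function P \<eta>" for \<eta>
  proof -
    note tX = test_function_axial[OF \<eta>]
    obtain \<epsilon> where \<epsilon>: "\<epsilon> > 0" and iv: "\<And>t. 0 < t \<Longrightarrow> t \<le> \<epsilon> \<Longrightarrow> inner_variation \<Omega> (\<lambda>x. t *\<^sub>R axial \<eta> x)"
      using inner_variation_small[OF open_\<Omega> tX] by blast
    have en: "energy H \<Omega> u \<le> energy H \<Omega> (\<lambda>x. u (x + t *\<^sub>R axial \<eta> x))" if t: "0 < t" "t \<le> \<epsilon>" for t
    proof -
      have e: "(\<lambda>x. t *\<^sub>R axial \<eta> x) = axial (\<lambda>p. t *\<^sub>R \<eta> p)" by (simp add: fun_eq_iff axial_scaleR)
      note ivt = iv[OF t, unfolded e]
      have "axisymmetric_map \<Omega> (\<lambda>x. u (x + axial (\<lambda>p. t *\<^sub>R \<eta> p) x))"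
        by (rule axisymmetric_compose[OF ivt test_function_scaleR[OF \<eta>] axi])
      moreover have "(\<lambda>x. u (x + axial (\<lambda>p. t *\<^sub>R \<eta> p) x)) \<in> admissible_nc \<Omega> g M"
        using inner_variation3.admissible_nc_compose[OF inner_variation3.intro[OF ivt] nc g b]
        unfolding inner_variation.\<psi>_def[OF ivt] .
      ultimately have "(\<lambda>x. u (x + t *\<^sub>R axial \<eta> x)) \<in> admissible_nc_axi \<Omega> g M"
        by (simp add: admissible_nc_axi_def axial_scaleR)
      then show ?thesis using min by blast
    qed
    show ?thesis
      by (rule first_variation(2)[OF open_\<Omega> b H wD f pos tX \<epsilon>]) (rule iv en; assumption)+
  qed
  have dX: "axial \<phi> differentiable (at x)" for x
    by (rule smooth_on_differentiable[OF test_function_smooth[OF test_function_axial[OF \<phi>]] UNIV_I])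
  \<comment> \<open>The inequality is linear in the field, so the opposite field gives the reverse
    inequality.\<close>
  have "axial (\<lambda>p. (- 1) *\<^sub>R \<phi> p) = (\<lambda>x. (- 1) *\<^sub>R axial \<phi> x)" by (rule ext) (rule axial_scaleR)
  then have "jacobian (axial (\<lambda>p. (- 1) *\<^sub>R \<phi> p)) (at x) = (- 1) *\<^sub>R jacobian (axial \<phi>) (at x)" for x
    using jacobian_scaleR[OF dX, of "- 1" x] by (simp only:)
  then have "0 \<le> - (LINT x|lebesgue_on \<Omega>. stress H (weak_D \<Omega> u x) \<bullet> jacobian (axial \<phi>) (at x))"
    using le[OF test_function_scaleR[OF \<phi>, of "- 1"]] by simp
  then show ?thesis using le[OF \<phi>] by linarith
qed

text \<open>Tested with f, the term (1/r) \<partial>_r (r F) becomes minus the integral of r F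
  \<partial>_r (f/r). The two equations are therefore the weak form with f/r in one of the two slots
  and 0 in the other.\<close>

lemma meridian_equations_weak_form:
  fixes v :: "real^2 \<Rightarrow> real^2" and H :: "real \<Rightarrow> real"
  defines "S \<equiv> \<lambda>p. stress H (frame (weak_D P v p) (v p $ 1 / p $ 1))"
  assumes S: "\<And>i j. locally_integrable P (\<lambda>p. S p $ i $ j)"
    and weak: "\<And>h\<^sub>1 h\<^sub>2. test_function P h\<^sub>1 \<Longrightarrow> test_function P h\<^sub>2 \<Longrightarrow> weak_form P S h\<^sub>1 h\<^sub>2 = 0"
  shows "meridian_equations H P v"
proof -
  have eqs: "(norm (column 1 (weak_D P v p)))\<^sup>2 - (norm (column 2 (weak_D P v p)))\<^sup>2 - (v p $ 1)\<^sup>2 / (p $ 1)\<^sup>2 +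
      deriv H (v p $ 1 / p $ 1 * det (weak_D P v p)) * (v p $ 1 / p $ 1 * det (weak_D P v p)) -
      H (v p $ 1 / p $ 1 * det (weak_D P v p)) = S p $ 1 $ 1"
    "2 * (column 1 (weak_D P v p) \<bullet> column 2 (weak_D P v p)) = S p $ 1 $ 3"
    "(norm (column 2 (weak_D P v p)))\<^sup>2 - (norm (column 1 (weak_D P v p)))\<^sup>2 - (v p $ 1)\<^sup>2 / (p $ 1)\<^sup>2 +
      deriv H (v p $ 1 / p $ 1 * det (weak_D P v p)) * (v p $ 1 / p $ 1 * det (weak_D P v p)) -
      H (v p $ 1 / p $ 1 * det (weak_D P v p)) = S p $ 3 $ 3"
    "- (norm (weak_D P v p))\<^sup>2 + (v p $ 1)\<^sup>2 / (p $ 1)\<^sup>2 +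
      deriv H (v p $ 1 / p $ 1 * det (weak_D P v p)) * (v p $ 1 / p $ 1 * det (weak_D P v p)) -
      H (v p $ 1 / p $ 1 * det (weak_D P v p)) = S p $ 2 $ 2" for p
    unfolding S_def stress_frame power_divide by simp_all
  have z0: "test_function P (\<lambda>p. 0 :: real)"
    unfolding test_function_def by (auto simp: smooth_on_const intro: exI[of _ "{}"])
  have d0: "partial j (\<lambda>p::real^2. 0 :: real) p = 0" for j p by (simp add: frechet_derivative_const)
  \<comment> \<open>Division by r keeps test functions, since their supports lie in r > 0, and r
    commutes with the derivative in z. The second identity needs no restriction on p, because f
    vanishes off the meridian set.\<close>
  have key: "test_function P (\<lambda>p. 1 / p $ 1 * f p)"
    "\<And>p. p $ 1 * (1 / p $ 1 * f p) = f p"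
    "\<And>p. p $ 1 * partial 2 (\<lambda>p. 1 / p $ 1 * f p) p = partial 2 f p" if f: "test_function P f" for f :: "real^2 \<Rightarrow> real"
  proof -
    define h where "h p = 1 / p $ 1 * f p" for p
    obtain K where K: "compact K" "K \<subseteq> P" "\<And>p. p \<notin> K \<Longrightarrow> f p = 0" using test_function_support[OF f] by blast
    have r: "p $ 1 > 0" if "p \<in> P" for p using that meridian_iff by blast
    have fz: "f p = 0" if "p \<notin> P" for p using K that by blast
    have "smooth_on P (\<lambda>p. 1 / p $ 1)"
      by (rule smooth_on_divide[OF open_meridian smooth_on_const smooth_on_linear[OF bounded_linear_vec_nth open_meridian]])
        (use r in force)
    then have "smooth_on P h" unfolding h_def[abs_def]
      by (rule smooth_on_mult[OF open_meridian _ smooth_on_subset[OF test_function_smooth[OF f] subset_UNIV]])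
    then have "test_function P (\<lambda>p. if p \<in> P then h p else 0)"
      by (rule test_function_extend[OF open_meridian _ K(1,2)]) (simp add: h_def K(3))
    moreover have "(\<lambda>p. if p \<in> P then h p else 0) = h" by (auto simp: fun_eq_iff h_def fz)
    ultimately have h: "test_function P h" by simp
    then show "test_function P (\<lambda>p. 1 / p $ 1 * f p)" by (simp only: h_def[abs_def])
    have e: "p $ 1 * h p = f p" for p
    proof (cases "p \<in> P")
      case True
      then show ?thesis using r[OF True] by (simp add: h_def)
    next
      case False
      then show ?thesis by (simp add: h_def fz)
    qed
    then show "p $ 1 * (1 / p $ 1 * f p) = f p" for p by (simp only: h_def)
    have "p $ 1 * partial 2 h p = partial 2 f p" for p
    proof -
      have "(h has_derivative frechet_derivative h (at p)) (at p)"
        by (rule smooth_on_has_derivative[OF test_function_smooth[OF h] UNIV_I])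
      from has_derivative_mult[OF bounded_linear_imp_has_derivative[OF bounded_linear_vec_nth] this, of 1]
      have "(f has_derivative (\<lambda>w. p $ 1 * frechet_derivative h (at p) w + w $ 1 * h p)) (at p)" by (simp only: e)
      from frechet_derivative_at[OF this, symmetric] show ?thesis by (simp add: axis_def)
    qed
    then show "p $ 1 * partial 2 (\<lambda>p. 1 / p $ 1 * f p) p = partial 2 f p" for p by (simp only: h_def[abs_def])
  qed
  have E: "- (LINT p|lebesgue_on P. p $ 1 * S p $ 1 $ 1 * partial 1 (\<lambda>x. 1 / x $ 1 * f x) p) +
      - (LINT p|lebesgue_on P. S p $ 1 $ 3 * partial 2 f p) = (LINT p|lebesgue_on P. 1 / p $ 1 * S p $ 2 $ 2 * f p)"
    "- (LINT p|lebesgue_on P. p $ 1 * S p $ 1 $ 3 * partial 1 (\<lambda>x. 1 / x $ 1 * f x) p) +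
      - (LINT p|lebesgue_on P. S p $ 3 $ 3 * partial 2 f p) = 0"
    if f: "test_function P f" for f :: "real^2 \<Rightarrow> real"
  proof -
    define h where "h = (\<lambda>x::real^2. 1 / x $ 1 * f x)"
    have c: "p $ 1 * S p $ i $ j * partial 1 h p = S p $ i $ j * (p $ 1 * partial 1 h p)"
      "1 / p $ 1 * S p $ 2 $ 2 * f p = S p $ 2 $ 2 * h p" for p i j by (simp_all add: h_def)
    have p2: "p $ 1 * partial 2 h p = partial 2 f p" for p unfolding h_def by (rule key(3)[OF f])
    have 1: "weak_form P S h (\<lambda>p. 0) = 0" and 2: "weak_form P S (\<lambda>p. 0) h = 0"
      unfolding h_def by (rule weak[OF key(1)[OF f] z0], rule weak[OF z0 key(1)[OF f]])
    show "- (LINT p|lebesgue_on P. p $ 1 * S p $ 1 $ 1 * partial 1 (\<lambda>x. 1 / x $ 1 * f x) p) +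
      - (LINT p|lebesgue_on P. S p $ 1 $ 3 * partial 2 f p) = (LINT p|lebesgue_on P. 1 / p $ 1 * S p $ 2 $ 2 * f p)"
      using 1 unfolding weak_form_def d0 add_0_right p2 h_def[symmetric] c mult_zero_right Bochner_Integration.integral_zero
      by linarith
    show "- (LINT p|lebesgue_on P. p $ 1 * S p $ 1 $ 3 * partial 1 (\<lambda>x. 1 / x $ 1 * f x) p) +
      - (LINT p|lebesgue_on P. S p $ 3 $ 3 * partial 2 f p) = 0"
      using 2 unfolding weak_form_def d0 add_0_left p2 h_def[symmetric] c mult_zero_right Bochner_Integration.integral_zero
      by linarith
  qed
  show ?thesis
    unfolding meridian_equations_def Let_def eqs distr_eq_def distr_mult_def distr_partial_def regular_distr_def
    by (intro conjI S allI impI) (rule E, assumption)+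
qed

end

theorem theorem6p1:
  fixes \<Omega> \<Omega>' :: "(real^3) set" and g u :: "real^3 \<Rightarrow> real^3" and v :: "real^2 \<Rightarrow> real^2"
    and H :: "real \<Rightarrow> real" and M :: real
  assumes "smooth_bounded_domain \<Omega>" and "axisymmetric_set \<Omega>"
    and "(INF x\<in>\<Omega>. sqrt ((x $ 1)\<^sup>2 + (x $ 2)\<^sup>2)) > 0"
    and "smooth_bounded_domain \<Omega>'" and "axisymmetric_set \<Omega>'"
    and "C1_diffeomorphism (closure \<Omega>) (closure \<Omega>') g" and "axisymmetric_map \<Omega> g"
    and "M > 0"
    and "energy_density_assms H"
    and "0 < (INF w\<in>admissible_nc_axi \<Omega> g M. energy H \<Omega> w)"
    and "(INF w\<in>admissible_nc_axi \<Omega> g M. energy H \<Omega> w) < \<infinity>"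
    and "u \<in> admissible_nc_axi \<Omega> g M"
    and "\<forall>w\<in>admissible_nc_axi \<Omega> g M. energy H \<Omega> u \<le> energy H \<Omega> w"
    and "meridian_rep \<Omega> u v"
  shows "meridian_equations H (meridian \<Omega>) v \<and>
    (meridian_equations H (meridian \<Omega>) v \<longleftrightarrow> Div_free \<Omega> (energy_momentum H \<Omega> u))"
proof -
  note H = assms(9)
  have \<Omega>: "open \<Omega>" "bounded \<Omega>" using assms(1) by (auto simp: smooth_bounded_domain_def)
  have off: "(x $ 1)\<^sup>2 + (x $ 2)\<^sup>2 > 0" if "x \<in> \<Omega>" for x
  proof -
    have "bdd_below ((\<lambda>x. sqrt ((x $ 1)\<^sup>2 + (x $ 2)\<^sup>2)) ` \<Omega>)" by (rule bdd_belowI[of _ 0]) auto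
    from cINF_lower[OF this that] have "sqrt ((x $ 1)\<^sup>2 + (x $ 2)\<^sup>2) > 0" using assms(3) by linarith
    then show ?thesis by (simp only: real_sqrt_gt_0_iff)
  qed
  interpret meridional \<Omega> by unfold_locales (rule \<Omega>(1), rule assms(2), rule off)
  have g: "Ck_on 1 \<Omega> g"
    using assms(6) by (intro Ck_on_C1_upto_boundary[OF \<Omega>(1)]) (simp add: C1_diffeomorphism_def)
  define A where "A = weak_D \<Omega> u"
  have W: "W12 \<Omega> u" and pos: "AE x in lebesgue_on \<Omega>. det (A x) > 0"
    using assms(12) by (auto simp: admissible_nc_axi_def admissible_nc_def admissible_def A_def)
  have uA: "is_weak_D \<Omega> u A" unfolding A_def by (rule W12_weak_D(1)[OF W])
  \<comment> \<open>Minimality and the finite infimum give the minimizer finite energy, and with it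
    the integrability of the density.\<close>
  have "energy H \<Omega> u \<le> (INF w\<in>admissible_nc_axi \<Omega> g M. energy H \<Omega> w)"
    using assms(13) by (intro INF_greatest) blast
  then have fin: "energy H \<Omega> u < \<infinity>" using assms(11) by (rule le_less_trans)
  have f: "integrable (lebesgue_on \<Omega>) (\<lambda>x. (norm (A x))\<^sup>2 + H (det (A x)))"
    by (rule energy_density_integrable[OF \<Omega>(1) H uA pos fin])
  define S where "S p = stress H (frame (weak_D P v p) (v p $ 1 / p $ 1))" for p
  obtain B where B: "is_weak_D P v B"
    "AE y in lebesgue_on D. A (polar y) = rot (y $ 2) ** frame (B (merid y)) (v (merid y) $ 1 / y $ 1) ** transpose (rot (y $ 2))"
    by (rule axisymmetric_structure[OF uA assms(14)])
  \<comment> \<open>The meridian equations are stated with the chosen gradient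
    \<open>weak_D P v\<close>; it agrees almost everywhere with the \<open>B\<close> produced from
    \<open>u\<close>, and this carries over to \<open>D\<close>.\<close>
  have "AE y in lebesgue_on D. weak_D P v (merid y) = B (merid y)"
    unfolding AE_D_iff using is_weak_D_AE_eq[OF open_meridian B(1)] unfolding AE_P_iff by (rule AE_lift)
  then have TS: "AE y in lebesgue_on D. stress H (A (polar y)) = rot (y $ 2) ** S (merid y) ** transpose (rot (y $ 2))"
    using B(2)
  proof eventually_elim
    case (elim y)
    show ?case unfolding elim(2) S_def elim(1) merid_nth by (rule stress_conj[OF rot_orthogonal(2) rot_orthogonal(1) det_rot])
  qed
  interpret meridional_stress \<Omega> "\<lambda>x. stress H (A x)" S
  proof
    show "locally_integrable \<Omega> (\<lambda>x. stress H (A x) $ i $ j)" for i j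
    proof -
      have i: "integrable (lebesgue_on \<Omega>) (\<lambda>x. stress H (A x) $ i $ j)"
        by (rule stress_integrable[OF \<Omega> H uA pos f])
      show ?thesis unfolding locally_integrable_def
        using i set_integrable_subset[of lebesgue \<Omega> "\<lambda>x. stress H (A x) $ i $ j"] compact_lebesgue
        unfolding lebesgue_on_integral(3)[OF open_lebesgue[OF \<Omega>(1)]] by blast
    qed
    show "S p \<bullet> Q = S p $ 1 $ 1 * Q $ 1 $ 1 + S p $ 1 $ 3 * (Q $ 1 $ 3 + Q $ 3 $ 1) +
      S p $ 3 $ 3 * Q $ 3 $ 3 + S p $ 2 $ 2 * Q $ 2 $ 2" for p Q
      unfolding S_def by (rule stress_frame(5))
  qed (rule TS)
  have weak: "weak_form P S h\<^sub>1 h\<^sub>2 = 0" if h: "test_function P h\<^sub>1" "test_function P h\<^sub>2" for h\<^sub>1 h\<^sub>2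
    using minimizer_stationary[OF \<Omega>(2) H g assms(12,13) f[unfolded A_def] LINT_axial(1)[OF h]] LINT_axial(2)[OF h]
    by (simp add: A_def)
  have "meridian_equations H P v"
    by (rule meridian_equations_weak_form) (use S_integrable weak in \<open>simp_all only: S_def[abs_def]\<close>)
  moreover have "energy_momentum H \<Omega> u = (\<lambda>x. stress H (A x))"
    by (simp add: fun_eq_iff energy_momentum_def stress_def Let_def A_def)
  then have "Div_free \<Omega> (energy_momentum H \<Omega> u)" using Div_free_T[OF weak] by simp
  \<comment> \<open>Both sides of the equivalence have been established for the minimizer.\<close>
  ultimately show ?thesis by blast
qed

end
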